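(* Let $G$ be a discrete, amenable group and assume that the full group $C^*$-algebra $C^*(G)$ has real rank zero. Then every normal subgroup of $G$ that is virtually polycyclic is finite.
   Context: $C^*(G)$ denotes the full group $C^*$-algebra of the discrete group $G$ (the completion of $\mathbb{C}[G]$ in the maximal norm). A $C^*$-algebra $A$ has real rank zero if for every $a=a^*\in A$ and every $\varepsilon>0$ there exists $v=v^*\in A$ with finite spectrum such that $\|a-v\|<\varepsilon$. *)

theory Defs
  imports Complex_Main "HOL-Algebra.Elementary_Groups" "HOL-Algebra.Module"
begin

section \<open>Amenable groups\<close>

text \<open>
  \<open>m\<close> is a left-invariant mean on the bounded real functions on \<open>G\<close>.  Functions are total on the
  type, but only their values on \<open>carrier G\<close> matter: linearity together with positivity (which only
  looks at the carrier) forces \<open>m f = m g\<close> whenever \<open>f\<close> and \<open>g\<close> agree on \<open>carrier G\<close>.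
\<close>

definition bounded_functions :: "('g, 'm) monoid_scheme \<Rightarrow> ('g \<Rightarrow> real) set" where
  "bounded_functions G = {f. \<exists>B. \<forall>x\<in>carrier G. \<bar>f x\<bar> \<le> B}"

definition left_invariant_mean :: "('g, 'm) monoid_scheme \<Rightarrow> (('g \<Rightarrow> real) \<Rightarrow> real) \<Rightarrow> bool" where
  "left_invariant_mean G m \<longleftrightarrow>
     (\<forall>f\<in>bounded_functions G. \<forall>g\<in>bounded_functions G. m (\<lambda>x. f x + g x) = m f + m g) \<and>
     (\<forall>f\<in>bounded_functions G. \<forall>c. m (\<lambda>x. c * f x) = c * m f) \<and>
     (\<forall>f\<in>bounded_functions G. (\<forall>x\<in>carrier G. 0 \<le> f x) \<longrightarrow> 0 \<le> m f) \<and>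
     m (\<lambda>x. 1) = 1 \<and>
     (\<forall>f\<in>bounded_functions G. \<forall>g\<in>carrier G. m (\<lambda>x. f (g \<otimes>\<^bsub>G\<^esub> x)) = m f)"

definition amenable :: "('g, 'm) monoid_scheme \<Rightarrow> bool" where
  "amenable G \<longleftrightarrow> (\<exists>m. left_invariant_mean G m)"


section \<open>Virtually polycyclic groups\<close>

definition polycyclic :: "('g, 'm) monoid_scheme \<Rightarrow> bool" where
  "polycyclic G \<longleftrightarrow>
     (\<exists>n (S :: nat \<Rightarrow> 'g set).
        S 0 = {\<one>\<^bsub>G\<^esub>} \<and> S n = carrier G \<and> (\<forall>i\<le>n. subgroup (S i) G) \<and>
        (\<forall>i<n. S i \<lhd> G\<lparr>carrier := S (Suc i)\<rparr> \<and>
               cyclic_group (G\<lparr>carrier := S (Suc i)\<rparr> Mod S i)))"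

definition virtually_polycyclic :: "('g, 'm) monoid_scheme \<Rightarrow> bool" where
  "virtually_polycyclic G \<longleftrightarrow>
     (\<exists>K. subgroup K G \<and> finite (rcosets\<^bsub>G\<^esub> K) \<and> polycyclic (G\<lparr>carrier := K\<rparr>))"


section \<open>Complex star-algebras and their completions\<close>

record 'a star_algebra = "(complex, 'a) module" +
  star :: "'a \<Rightarrow> 'a"

record 'a normed_star_algebra = "'a star_algebra" +
  cnorm :: "'a \<Rightarrow> real"

definition cstar_seminorm :: "('a, 'm) star_algebra_scheme \<Rightarrow> ('a \<Rightarrow> real) \<Rightarrow> bool" where
  "cstar_seminorm A p \<longleftrightarrow>
     (\<forall>a\<in>carrier A. 0 \<le> p a) \<and>
     (\<forall>a\<in>carrier A. \<forall>b\<in>carrier A. p (a \<oplus>\<^bsub>A\<^esub> b) \<le> p a + p b) \<and>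
     (\<forall>c. \<forall>a\<in>carrier A. p (c \<odot>\<^bsub>A\<^esub> a) = cmod c * p a) \<and>
     (\<forall>a\<in>carrier A. \<forall>b\<in>carrier A. p (a \<otimes>\<^bsub>A\<^esub> b) \<le> p a * p b) \<and>
     (\<forall>a\<in>carrier A. p (star A a \<otimes>\<^bsub>A\<^esub> a) = (p a)\<^sup>2)"

text \<open>
  The maximal norm is the largest C*-seminorm.  The C*-seminorms on a star-algebra are exactly the
  functions \<open>a \<mapsto> \<parallel>\<pi> a\<parallel>\<close> for \<open>\<pi>\<close> a star-homomorphism into a C*-algebra (equivalently, a
  star-representation on a Hilbert space); quantifying over seminorms avoids quantifying over types.
  For a group algebra the supremum is over a nonempty set that is bounded above: each group element
  has seminorm at most 1, so every C*-seminorm is dominated by the \<open>\<ell>\<^sup>1\<close>-norm.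
\<close>

definition max_norm :: "('a, 'm) star_algebra_scheme \<Rightarrow> 'a \<Rightarrow> real" where
  "max_norm A a = (SUP p\<in>{p. cstar_seminorm A p}. p a)"

text \<open>
  The completion of \<open>A\<close> in a seminorm \<open>N\<close>: Cauchy sequences in \<open>A\<close>, modulo sequences converging
  to 0, with the operations induced by the pointwise ones.
\<close>

definition cauchy_seqs :: "('a, 'm) star_algebra_scheme \<Rightarrow> ('a \<Rightarrow> real) \<Rightarrow> (nat \<Rightarrow> 'a) set" where
  "cauchy_seqs A N =
     {u. (\<forall>n. u n \<in> carrier A) \<and>
         (\<forall>e>0. \<exists>M. \<forall>m\<ge>M. \<forall>n\<ge>M. N (u m \<ominus>\<^bsub>A\<^esub> u n) < e)}"

definition null_rel :: "('a, 'm) star_algebra_scheme \<Rightarrow> ('a \<Rightarrow> real) \<Rightarrow> ((nat \<Rightarrow> 'a) \<times> (nat \<Rightarrow> 'a)) set" where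
  "null_rel A N =
     {(u, w). u \<in> cauchy_seqs A N \<and> w \<in> cauchy_seqs A N \<and>
              (\<lambda>n. N (u n \<ominus>\<^bsub>A\<^esub> w n)) \<longlonglongrightarrow> 0}"

definition completion ::
  "('a, 'm) star_algebra_scheme \<Rightarrow> ('a \<Rightarrow> real) \<Rightarrow> (nat \<Rightarrow> 'a) set normed_star_algebra" where
  "completion A N =
     \<lparr> carrier = cauchy_seqs A N // null_rel A N,
       monoid.mult = (\<lambda>P Q. \<Union>u\<in>P. \<Union>w\<in>Q. null_rel A N `` {\<lambda>n. u n \<otimes>\<^bsub>A\<^esub> w n}),
       one = null_rel A N `` {\<lambda>n. \<one>\<^bsub>A\<^esub>},
       zero = null_rel A N `` {\<lambda>n. \<zero>\<^bsub>A\<^esub>},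
       add = (\<lambda>P Q. \<Union>u\<in>P. \<Union>w\<in>Q. null_rel A N `` {\<lambda>n. u n \<oplus>\<^bsub>A\<^esub> w n}),
       smult = (\<lambda>c P. \<Union>u\<in>P. null_rel A N `` {\<lambda>n. c \<odot>\<^bsub>A\<^esub> u n}),
       star = (\<lambda>P. \<Union>u\<in>P. null_rel A N `` {\<lambda>n. star A (u n)}),
       cnorm = (\<lambda>P. the_elem ((\<lambda>u. lim (\<lambda>n. N (u n))) ` P)) \<rparr>"


section \<open>The full group C*-algebra\<close>

text \<open>
  \<open>\<complex>[G]\<close>: finitely supported complex functions on \<open>G\<close> (extended by 0 outside the carrier), with
  convolution and \<open>f\<^sup>*(x) = cnj (f (x\<^sup>-\<^sup>1))\<close>.
\<close>

definition group_algebra :: "('g, 'm) monoid_scheme \<Rightarrow> ('g \<Rightarrow> complex) star_algebra" where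
  "group_algebra G =
     \<lparr> carrier = {f. finite {x. f x \<noteq> 0} \<and> {x. f x \<noteq> 0} \<subseteq> carrier G},
       monoid.mult = (\<lambda>f h x. if x \<in> carrier G
                       then \<Sum>y\<in>{y. f y \<noteq> 0}. f y * h (inv\<^bsub>G\<^esub> y \<otimes>\<^bsub>G\<^esub> x) else 0),
       one = (\<lambda>x. if x = \<one>\<^bsub>G\<^esub> then 1 else 0),
       zero = (\<lambda>x. 0),
       add = (\<lambda>f h x. f x + h x),
       smult = (\<lambda>c f x. c * f x),
       star = (\<lambda>f x. if x \<in> carrier G then cnj (f (inv\<^bsub>G\<^esub> x)) else 0) \<rparr>"

definition full_group_cstar_algebra ::
  "('g, 'm) monoid_scheme \<Rightarrow> (nat \<Rightarrow> 'g \<Rightarrow> complex) set normed_star_algebra" where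
  "full_group_cstar_algebra G = completion (group_algebra G) (max_norm (group_algebra G))"


section \<open>Real rank zero\<close>

text \<open>These are the notions for unital algebras; \<open>\<complex>[G]\<close> and its completion are unital.\<close>

definition spectrum :: "('a, 'm) star_algebra_scheme \<Rightarrow> 'a \<Rightarrow> complex set" where
  "spectrum A a = {z. a \<ominus>\<^bsub>A\<^esub> (z \<odot>\<^bsub>A\<^esub> \<one>\<^bsub>A\<^esub>) \<notin> Units A}"

definition self_adjoint :: "('a, 'm) star_algebra_scheme \<Rightarrow> 'a \<Rightarrow> bool" where
  "self_adjoint A a \<longleftrightarrow> a \<in> carrier A \<and> star A a = a"

definition real_rank_zero :: "('a, 'm) normed_star_algebra_scheme \<Rightarrow> bool" where
  "real_rank_zero A \<longleftrightarrow>
     (\<forall>a. self_adjoint A a \<longrightarrow>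
       (\<forall>\<epsilon>>0. \<exists>v. self_adjoint A v \<and> finite (spectrum A v) \<and> cnorm A (a \<ominus>\<^bsub>A\<^esub> v) < \<epsilon>))"

end

theory Submission
  imports Defs "HOL-Analysis.Analysis"
begin

text \<open>
  Real rank zero forbids deformations.  Let \<open>A\<close> be normal in \<open>G\<close>, let \<open>H \<supseteq> A\<close> have finite index, and
  let \<open>\<psi>\<close> be an \<open>H\<close>-invariant homomorphism from \<open>A\<close> to \<open>\<real>\<close>.  The representations of \<open>G\<close> induced from
  representations of \<open>H\<close> in which \<open>A\<close> acts by the character \<open>cis (t * \<psi> a)\<close> define a C*-seminorm \<open>p\<^sub>t\<close>
  on the group algebra.  As \<open>G\<close> is amenable, almost invariant vectors move a representation from \<open>t\<close>
  to a nearby parameter at little cost, so that \<open>p\<^sub>t x\<close> is continuous in \<open>t\<close>.  For a self-adjoint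
  element with finite spectrum, \<open>p\<^sub>t\<close> takes values among the moduli of spectral points and is therefore
  constant in \<open>t\<close>; by real rank zero, \<open>p\<^sub>t a\<close> is constant for all self-adjoint \<open>a\<close>.  But if \<open>\<psi> z = pi\<close>,
  then \<open>1 - z\<close> is annihilated at \<open>t = 0\<close> and not at \<open>t = 1\<close>.  Hence \<open>\<psi> = 0\<close>; this is
  \<open>real_rank_zero_invariant_character\<close>.  For \<open>A = H\<close> it says that no subgroup of finite index has a
  nonzero homomorphism to \<open>\<real>\<close>, a property called rigid below.

  Now let \<open>N\<close> be an infinite virtually polycyclic normal subgroup.  Powers of its elements generate
  an infinite normal subgroup of \<open>G\<close> that lies in a polycyclic group, and the last infinite term \<open>A\<close> of
  its derived series has finite derived subgroup.  So there is a nonzero homomorphism from \<open>A\<close> to the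
  integers, and the group \<open>L\<close> of all of them is a lattice in the finite-dimensional space \<open>V\<close> of
  homomorphisms to \<open>\<real>\<close>, on which \<open>G\<close> acts by conjugation.  A nonzero point of \<open>L\<close> that is fixed by a
  subgroup of finite index contradicts the first part.

  Such a point exists because a rigid amenable group cannot expand vectors.  If no proper
  nonzero subspace of a representation is invariant under a subgroup of finite index, then the
  representation is bounded.  This is an argument of Furstenberg, done with an invariant mean: unbounded
  elements would push the mass of an orbit to a proper subspace, and the mean logarithmic growth is
  a homomorphism to \<open>\<real>\<close> (\<open>strongly_irreducible_bounded\<close>).  By induction on the dimension,
  \<open>rigid_amenable_slowly_growing\<close> provides, for finitely many elements \<open>f\<close> of a subgroup of finite
  index, a norm on \<open>V\<close> in which they expand by little.  If they also act trivially on \<open>L\<close> modulo \<open>3\<close>,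
  then \<open>f l - l\<close> is three times a lattice point and at most \<open>5/2\<close> times as long as \<open>l\<close>.  So it is zero
  for a nearly shortest \<open>l\<close>, which gives the fixed point (\<open>fixed_lattice_point\<close>).
\<close>

section \<open>The group algebra\<close>

definition fin_supp :: "('g, 'm) monoid_scheme => ('g => complex) set" where
  "fin_supp G = {f. finite {x. f x ~= 0} \<and> {x. f x ~= 0} \<subseteq> carrier G}"

definition convol ::
  "('g, 'm) monoid_scheme => ('g => complex) => ('g => complex) => 'g => complex" where
  "convol G f h = (\<lambda>x. if x \<in> carrier G
      then \<Sum>y\<in>{y. f y ~= 0}. f y * h (inv\<^bsub>G\<^esub> y \<otimes>\<^bsub>G\<^esub> x) else 0)"

definition involution :: "('g, 'm) monoid_scheme => ('g => complex) => 'g => complex" where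
  "involution G f = (\<lambda>x. if x \<in> carrier G then cnj (f (inv\<^bsub>G\<^esub> x)) else 0)"

definition delta :: "'g => 'g => complex" where
  "delta g = (\<lambda>x. if x = g then 1 else 0)"

lemma group_algebra_simps:
  "carrier (group_algebra G) = fin_supp G"
  "monoid.mult (group_algebra G) = convol G"
  "one (group_algebra G) = delta (one G)"
  "zero (group_algebra G) = (\<lambda>x. 0)"
  "add (group_algebra G) = (\<lambda>f h x. f x + h x)"
  "module.smult (group_algebra G) = (\<lambda>c f x. c * f x)"
  "star (group_algebra G) = involution G"
  by (simp_all add: group_algebra_def fin_supp_def convol_def involution_def delta_def fun_eq_iff)

text \<open>
  The linear extension of \<open>\<phi>\<close> to finitely supported functions.  Identities in the group algebra are
  checked by testing against all \<open>\<phi>\<close>, because \<open>lin_ext\<close> turns convolution into an iterated sum.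
\<close>

definition lin_ext :: "('g => complex) => ('g => complex) => complex" where
  "lin_ext \<phi> f = (\<Sum>x\<in>{x. f x ~= 0}. f x * \<phi> x)"

lemma lin_ext_superset:
  assumes "finite T" "{x. f x ~= 0} \<subseteq> T"
  shows "lin_ext \<phi> f = (\<Sum>x\<in>T. f x * \<phi> x)"
  unfolding lin_ext_def using assms by (intro sum.mono_neutral_left) auto

context group
begin

lemma fin_suppD:
  assumes "f \<in> fin_supp G"
  shows "finite {x. f x ~= 0}" "{x. f x ~= 0} \<subseteq> carrier G" "x \<notin> carrier G ==> f x = 0"
  using assms by (auto simp: fin_supp_def)

lemma fin_suppI:
  assumes "finite T" "T \<subseteq> carrier G" "\<And>x. x \<notin> T ==> f x = 0"
  shows "f \<in> fin_supp G"
proof -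
  have "{x. f x ~= 0} \<subseteq> T" using assms(3) by blast
  then show ?thesis using assms(1,2) finite_subset by (auto simp: fin_supp_def)
qed

lemma zero_in_fin_supp [simp]: "(\<lambda>x. 0) \<in> fin_supp G"
  by (rule fin_suppI[of "{}"]) auto

lemma delta_in_fin_supp [simp]: "g \<in> carrier G ==> delta g \<in> fin_supp G"
  by (rule fin_suppI[of "{g}"]) (auto simp: delta_def)

lemma add_in_fin_supp [simp]:
  assumes "f \<in> fin_supp G" "h \<in> fin_supp G"
  shows "(\<lambda>x. f x + h x) \<in> fin_supp G"
  by (rule fin_suppI[of "{x. f x ~= 0} \<union> {x. h x ~= 0}"])
    (use assms in \<open>auto simp: fin_supp_def\<close>)

lemma diff_in_fin_supp [simp]:
  assumes "f \<in> fin_supp G" "h \<in> fin_supp G"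
  shows "(\<lambda>x. f x - h x) \<in> fin_supp G"
  by (rule fin_suppI[of "{x. f x ~= 0} \<union> {x. h x ~= 0}"])
    (use assms in \<open>auto simp: fin_supp_def\<close>)

lemma scale_in_fin_supp [simp]:
  assumes "f \<in> fin_supp G"
  shows "(\<lambda>x. c * f x) \<in> fin_supp G"
  by (rule fin_suppI[of "{x. f x ~= 0}"]) (use assms in \<open>auto simp: fin_supp_def\<close>)

lemma uminus_in_fin_supp [simp]:
  assumes "f \<in> fin_supp G"
  shows "(\<lambda>x. - f x) \<in> fin_supp G"
  by (rule fin_suppI[of "{x. f x ~= 0}"]) (use assms in \<open>auto simp: fin_supp_def\<close>)

lemma convol_in_fin_supp [simp]:
  assumes f: "f \<in> fin_supp G" and h: "h \<in> fin_supp G"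
  shows "convol G f h \<in> fin_supp G"
proof (rule fin_suppI[of "(\<lambda>(a, b). a \<otimes> b) ` ({x. f x ~= 0} \<times> {x. h x ~= 0})"])
  show "finite ((\<lambda>(a, b). a \<otimes> b) ` ({x. f x ~= 0} \<times> {x. h x ~= 0}))"
    using fin_suppD(1)[OF f] fin_suppD(1)[OF h] by simp
  show "(\<lambda>(a, b). a \<otimes> b) ` ({x. f x ~= 0} \<times> {x. h x ~= 0}) \<subseteq> carrier G"
    using fin_suppD(2)[OF f] fin_suppD(2)[OF h] by auto
  fix x assume x: "x \<notin> (\<lambda>(a, b). a \<otimes> b) ` ({x. f x ~= 0} \<times> {x. h x ~= 0})"
  show "convol G f h x = 0"
  proof (cases "x \<in> carrier G")
    case True
    have "h (inv y \<otimes> x) = 0" if "f y ~= 0" for y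
    proof (rule ccontr)
      assume "h (inv y \<otimes> x) ~= 0"
      moreover have "y \<otimes> (inv y \<otimes> x) = x"
        using that True fin_suppD(2)[OF f] by (simp add: m_assoc[symmetric] subset_iff)
      ultimately show False using x that by force
    qed
    then show ?thesis by (auto simp: convol_def intro!: sum.neutral)
  qed (simp add: convol_def)
qed

lemma involution_in_fin_supp [simp]:
  assumes f: "f \<in> fin_supp G"
  shows "involution G f \<in> fin_supp G"
proof (rule fin_suppI[of "m_inv G ` {x. f x ~= 0}"])
  show "finite (m_inv G ` {x. f x ~= 0})" using fin_suppD(1)[OF f] by simp
  show "m_inv G ` {x. f x ~= 0} \<subseteq> carrier G" using fin_suppD(2)[OF f] by auto
  show "involution G f x = 0" if "x \<notin> m_inv G ` {x. f x ~= 0}" for x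
    using that by (force simp: involution_def image_iff)
qed

lemma lin_ext_add:
  assumes "f \<in> fin_supp G" "h \<in> fin_supp G"
  shows "lin_ext \<phi> (\<lambda>x. f x + h x) = lin_ext \<phi> f + lin_ext \<phi> h"
proof -
  define T where "T = {x. f x ~= 0} \<union> {x. h x ~= 0}"
  have T: "finite T" using fin_suppD(1) assms by (auto simp: T_def)
  have sub: "{x. f x + h x ~= 0} \<subseteq> T" "{x. f x ~= 0} \<subseteq> T" "{x. h x ~= 0} \<subseteq> T"
    by (auto simp: T_def)
  show ?thesis
    by (simp add: lin_ext_superset[OF T sub(1)] lin_ext_superset[OF T sub(2)]
        lin_ext_superset[OF T sub(3)] sum.distrib distrib_right)
qed

lemma lin_ext_scale:
  assumes "f \<in> fin_supp G"
  shows "lin_ext \<phi> (\<lambda>x. c * f x) = c * lin_ext \<phi> f"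
proof -
  have "{x. c * f x ~= 0} \<subseteq> {x. f x ~= 0}" by auto
  from lin_ext_superset[OF fin_suppD(1)[OF assms] this] show ?thesis
    by (simp add: lin_ext_def sum_distrib_left mult.assoc)
qed

lemma lin_ext_diff:
  assumes "f \<in> fin_supp G" "h \<in> fin_supp G"
  shows "lin_ext \<phi> (\<lambda>x. f x - h x) = lin_ext \<phi> f - lin_ext \<phi> h"
  using lin_ext_add[of f "\<lambda>x. (-1) * h x" \<phi>] lin_ext_scale[of h \<phi> "-1"] assms
    scale_in_fin_supp[of h "-1"] by simp

lemma lin_ext_zero [simp]: "lin_ext \<phi> (\<lambda>x. 0) = 0"
  by (simp add: lin_ext_def)

lemma lin_ext_delta [simp]: "lin_ext \<phi> (delta g) = \<phi> g"
  by (simp add: lin_ext_def delta_def)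

lemma lin_ext_test_add: "lin_ext (\<lambda>x. \<phi> x + \<psi> x) f = lin_ext \<phi> f + lin_ext \<psi> f"
  by (simp add: lin_ext_def sum.distrib distrib_left)

lemma lin_ext_test_diff: "lin_ext (\<lambda>x. \<phi> x - \<psi> x) f = lin_ext \<phi> f - lin_ext \<psi> f"
  by (simp add: lin_ext_def sum_subtractf right_diff_distrib)

lemma lin_ext_test_scale: "lin_ext (\<lambda>x. c * \<phi> x) f = c * lin_ext \<phi> f"
  by (simp add: lin_ext_def sum_distrib_left mult.left_commute)

lemma lin_ext_cong:
  assumes "f \<in> fin_supp G" "\<And>x. x \<in> carrier G ==> \<phi> x = \<psi> x"
  shows "lin_ext \<phi> f = lin_ext \<psi> f"
  unfolding lin_ext_def using fin_suppD(2)[OF assms(1)] assms(2) by (intro sum.cong) auto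

lemma lin_ext_commute:
  "lin_ext (\<lambda>a. lin_ext (\<lambda>b. \<Phi> a b) h) f = lin_ext (\<lambda>b. lin_ext (\<lambda>a. \<Phi> a b) f) h"
  unfolding lin_ext_def sum_distrib_left by (subst sum.swap) (simp add: mult.left_commute)

lemma lin_ext_eqI:
  assumes "f \<in> fin_supp G" "h \<in> fin_supp G" "\<And>\<phi>. lin_ext \<phi> f = lin_ext \<phi> h"
  shows "f = h"
proof
  fix x
  have "lin_ext (delta x) u = u x" if "u \<in> fin_supp G" for u :: "'a => complex"
  proof (cases "u x = 0")
    case True
    then show ?thesis
      unfolding lin_ext_def by (auto simp: delta_def intro!: sum.neutral)
  next
    case False
    have "(\<Sum>y\<in>{y. u y ~= 0}. u y * delta x y) = (\<Sum>y\<in>{x}. u y * delta x y)"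
      using False fin_suppD(1)[OF that] by (intro sum.mono_neutral_right) (auto simp: delta_def)
    then show ?thesis by (simp add: lin_ext_def delta_def)
  qed
  then show "f x = h x" using assms by metis
qed

lemma lin_ext_convol:
  assumes f: "f \<in> fin_supp G" and h: "h \<in> fin_supp G"
  shows "lin_ext \<phi> (convol G f h) = lin_ext (\<lambda>a. lin_ext (\<lambda>b. \<phi> (a \<otimes> b)) h) f"
proof -
  define F where "F = {x. f x ~= 0}"
  define E where "E = {x. h x ~= 0}"
  have F: "finite F" "F \<subseteq> carrier G" and E: "finite E" "E \<subseteq> carrier G"
    using fin_suppD[OF f] fin_suppD[OF h] by (auto simp: F_def E_def)
  define T where "T = (\<lambda>(a, b). a \<otimes> b) ` (F \<times> E)"
  have T: "finite T" "T \<subseteq> carrier G" using F E by (auto simp: T_def)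
  have supp: "{x. convol G f h x ~= 0} \<subseteq> T"
  proof
    fix x assume "x \<in> {x. convol G f h x ~= 0}"
    then have nz: "convol G f h x ~= 0" and x: "x \<in> carrier G"
      by (auto simp: convol_def split: if_splits)
    then have "(\<Sum>y\<in>F. f y * h (inv y \<otimes> x)) ~= 0" by (simp add: convol_def F_def)
    then obtain y where y: "y \<in> F" "f y * h (inv y \<otimes> x) ~= 0"
      by (metis (no_types, lifting) sum.neutral)
    have "y \<otimes> (inv y \<otimes> x) = x" using y F x by (simp add: m_assoc[symmetric] subset_iff)
    then show "x \<in> T" using y unfolding T_def E_def by force
  qed
  have inner: "(\<Sum>x\<in>T. h (inv y \<otimes> x) * \<phi> x) = (\<Sum>b\<in>E. h b * \<phi> (y \<otimes> b))" if y: "y \<in> F" for y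
  proof -
    have yc: "y \<in> carrier G" using y F by auto
    have "(\<Sum>b\<in>E. h b * \<phi> (y \<otimes> b)) = (\<Sum>x\<in>(\<lambda>b. y \<otimes> b) ` E. h (inv y \<otimes> x) * \<phi> x)"
    proof (subst sum.reindex)
      show "inj_on ((\<otimes>) y) E" using yc E by (auto simp: inj_on_def subset_iff)
      show "(\<Sum>b\<in>E. h b * \<phi> (y \<otimes> b)) = (\<Sum>a\<in>E. ((\<lambda>x. h (inv y \<otimes> x) * \<phi> x) \<circ> (\<otimes>) y) a)"
        using yc E by (intro sum.cong) (auto simp: m_assoc[symmetric] subset_iff)
    qed
    also have "\<dots> = (\<Sum>x\<in>T. h (inv y \<otimes> x) * \<phi> x)"
    proof (rule sum.mono_neutral_left)
      show "(\<otimes>) y ` E \<subseteq> T" using y by (auto simp: T_def)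
      show "\<forall>x\<in>T - (\<otimes>) y ` E. h (inv y \<otimes> x) * \<phi> x = 0"
      proof
        fix x assume x: "x \<in> T - (\<otimes>) y ` E"
        then have "y \<otimes> (inv y \<otimes> x) = x" using yc T by (simp add: m_assoc[symmetric] subset_iff)
        then have "inv y \<otimes> x \<notin> E" using x by force
        then show "h (inv y \<otimes> x) * \<phi> x = 0" by (simp add: E_def)
      qed
    qed (use T in auto)
    finally show ?thesis by simp
  qed
  have "lin_ext \<phi> (convol G f h) = (\<Sum>x\<in>T. convol G f h x * \<phi> x)"
    by (rule lin_ext_superset[OF T(1) supp])
  also have "\<dots> = (\<Sum>x\<in>T. \<Sum>y\<in>F. f y * (h (inv y \<otimes> x) * \<phi> x))"
    using T by (intro sum.cong) (auto simp: convol_def F_def sum_distrib_right mult.assoc)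
  also have "\<dots> = (\<Sum>y\<in>F. f y * (\<Sum>x\<in>T. h (inv y \<otimes> x) * \<phi> x))"
    by (subst sum.swap) (simp add: sum_distrib_left)
  also have "\<dots> = (\<Sum>y\<in>F. f y * (\<Sum>b\<in>E. h b * \<phi> (y \<otimes> b)))" using inner by simp
  finally show ?thesis by (simp add: lin_ext_def F_def E_def)
qed

lemma lin_ext_involution:
  assumes f: "f \<in> fin_supp G"
  shows "lin_ext \<phi> (involution G f) = cnj (lin_ext (\<lambda>x. cnj (\<phi> (inv x))) f)"
proof -
  define F where "F = {x. f x ~= 0}"
  have F: "finite F" "F \<subseteq> carrier G" using fin_suppD[OF f] by (auto simp: F_def)
  have "{x. involution G f x ~= 0} \<subseteq> m_inv G ` F"
    by (force simp: involution_def F_def image_iff split: if_splits)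
  then have "lin_ext \<phi> (involution G f) = (\<Sum>x\<in>m_inv G ` F. involution G f x * \<phi> x)"
    using F by (intro lin_ext_superset) auto
  also have "\<dots> = (\<Sum>x\<in>F. cnj (f x) * \<phi> (inv x))"
  proof (subst sum.reindex)
    show "inj_on (m_inv G) F" using F inv_inj by (metis inj_on_subset)
    show "sum ((\<lambda>x. involution G f x * \<phi> x) \<circ> m_inv G) F = (\<Sum>x\<in>F. cnj (f x) * \<phi> (inv x))"
      using F by (intro sum.cong) (auto simp: involution_def subset_iff)
  qed
  finally show ?thesis by (simp add: lin_ext_def F_def)
qed

lemma convol_assoc:
  assumes "f \<in> fin_supp G" "h \<in> fin_supp G" "k \<in> fin_supp G"
  shows "convol G (convol G f h) k = convol G f (convol G h k)"
proof (rule lin_ext_eqI)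
  fix \<phi> :: "'a => complex"
  have "lin_ext \<phi> (convol G (convol G f h) k)
      = lin_ext (\<lambda>a. lin_ext (\<lambda>b. lin_ext (\<lambda>c. \<phi> (a \<otimes> b \<otimes> c)) k) h) f"
    using assms by (simp add: lin_ext_convol)
  also have "\<dots> = lin_ext (\<lambda>a. lin_ext (\<lambda>b. lin_ext (\<lambda>c. \<phi> (a \<otimes> (b \<otimes> c))) k) h) f"
    using assms by (auto intro!: lin_ext_cong simp: m_assoc)
  also have "\<dots> = lin_ext \<phi> (convol G f (convol G h k))"
    using assms by (simp add: lin_ext_convol)
  finally show "lin_ext \<phi> (convol G (convol G f h) k)
      = lin_ext \<phi> (convol G f (convol G h k))" .
qed (use assms in auto)

lemma convol_add_left:
  assumes "f \<in> fin_supp G" "h \<in> fin_supp G" "k \<in> fin_supp G"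
  shows "convol G (\<lambda>x. f x + h x) k = (\<lambda>x. convol G f k x + convol G h k x)"
  by (rule lin_ext_eqI) (use assms in \<open>auto simp: lin_ext_convol lin_ext_add\<close>)

lemma convol_add_right:
  assumes "f \<in> fin_supp G" "h \<in> fin_supp G" "k \<in> fin_supp G"
  shows "convol G k (\<lambda>x. f x + h x) = (\<lambda>x. convol G k f x + convol G k h x)"
  by (rule lin_ext_eqI) (use assms in \<open>auto simp: lin_ext_convol lin_ext_add lin_ext_test_add\<close>)

lemma convol_diff_left:
  assumes "f \<in> fin_supp G" "h \<in> fin_supp G" "k \<in> fin_supp G"
  shows "convol G (\<lambda>x. f x - h x) k = (\<lambda>x. convol G f k x - convol G h k x)"
  by (rule lin_ext_eqI) (use assms in \<open>auto simp: lin_ext_convol lin_ext_diff\<close>)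

lemma convol_diff_right:
  assumes "f \<in> fin_supp G" "h \<in> fin_supp G" "k \<in> fin_supp G"
  shows "convol G k (\<lambda>x. f x - h x) = (\<lambda>x. convol G k f x - convol G k h x)"
  by (rule lin_ext_eqI) (use assms in \<open>auto simp: lin_ext_convol lin_ext_diff lin_ext_test_diff\<close>)

lemma convol_scale_left:
  assumes "f \<in> fin_supp G" "k \<in> fin_supp G"
  shows "convol G (\<lambda>x. c * f x) k = (\<lambda>x. c * convol G f k x)"
  by (rule lin_ext_eqI) (use assms in \<open>auto simp: lin_ext_convol lin_ext_scale\<close>)

lemma convol_scale_right:
  assumes "f \<in> fin_supp G" "k \<in> fin_supp G"
  shows "convol G k (\<lambda>x. c * f x) = (\<lambda>x. c * convol G k f x)"
  by (rule lin_ext_eqI) (use assms in \<open>auto simp: lin_ext_convol lin_ext_scale lin_ext_test_scale\<close>)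

lemma convol_one [simp]:
  assumes "f \<in> fin_supp G"
  shows "convol G (delta \<one>) f = f" "convol G f (delta \<one>) = f"
  by (rule lin_ext_eqI; use assms in \<open>auto simp: lin_ext_convol intro!: lin_ext_cong\<close>)+

lemma convol_delta:
  assumes "g \<in> carrier G" "h \<in> carrier G"
  shows "convol G (delta g) (delta h) = delta (g \<otimes> h)"
  by (rule lin_ext_eqI) (use assms in \<open>auto simp: lin_ext_convol\<close>)

lemma involution_delta:
  assumes "g \<in> carrier G"
  shows "involution G (delta g) = delta (inv g)"
  by (rule lin_ext_eqI) (use assms in \<open>auto simp: lin_ext_involution\<close>)

lemma involution_involution [simp]:
  assumes "f \<in> fin_supp G"
  shows "involution G (involution G f) = f"
  using assms by (auto simp: involution_def fun_eq_iff fin_suppD(3))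

lemma involution_add:
  "involution G (\<lambda>x. f x + h x) = (\<lambda>x. involution G f x + involution G h x)"
  by (simp add: involution_def fun_eq_iff)

lemma involution_diff:
  "involution G (\<lambda>x. f x - h x) = (\<lambda>x. involution G f x - involution G h x)"
  by (simp add: involution_def fun_eq_iff)

lemma involution_scale:
  "involution G (\<lambda>x. c * f x) = (\<lambda>x. cnj c * involution G f x)"
  by (simp add: involution_def fun_eq_iff)

lemma involution_convol:
  assumes f: "f \<in> fin_supp G" and h: "h \<in> fin_supp G"
  shows "involution G (convol G f h) = convol G (involution G h) (involution G f)"
proof (rule lin_ext_eqI)
  fix \<phi> :: "'a => complex"
  have "lin_ext \<phi> (involution G (convol G f h))
      = cnj (lin_ext (\<lambda>a. lin_ext (\<lambda>b. cnj (\<phi> (inv (a \<otimes> b)))) h) f)"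
    using f h by (simp add: lin_ext_involution lin_ext_convol)
  also have "\<dots> = cnj (lin_ext (\<lambda>b. lin_ext (\<lambda>a. cnj (\<phi> (inv b \<otimes> inv a))) f) h)"
    by (subst lin_ext_commute) (use f h in \<open>auto intro!: lin_ext_cong arg_cong[of _ _ cnj] simp: inv_mult_group\<close>)
  also have "\<dots> = lin_ext \<phi> (convol G (involution G h) (involution G f))"
    using f h by (simp add: lin_ext_involution lin_ext_convol)
  finally show "lin_ext \<phi> (involution G (convol G f h))
      = lin_ext \<phi> (convol G (involution G h) (involution G f))" .
qed (use f h in auto)

lemma fin_supp_induct [consumes 1, case_names zero add]:
  assumes f: "f \<in> fin_supp G"
    and zero: "P (\<lambda>x. 0)"
    and add: "\<And>f g c. [|f \<in> fin_supp G; g \<in> carrier G; f g = 0; P f|] ==> P (\<lambda>x. f x + c * delta g x)"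
  shows "P f"
proof -
  have "P f" if "finite T" "T \<subseteq> carrier G" "{x. f x ~= 0} \<subseteq> T" for T f
    using that
  proof (induction T arbitrary: f rule: finite_induct)
    case empty
    then have "f = (\<lambda>x. 0)" by auto
    then show ?case using zero by simp
  next
    case (insert g T)
    define f' where "f' = (\<lambda>x. if x = g then 0 else f x)"
    have supp: "{x. f' x ~= 0} \<subseteq> T" using insert.prems by (auto simp: f'_def)
    then have "f' \<in> fin_supp G"
      using insert.hyps insert.prems by (intro fin_suppI[of T]) auto
    moreover have "P f'" using insert supp by auto
    moreover have "f = (\<lambda>x. f' x + f g * delta g x)" by (auto simp: f'_def delta_def)
    ultimately show ?case using add[of f' g "f g"] insert.prems by (auto simp: f'_def)
  qed
  then show ?thesis using fin_suppD[OF f] by blast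
qed

end

section \<open>The maximal norm\<close>

context group
begin

lemma cstar_seminorm_group_algebra_iff:
  "cstar_seminorm (group_algebra G) p \<longleftrightarrow>
     (\<forall>a\<in>fin_supp G. 0 <= p a) \<and>
     (\<forall>a\<in>fin_supp G. \<forall>b\<in>fin_supp G. p (\<lambda>x. a x + b x) <= p a + p b) \<and>
     (\<forall>c. \<forall>a\<in>fin_supp G. p (\<lambda>x. c * a x) = cmod c * p a) \<and>
     (\<forall>a\<in>fin_supp G. \<forall>b\<in>fin_supp G. p (convol G a b) <= p a * p b) \<and>
     (\<forall>a\<in>fin_supp G. p (convol G (involution G a) a) = (p a)\<^sup>2)"
  by (simp add: cstar_seminorm_def group_algebra_simps)

lemma cstar_seminormD:
  assumes "cstar_seminorm (group_algebra G) p" and "a \<in> fin_supp G"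
  shows cstar_seminorm_nonneg: "0 <= p a"
    and cstar_seminorm_add: "b \<in> fin_supp G ==> p (\<lambda>x. a x + b x) <= p a + p b"
    and cstar_seminorm_scale: "p (\<lambda>x. c * a x) = cmod c * p a"
    and cstar_seminorm_mult: "b \<in> fin_supp G ==> p (convol G a b) <= p a * p b"
    and cstar_seminorm_star: "p (convol G (involution G a) a) = (p a)\<^sup>2"
  using assms unfolding cstar_seminorm_group_algebra_iff by blast+

lemma cstar_seminorm_zero:
  assumes p: "cstar_seminorm (group_algebra G) p"
  shows "p (\<lambda>x. 0) = 0"
  using cstar_seminorm_scale[OF p zero_in_fin_supp, of 0] by simp

lemma cstar_seminorm_delta_le:
  assumes p: "cstar_seminorm (group_algebra G) p" and g: "g \<in> carrier G"
  shows "p (delta g) <= 1"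
proof -
  have sq: "p (delta \<one>) = (p (delta h))\<^sup>2" if "h \<in> carrier G" for h
    using cstar_seminorm_star[OF p, of "delta h"] that
    by (simp add: involution_delta convol_delta)
  have "p (delta \<one>) <= 1"
  proof (rule ccontr)
    assume "\<not> p (delta \<one>) <= 1"
    then show False using sq[OF one_closed] by (simp add: power2_eq_square)
  qed
  then have "(p (delta g))\<^sup>2 <= 1\<^sup>2" using sq[OF g] by simp
  then show ?thesis by (rule power2_le_imp_le) simp
qed

definition l1_norm :: "('a => complex) => real" where
  "l1_norm f = (\<Sum>x\<in>{x. f x ~= 0}. cmod (f x))"

lemma cstar_seminorm_le_l1_norm:
  assumes p: "cstar_seminorm (group_algebra G) p" and f: "f \<in> fin_supp G"
  shows "p f <= l1_norm f"
  using f
proof (induction rule: fin_supp_induct)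
  case zero
  then show ?case by (simp add: l1_norm_def cstar_seminorm_zero[OF p])
next
  case (add f g c)
  have "p (\<lambda>x. f x + c * delta g x) <= p f + p (\<lambda>x. c * delta g x)"
    using add by (intro cstar_seminorm_add[OF p]) auto
  also have "p (\<lambda>x. c * delta g x) = cmod c * p (delta g)"
    using add by (intro cstar_seminorm_scale[OF p]) auto
  also have "\<dots> <= cmod c"
    using cstar_seminorm_delta_le[OF p] add by (simp add: mult_left_le)
  also have "p f + cmod c <= l1_norm f + cmod c" using add by simp
  also have "\<dots> = l1_norm (\<lambda>x. f x + c * delta g x)"
  proof (cases "c = 0")
    case False
    have "{x. f x + c * delta g x ~= 0} = insert g {x. f x ~= 0}"
      using False add by (auto simp: delta_def)
    moreover have "(\<Sum>x | f x ~= 0. cmod (f x + c * delta g x)) = (\<Sum>x | f x ~= 0. cmod (f x))"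
      using add by (intro sum.cong) (auto simp: delta_def)
    ultimately show ?thesis
      using fin_suppD(1)[of f] add by (simp add: l1_norm_def delta_def)
  qed simp
  finally show ?case by simp
qed

lemma cstar_seminorm_involution:
  assumes p: "cstar_seminorm (group_algebra G) p" and f: "f \<in> fin_supp G"
  shows "p (involution G f) = p f"
proof -
  have le: "p h <= p (involution G h)" if h: "h \<in> fin_supp G" for h
  proof (cases "p h = 0")
    case True
    then show ?thesis using cstar_seminorm_nonneg[OF p] h by simp
  next
    case False
    have "p h * p h <= p (involution G h) * p h"
      using cstar_seminorm_mult[OF p, of "involution G h" h] cstar_seminorm_star[OF p h] h
      by (simp add: power2_eq_square)
    then show ?thesis using False cstar_seminorm_nonneg[OF p h] by simp
  qed
  show ?thesis using le[of f] le[of "involution G f"] f by simp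
qed

abbreviation maximal_norm :: "('a => complex) => real" where
  "maximal_norm \<equiv> max_norm (group_algebra G)"

lemma cstar_seminorm_le_max_norm:
  assumes p: "cstar_seminorm (group_algebra G) p" and f: "f \<in> fin_supp G"
  shows "p f <= maximal_norm f"
  unfolding max_norm_def
  by (rule cSUP_upper) (use p f cstar_seminorm_le_l1_norm in \<open>auto simp: bdd_above_def\<close>)

lemma max_norm_le:
  assumes "\<And>p. cstar_seminorm (group_algebra G) p ==> p f <= B"
  shows "maximal_norm f <= B"
proof -
  have "cstar_seminorm (group_algebra G) (\<lambda>_. 0)"
    by (simp add: cstar_seminorm_group_algebra_iff)
  then show ?thesis unfolding max_norm_def by (intro cSUP_least) (use assms in auto)
qed

end

section \<open>The completion\<close>

locale group_algebra_norm = group G for G :: "('g, 'm) monoid_scheme" (structure) +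
  fixes N :: "('g => complex) => real"
  assumes N_nonneg [simp]: "a \<in> fin_supp G ==> 0 <= N a"
    and N_add: "[|a \<in> fin_supp G; b \<in> fin_supp G|] ==> N (\<lambda>x. a x + b x) <= N a + N b"
    and N_scale: "a \<in> fin_supp G ==> N (\<lambda>x. c * a x) = cmod c * N a"
    and N_mult: "[|a \<in> fin_supp G; b \<in> fin_supp G|] ==> N (convol G a b) <= N a * N b"
    and N_involution: "a \<in> fin_supp G ==> N (involution G a) = N a"

lemma (in group) max_norm_group_algebra_norm: "group_algebra_norm G maximal_norm"
proof
  have zero: "cstar_seminorm (group_algebra G) (\<lambda>_. 0)"
    by (simp add: cstar_seminorm_group_algebra_iff)
  fix a assume a: "a \<in> fin_supp G"
  show nonneg: "0 <= maximal_norm a"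
    using cstar_seminorm_le_max_norm[OF zero a] .
  have scale: "maximal_norm (\<lambda>x. c * h x) <= cmod c * maximal_norm h" if h: "h \<in> fin_supp G" for c h
  proof (rule max_norm_le)
    fix p assume p: "cstar_seminorm (group_algebra G) p"
    show "p (\<lambda>x. c * h x) <= cmod c * maximal_norm h"
      unfolding cstar_seminorm_scale[OF p h]
      using cstar_seminorm_le_max_norm[OF p h] by (rule mult_left_mono) simp
  qed
  show "maximal_norm (\<lambda>x. c * a x) = cmod c * maximal_norm a" for c
  proof (cases "c = 0")
    case True
    have "maximal_norm (\<lambda>x. 0) <= 0" by (rule max_norm_le) (simp add: cstar_seminorm_zero)
    moreover have "0 <= maximal_norm (\<lambda>x. 0)"
      using cstar_seminorm_le_max_norm[OF zero zero_in_fin_supp] .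
    ultimately show ?thesis using True by simp
  next
    case False
    have "maximal_norm a <= cmod (inverse c) * maximal_norm (\<lambda>x. c * a x)"
      using scale[of "\<lambda>x. c * a x" "inverse c"] a False by (simp add: mult.assoc[symmetric])
    then have "cmod c * maximal_norm a <= cmod c * (cmod (inverse c) * maximal_norm (\<lambda>x. c * a x))"
      by (rule mult_left_mono) simp
    then have "cmod c * maximal_norm a <= maximal_norm (\<lambda>x. c * a x)"
      using False by (simp add: norm_mult[symmetric] mult.assoc[symmetric])
    then show ?thesis using scale[OF a, of c] by simp
  qed
  show "maximal_norm (involution G a) = maximal_norm a"
  proof (rule antisym)
    show "maximal_norm (involution G a) <= maximal_norm a"
    proof (rule max_norm_le)
      fix p assume p: "cstar_seminorm (group_algebra G) p"
      show "p (involution G a) <= maximal_norm a"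
        unfolding cstar_seminorm_involution[OF p a] by (rule cstar_seminorm_le_max_norm[OF p a])
    qed
    show "maximal_norm a <= maximal_norm (involution G a)"
    proof (rule max_norm_le)
      fix p assume p: "cstar_seminorm (group_algebra G) p"
      show "p a <= maximal_norm (involution G a)"
        unfolding cstar_seminorm_involution[OF p a, symmetric]
        by (rule cstar_seminorm_le_max_norm[OF p involution_in_fin_supp[OF a]])
    qed
  qed
  fix b assume b: "b \<in> fin_supp G"
  show "maximal_norm (\<lambda>x. a x + b x) <= maximal_norm a + maximal_norm b"
  proof (rule max_norm_le)
    fix p assume p: "cstar_seminorm (group_algebra G) p"
    show "p (\<lambda>x. a x + b x) <= maximal_norm a + maximal_norm b"
      using cstar_seminorm_add[OF p a b] cstar_seminorm_le_max_norm[OF p a]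
        cstar_seminorm_le_max_norm[OF p b] by linarith
  qed
  show "maximal_norm (convol G a b) <= maximal_norm a * maximal_norm b"
  proof (rule max_norm_le)
    fix p assume p: "cstar_seminorm (group_algebra G) p"
    have "p (convol G a b) <= p a * p b"
      by (rule cstar_seminorm_mult[OF p a b])
    also have "\<dots> <= maximal_norm a * maximal_norm b"
      by (intro mult_mono cstar_seminorm_le_max_norm[OF p] a b nonneg cstar_seminorm_nonneg[OF p])
    finally show "p (convol G a b) <= maximal_norm a * maximal_norm b" .
  qed
qed

context group_algebra_norm
begin

abbreviation A where "A \<equiv> group_algebra G"

lemma N_zero [simp]: "N (\<lambda>x. 0) = 0"
  using N_scale[OF zero_in_fin_supp, of 0] by simp

lemma N_uminus: "a \<in> fin_supp G ==> N (\<lambda>x. - a x) = N a"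
  using N_scale[of a "-1"] by simp

lemma N_diff_commute:
  "[|a \<in> fin_supp G; b \<in> fin_supp G|] ==> N (\<lambda>x. a x - b x) = N (\<lambda>x. b x - a x)"
  using N_uminus[of "\<lambda>x. a x - b x"] by simp

lemma N_diff_triangle:
  assumes "a \<in> fin_supp G" "b \<in> fin_supp G" "c \<in> fin_supp G"
  shows "N (\<lambda>x. a x - c x) <= N (\<lambda>x. a x - b x) + N (\<lambda>x. b x - c x)"
  using N_add[of "\<lambda>x. a x - b x" "\<lambda>x. b x - c x"] assms by simp

lemma N_diff_add:
  assumes "a \<in> fin_supp G" "b \<in> fin_supp G" "a' \<in> fin_supp G" "b' \<in> fin_supp G"
  shows "N (\<lambda>x. (a x + b x) - (a' x + b' x)) <= N (\<lambda>x. a x - a' x) + N (\<lambda>x. b x - b' x)"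
  using N_add[of "\<lambda>x. a x - a' x" "\<lambda>x. b x - b' x"] assms by (simp add: algebra_simps)

lemma N_diff_mult:
  assumes "a \<in> fin_supp G" "b \<in> fin_supp G" "a' \<in> fin_supp G" "b' \<in> fin_supp G"
  shows "N (\<lambda>x. convol G a b x - convol G a' b' x)
    <= N a * N (\<lambda>x. b x - b' x) + N (\<lambda>x. a x - a' x) * N b'"
proof -
  have eq: "(\<lambda>x. convol G a b x - convol G a' b' x)
      = (\<lambda>x. convol G a (\<lambda>x. b x - b' x) x + convol G (\<lambda>x. a x - a' x) b' x)"
    using assms by (simp add: convol_diff_left convol_diff_right)
  have "N (\<lambda>x. convol G a b x - convol G a' b' x)
    <= N (convol G a (\<lambda>x. b x - b' x)) + N (convol G (\<lambda>x. a x - a' x) b')"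
    unfolding eq using assms by (intro N_add) auto
  also have "\<dots> <= N a * N (\<lambda>x. b x - b' x) + N (\<lambda>x. a x - a' x) * N b'"
    using assms by (intro add_mono N_mult) auto
  finally show ?thesis .
qed

lemma N_abs_diff:
  assumes "a \<in> fin_supp G" "b \<in> fin_supp G"
  shows "\<bar>N a - N b\<bar> <= N (\<lambda>x. a x - b x)"
  using N_add[of "\<lambda>x. a x - b x" b] N_add[of "\<lambda>x. b x - a x" a] N_diff_commute[of a b] assms by simp

lemma abelian_group_A: "abelian_group A"
proof (rule abelian_groupI)
  show "\<exists>y\<in>carrier A. y \<oplus>\<^bsub>A\<^esub> x = \<zero>\<^bsub>A\<^esub>" if "x \<in> carrier A" for x
    using that by (intro bexI[of _ "\<lambda>g. - x g"]) (auto simp: group_algebra_simps)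
qed (auto simp: group_algebra_simps algebra_simps)

lemma A_minus:
  assumes "a \<in> fin_supp G" "b \<in> fin_supp G"
  shows "a \<ominus>\<^bsub>A\<^esub> b = (\<lambda>x. a x - b x)"
proof -
  interpret A: abelian_group A by (rule abelian_group_A)
  have "\<ominus>\<^bsub>A\<^esub> b = (\<lambda>x. - b x)"
    by (rule A.minus_equality) (use assms in \<open>auto simp: group_algebra_simps\<close>)
  then show ?thesis by (simp add: a_minus_def group_algebra_simps)
qed

end

context group_algebra_norm
begin
definition cauchy :: "(nat => 'g => complex) => bool" where
  "cauchy u \<longleftrightarrow> (\<forall>n. u n \<in> fin_supp G) \<and>
     (\<forall>e>0. \<exists>M. \<forall>m\<ge>M. \<forall>n\<ge>M. N (\<lambda>x. u m x - u n x) < e)"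

lemma cauchy_seqs_iff: "u \<in> cauchy_seqs A N \<longleftrightarrow> cauchy u"
proof -
  have "(\<forall>n. u n \<in> fin_supp G) ==>
     (N (u m \<ominus>\<^bsub>A\<^esub> u n) < e) = (N (\<lambda>x. u m x - u n x) < e)" for m n e
    by (simp add: A_minus)
  then show ?thesis
    unfolding cauchy_seqs_def cauchy_def mem_Collect_eq group_algebra_simps by blast
qed

lemma cauchy_in [simp]: "cauchy u ==> u n \<in> fin_supp G"
  by (simp add: cauchy_def)

lemma null_rel_iff:
  "(u, w) \<in> null_rel A N \<longleftrightarrow> cauchy u \<and> cauchy w \<and> (\<lambda>n. N (\<lambda>x. u n x - w n x)) \<longlonglongrightarrow> 0"
  unfolding null_rel_def by (auto simp: cauchy_seqs_iff A_minus)

lemma null_relI: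
  assumes "cauchy u" "cauchy w" "\<And>n. N (\<lambda>x. u n x - w n x) <= d n" "d \<longlonglongrightarrow> 0"
  shows "(u, w) \<in> null_rel A N"
  unfolding null_rel_iff using assms
  by (auto intro!: real_tendsto_sandwich[OF _ _ tendsto_const assms(4)])

lemma equiv_null_rel: "equiv (cauchy_seqs A N) (null_rel A N)"
proof (rule equivI)
  show "null_rel A N \<subseteq> cauchy_seqs A N \<times> cauchy_seqs A N" by (auto simp: null_rel_def)
  show "refl_on (cauchy_seqs A N) (null_rel A N)"
    by (auto simp: refl_on_def null_rel_iff cauchy_seqs_iff)
  show "sym (null_rel A N)"
  proof (rule symI)
    fix u w assume uw: "(u, w) \<in> null_rel A N"
    then have "N (\<lambda>x. u n x - w n x) = N (\<lambda>x. w n x - u n x)" for n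
      by (intro N_diff_commute) (auto simp: null_rel_iff)
    then show "(w, u) \<in> null_rel A N" using uw by (simp add: null_rel_iff)
  qed
  show "trans (null_rel A N)"
  proof (rule transI)
    fix u v w assume uv: "(u, v) \<in> null_rel A N" and vw: "(v, w) \<in> null_rel A N"
    show "(u, w) \<in> null_rel A N"
    proof (rule null_relI)
      show "N (\<lambda>x. u n x - w n x) <= N (\<lambda>x. u n x - v n x) + N (\<lambda>x. v n x - w n x)" for n
        using uv vw by (intro N_diff_triangle) (auto simp: null_rel_iff)
      show "(\<lambda>n. N (\<lambda>x. u n x - v n x) + N (\<lambda>x. v n x - w n x)) \<longlonglongrightarrow> 0"
        using uv vw tendsto_add[of _ 0 _ _ 0] by (fastforce simp: null_rel_iff)
    qed (use uv vw in \<open>auto simp: null_rel_iff\<close>)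
  qed
qed

definition cls :: "(nat => 'g => complex) => (nat => 'g => complex) set" where
  "cls u = null_rel A N `` {u}"

lemma cls_eq_iff: "[|cauchy u; cauchy w|] ==> cls u = cls w \<longleftrightarrow> (u, w) \<in> null_rel A N"
  unfolding cls_def using eq_equiv_class_iff[OF equiv_null_rel] by (simp add: cauchy_seqs_iff)

lemma mem_cls_iff: "w \<in> cls u \<longleftrightarrow> (u, w) \<in> null_rel A N"
  by (simp add: cls_def)

lemma self_mem_cls: "cauchy u ==> u \<in> cls u"
  by (simp add: mem_cls_iff null_rel_iff)

lemma cls_UN:
  assumes "cauchy u" and "\<And>w. (u, w) \<in> null_rel A N ==> F w = F u"
  shows "(\<Union>w\<in>cls u. F w) = F u"
proof -
  have "(\<Union>w\<in>cls u. F w) = (\<Union>w\<in>cls u. F u)"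
    by (intro SUP_cong refl) (rule assms(2), simp add: mem_cls_iff)
  then show ?thesis using self_mem_cls[OF assms(1)] by blast
qed

lemma cauchyI:
  assumes u: "\<And>n. u n \<in> fin_supp G"
    and le: "\<And>m n. N (\<lambda>x. u m x - u n x) <= d m n"
    and d: "\<And>e. e > 0 ==> \<exists>M. \<forall>m\<ge>M. \<forall>n\<ge>M. d m n < (e::real)"
  shows "cauchy u"
  unfolding cauchy_def using u le d by (meson order_le_less_trans)

lemma cauchyE:
  assumes "cauchy u" "e > 0"
  obtains M where "\<And>m n. m >= M ==> n >= M ==> N (\<lambda>x. u m x - u n x) < e"
  using assms unfolding cauchy_def by blast

lemma cauchy_const: "a \<in> fin_supp G ==> cauchy (\<lambda>n. a)"
  by (simp add: cauchy_def)

lemma cauchy_add: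
  assumes u: "cauchy u" and w: "cauchy w"
  shows "cauchy (\<lambda>n x. u n x + w n x)"
proof (rule cauchyI)
  show "N (\<lambda>x. (u m x + w m x) - (u n x + w n x)) <= N (\<lambda>x. u m x - u n x) + N (\<lambda>x. w m x - w n x)" for m n
    using u w by (intro N_diff_add) auto
  show "\<exists>M. \<forall>m\<ge>M. \<forall>n\<ge>M. N (\<lambda>x. u m x - u n x) + N (\<lambda>x. w m x - w n x) < e" if e: "e > 0" for e
  proof -
    obtain M1 where M1: "\<And>m n. m >= M1 ==> n >= M1 ==> N (\<lambda>x. u m x - u n x) < e/2"
      using cauchyE[OF u half_gt_zero[OF e]] by blast
    obtain M2 where M2: "\<And>m n. m >= M2 ==> n >= M2 ==> N (\<lambda>x. w m x - w n x) < e/2"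
      using cauchyE[OF w half_gt_zero[OF e]] by blast
    have "\<forall>m\<ge>max M1 M2. \<forall>n\<ge>max M1 M2. N (\<lambda>x. u m x - u n x) + N (\<lambda>x. w m x - w n x) < e"
    proof (intro allI impI)
      fix m n assume "m >= max M1 M2" "n >= max M1 M2"
      then show "N (\<lambda>x. u m x - u n x) + N (\<lambda>x. w m x - w n x) < e"
        using M1[of m n] M2[of m n] by simp
    qed
    then show ?thesis by blast
  qed
qed (use u w in auto)

lemma cauchy_scale:
  assumes u: "cauchy u"
  shows "cauchy (\<lambda>n x. c * u n x)"
proof (rule cauchyI)
  show "N (\<lambda>x. c * u m x - c * u n x) <= cmod c * N (\<lambda>x. u m x - u n x)" for m n
    using u N_scale[of "\<lambda>x. u m x - u n x" c] by (simp add: right_diff_distrib)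
  show "\<exists>M. \<forall>m\<ge>M. \<forall>n\<ge>M. cmod c * N (\<lambda>x. u m x - u n x) < e" if e: "e > 0" for e
  proof -
    have pos: "0 < e / (cmod c + 1)" using e by (simp add: add_nonneg_pos)
    obtain M where M: "\<And>m n. m >= M ==> n >= M ==> N (\<lambda>x. u m x - u n x) < e / (cmod c + 1)"
      using cauchyE[OF u pos] by blast
    have "cmod c * N (\<lambda>x. u m x - u n x) < e" if "m >= M" "n >= M" for m n
    proof -
      have "cmod c * N (\<lambda>x. u m x - u n x) <= (cmod c + 1) * N (\<lambda>x. u m x - u n x)"
        using u by (intro mult_right_mono) auto
      also have "\<dots> < (cmod c + 1) * (e / (cmod c + 1))"
        using M[OF that] by (rule mult_strict_left_mono) (simp add: add_nonneg_pos)
      also have "\<dots> = e" using norm_ge_zero[of c] by (simp add: add_nonneg_eq_0_iff)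
      finally show ?thesis .
    qed
    then show ?thesis by blast
  qed
qed (use u in auto)

lemma cauchy_uminus: "cauchy u ==> cauchy (\<lambda>n x. - u n x)"
  using cauchy_scale[of u "-1"] by simp

lemma cauchy_diff: "[|cauchy u; cauchy w|] ==> cauchy (\<lambda>n x. u n x - w n x)"
  using cauchy_add[OF _ cauchy_uminus, of u w] by simp

lemma cauchy_involution: "cauchy u ==> cauchy (\<lambda>n. involution G (u n))"
proof (rule cauchyI)
  assume u: "cauchy u"
  show "N (\<lambda>x. involution G (u m) x - involution G (u n) x) <= N (\<lambda>x. u m x - u n x)" for m n
    unfolding involution_diff[symmetric]
    by (rule eq_refl[OF N_involution]) (use u in simp)
  show "\<exists>M. \<forall>m\<ge>M. \<forall>n\<ge>M. N (\<lambda>x. u m x - u n x) < e" if "e > 0" for e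
    using u that by (simp add: cauchy_def)
qed simp

lemma cauchy_N_Cauchy: "cauchy u ==> Cauchy (\<lambda>n. N (u n))"
proof (rule metric_CauchyI)
  fix e :: real assume u: "cauchy u" and "e > 0"
  then obtain M where M: "\<And>m n. m >= M ==> n >= M ==> N (\<lambda>x. u m x - u n x) < e"
    using cauchyE by blast
  then show "\<exists>M. \<forall>m\<ge>M. \<forall>n\<ge>M. dist (N (u m)) (N (u n)) < e"
  proof (intro exI allI impI)
    fix m n assume "m >= M" "n >= M"
    then have "N (\<lambda>x. u m x - u n x) < e" using M by blast
    then show "dist (N (u m)) (N (u n)) < e"
      using N_abs_diff[OF cauchy_in[OF u] cauchy_in[OF u], of m n] by (simp add: dist_real_def)
  qed
qed

lemma cauchy_bounded:
  assumes "cauchy u"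
  obtains B where "B > 0" "\<And>n. N (u n) <= B"
  using Cauchy_Bseq[OF cauchy_N_Cauchy[OF assms]] unfolding Bseq_def
  by (auto simp: abs_le_iff)

lemma cauchy_mult:
  assumes u: "cauchy u" and w: "cauchy w"
  shows "cauchy (\<lambda>n. convol G (u n) (w n))"
proof -
  obtain B where B: "B > 0" "\<And>n. N (u n) <= B" using cauchy_bounded[OF u] by blast
  obtain D where D: "D > 0" "\<And>n. N (w n) <= D" using cauchy_bounded[OF w] by blast
  show ?thesis
  proof (rule cauchyI)
    show "N (\<lambda>x. convol G (u m) (w m) x - convol G (u n) (w n) x)
        <= B * N (\<lambda>x. w m x - w n x) + N (\<lambda>x. u m x - u n x) * D" for m n
      by (rule order_trans[OF N_diff_mult add_mono[OF mult_right_mono mult_left_mono]]) (use u w B D in auto)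
    show "\<exists>M. \<forall>m\<ge>M. \<forall>n\<ge>M. B * N (\<lambda>x. w m x - w n x) + N (\<lambda>x. u m x - u n x) * D < e" if "e > 0" for e
    proof -
      have pos: "e/(2*D) > 0" "e/(2*B) > 0" using that B D by auto
      obtain M1 where M1: "\<And>m n. m >= M1 ==> n >= M1 ==> N (\<lambda>x. u m x - u n x) < e/(2*D)"
        using cauchyE[OF u pos(1)] by blast
      obtain M2 where M2: "\<And>m n. m >= M2 ==> n >= M2 ==> N (\<lambda>x. w m x - w n x) < e/(2*B)"
        using cauchyE[OF w pos(2)] by blast
      have "\<forall>m\<ge>max M1 M2. \<forall>n\<ge>max M1 M2. B * N (\<lambda>x. w m x - w n x) + N (\<lambda>x. u m x - u n x) * D < e"
      proof (intro allI impI)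
        fix m n assume "m >= max M1 M2" "n >= max M1 M2"
        then have "N (\<lambda>x. u m x - u n x) * D < e/(2*D) * D" "B * N (\<lambda>x. w m x - w n x) < B * (e/(2*B))"
          using M1[of m n] M2[of m n] B(1) D(1) \<open>m >= max M1 M2\<close> \<open>n >= max M1 M2\<close>
          by (intro mult_strict_right_mono mult_strict_left_mono; simp)+
        then show "B * N (\<lambda>x. w m x - w n x) + N (\<lambda>x. u m x - u n x) * D < e"
          using B(1) D(1) by simp
      qed
      then show ?thesis by blast
    qed
  qed (use u w in auto)
qed

end

context group_algebra_norm
begin
abbreviation C where "C \<equiv> Defs.completion A N"

lemma carrier_C: "P \<in> carrier C \<longleftrightarrow> (\<exists>u. cauchy u \<and> P = cls u)"
  unfolding Defs.completion_def cls_def by (auto simp: quotient_def cauchy_seqs_iff)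

lemma cls_in_carrier: "cauchy u ==> cls u \<in> carrier C"
  unfolding carrier_C by blast

lemma cls_eqI: "(u, w) \<in> null_rel A N ==> cls w = cls u"
  using cls_eq_iff[of u w] null_rel_iff[of u w] by blast

lemma C_add:
  assumes u: "cauchy u" and w: "cauchy w"
  shows "cls u \<oplus>\<^bsub>C\<^esub> cls w = cls (\<lambda>n x. u n x + w n x)"
proof -
  have step: "cls (\<lambda>n x. u' n x + w' n x) = cls (\<lambda>n x. u n x + w n x)"
    if u': "(u, u') \<in> null_rel A N" and w': "(w, w') \<in> null_rel A N" for u u' w w'
  proof -
    have c: "cauchy u" "cauchy u'" "cauchy w" "cauchy w'" using u' w' by (auto simp: null_rel_iff)
    have "((\<lambda>n x. u n x + w n x), (\<lambda>n x. u' n x + w' n x)) \<in> null_rel A N"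
    proof (rule null_relI)
      show "N (\<lambda>x. (u n x + w n x) - (u' n x + w' n x))
         <= N (\<lambda>x. u n x - u' n x) + N (\<lambda>x. w n x - w' n x)" for n
        using c by (intro N_diff_add) auto
      show "(\<lambda>n. N (\<lambda>x. u n x - u' n x) + N (\<lambda>x. w n x - w' n x)) \<longlonglongrightarrow> 0"
        using tendsto_add[of "\<lambda>n. N (\<lambda>x. u n x - u' n x)" 0 _ "\<lambda>n. N (\<lambda>x. w n x - w' n x)" 0] u' w'
        unfolding null_rel_iff add_0 by blast
    qed (use c cauchy_add in auto)
    then show ?thesis by (rule cls_eqI)
  qed
  have "cls u \<oplus>\<^bsub>C\<^esub> cls w = (\<Union>u'\<in>cls u. \<Union>w'\<in>cls w. cls (\<lambda>n x. u' n x + w' n x))"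
    by (simp add: Defs.completion_def cls_def group_algebra_simps)
  also have "\<dots> = (\<Union>u'\<in>cls u. cls (\<lambda>n x. u' n x + w n x))"
  proof (intro SUP_cong refl cls_UN w)
    fix u' w' assume u': "u' \<in> cls u" and w': "(w, w') \<in> null_rel A N"
    have "(u', u') \<in> null_rel A N" using u' by (auto simp: mem_cls_iff null_rel_iff)
    from step[OF this w'] show "cls (\<lambda>n x. u' n x + w' n x) = cls (\<lambda>n x. u' n x + w n x)" .
  qed
  also have "\<dots> = cls (\<lambda>n x. u n x + w n x)"
  proof (intro cls_UN u)
    fix u' assume u': "(u, u') \<in> null_rel A N"
    have "(w, w) \<in> null_rel A N" using w by (auto simp: null_rel_iff)
    from step[OF u' this] show "cls (\<lambda>n x. u' n x + w n x) = cls (\<lambda>n x. u n x + w n x)" .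
  qed
  finally show ?thesis .
qed

lemma C_mult:
  assumes u: "cauchy u" and w: "cauchy w"
  shows "cls u \<otimes>\<^bsub>C\<^esub> cls w = cls (\<lambda>n. convol G (u n) (w n))"
proof -
  have step: "cls (\<lambda>n. convol G (u' n) (w' n)) = cls (\<lambda>n. convol G (u n) (w n))"
    if u': "(u, u') \<in> null_rel A N" and w': "(w, w') \<in> null_rel A N" for u u' w w'
  proof -
    have c: "cauchy u" "cauchy u'" "cauchy w" "cauchy w'" using u' w' by (auto simp: null_rel_iff)
    obtain B where B: "B > 0" "\<And>n. N (u n) <= B" using cauchy_bounded[OF c(1)] by blast
    obtain D where D: "D > 0" "\<And>n. N (w' n) <= D" using cauchy_bounded[OF c(4)] by blast
    have "((\<lambda>n. convol G (u n) (w n)), (\<lambda>n. convol G (u' n) (w' n))) \<in> null_rel A N"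
    proof (rule null_relI)
      show "N (\<lambda>x. convol G (u n) (w n) x - convol G (u' n) (w' n) x)
         <= B * N (\<lambda>x. w n x - w' n x) + N (\<lambda>x. u n x - u' n x) * D" for n
        by (rule order_trans[OF N_diff_mult add_mono[OF mult_right_mono mult_left_mono]]) (use c B D in auto)
      have "(\<lambda>n. B * N (\<lambda>x. w n x - w' n x) + N (\<lambda>x. u n x - u' n x) * D) \<longlonglongrightarrow> B * 0 + 0 * D"
        using u' w' by (intro tendsto_intros) (auto simp: null_rel_iff)
      then show "(\<lambda>n. B * N (\<lambda>x. w n x - w' n x) + N (\<lambda>x. u n x - u' n x) * D) \<longlonglongrightarrow> 0" by simp
    qed (use c cauchy_mult in auto)
    then show ?thesis by (rule cls_eqI)
  qed
  have "cls u \<otimes>\<^bsub>C\<^esub> cls w = (\<Union>u'\<in>cls u. \<Union>w'\<in>cls w. cls (\<lambda>n. convol G (u' n) (w' n)))"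
    by (simp add: Defs.completion_def cls_def group_algebra_simps)
  also have "\<dots> = (\<Union>u'\<in>cls u. cls (\<lambda>n. convol G (u' n) (w n)))"
  proof (intro SUP_cong refl cls_UN w)
    fix u' w' assume u': "u' \<in> cls u" and w': "(w, w') \<in> null_rel A N"
    have "(u', u') \<in> null_rel A N" using u' by (auto simp: mem_cls_iff null_rel_iff)
    from step[OF this w'] show "cls (\<lambda>n. convol G (u' n) (w' n)) = cls (\<lambda>n. convol G (u' n) (w n))" .
  qed
  also have "\<dots> = cls (\<lambda>n. convol G (u n) (w n))"
  proof (intro cls_UN u)
    fix u' assume u': "(u, u') \<in> null_rel A N"
    have "(w, w) \<in> null_rel A N" using w by (auto simp: null_rel_iff)
    from step[OF u' this] show "cls (\<lambda>n. convol G (u' n) (w n)) = cls (\<lambda>n. convol G (u n) (w n))" .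
  qed
  finally show ?thesis .
qed

lemma C_smult:
  assumes u: "cauchy u"
  shows "c \<odot>\<^bsub>C\<^esub> cls u = cls (\<lambda>n x. c * u n x)"
proof -
  have "c \<odot>\<^bsub>C\<^esub> cls u = (\<Union>u'\<in>cls u. cls (\<lambda>n x. c * u' n x))"
    by (simp add: Defs.completion_def cls_def group_algebra_simps)
  also have "\<dots> = cls (\<lambda>n x. c * u n x)"
  proof (intro cls_UN u)
    fix u' assume u': "(u, u') \<in> null_rel A N"
    have "((\<lambda>n x. c * u n x), (\<lambda>n x. c * u' n x)) \<in> null_rel A N"
    proof (rule null_relI)
      show "N (\<lambda>x. c * u n x - c * u' n x) <= cmod c * N (\<lambda>x. u n x - u' n x)" for n
        unfolding right_diff_distrib[symmetric]
        by (rule eq_refl[OF N_scale]) (use u' in \<open>simp add: null_rel_iff\<close>)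
      show "(\<lambda>n. cmod c * N (\<lambda>x. u n x - u' n x)) \<longlonglongrightarrow> 0"
        using u' unfolding null_rel_iff by (intro tendsto_mult_right_zero) blast
      show "cauchy (\<lambda>n x. c * u n x)" "cauchy (\<lambda>n x. c * u' n x)"
        using u' unfolding null_rel_iff by (blast intro: cauchy_scale)+
    qed
    then show "cls (\<lambda>n x. c * u' n x) = cls (\<lambda>n x. c * u n x)"
      by (rule cls_eqI)
  qed
  finally show ?thesis .
qed

lemma C_star:
  assumes u: "cauchy u"
  shows "star C (cls u) = cls (\<lambda>n. involution G (u n))"
proof -
  have "star C (cls u) = (\<Union>u'\<in>cls u. cls (\<lambda>n. involution G (u' n)))"
    by (simp add: Defs.completion_def cls_def group_algebra_simps)
  also have "\<dots> = cls (\<lambda>n. involution G (u n))"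
  proof (intro cls_UN u)
    fix u' assume u': "(u, u') \<in> null_rel A N"
    have "((\<lambda>n. involution G (u n)), (\<lambda>n. involution G (u' n))) \<in> null_rel A N"
    proof (rule null_relI)
      show "N (\<lambda>x. involution G (u n) x - involution G (u' n) x) <= N (\<lambda>x. u n x - u' n x)" for n
        unfolding involution_diff[symmetric]
        by (rule eq_refl[OF N_involution]) (use u' in \<open>auto simp: null_rel_iff\<close>)
    qed (use u' cauchy_involution in \<open>auto simp: null_rel_iff\<close>)
    then show "cls (\<lambda>n. involution G (u' n)) = cls (\<lambda>n. involution G (u n))"
      by (rule cls_eqI)
  qed
  finally show ?thesis .
qed

lemma C_one: "\<one>\<^bsub>C\<^esub> = cls (\<lambda>n. delta \<one>)"
  by (simp add: Defs.completion_def cls_def group_algebra_simps)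

lemma C_zero: "\<zero>\<^bsub>C\<^esub> = cls (\<lambda>n x. 0)"
  by (simp add: Defs.completion_def cls_def group_algebra_simps)

lemma C_cnorm:
  assumes u: "cauchy u"
  shows "(\<lambda>n. N (u n)) \<longlonglongrightarrow> cnorm C (cls u)"
proof -
  have lim: "(\<lambda>n. N (w n)) \<longlonglongrightarrow> lim (\<lambda>n. N (w n))" if "cauchy w" for w
    using cauchy_N_Cauchy[OF that] by (simp add: Cauchy_convergent_iff convergent_LIMSEQ_iff)
  have "lim (\<lambda>n. N (w n)) = lim (\<lambda>n. N (u n))" if w: "w \<in> cls u" for w
  proof -
    have cw: "cauchy w" and d: "(\<lambda>n. N (\<lambda>x. u n x - w n x)) \<longlonglongrightarrow> 0"
      using w by (auto simp: mem_cls_iff null_rel_iff)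
    have "(\<lambda>n. N (u n) - N (w n)) \<longlonglongrightarrow> 0"
    proof (rule Lim_null_comparison[OF always_eventually d], intro allI)
      show "norm (N (u n) - N (w n)) <= N (\<lambda>x. u n x - w n x)" for n
        using N_abs_diff[OF cauchy_in[OF u] cauchy_in[OF cw], of n n] by simp
    qed
    from tendsto_diff[OF lim[OF u] this] have "(\<lambda>n. N (w n)) \<longlonglongrightarrow> lim (\<lambda>n. N (u n))"
      by (simp only: diff_diff_eq2 add_diff_cancel_left' diff_zero)
    then show ?thesis using lim[OF cw] LIMSEQ_unique by blast
  qed
  then have im: "(\<lambda>w. lim (\<lambda>n. N (w n))) ` cls u = {lim (\<lambda>n. N (u n))}"
    using self_mem_cls[OF u] by blast
  have "cnorm C (cls u) = the_elem ((\<lambda>w. lim (\<lambda>n. N (w n))) ` cls u)"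
    by (simp add: Defs.completion_def)
  then have "cnorm C (cls u) = lim (\<lambda>n. N (u n))"
    unfolding im the_elem_eq .
  then show ?thesis using lim[OF u] by simp
qed

lemma abelian_group_C: "abelian_group C"
proof (rule abelian_groupI)
  fix P Q R assume "P \<in> carrier C" "Q \<in> carrier C" "R \<in> carrier C"
  then obtain u v w where *: "cauchy u" "P = cls u" "cauchy v" "Q = cls v" "cauchy w" "R = cls w"
    unfolding carrier_C by blast
  then show "P \<oplus>\<^bsub>C\<^esub> Q \<oplus>\<^bsub>C\<^esub> R = P \<oplus>\<^bsub>C\<^esub> (Q \<oplus>\<^bsub>C\<^esub> R)"
    by (simp add: C_add cauchy_add add.assoc)
next
  fix P Q assume "P \<in> carrier C" "Q \<in> carrier C"
  then obtain u v where *: "cauchy u" "P = cls u" "cauchy v" "Q = cls v"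
    unfolding carrier_C by blast
  then show "P \<oplus>\<^bsub>C\<^esub> Q = Q \<oplus>\<^bsub>C\<^esub> P" by (simp add: C_add add.commute)
  show "P \<oplus>\<^bsub>C\<^esub> Q \<in> carrier C"
    using * by (simp add: C_add cls_in_carrier cauchy_add)
next
  show "\<zero>\<^bsub>C\<^esub> \<in> carrier C" using cls_in_carrier[OF cauchy_const[OF zero_in_fin_supp]] by (simp add: C_zero)
next
  fix P assume "P \<in> carrier C"
  then obtain u where *: "cauchy u" "P = cls u" unfolding carrier_C by blast
  then show "\<zero>\<^bsub>C\<^esub> \<oplus>\<^bsub>C\<^esub> P = P"
    using cauchy_const[OF zero_in_fin_supp] by (simp add: C_zero C_add)
  show "\<exists>Q\<in>carrier C. Q \<oplus>\<^bsub>C\<^esub> P = \<zero>\<^bsub>C\<^esub>"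
  proof (rule bexI)
    show "cls (\<lambda>n x. - u n x) \<oplus>\<^bsub>C\<^esub> P = \<zero>\<^bsub>C\<^esub>"
      using *(1) cauchy_uminus[OF *(1)] by (simp add: *(2) C_add C_zero)
    show "cls (\<lambda>n x. - u n x) \<in> carrier C"
      by (rule cls_in_carrier[OF cauchy_uminus[OF *(1)]])
  qed
qed

lemma C_minus:
  assumes u: "cauchy u" and w: "cauchy w"
  shows "cls u \<ominus>\<^bsub>C\<^esub> cls w = cls (\<lambda>n x. u n x - w n x)"
proof -
  interpret C: abelian_group C by (rule abelian_group_C)
  have "\<ominus>\<^bsub>C\<^esub> (cls w) = cls (\<lambda>n x. - w n x)"
    by (rule C.minus_equality)
      (use w cauchy_uminus[OF w] in \<open>simp_all add: cls_in_carrier C_add C_zero\<close>)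
  then show ?thesis using C_add[OF u cauchy_uminus[OF w]] by (simp add: a_minus_def)
qed

end

context group_algebra_norm
begin
text \<open>
  Real rank zero in terms of Cauchy sequences.  A self-adjoint element of the completion is the class
  of a sequence of self-adjoint terms: replace each term by its real part.
\<close>

lemma real_rank_zero_completionD:
  assumes rr0: "real_rank_zero C"
    and a: "a \<in> fin_supp G" "involution G a = a" and e: "e > 0"
  obtains u Sp where "cauchy u" "\<And>n. involution G (u n) = u n"
    "\<forall>\<^sub>F n in sequentially. N (\<lambda>x. a x - u n x) < e" "finite Sp"
    "\<And>z. z \<notin> Sp ==>
       \<exists>b. cauchy b \<and> (\<lambda>n. N (\<lambda>x. convol G (b n) (\<lambda>x. u n x - z * delta \<one> x) x - delta \<one> x)) \<longlonglongrightarrow> 0"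
proof -
  have ca: "cauchy (\<lambda>n. a)" using cauchy_const a by blast
  have "self_adjoint C (cls (\<lambda>n. a))"
    using ca a by (simp add: self_adjoint_def cls_in_carrier C_star)
  then obtain v where v: "self_adjoint C v" "finite (spectrum C v)" "cnorm C (cls (\<lambda>n. a) \<ominus>\<^bsub>C\<^esub> v) < e"
    using rr0 e unfolding real_rank_zero_def by blast
  obtain w where w: "cauchy w" "v = cls w" using v(1) unfolding self_adjoint_def carrier_C by blast
  have aw: "cauchy (\<lambda>n. involution G (w n))" using cauchy_involution w by blast
  have "cls (\<lambda>n. involution G (w n)) = cls w" using v(1) w by (simp add: self_adjoint_def C_star)
  then have null: "(\<lambda>n. N (\<lambda>x. involution G (w n) x - w n x)) \<longlonglongrightarrow> 0"
    using w aw by (simp add: cls_eq_iff null_rel_iff)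
  define u where "u = (\<lambda>n x. (1/2) * (w n x + involution G (w n) x))"
  have cu: "cauchy u" unfolding u_def using w aw by (intro cauchy_scale cauchy_add)
  have adj: "involution G (u n) = u n" for n
    using w unfolding u_def by (subst involution_scale, subst involution_add) (simp add: add.commute)
  have "(u, w) \<in> null_rel A N"
  proof (rule null_relI)
    fix n
    have d: "(\<lambda>x. involution G (w n) x - w n x) \<in> fin_supp G" using w by simp
    have "(\<lambda>x. u n x - w n x) = (\<lambda>x. (1/2) * (involution G (w n) x - w n x))"
      by (simp add: u_def fun_eq_iff field_simps)
    then have "N (\<lambda>x. u n x - w n x) = cmod (1/2) * N (\<lambda>x. involution G (w n) x - w n x)"
      using N_scale[OF d, of "1/2"] by (simp only:)
    then show "N (\<lambda>x. u n x - w n x) <= N (\<lambda>x. involution G (w n) x - w n x)"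
      using N_nonneg[OF d] by simp
  qed (use null cu w in auto)
  then have vu: "v = cls u" unfolding w(2) by (rule cls_eqI)
  show thesis
  proof (rule that[OF cu adj _ v(2)])
    have "(\<lambda>n. N (\<lambda>x. a x - u n x)) \<longlonglongrightarrow> cnorm C (cls (\<lambda>n. a) \<ominus>\<^bsub>C\<^esub> v)"
      using C_cnorm[OF cauchy_diff[OF ca cu]] by (simp add: vu C_minus ca cu)
    then show "\<forall>\<^sub>F n in sequentially. N (\<lambda>x. a x - u n x) < e"
      using v(3) by (rule order_tendstoD(2))
  next
    fix z assume "z \<notin> spectrum C v"
    then have "cls u \<ominus>\<^bsub>C\<^esub> (z \<odot>\<^bsub>C\<^esub> \<one>\<^bsub>C\<^esub>) \<in> Units C" by (simp add: spectrum_def vu)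
    moreover have c1: "cauchy (\<lambda>n. delta \<one>)" by (simp add: cauchy_const)
    moreover have cz: "cauchy (\<lambda>n x. u n x - z * delta \<one> x)"
      using cauchy_diff[OF cu cauchy_scale[OF c1]] .
    ultimately have "cls (\<lambda>n x. u n x - z * delta \<one> x) \<in> Units C"
      by (simp add: C_one C_smult C_minus cu cauchy_scale)
    then obtain Q where Q: "Q \<in> carrier C" "Q \<otimes>\<^bsub>C\<^esub> cls (\<lambda>n x. u n x - z * delta \<one> x) = \<one>\<^bsub>C\<^esub>"
      unfolding Units_def by blast
    obtain b where b: "cauchy b" "Q = cls b" using Q(1) unfolding carrier_C by blast
    have "cls (\<lambda>n. convol G (b n) (\<lambda>x. u n x - z * delta \<one> x)) = cls (\<lambda>n. delta \<one>)"
      using Q(2) C_mult[OF b(1) cz] b(2) C_one by simp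
    then have "((\<lambda>n. convol G (b n) (\<lambda>x. u n x - z * delta \<one> x)), \<lambda>n. delta \<one>) \<in> null_rel A N"
      using cls_eq_iff[OF cauchy_mult[OF b(1) cz] c1] by blast
    then show "\<exists>b. cauchy b \<and> (\<lambda>n. N (\<lambda>x. convol G (b n) (\<lambda>x. u n x - z * delta \<one> x) x - delta \<one> x)) \<longlonglongrightarrow> 0"
      unfolding null_rel_iff using b(1) by blast
  qed
qed

end

section \<open>Seminorms defined by states\<close>

context group
begin

text \<open>The sesquilinear form of the GNS construction for the functional extending \<open>\<phi>\<close>.\<close>

definition gns_form :: "('a => complex) => ('a => complex) => ('a => complex) => complex" where
  "gns_form \<phi> x y = lin_ext \<phi> (convol G (involution G x) y)"

definition gns_norm :: "('a => complex) => ('a => complex) => real" where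
  "gns_norm \<phi> x = sqrt (Re (gns_form \<phi> x x))"

definition positive_functional :: "('a => complex) => bool" where
  "positive_functional \<phi> \<longleftrightarrow> \<phi> \<one> = 1 \<and>
     (\<forall>x\<in>fin_supp G. 0 <= Re (gns_form \<phi> x x) \<and> Im (gns_form \<phi> x x) = 0)"

lemma gns_form_add_left:
  assumes "x \<in> fin_supp G" "y \<in> fin_supp G" "z \<in> fin_supp G"
  shows "gns_form \<phi> (\<lambda>g. x g + y g) z = gns_form \<phi> x z + gns_form \<phi> y z"
  using assms unfolding gns_form_def involution_add by (simp add: convol_add_left lin_ext_add)

lemma gns_form_add_right:
  assumes "x \<in> fin_supp G" "y \<in> fin_supp G" "z \<in> fin_supp G"
  shows "gns_form \<phi> z (\<lambda>g. x g + y g) = gns_form \<phi> z x + gns_form \<phi> z y"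
  using assms unfolding gns_form_def by (simp add: convol_add_right lin_ext_add)

lemma gns_form_scale_left:
  assumes "x \<in> fin_supp G" "y \<in> fin_supp G"
  shows "gns_form \<phi> (\<lambda>g. c * x g) y = cnj c * gns_form \<phi> x y"
  using assms unfolding gns_form_def involution_scale by (simp add: convol_scale_left lin_ext_scale)

lemma gns_form_scale_right:
  assumes "x \<in> fin_supp G" "y \<in> fin_supp G"
  shows "gns_form \<phi> x (\<lambda>g. c * y g) = c * gns_form \<phi> x y"
  using assms unfolding gns_form_def by (simp add: convol_scale_right lin_ext_scale)

lemma gns_form_mult:
  assumes x: "x \<in> fin_supp G" and y: "y \<in> fin_supp G" and z: "z \<in> fin_supp G"
  shows "gns_form \<phi> (convol G x y) z = gns_form \<phi> y (convol G (involution G x) z)"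
  using assms unfolding gns_form_def by (simp add: involution_convol convol_assoc)

lemma gns_form_delta:
  assumes g: "g \<in> carrier G" and x: "x \<in> fin_supp G" and y: "y \<in> fin_supp G"
  shows "gns_form \<phi> (convol G (delta g) x) (convol G (delta g) y) = gns_form \<phi> x y"
proof -
  have "convol G (involution G (delta g)) (convol G (delta g) y) = y"
    using g y by (simp add: convol_assoc[symmetric] involution_delta convol_delta)
  then show ?thesis using g x y by (simp add: gns_form_mult)
qed

context
  fixes \<phi> assumes pos: "positive_functional \<phi>"
begin

lemma gns_form_self:
  assumes "x \<in> fin_supp G"
  shows "gns_form \<phi> x x = of_real ((gns_norm \<phi> x)\<^sup>2)"
  using pos assms by (simp add: positive_functional_def gns_norm_def complex_eq_iff)

lemma gns_norm_nonneg: "x \<in> fin_supp G ==> 0 <= gns_norm \<phi> x"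
  using pos by (simp add: positive_functional_def gns_norm_def)

lemma gns_form_expand:
  assumes "x \<in> fin_supp G" "y \<in> fin_supp G"
  shows "gns_form \<phi> (\<lambda>g. x g + c * y g) (\<lambda>g. x g + c * y g)
    = gns_form \<phi> x x + c * gns_form \<phi> x y + cnj c * gns_form \<phi> y x + c * cnj c * gns_form \<phi> y y"
  using assms
  by (simp add: gns_form_add_left gns_form_add_right gns_form_scale_left gns_form_scale_right algebra_simps)

lemma gns_form_hermitian:
  assumes x: "x \<in> fin_supp G" and y: "y \<in> fin_supp G"
  shows "gns_form \<phi> y x = cnj (gns_form \<phi> x y)"
proof -
  have real: "Im (c * gns_form \<phi> x y + cnj c * gns_form \<phi> y x) = 0" for c
  proof -
    have "Im (gns_form \<phi> (\<lambda>g. x g + c * y g) (\<lambda>g. x g + c * y g)) = 0"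
      using pos x y by (simp add: positive_functional_def)
    then show ?thesis
      unfolding gns_form_expand[OF x y] gns_form_self[OF x] gns_form_self[OF y] by simp
  qed
  show ?thesis using real[of 1] real[of \<i>] by (simp add: complex_eq_iff)
qed

lemma gns_cauchy_schwarz:
  assumes x: "x \<in> fin_supp G" and y: "y \<in> fin_supp G"
  shows "cmod (gns_form \<phi> x y) <= gns_norm \<phi> x * gns_norm \<phi> y"
proof -
  define \<beta> where "\<beta> = gns_form \<phi> x y"
  define X where "X = (gns_norm \<phi> x)\<^sup>2"
  define Y where "Y = (gns_norm \<phi> y)\<^sup>2"
  have quad: "0 <= X - 2 * s * (cmod \<beta>)\<^sup>2 + s\<^sup>2 * (cmod \<beta>)\<^sup>2 * Y" for s :: real
  proof -
    define c where "c = - of_real s * cnj \<beta>"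
    have "0 <= Re (gns_form \<phi> (\<lambda>g. x g + c * y g) (\<lambda>g. x g + c * y g))"
      using pos x y by (simp add: positive_functional_def)
    also have "gns_form \<phi> (\<lambda>g. x g + c * y g) (\<lambda>g. x g + c * y g)
       = of_real X + c * \<beta> + cnj c * cnj \<beta> + c * cnj c * of_real Y"
      unfolding gns_form_expand[OF x y] gns_form_hermitian[OF x y] gns_form_self[OF x]
        gns_form_self[OF y] X_def Y_def \<beta>_def ..
    also have "\<dots> = of_real (X - 2 * s * (cmod \<beta>)\<^sup>2 + s\<^sup>2 * (cmod \<beta>)\<^sup>2 * Y)"
    proof -
      have b: "\<beta> * cnj \<beta> = of_real ((cmod \<beta>)\<^sup>2)" by (rule complex_norm_square[symmetric])
      have "c * \<beta> = - of_real s * (\<beta> * cnj \<beta>)" "cnj c * cnj \<beta> = - of_real s * (\<beta> * cnj \<beta>)"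
        "c * cnj c = of_real (s\<^sup>2) * (\<beta> * cnj \<beta>)"
        by (simp_all add: c_def power2_eq_square algebra_simps)
      then show ?thesis unfolding b by simp
    qed
    finally show ?thesis by simp
  qed
  have "(cmod \<beta>)\<^sup>2 <= X * Y"
  proof (cases "Y = 0")
    case True
    have "(cmod \<beta>)\<^sup>2 = 0"
    proof (rule ccontr)
      assume "(cmod \<beta>)\<^sup>2 ~= 0"
      then have "(cmod \<beta>)\<^sup>2 > 0" by simp
      then show False
        using quad[of "(X + 1) / (2 * (cmod \<beta>)\<^sup>2)"] True by (simp add: field_simps)
    qed
    then show ?thesis using True by simp
  next
    case False
    then have "Y > 0" by (simp add: Y_def)
    then show ?thesis using quad[of "1 / Y"] by (simp add: field_simps power2_eq_square)
  qed
  then have "(cmod \<beta>)\<^sup>2 <= (gns_norm \<phi> x * gns_norm \<phi> y)\<^sup>2"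
    by (simp add: X_def Y_def power_mult_distrib)
  then show ?thesis unfolding \<beta>_def
    by (rule power2_le_imp_le) (simp add: gns_norm_nonneg x y)
qed

lemma gns_norm_triangle:
  assumes x: "x \<in> fin_supp G" and y: "y \<in> fin_supp G"
  shows "gns_norm \<phi> (\<lambda>g. x g + y g) <= gns_norm \<phi> x + gns_norm \<phi> y"
proof -
  have xy: "(\<lambda>g. x g + y g) \<in> fin_supp G" using x y by simp
  have "complex_of_real ((gns_norm \<phi> (\<lambda>g. x g + y g))\<^sup>2)
      = of_real ((gns_norm \<phi> x)\<^sup>2) + gns_form \<phi> x y + cnj (gns_form \<phi> x y) + of_real ((gns_norm \<phi> y)\<^sup>2)"
    using gns_form_expand[OF x y, of 1]
    unfolding gns_form_self[OF x] gns_form_self[OF y] gns_form_hermitian[OF x y]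
    by (simp add: gns_form_self[OF xy])
  then have "(gns_norm \<phi> (\<lambda>g. x g + y g))\<^sup>2
      = (gns_norm \<phi> x)\<^sup>2 + 2 * Re (gns_form \<phi> x y) + (gns_norm \<phi> y)\<^sup>2"
    by (simp add: complex_eq_iff)
  also have "\<dots> <= (gns_norm \<phi> x + gns_norm \<phi> y)\<^sup>2"
    using gns_cauchy_schwarz[OF x y] complex_Re_le_cmod[of "gns_form \<phi> x y"]
    by (simp add: power2_sum)
  finally show ?thesis by (rule power2_le_imp_le) (simp add: gns_norm_nonneg x y)
qed

lemma gns_norm_scale:
  assumes x: "x \<in> fin_supp G"
  shows "gns_norm \<phi> (\<lambda>g. c * x g) = cmod c * gns_norm \<phi> x"
proof -
  have cx: "(\<lambda>g. c * x g) \<in> fin_supp G" using x by simp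
  have "complex_of_real ((gns_norm \<phi> (\<lambda>g. c * x g))\<^sup>2) = c * cnj c * of_real ((gns_norm \<phi> x)\<^sup>2)"
    unfolding gns_form_self[OF cx, symmetric] gns_form_scale_left[OF x cx] gns_form_scale_right[OF x x]
      gns_form_self[OF x] by simp
  also have "\<dots> = of_real ((cmod c * gns_norm \<phi> x)\<^sup>2)"
    unfolding complex_norm_square[symmetric] by (simp add: power_mult_distrib)
  finally have "(gns_norm \<phi> (\<lambda>g. c * x g))\<^sup>2 = (cmod c * gns_norm \<phi> x)\<^sup>2"
    by (simp only: of_real_eq_iff)
  then show ?thesis
    by (rule power2_eq_imp_eq) (simp_all add: gns_norm_nonneg x)
qed

lemma gns_norm_one: "gns_norm \<phi> (delta \<one>) = 1"
  using pos by (simp add: gns_norm_def gns_form_def positive_functional_def involution_delta)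

lemma gns_norm_mult_le_l1:
  assumes x: "x \<in> fin_supp G" and y: "y \<in> fin_supp G"
  shows "gns_norm \<phi> (convol G x y) <= l1_norm x * gns_norm \<phi> y"
  using x
proof (induction rule: fin_supp_induct)
  case zero
  have "convol G (\<lambda>x. 0) y = (\<lambda>x. 0)" by (simp add: convol_def fun_eq_iff)
  moreover have "gns_norm \<phi> (\<lambda>x. 0) = 0"
    using gns_norm_scale[OF zero_in_fin_supp, of 0] by simp
  ultimately show ?case by (simp add: l1_norm_def)
next
  case (add f g c)
  have dy: "convol G (delta g) y \<in> fin_supp G" and fy: "convol G f y \<in> fin_supp G"
    using add y by simp_all
  have "convol G (\<lambda>x. f x + c * delta g x) y
      = (\<lambda>x. convol G f y x + c * convol G (delta g) y x)"
    using add y by (simp add: convol_add_left convol_scale_left)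
  then have "gns_norm \<phi> (convol G (\<lambda>x. f x + c * delta g x) y)
      <= gns_norm \<phi> (convol G f y) + cmod c * gns_norm \<phi> (convol G (delta g) y)"
    using gns_norm_triangle[OF fy scale_in_fin_supp[OF dy], of c] gns_norm_scale[OF dy, of c]
    by simp
  also have "gns_norm \<phi> (convol G (delta g) y) = gns_norm \<phi> y"
    using gns_form_delta[OF \<open>g \<in> carrier G\<close> y y] by (simp add: gns_norm_def)
  also have "gns_norm \<phi> (convol G f y) + cmod c * gns_norm \<phi> y <= (l1_norm f + cmod c) * gns_norm \<phi> y"
    using add.IH by (simp add: distrib_right)
  also have "l1_norm f + cmod c = l1_norm (\<lambda>x. f x + c * delta g x)"
  proof (cases "c = 0")
    case False
    have "{x. f x + c * delta g x ~= 0} = insert g {x. f x ~= 0}"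
      using False add by (auto simp: delta_def)
    moreover have "(\<Sum>x | f x ~= 0. cmod (f x + c * delta g x)) = (\<Sum>x | f x ~= 0. cmod (f x))"
      using add by (intro sum.cong) (auto simp: delta_def)
    ultimately show ?thesis
      using fin_suppD(1)[of f] add by (simp add: l1_norm_def delta_def)
  qed simp
  finally show ?case .
qed

lemma gns_norm_le_l1: "x \<in> fin_supp G ==> gns_norm \<phi> x <= l1_norm x"
  using gns_norm_mult_le_l1[of x "delta \<one>"] by (simp add: gns_norm_one)

end

end

text \<open>
  A set of states closed under passing to the vector states of its GNS representations.  The seminorm
  of \<open>x\<close> is then the operator norm of \<open>x\<close> in the direct sum of these representations.
\<close>

locale state_set = group G for G :: "('g, 'm) monoid_scheme" (structure) +
  fixes S :: "('g => complex) set"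
  assumes S_nonempty: "S ~= {}"
    and S_positive: "\<phi> \<in> S ==> positive_functional \<phi>"
    and S_vector: "[|\<phi> \<in> S; c \<in> fin_supp G; gns_norm \<phi> c ~= 0|] ==>
       \<exists>\<phi>'\<in>S. \<forall>x\<in>fin_supp G. gns_norm \<phi>' x = gns_norm \<phi> (convol G x c) / gns_norm \<phi> c"
begin

definition state_norm :: "('g => complex) => real" where
  "state_norm x = (SUP \<phi>\<in>S. gns_norm \<phi> x)"

lemma gns_norm_le_state_norm:
  assumes "\<phi> \<in> S" "x \<in> fin_supp G"
  shows "gns_norm \<phi> x <= state_norm x"
  unfolding state_norm_def
  by (rule cSUP_upper[OF assms(1)])
    (use assms gns_norm_le_l1[OF S_positive] in \<open>auto simp: bdd_above_def\<close>)

lemma state_norm_le: "(\<And>\<phi>. \<phi> \<in> S ==> gns_norm \<phi> x <= B) ==> state_norm x <= B"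
  unfolding state_norm_def using S_nonempty by (rule cSUP_least)

lemma less_state_normD:
  assumes "B < state_norm x" obtains \<phi> where "\<phi> \<in> S" "B < gns_norm \<phi> x"
  using state_norm_le[of x B] assms by (meson not_le)

lemma state_norm_nonneg: "x \<in> fin_supp G ==> 0 <= state_norm x"
  using S_nonempty gns_norm_le_state_norm gns_norm_nonneg[OF S_positive] order_trans by blast

lemma gns_norm_mult_le:
  assumes \<phi>: "\<phi> \<in> S" and x: "x \<in> fin_supp G" and y: "y \<in> fin_supp G"
  shows "gns_norm \<phi> (convol G x y) <= state_norm x * gns_norm \<phi> y"
proof (cases "gns_norm \<phi> y = 0")
  case True
  then show ?thesis using gns_norm_mult_le_l1[OF S_positive[OF \<phi>] x y] by simp
next
  case False
  then obtain \<phi>' where \<phi>': "\<phi>' \<in> S" "gns_norm \<phi>' x = gns_norm \<phi> (convol G x y) / gns_norm \<phi> y"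
    using S_vector[OF \<phi> y] x by blast
  have "gns_norm \<phi> y > 0" using False gns_norm_nonneg[OF S_positive[OF \<phi>] y] by simp
  moreover have "gns_norm \<phi> (convol G x y) / gns_norm \<phi> y <= state_norm x"
    using gns_norm_le_state_norm[OF \<phi>'(1) x] \<phi>'(2) by simp
  ultimately show ?thesis by (simp add: pos_divide_le_eq)
qed

lemma state_norm_star_le:
  assumes x: "x \<in> fin_supp G"
  shows "(state_norm x)\<^sup>2 <= state_norm (convol G (involution G x) x)"
proof -
  have xx: "convol G (involution G x) x \<in> fin_supp G" using x by simp
  have "state_norm x <= sqrt (state_norm (convol G (involution G x) x))"
  proof (rule state_norm_le)
    fix \<phi> assume \<phi>: "\<phi> \<in> S"
    note p = S_positive[OF \<phi>]
    have "gns_form \<phi> x x = gns_form \<phi> (delta \<one>) (convol G (involution G x) x)"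
      using xx by (simp add: gns_form_def involution_delta)
    then have "cmod (gns_form \<phi> x x) <= gns_norm \<phi> (convol G (involution G x) x)"
      using gns_cauchy_schwarz[OF p delta_in_fin_supp[OF one_closed] xx] gns_norm_one[OF p]
      by simp
    then have "(gns_norm \<phi> x)\<^sup>2 <= gns_norm \<phi> (convol G (involution G x) x)"
      unfolding gns_form_self[OF p x] by (simp add: norm_power)
    also have "\<dots> <= state_norm (convol G (involution G x) x)"
      using gns_norm_le_state_norm[OF \<phi> xx] .
    finally show "gns_norm \<phi> x <= sqrt (state_norm (convol G (involution G x) x))"
      by (rule real_le_rsqrt)
  qed
  then show ?thesis
    using state_norm_nonneg[OF x] state_norm_nonneg[OF xx]
    by (metis power_mono real_sqrt_pow2)
qed

lemma state_norm_mult: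
  assumes x: "x \<in> fin_supp G" and y: "y \<in> fin_supp G"
  shows "state_norm (convol G x y) <= state_norm x * state_norm y"
proof (rule state_norm_le)
  fix \<phi> assume \<phi>: "\<phi> \<in> S"
  show "gns_norm \<phi> (convol G x y) <= state_norm x * state_norm y"
    using gns_norm_mult_le[OF \<phi> x y] gns_norm_le_state_norm[OF \<phi> y] state_norm_nonneg[OF x]
    by (meson mult_left_mono order_trans)
qed

lemma state_norm_involution_le:
  assumes x: "x \<in> fin_supp G"
  shows "state_norm x <= state_norm (involution G x)"
proof (cases "state_norm x = 0")
  case True
  then show ?thesis using x by (simp add: state_norm_nonneg)
next
  case False
  have "state_norm x * state_norm x <= state_norm (involution G x) * state_norm x"
    using state_norm_star_le[OF x] state_norm_mult[of "involution G x" x] x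
    by (simp add: power2_eq_square)
  then show ?thesis using False state_norm_nonneg[OF x] by simp
qed

lemma state_norm_scale:
  assumes x: "x \<in> fin_supp G"
  shows "state_norm (\<lambda>g. c * x g) = cmod c * state_norm x"
proof (rule antisym)
  show le: "state_norm (\<lambda>g. c * x g) <= cmod c * state_norm x"
    by (rule state_norm_le)
      (simp add: gns_norm_scale[OF S_positive x] gns_norm_le_state_norm[OF _ x] mult_left_mono)
  show "cmod c * state_norm x <= state_norm (\<lambda>g. c * x g)"
  proof (cases "c = 0")
    case True
    then show ?thesis by (simp add: state_norm_nonneg)
  next
    case False
    have "state_norm x <= state_norm (\<lambda>g. c * x g) / cmod c"
    proof (rule state_norm_le)
      fix \<phi> assume \<phi>: "\<phi> \<in> S"
      have "cmod c * gns_norm \<phi> x <= state_norm (\<lambda>g. c * x g)"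
        using gns_norm_le_state_norm[OF \<phi> scale_in_fin_supp[OF x], of c]
        by (simp add: gns_norm_scale[OF S_positive[OF \<phi>] x])
      then show "gns_norm \<phi> x <= state_norm (\<lambda>g. c * x g) / cmod c"
        using False by (simp add: field_simps)
    qed
    then show ?thesis using False by (simp add: field_simps)
  qed
qed

lemma cstar_seminorm_state_norm: "cstar_seminorm (group_algebra G) state_norm"
  unfolding cstar_seminorm_group_algebra_iff
proof (intro conjI ballI allI)
  fix x assume x: "x \<in> fin_supp G"
  show "0 <= state_norm x" by (rule state_norm_nonneg[OF x])
  show "state_norm (\<lambda>g. c * x g) = cmod c * state_norm x" for c by (rule state_norm_scale[OF x])
  show "state_norm (convol G (involution G x) x) = (state_norm x)\<^sup>2"
  proof (rule antisym)
    have "state_norm (involution G x) <= state_norm x"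
      using state_norm_involution_le[of "involution G x"] x by simp
    then have "state_norm (involution G x) * state_norm x <= state_norm x * state_norm x"
      using state_norm_nonneg[OF x] by (rule mult_right_mono)
    then show "state_norm (convol G (involution G x) x) <= (state_norm x)\<^sup>2"
      using state_norm_mult[of "involution G x" x] x by (simp add: power2_eq_square)
  qed (rule state_norm_star_le[OF x])
  fix y assume y: "y \<in> fin_supp G"
  show "state_norm (convol G x y) <= state_norm x * state_norm y"
    by (rule state_norm_mult[OF x y])
  show "state_norm (\<lambda>g. x g + y g) <= state_norm x + state_norm y"
  proof (rule state_norm_le)
    fix \<phi> assume \<phi>: "\<phi> \<in> S"
    show "gns_norm \<phi> (\<lambda>g. x g + y g) <= state_norm x + state_norm y"
      using gns_norm_triangle[OF S_positive[OF \<phi>] x y] gns_norm_le_state_norm[OF \<phi> x]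
        gns_norm_le_state_norm[OF \<phi> y] by linarith
  qed
qed

lemma state_norm_le_maximal_norm: "x \<in> fin_supp G ==> state_norm x <= maximal_norm x"
  by (rule cstar_seminorm_le_max_norm[OF cstar_seminorm_state_norm])

sublocale state_norm: group_algebra_norm G state_norm
proof
  fix a b assume a: "a \<in> fin_supp G"
  note p = cstar_seminorm_state_norm
  show "0 <= state_norm a" "state_norm (\<lambda>x. c * a x) = cmod c * state_norm a"
    "state_norm (involution G a) = state_norm a" for c
    using cstar_seminormD[OF p a] cstar_seminorm_involution[OF p a] by blast+
  assume b: "b \<in> fin_supp G"
  show "state_norm (\<lambda>x. a x + b x) <= state_norm a + state_norm b"
    "state_norm (convol G a b) <= state_norm a * state_norm b"
    using cstar_seminormD[OF p a] b by blast+
qed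

text \<open>
  The quantitative core of the fact that the norm \<open>r\<close> of a self-adjoint operator \<open>u\<close> lies, up to sign,
  in its spectrum.  A unit vector on which \<open>u\<close> almost attains its norm is almost annihilated by
  \<open>u\<^sup>2 - r\<^sup>2 = (u + r) (u - r)\<close>, which left inverses of both factors forbid.
\<close>

lemma near_inverses_bound:
  assumes u: "u \<in> fin_supp G" "involution G u = u"
    and b: "b \<in> fin_supp G" "state_norm b <= B" and b': "b' \<in> fin_supp G" "state_norm b' <= B"
    and \<eta>: "0 < \<eta>" "\<eta> < r" and up: "state_norm u <= r + \<eta>" and low: "r - \<eta> < state_norm u"
    and inv: "state_norm (\<lambda>x. convol G b (\<lambda>x. u x - of_real r * delta \<one> x) x - delta \<one> x) <= \<eta>"
    and inv': "state_norm (\<lambda>x. convol G b' (\<lambda>x. u x + of_real r * delta \<one> x) x - delta \<one> x) <= \<eta>"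
  shows "1 <= \<eta> + B * (\<eta> * (2 * r + \<eta>) + B * sqrt ((r + \<eta>)^4 - 2 * r\<^sup>2 * (r - \<eta>)\<^sup>2 + r^4))"
proof -
  obtain \<phi> where \<phi>: "\<phi> \<in> S" and low': "r - \<eta> < gns_norm \<phi> u"
    using less_state_normD[OF low] by blast
  note p = S_positive[OF \<phi>]
  define e where "e = delta (one G)"
  define y where "y = (\<lambda>x. u x - of_real r * e x)"
  define w where "w = (\<lambda>x. u x + of_real r * e x)"
  define m where "m = (\<lambda>x. convol G u u x + of_real (- (r\<^sup>2)) * e x)"
  have e: "e \<in> fin_supp G" by (simp add: e_def)
  have y: "y \<in> fin_supp G" and w: "w \<in> fin_supp G" and uu: "convol G u u \<in> fin_supp G"
    using u e by (simp_all add: y_def w_def)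
  have m: "m \<in> fin_supp G" unfolding m_def using uu e by (intro add_in_fin_supp scale_in_fin_supp)
  have eu: "convol G e z = z" "convol G z e = z" if "z \<in> fin_supp G" for z
    using that by (simp_all add: e_def)
  have B: "0 <= B" using b(2) state_norm_nonneg[OF b(1)] by linarith
  have wy: "convol G w y = m"
  proof -
    have "convol G w y = (\<lambda>x. convol G u y x + of_real r * convol G e y x)"
      using u e y unfolding w_def by (simp add: convol_add_left convol_scale_left)
    also have "\<dots> = (\<lambda>x. convol G u y x + of_real r * y x)" using eu y by simp
    also have "convol G u y = (\<lambda>x. convol G u u x - of_real r * convol G u e x)"
      using u e unfolding y_def by (simp add: convol_diff_right convol_scale_right)
    also have "convol G u e = u" using eu u by simp
    also have "(\<lambda>x. convol G u u x - of_real r * u x + of_real r * y x) = m"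
      by (simp add: m_def y_def fun_eq_iff algebra_simps power2_eq_square)
    finally show ?thesis .
  qed
  have cross: "gns_form \<phi> (convol G u u) e = of_real ((gns_norm \<phi> u)\<^sup>2)"
    using gns_form_mult[OF u(1) u(1) e, of \<phi>] u eu gns_form_self[OF p u(1)] by simp
  have m_le: "gns_norm \<phi> m <= sqrt ((r + \<eta>)^4 - 2 * r\<^sup>2 * (r - \<eta>)\<^sup>2 + r^4)"
  proof (rule real_le_rsqrt)
    have "complex_of_real ((gns_norm \<phi> m)\<^sup>2) = of_real ((gns_norm \<phi> (convol G u u))\<^sup>2
        - 2 * r\<^sup>2 * (gns_norm \<phi> u)\<^sup>2 + r^4)"
      unfolding gns_form_self[OF p m, symmetric] unfolding m_def gns_form_expand[OF p uu e]
        gns_form_hermitian[OF p uu e] cross gns_form_self[OF p uu] gns_form_self[OF p e]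
      by (simp add: e_def gns_norm_one[OF p] power4_eq_xxxx power2_eq_square)
    then have "(gns_norm \<phi> m)\<^sup>2 = (gns_norm \<phi> (convol G u u))\<^sup>2 - 2 * r\<^sup>2 * (gns_norm \<phi> u)\<^sup>2 + r^4"
      by (simp only: of_real_eq_iff)
    moreover have "(gns_norm \<phi> (convol G u u))\<^sup>2 <= (r + \<eta>)^4"
    proof -
      have "gns_norm \<phi> (convol G u u) <= state_norm u * state_norm u"
        using gns_norm_le_state_norm[OF \<phi> uu] state_norm_mult[OF u(1) u(1)] by linarith
      also have "\<dots> <= (r + \<eta>) * (r + \<eta>)"
        using up state_norm_nonneg[OF u(1)] by (intro mult_mono) auto
      finally have "(gns_norm \<phi> (convol G u u))\<^sup>2 <= ((r + \<eta>) * (r + \<eta>))\<^sup>2"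
        using gns_norm_nonneg[OF p uu] by (rule power_mono)
      then show ?thesis by (simp add: power4_eq_xxxx power2_eq_square mult.assoc)
    qed
    moreover have "2 * r\<^sup>2 * (r - \<eta>)\<^sup>2 <= 2 * r\<^sup>2 * (gns_norm \<phi> u)\<^sup>2"
      using low' \<eta> by (intro mult_left_mono power_mono) auto
    ultimately show "(gns_norm \<phi> m)\<^sup>2 <= (r + \<eta>)^4 - 2 * r\<^sup>2 * (r - \<eta>)\<^sup>2 + r^4" by linarith
  qed
  have triangle: "gns_norm \<phi> z <= state_norm (\<lambda>x. convol G c v x - e x) * gns_norm \<phi> z
      + state_norm c * gns_norm \<phi> (convol G v z)"
    if "c \<in> fin_supp G" "v \<in> fin_supp G" "z \<in> fin_supp G" for c v z
  proof -
    define k where "k = (\<lambda>x. convol G c v x - e x)"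
    have k: "k \<in> fin_supp G" using that e by (simp add: k_def)
    have z: "z = (\<lambda>x. (-1) * convol G k z x + convol G c (convol G v z) x)"
      using that e eu by (simp add: k_def convol_diff_left convol_assoc fun_eq_iff)
    have "gns_norm \<phi> z <= gns_norm \<phi> (\<lambda>x. (-1) * convol G k z x) + gns_norm \<phi> (convol G c (convol G v z))"
      by (subst z, rule gns_norm_triangle[OF p]) (use that k in auto)
    also have "gns_norm \<phi> (\<lambda>x. (-1) * convol G k z x) = gns_norm \<phi> (convol G k z)"
      using gns_norm_scale[OF p, of "convol G k z" "-1"] that k by simp
    also have "\<dots> <= state_norm k * gns_norm \<phi> z"
      using gns_norm_mult_le[OF \<phi> k] that by simp
    also have "gns_norm \<phi> (convol G c (convol G v z)) <= state_norm c * gns_norm \<phi> (convol G v z)"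
      using gns_norm_mult_le[OF \<phi>] that by simp
    finally show ?thesis by (simp add: k_def)
  qed
  have y_up: "gns_norm \<phi> y <= 2 * r + \<eta>"
  proof -
    have "gns_norm \<phi> y <= gns_norm \<phi> u + gns_norm \<phi> (\<lambda>x. of_real (- r) * e x)"
      using gns_norm_triangle[OF p u(1) scale_in_fin_supp[OF e], of "of_real (- r)"]
      by (simp add: y_def)
    also have "gns_norm \<phi> (\<lambda>x. of_real (- r) * e x) = r"
      using gns_norm_scale[OF p e, of "of_real (- r)"] \<eta> by (simp add: e_def gns_norm_one[OF p])
    finally show ?thesis using gns_norm_le_state_norm[OF \<phi> u(1)] up by linarith
  qed
  have "gns_norm \<phi> y <= \<eta> * (2 * r + \<eta>) + B * gns_norm \<phi> m"
  proof -
    have "gns_norm \<phi> y <= state_norm (\<lambda>x. convol G b' w x - e x) * gns_norm \<phi> y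
      + state_norm b' * gns_norm \<phi> m"
      using triangle[OF b'(1) w y] wy by simp
    also have "\<dots> <= \<eta> * (2 * r + \<eta>) + B * gns_norm \<phi> m"
    proof (intro add_mono mult_mono)
      show "state_norm (\<lambda>x. convol G b' w x - e x) <= \<eta>" using inv' by (simp add: w_def e_def)
    qed (use y_up b' \<eta> B gns_norm_nonneg[OF p] y m in auto)
    finally show ?thesis .
  qed
  then have y_le: "gns_norm \<phi> y <= \<eta> * (2 * r + \<eta>) + B * sqrt ((r + \<eta>)^4 - 2 * r\<^sup>2 * (r - \<eta>)\<^sup>2 + r^4)"
    using mult_left_mono[OF m_le B] by linarith
  have "1 = gns_norm \<phi> e" by (simp add: e_def gns_norm_one[OF p])
  also have "\<dots> <= state_norm (\<lambda>x. convol G b y x - e x) * gns_norm \<phi> e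
      + state_norm b * gns_norm \<phi> y"
    using triangle[OF b(1) y e] eu y by simp
  also have "\<dots> <= \<eta> * 1 + B * gns_norm \<phi> y"
  proof (intro add_mono mult_mono)
    show "state_norm (\<lambda>x. convol G b y x - e x) <= \<eta>" using inv by (simp add: y_def e_def)
  qed (use b \<eta> B gns_norm_nonneg[OF p] y e in \<open>auto simp: e_def gns_norm_one[OF p]\<close>)
  also have "\<dots> <= \<eta> + B * (\<eta> * (2 * r + \<eta>) + B * sqrt ((r + \<eta>)^4 - 2 * r\<^sup>2 * (r - \<eta>)\<^sup>2 + r^4))"
    using mult_left_mono[OF y_le B] by simp
  finally show ?thesis .
qed

lemma limit_norm_in_spectrum:
  assumes u: "\<And>n. u n \<in> fin_supp G" "\<And>n. involution G (u n) = u n"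
    and lim: "(\<lambda>n. state_norm (u n)) \<longlonglongrightarrow> r" and r: "r > 0"
    and b: "\<And>n. b n \<in> fin_supp G" "\<And>n. state_norm (b n) <= B"
    and b': "\<And>n. b' n \<in> fin_supp G" "\<And>n. state_norm (b' n) <= B"
    and inv: "(\<lambda>n. state_norm (\<lambda>x. convol G (b n) (\<lambda>x. u n x - of_real r * delta \<one> x) x - delta \<one> x)) \<longlonglongrightarrow> 0"
    and inv': "(\<lambda>n. state_norm (\<lambda>x. convol G (b' n) (\<lambda>x. u n x + of_real r * delta \<one> x) x - delta \<one> x)) \<longlonglongrightarrow> 0"
  shows False
proof -
  define f where "f = (\<lambda>\<eta>::real. \<eta> + B * (\<eta> * (2 * r + \<eta>) + B * sqrt ((r + \<eta>)^4 - 2 * r\<^sup>2 * (r - \<eta>)\<^sup>2 + r^4)))"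
  have "(f \<longlongrightarrow> f 0) (at_right 0)"
    unfolding f_def by (intro tendsto_intros)
  moreover have "f 0 = 0" by (simp add: f_def power4_eq_xxxx power2_eq_square)
  ultimately have "eventually (\<lambda>\<eta>. f \<eta> < 1) (at_right 0)"
    using order_tendstoD(2)[of f "f 0" "at_right 0" 1] by simp
  moreover have "eventually (\<lambda>\<eta>::real. \<eta> < r) (at_right 0)"
    using r by (intro eventually_at_rightI[of 0 r]) auto
  moreover have "eventually (\<lambda>\<eta>::real. 0 < \<eta>) (at_right 0)"
    by (rule eventually_at_right_less)
  ultimately have "eventually (\<lambda>\<eta>. f \<eta> < 1 \<and> \<eta> < r \<and> 0 < \<eta>) (at_right 0)"
    by (intro eventually_conj)
  then obtain \<eta> where \<eta>: "f \<eta> < 1" "\<eta> < r" "0 < \<eta>"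
    using eventually_happens trivial_limit_at_right_real by blast
  have "eventually (\<lambda>n. state_norm (u n) < r + \<eta>) sequentially"
    using order_tendstoD(2)[OF lim] \<eta> by simp
  moreover have "eventually (\<lambda>n. r - \<eta> < state_norm (u n)) sequentially"
    using order_tendstoD(1)[OF lim] \<eta> by simp
  moreover note order_tendstoD(2)[OF inv \<eta>(3)] order_tendstoD(2)[OF inv' \<eta>(3)]
  ultimately have "eventually (\<lambda>n. 1 <= f \<eta>) sequentially"
  proof eventually_elim
    case (elim n)
    show ?case
      unfolding f_def
      by (rule near_inverses_bound[OF u b b' \<eta>(3,2) less_imp_le[OF elim(1)] elim(2)
          less_imp_le[OF elim(3)] less_imp_le[OF elim(4)]])
  qed
  then show False using \<eta>(1) by simp
qed

end

section \<open>Real rank zero and continuous families of seminorms\<close>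

context group
begin

text \<open>
  Approximate \<open>a\<close> by a self-adjoint element of the completion with finite spectrum.  In each seminorm
  of the family, its norm is \<open>0\<close> or the modulus of a point of the spectrum.  The norm is continuous in
  the parameter and takes finitely many values, so it is constant.
\<close>

lemma real_rank_zero_constant_state_norm:
  fixes S :: "real => ('a => complex) set"
  assumes rr0: "real_rank_zero (full_group_cstar_algebra G)"
    and S: "\<And>t. state_set G (S t)"
    and cont: "\<And>x. x \<in> fin_supp G ==> continuous_on {0..1} (\<lambda>t. state_set.state_norm G (S t) x)"
    and a: "a \<in> fin_supp G" "involution G a = a"
  shows "state_set.state_norm G (S 0) a = state_set.state_norm G (S 1) a"
proof -
  interpret M: group_algebra_norm G maximal_norm by (rule max_norm_group_algebra_norm)
  define q where "q t = state_set.state_norm G (S t)" for t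
  have q_norm: "group_algebra_norm G (q t)" for t
  proof -
    interpret state_set G "S t" by (rule S)
    show ?thesis unfolding q_def by (rule state_norm.group_algebra_norm_axioms)
  qed
  have q_le: "q t x <= maximal_norm x" if "x \<in> fin_supp G" for t x
    unfolding q_def using state_set.state_norm_le_maximal_norm[OF S that] .
  have q_diff: "\<bar>q t x - q t y\<bar> <= maximal_norm (\<lambda>g. x g - y g)"
    if "x \<in> fin_supp G" "y \<in> fin_supp G" for t x y
    using group_algebra_norm.N_abs_diff[OF q_norm that, of t] q_le[of "\<lambda>g. x g - y g" t] that by simp
  have close: "\<bar>q 0 a - q 1 a\<bar> <= 2 * e" if e: "e > 0" for e
  proof -
    obtain u Sp where u: "M.cauchy u" "\<And>n. involution G (u n) = u n"
      and near: "\<forall>\<^sub>F n in sequentially. maximal_norm (\<lambda>x. a x - u n x) < e" and Sp: "finite Sp"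
      and inv: "\<And>z. z \<notin> Sp ==> \<exists>b. M.cauchy b \<and>
         (\<lambda>n. maximal_norm (\<lambda>x. convol G (b n) (\<lambda>x. u n x - z * delta \<one> x) x - delta \<one> x)) \<longlonglongrightarrow> 0"
      using M.real_rank_zero_completionD[OF rr0[unfolded full_group_cstar_algebra_def] a e] by blast
    note u_in = M.cauchy_in[OF u(1)]
    have unif: "uniformly_Cauchy_on {0..1} (\<lambda>n t. q t (u n))"
    proof (rule uniformly_Cauchy_onI)
      fix d :: real assume "d > 0"
      then obtain K where K: "\<And>m n. m >= K ==> n >= K ==> maximal_norm (\<lambda>x. u m x - u n x) < d"
        using M.cauchyE[OF u(1)] by blast
      show "\<exists>K. \<forall>t\<in>{0..1}. \<forall>m\<ge>K. \<forall>n\<ge>K. dist (q t (u m)) (q t (u n)) < d"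
      proof (intro exI ballI allI impI)
        fix t :: real and m n assume "m >= K" "n >= K"
        then show "dist (q t (u m)) (q t (u n)) < d"
          using q_diff[OF u_in u_in, of t m n] K[of m n] by (simp add: dist_real_def)
      qed
    qed
    then have "uniformly_convergent_on {0..1} (\<lambda>n t. q t (u n))"
      by (rule Cauchy_uniformly_convergent)
    then obtain r where r: "uniform_limit {0..1} (\<lambda>n t. q t (u n)) r sequentially"
      unfolding uniformly_convergent_on_def by blast
    have lim: "(\<lambda>n. q t (u n)) \<longlonglongrightarrow> r t" if "t \<in> {0..1}" for t
      using tendsto_uniform_limitI[OF r that] .
    have r_cont: "continuous_on {0..1} r"
      by (rule uniform_limit_theorem[OF _ r]) (use cont u_in in \<open>auto simp: q_def\<close>)
    have r_in: "r t \<in> insert 0 (cmod ` Sp)" if t: "t \<in> {0..1}" for t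
    proof (rule ccontr)
      assume not: "r t \<notin> insert 0 (cmod ` Sp)"
      have "r t >= 0"
        by (rule LIMSEQ_le_const[OF lim[OF t]]) (use group_algebra_norm.N_nonneg[OF q_norm u_in] in auto)
      then have pos: "r t > 0" using not by (metis insertI1 order_le_less)
      then have "cmod (of_real (r t)) = r t" "cmod (of_real (- r t)) = r t" by simp_all
      then have "complex_of_real (r t) \<notin> Sp" "complex_of_real (- r t) \<notin> Sp"
        using not by (metis image_eqI insertI2)+
      then obtain b b' where b: "M.cauchy b"
          "(\<lambda>n. maximal_norm (\<lambda>x. convol G (b n) (\<lambda>x. u n x - of_real (r t) * delta \<one> x) x - delta \<one> x)) \<longlonglongrightarrow> 0"
        and b': "M.cauchy b'"
          "(\<lambda>n. maximal_norm (\<lambda>x. convol G (b' n) (\<lambda>x. u n x - of_real (- r t) * delta \<one> x) x - delta \<one> x)) \<longlonglongrightarrow> 0"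
        using inv by blast
      obtain B where B: "\<And>n. maximal_norm (b n) <= B" using M.cauchy_bounded[OF b(1)] by blast
      obtain B' where B': "\<And>n. maximal_norm (b' n) <= B'" using M.cauchy_bounded[OF b'(1)] by blast
      have q_null: "(\<lambda>n. q t (f n)) \<longlonglongrightarrow> 0"
        if "(\<lambda>n. maximal_norm (f n)) \<longlonglongrightarrow> 0" "\<And>n. f n \<in> fin_supp G" for f :: "nat => 'a => complex"
        by (rule real_tendsto_sandwich[OF _ _ tendsto_const that(1)])
          (use q_le[OF that(2)] group_algebra_norm.N_nonneg[OF q_norm that(2)] in auto)
      have bn: "q t (b n) <= max B B'" "q t (b' n) <= max B B'" for n
        using q_le[OF M.cauchy_in[OF b(1)], of t n] B[of n]
          q_le[OF M.cauchy_in[OF b'(1)], of t n] B'[of n] by linarith+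
      have "(\<lambda>n. q t (\<lambda>x. convol G (b n) (\<lambda>x. u n x - of_real (r t) * delta \<one> x) x - delta \<one> x)) \<longlonglongrightarrow> 0"
        by (rule q_null[OF b(2)]) (use u_in b(1) in simp)
      moreover have "(\<lambda>n. q t (\<lambda>x. convol G (b' n) (\<lambda>x. u n x + of_real (r t) * delta \<one> x) x - delta \<one> x)) \<longlonglongrightarrow> 0"
      proof -
        have "(\<lambda>n. q t (\<lambda>x. convol G (b' n) (\<lambda>x. u n x - of_real (- r t) * delta \<one> x) x - delta \<one> x)) \<longlonglongrightarrow> 0"
          by (rule q_null[OF b'(2)]) (use u_in b'(1) in simp)
        then show ?thesis by (simp only: of_real_minus mult_minus_left diff_minus_eq_add)
      qed
      ultimately show False
        using state_set.limit_norm_in_spectrum[OF S[of t], of u "r t" b "max B B'" b',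
            OF u_in u(2) lim[OF t, unfolded q_def] pos M.cauchy_in[OF b(1)] bn(1)[unfolded q_def]
            M.cauchy_in[OF b'(1)] bn(2)[unfolded q_def]]
        unfolding q_def by blast
    qed
    have "r constant_on {0..1}"
    proof (rule continuous_finite_range_constant[OF _ r_cont])
      show "connected {0..1::real}" by simp
      show "finite (r ` {0..1})"
      proof (rule finite_subset)
        show "r ` {0..1} \<subseteq> insert 0 (cmod ` Sp)" using r_in by blast
        show "finite (insert 0 (cmod ` Sp))" using Sp by simp
      qed
    qed
    then have r01: "r 0 = r 1" unfolding constant_on_def by force
    have "\<bar>q t a - r t\<bar> <= e" if t: "t \<in> {0..1}" for t
    proof (rule tendsto_upperbound)
      show "(\<lambda>n. \<bar>q t a - q t (u n)\<bar>) \<longlonglongrightarrow> \<bar>q t a - r t\<bar>"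
        by (intro tendsto_intros lim t)
      show "\<forall>\<^sub>F n in sequentially. \<bar>q t a - q t (u n)\<bar> <= e"
        using near
      proof eventually_elim
        case (elim n)
        then show ?case using q_diff[OF a(1) u_in, of t n] by linarith
      qed
    qed simp
    from this[of 0] this[of 1] show ?thesis using r01 by simp
  qed
  have "\<bar>q 0 a - q 1 a\<bar> <= 0 + d" if "d > 0" for d
    using close[of "d / 2"] that by simp
  then have "\<bar>q 0 a - q 1 a\<bar> <= 0" by (rule field_le_epsilon)
  then show ?thesis by (simp add: q_def)
qed

end

section \<open>A Hahn--Banach lemma\<close>

text \<open>
  Only one fact is needed: below every sublinear functional there is a linear one.  A minimal sublinear
  functional exists by Zorn's lemma, and is additive, because \<open>x \<mapsto> inf (q (x + t y) - t q y)\<close> is another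
  sublinear functional below it.
\<close>

definition function_cone_space :: "('i => real) set => bool" where
  "function_cone_space E \<longleftrightarrow> (\<lambda>i. 0) \<in> E \<and> (\<forall>x\<in>E. \<forall>y\<in>E. (\<lambda>i. x i + y i) \<in> E) \<and>
     (\<forall>x\<in>E. \<forall>c. (\<lambda>i. c * x i) \<in> E)"

definition sublinear_on :: "('i => real) set => (('i => real) => real) => bool" where
  "sublinear_on E q \<longleftrightarrow> (\<forall>x\<in>E. \<forall>y\<in>E. q (\<lambda>i. x i + y i) <= q x + q y) \<and>
     (\<forall>x\<in>E. \<forall>c\<ge>0. q (\<lambda>i. c * x i) = c * q x)"

lemma function_cone_spaceD:
  assumes "function_cone_space E"
  shows "(\<lambda>i. 0) \<in> E" "[|x \<in> E; y \<in> E|] ==> (\<lambda>i. x i + y i) \<in> E" "x \<in> E ==> (\<lambda>i. c * x i) \<in> E"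
  using assms unfolding function_cone_space_def by blast+

lemma sublinear_onD:
  assumes "sublinear_on E q"
  shows "[|x \<in> E; y \<in> E|] ==> q (\<lambda>i. x i + y i) <= q x + q y"
    and "[|x \<in> E; c >= 0|] ==> q (\<lambda>i. c * x i) = c * q x"
  using assms unfolding sublinear_on_def by blast+

lemma sublinear_onI:
  assumes E: "function_cone_space E"
    and add: "\<And>x y. [|x \<in> E; y \<in> E|] ==> q (\<lambda>i. x i + y i) <= q x + q y"
    and le: "\<And>x c. [|x \<in> E; c > 0|] ==> q (\<lambda>i. c * x i) <= c * q x"
    and zero: "q (\<lambda>i. 0) = 0"
  shows "sublinear_on E q"
  unfolding sublinear_on_def
proof (intro conjI ballI allI impI)
  fix x and c :: real assume x: "x \<in> E" and c: "0 <= c"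
  show "q (\<lambda>i. c * x i) = c * q x"
  proof (cases "c = 0")
    case True
    then show ?thesis using zero by simp
  next
    case False
    then have c: "c > 0" using c by simp
    have "q (\<lambda>i. inverse c * (c * x i)) <= inverse c * q (\<lambda>i. c * x i)"
      using le[of "\<lambda>i. c * x i" "inverse c"] c function_cone_spaceD(3)[OF E x] by simp
    then have "q x <= inverse c * q (\<lambda>i. c * x i)" using c by (simp add: mult.assoc[symmetric])
    then have "c * q x <= c * (inverse c * q (\<lambda>i. c * x i))" using c by simp
    then have "c * q x <= q (\<lambda>i. c * x i)" using c by (simp add: mult.assoc[symmetric])
    then show ?thesis using le[OF x c] by linarith
  qed
qed (rule add)

lemma sublinear_on_lower:
  assumes E: "function_cone_space E" and q: "sublinear_on E q" and x: "x \<in> E"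
  shows "- q (\<lambda>i. (-1) * x i) <= q x"
proof -
  have "q (\<lambda>i. 0) = 0" using sublinear_onD(2)[OF q function_cone_spaceD(1)[OF E], of 0] by simp
  then show ?thesis
    using sublinear_onD(1)[OF q x function_cone_spaceD(3)[OF E x, of "-1"]] by simp
qed

lemma ex_linear_below_sublinear:
  assumes E: "function_cone_space E" and p: "sublinear_on E p"
  obtains \<Lambda> where "\<And>x. x \<in> E ==> \<Lambda> x <= p x"
    "\<And>x y. [|x \<in> E; y \<in> E|] ==> \<Lambda> (\<lambda>i. x i + y i) = \<Lambda> x + \<Lambda> y"
proof -
  note E' = function_cone_spaceD[OF E]
  define \<A> where "\<A> = {q. sublinear_on E q \<and> (\<forall>x\<in>E. q x <= p x) \<and> (\<forall>x. x \<notin> E --> q x = 0)}"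
  define R where "R = (\<lambda>q q' :: ('a => real) => real. \<forall>x. q' x <= q x)"
  have ord: "partial_order_on \<A> (relation_of R \<A>)"
  proof (rule partial_order_on_relation_ofI)
    show "R a a" for a by (simp add: R_def)
    show "R a c" if "R a b" "R b c" for a b c using that unfolding R_def by (meson order_trans)
    show "a = b" if "R a b" "R b a" for a b
      using that unfolding R_def by (intro ext order_antisym) auto
  qed
  have "\<exists>m\<in>\<A>. \<forall>q\<in>\<A>. R m q --> q = m"
  proof (rule predicate_Zorn[OF ord])
    fix C assume C: "C \<in> Chains (relation_of R \<A>)"
    then have CA: "C \<subseteq> \<A>" by (rule Chains_relation_of)
    have total: "R q q' \<or> R q' q" if "q \<in> C" "q' \<in> C" for q q'
      using C that unfolding Chains_def relation_of_def by blast
    show "\<exists>u\<in>\<A>. \<forall>q\<in>C. R q u"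
    proof (cases "C = {}")
      case True
      define u where "u = (\<lambda>x. if x \<in> E then p x else 0)"
      have "sublinear_on E u" using p E' by (simp add: sublinear_on_def u_def)
      then have "u \<in> \<A>" by (simp add: \<A>_def u_def)
      then show ?thesis using True by blast
    next
      case False
      define u where "u = (\<lambda>x. INF q\<in>C. q x)"
      have sub: "sublinear_on E q" and below: "x \<in> E ==> q x <= p x" and out: "x \<notin> E ==> q x = 0"
        if "q \<in> C" for q x using that CA by (auto simp: \<A>_def)
      have lower: "- p (\<lambda>i. (-1) * x i) <= q x" if "x \<in> E" "q \<in> C" for q x
        using sublinear_on_lower[OF E sub[OF that(2)] that(1)]
          below[OF that(2) E'(3)[OF that(1), of "-1"]] by linarith
      have bdd: "bdd_below ((\<lambda>q. q x) ` C)" for x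
      proof (cases "x \<in> E")
        case True
        then show ?thesis using lower by (auto simp: bdd_below_def)
      next
        case False
        have "q x = 0" if "q \<in> C" for q using out[OF that False] .
        then show ?thesis unfolding bdd_below_def by (intro exI[of _ 0]) force
      qed
      have u_zero: "u x = 0" if "\<And>q. q \<in> C ==> q x = 0" for x
      proof -
        have "(\<lambda>q. q x) ` C = {0}" using that False by force
        then show ?thesis by (simp add: u_def)
      qed
      have u_le: "u x <= q x" if "q \<in> C" for q x
        unfolding u_def by (rule cINF_lower[OF bdd that])
      have le_u: "b <= u x" if "\<And>q. q \<in> C ==> b <= q x" for b x
        unfolding u_def by (rule cINF_greatest[OF False that])
      have "sublinear_on E u"
      proof (rule sublinear_onI[OF E])
        fix x y assume x: "x \<in> E" and y: "y \<in> E"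
        have pair: "u (\<lambda>i. x i + y i) <= q x + q' y" if q: "q \<in> C" and q': "q' \<in> C" for q q'
        proof -
          obtain q0 where q0: "q0 \<in> C" "q0 x <= q x" "q0 y <= q' y"
            using total[OF q q'] q q' unfolding R_def by blast
          show ?thesis
            using u_le[OF q0(1), of "\<lambda>i. x i + y i"] sublinear_onD(1)[OF sub[OF q0(1)] x y] q0 by linarith
        qed
        have "u (\<lambda>i. x i + y i) - q' y <= u x" if "q' \<in> C" for q'
          by (rule le_u) (use pair[OF _ that] in fastforce)
        then have "u (\<lambda>i. x i + y i) - u x <= u y"
          by (intro le_u) fastforce
        then show "u (\<lambda>i. x i + y i) <= u x + u y" by linarith
      next
        fix x and c :: real assume x: "x \<in> E" and c: "c > 0"
        have "u (\<lambda>i. c * x i) / c <= u x"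
        proof (rule le_u)
          fix q assume q: "q \<in> C"
          have "u (\<lambda>i. c * x i) <= c * q x"
            using u_le[OF q, of "\<lambda>i. c * x i"] sublinear_onD(2)[OF sub[OF q] x, of c] c by simp
          then show "u (\<lambda>i. c * x i) / c <= q x" using c by (simp add: field_simps)
        qed
        then show "u (\<lambda>i. c * x i) <= c * u x" using c by (simp add: field_simps)
      next
        have "q (\<lambda>i. 0) = 0" if "q \<in> C" for q
          using sublinear_onD(2)[OF sub[OF that] E'(1), of 0] by simp
        then show "u (\<lambda>i. 0) = 0" by (rule u_zero)
      qed
      moreover obtain q0 where q0: "q0 \<in> C" using False by blast
      have "u x <= p x" if "x \<in> E" for x
        using u_le[OF q0, of x] below[OF q0 that] by linarith
      moreover have "u x = 0" if "x \<notin> E" for x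
        by (rule u_zero) (rule out[OF _ that])
      ultimately have "u \<in> \<A>" unfolding \<A>_def by (intro CollectI conjI ballI allI impI)
      then show ?thesis using u_le unfolding R_def by blast
    qed
  qed
  then obtain q where q: "q \<in> \<A>" and min: "\<And>q'. q' \<in> \<A> ==> R q q' ==> q' = q" by blast
  have sub: "sublinear_on E q" and below: "\<And>x. x \<in> E ==> q x <= p x" and out: "\<And>x. x \<notin> E ==> q x = 0"
    using q by (auto simp: \<A>_def)
  have q0: "q (\<lambda>i. 0) = 0" using sublinear_onD(2)[OF sub E'(1), of 0] by simp
  have "q (\<lambda>i. x i + y i) = q x + q y" if x: "x \<in> E" and y: "y \<in> E" for x y
  proof -
    define F where "F = (\<lambda>x t. q (\<lambda>i. x i + t * y i) - t * q y)"
    define u where "u = (\<lambda>x. if x \<in> E then INF t\<in>{0..}. F x t else 0)"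
    have lower: "- q (\<lambda>i. (-1) * z i) <= F z t" if z: "z \<in> E" and t: "t >= 0" for z t
    proof -
      have "q (\<lambda>i. (z i + t * y i) + (-1) * z i) <= q (\<lambda>i. z i + t * y i) + q (\<lambda>i. (-1) * z i)"
        using z y by (intro sublinear_onD(1)[OF sub] E') auto
      then show ?thesis using sublinear_onD(2)[OF sub y t] by (simp add: F_def)
    qed
    have bdd: "bdd_below (F z ` {0..})" if "z \<in> E" for z
      using lower[OF that] by (auto simp: bdd_below_def)
    have u_le: "u z <= F z t" if "z \<in> E" "t >= 0" for z t
      using cINF_lower[OF bdd[OF that(1)], of t] that by (simp add: u_def)
    have le_u: "b <= u z" if "z \<in> E" "\<And>t. t >= 0 ==> b <= F z t" for b z
      using cINF_greatest[of "{0..}" b "F z"] that by (auto simp: u_def)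
    have u_le_q: "u z <= q z" if "z \<in> E" for z
      using u_le[OF that, of 0] by (simp add: F_def)
    have "sublinear_on E u"
    proof (rule sublinear_onI[OF E])
      fix z w assume z: "z \<in> E" and w: "w \<in> E"
      have zw: "(\<lambda>i. z i + w i) \<in> E" using E'(2)[OF z w] .
      have pair: "u (\<lambda>i. z i + w i) <= F z s + F w t" if s: "s >= 0" and t: "t >= 0" for s t
      proof -
        have "u (\<lambda>i. z i + w i) <= F (\<lambda>i. z i + w i) (s + t)" using u_le[OF zw] s t by simp
        also have "(\<lambda>i. (z i + w i) + (s + t) * y i) = (\<lambda>i. (z i + s * y i) + (w i + t * y i))"
          by (simp add: fun_eq_iff algebra_simps)
        then have "F (\<lambda>i. z i + w i) (s + t) <= F z s + F w t"
          using sublinear_onD(1)[OF sub E'(2)[OF z E'(3)[OF y, of s]] E'(2)[OF w E'(3)[OF y, of t]]]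
          by (simp add: F_def algebra_simps)
        finally show ?thesis .
      qed
      have "u (\<lambda>i. z i + w i) - F w t <= u z" if "t >= 0" for t
        by (rule le_u[OF z]) (use pair[OF _ that] in fastforce)
      then have "u (\<lambda>i. z i + w i) - u z <= u w"
        by (intro le_u[OF w]) fastforce
      then show "u (\<lambda>i. z i + w i) <= u z + u w" by linarith
    next
      fix z and c :: real assume z: "z \<in> E" and c: "c > 0"
      have "u (\<lambda>i. c * z i) / c <= u z"
      proof (rule le_u[OF z])
        fix t :: real assume t: "t >= 0"
        have "u (\<lambda>i. c * z i) <= F (\<lambda>i. c * z i) (c * t)"
          using u_le[OF E'(3)[OF z, of c], of "c * t"] c t by simp
        also have "(\<lambda>i. c * z i + c * t * y i) = (\<lambda>i. c * (z i + t * y i))"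
          by (simp add: fun_eq_iff algebra_simps)
        then have "F (\<lambda>i. c * z i) (c * t) = c * F z t"
          using sublinear_onD(2)[OF sub E'(2)[OF z E'(3)[OF y, of t]], of c] c
          by (simp add: F_def algebra_simps)
        finally show "u (\<lambda>i. c * z i) / c <= F z t" using c by (simp add: field_simps)
      qed
      then show "u (\<lambda>i. c * z i) <= c * u z" using c by (simp add: field_simps)
    next
      have "0 <= u (\<lambda>i. 0)"
        by (rule le_u[OF E'(1)]) (use sublinear_onD(2)[OF sub y] in \<open>simp add: F_def\<close>)
      then show "u (\<lambda>i. 0) = 0" using u_le_q[OF E'(1)] q0 by simp
    qed
    moreover have "u z <= p z" if "z \<in> E" for z using u_le_q[OF that] below[OF that] by linarith
    moreover have u_out: "u z = 0" if "z \<notin> E" for z using that by (simp add: u_def)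
    ultimately have "u \<in> \<A>" unfolding \<A>_def by (intro CollectI conjI ballI allI impI)
    moreover have "R q u" unfolding R_def
    proof
      show "u z <= q z" for z
        using u_le_q[of z] u_out[of z] out[of z] by (cases "z \<in> E") simp_all
    qed
    ultimately have "u = q" by (rule min)
    then have "q x <= q (\<lambda>i. x i + y i) - q y"
      using u_le[OF x, of 1] by (simp add: F_def)
    then show ?thesis using sublinear_onD(1)[OF sub x y] by linarith
  qed
  then show thesis using that below by blast
qed

section \<open>Invariant means\<close>

locale mean_group = group G for G :: "('g, 'm) monoid_scheme" (structure) +
  fixes m :: "('g => real) => real"
  assumes mean: "left_invariant_mean G m"
begin

lemma bounded_functionsI: "(\<And>x. x \<in> carrier G ==> \<bar>f x\<bar> <= B) ==> f \<in> bounded_functions G"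
  unfolding bounded_functions_def by blast

lemma bounded_functions_const [simp]: "(\<lambda>x. c) \<in> bounded_functions G"
  by (rule bounded_functionsI[of _ "\<bar>c\<bar>"]) simp

lemma bounded_functions_add [simp]:
  assumes f: "f \<in> bounded_functions G" and h: "h \<in> bounded_functions G"
  shows "(\<lambda>x. f x + h x) \<in> bounded_functions G"
proof -
  obtain B C where B: "\<And>x. x \<in> carrier G ==> \<bar>f x\<bar> <= B" and C: "\<And>x. x \<in> carrier G ==> \<bar>h x\<bar> <= C"
    using f h unfolding bounded_functions_def by blast
  show ?thesis
  proof (rule bounded_functionsI)
    show "\<bar>f x + h x\<bar> <= B + C" if "x \<in> carrier G" for x
      using B[OF that] C[OF that] by linarith
  qed
qed

lemma bounded_functions_scale [simp]:
  assumes f: "f \<in> bounded_functions G"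
  shows "(\<lambda>x. c * f x) \<in> bounded_functions G"
proof -
  obtain B where B: "\<And>x. x \<in> carrier G ==> \<bar>f x\<bar> <= B"
    using f unfolding bounded_functions_def by blast
  show ?thesis
  proof (rule bounded_functionsI)
    show "\<bar>c * f x\<bar> <= \<bar>c\<bar> * B" if "x \<in> carrier G" for x
      using B[OF that] by (simp add: abs_mult mult_left_mono)
  qed
qed

lemma bounded_functions_diff [simp]:
  assumes f: "f \<in> bounded_functions G" and h: "h \<in> bounded_functions G"
  shows "(\<lambda>x. f x - h x) \<in> bounded_functions G"
  using bounded_functions_add[OF f bounded_functions_scale[OF h, of "-1"]] by simp

lemma bounded_functions_translate [simp]:
  assumes f: "f \<in> bounded_functions G" and g: "g \<in> carrier G"
  shows "(\<lambda>x. f (g \<otimes> x)) \<in> bounded_functions G"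
proof -
  obtain B where "\<And>x. x \<in> carrier G ==> \<bar>f x\<bar> <= B"
    using f unfolding bounded_functions_def by blast
  then show ?thesis using g by (intro bounded_functionsI[of _ B]) simp
qed

lemma mean_add: "[|f \<in> bounded_functions G; h \<in> bounded_functions G|] ==> m (\<lambda>x. f x + h x) = m f + m h"
  using mean unfolding left_invariant_mean_def by blast

lemma mean_scale: "f \<in> bounded_functions G ==> m (\<lambda>x. c * f x) = c * m f"
  using mean unfolding left_invariant_mean_def by blast

lemma mean_diff:
  assumes f: "f \<in> bounded_functions G" and h: "h \<in> bounded_functions G"
  shows "m (\<lambda>x. f x - h x) = m f - m h"
  using mean_add[OF f bounded_functions_scale[OF h, of "-1"]] mean_scale[OF h, of "-1"] by simp

lemma mean_const: "m (\<lambda>x. c) = c"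
proof -
  have "m (\<lambda>x. c * 1) = c * m (\<lambda>x. 1)" by (rule mean_scale) simp
  moreover have "m (\<lambda>x. 1) = 1" using mean unfolding left_invariant_mean_def by blast
  ultimately show ?thesis by simp
qed

lemma mean_translate: "[|f \<in> bounded_functions G; g \<in> carrier G|] ==> m (\<lambda>x. f (g \<otimes> x)) = m f"
  using mean unfolding left_invariant_mean_def by blast

lemma mean_mono:
  assumes f: "f \<in> bounded_functions G" and h: "h \<in> bounded_functions G"
    and le: "\<And>x. x \<in> carrier G ==> f x <= h x"
  shows "m f <= m h"
proof -
  have "0 <= m (\<lambda>x. h x - f x)"
    using mean le bounded_functions_diff[OF h f] unfolding left_invariant_mean_def by simp
  then show ?thesis using mean_diff[OF h f] by simp
qed

lemma mean_sum:
  assumes "finite I" "\<And>i. i \<in> I ==> f i \<in> bounded_functions G"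
  shows "(\<lambda>x. \<Sum>i\<in>I. f i x) \<in> bounded_functions G \<and> m (\<lambda>x. \<Sum>i\<in>I. f i x) = (\<Sum>i\<in>I. m (f i))"
  using assms
proof (induction I rule: finite_induct)
  case empty
  then show ?case using mean_const[of 0] by simp
next
  case (insert i I)
  then have "f i \<in> bounded_functions G" "(\<lambda>x. \<Sum>i\<in>I. f i x) \<in> bounded_functions G"
    "m (\<lambda>x. \<Sum>i\<in>I. f i x) = (\<Sum>i\<in>I. m (f i))" by auto
  then show ?case using insert.hyps by (simp add: mean_add)
qed

end

text \<open>
  An invariant mean is pushed forward along a map \<open>\<pi>\<close> that need not be a homomorphism: translations of
  \<open>Q\<close> have to lift to translations of \<open>G\<close>.  This covers quotients and, by an equivariant retraction,
  subgroups.
\<close>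

lemma amenable_image:
  assumes G: "group G" and Q: "group Q" and am: "amenable G"
    and \<pi>: "\<And>x. x \<in> carrier G ==> \<pi> x \<in> carrier Q"
    and lift: "\<And>q. q \<in> carrier Q ==> \<exists>g\<in>carrier G. \<forall>x\<in>carrier G. \<pi> (g \<otimes>\<^bsub>G\<^esub> x) = q \<otimes>\<^bsub>Q\<^esub> \<pi> x"
  shows "amenable Q"
proof -
  obtain m where m: "left_invariant_mean G m" using am by (auto simp: amenable_def)
  interpret mean_group G m using G m by (simp add: mean_group_def mean_group_axioms_def)
  have b: "(\<lambda>x. f (\<pi> x)) \<in> bounded_functions G" if "f \<in> bounded_functions Q" for f
    using that \<pi> unfolding bounded_functions_def by blast
  have "left_invariant_mean Q (\<lambda>f. m (\<lambda>x. f (\<pi> x)))"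
    unfolding left_invariant_mean_def
  proof (intro conjI ballI allI impI)
    fix f q assume f: "f \<in> bounded_functions Q" and q: "q \<in> carrier Q"
    obtain g where g: "g \<in> carrier G" "\<And>x. x \<in> carrier G ==> \<pi> (g \<otimes>\<^bsub>G\<^esub> x) = q \<otimes>\<^bsub>Q\<^esub> \<pi> x"
      using lift[OF q] by blast
    have fq: "(\<lambda>x. f (q \<otimes>\<^bsub>Q\<^esub> x)) \<in> bounded_functions Q"
    proof -
      interpret Q: group Q by (rule Q)
      obtain B where "\<And>x. x \<in> carrier Q ==> \<bar>f x\<bar> <= B"
        using f unfolding bounded_functions_def by blast
      then have "\<forall>x\<in>carrier Q. \<bar>f (q \<otimes>\<^bsub>Q\<^esub> x)\<bar> <= B" using q by simp
      then show ?thesis unfolding bounded_functions_def by blast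
    qed
    have "m (\<lambda>x. f (q \<otimes>\<^bsub>Q\<^esub> \<pi> x)) = m (\<lambda>x. f (\<pi> (g \<otimes>\<^bsub>G\<^esub> x)))"
    proof (rule antisym)
      note b' = b[OF fq] bounded_functions_translate[OF b[OF f] g(1)]
      show "m (\<lambda>x. f (q \<otimes>\<^bsub>Q\<^esub> \<pi> x)) <= m (\<lambda>x. f (\<pi> (g \<otimes>\<^bsub>G\<^esub> x)))"
        by (rule mean_mono[OF b']) (simp add: g(2))
      show "m (\<lambda>x. f (\<pi> (g \<otimes>\<^bsub>G\<^esub> x))) <= m (\<lambda>x. f (q \<otimes>\<^bsub>Q\<^esub> \<pi> x))"
        by (rule mean_mono[OF b'(2,1)]) (simp add: g(2))
    qed
    also have "\<dots> = m (\<lambda>x. f (\<pi> x))" by (rule mean_translate[OF b[OF f] g(1)])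
    finally show "m (\<lambda>x. f (q \<otimes>\<^bsub>Q\<^esub> \<pi> x)) = m (\<lambda>x. f (\<pi> x))" .
  next
    fix f assume f: "f \<in> bounded_functions Q" and "\<forall>x\<in>carrier Q. 0 <= f x"
    then have "m (\<lambda>x. 0) <= m (\<lambda>x. f (\<pi> x))"
      by (intro mean_mono[OF bounded_functions_const b[OF f]]) (simp add: \<pi>)
    then show "0 <= m (\<lambda>x. f (\<pi> x))" unfolding mean_const .
  next
    fix f h assume "f \<in> bounded_functions Q" "h \<in> bounded_functions Q"
    then show "m (\<lambda>x. f (\<pi> x) + h (\<pi> x)) = m (\<lambda>x. f (\<pi> x)) + m (\<lambda>x. h (\<pi> x))"
      by (intro mean_add b)
  next
    fix f c assume "f \<in> bounded_functions Q"
    then show "m (\<lambda>x. c * f (\<pi> x)) = c * m (\<lambda>x. f (\<pi> x))" by (intro mean_scale b)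
  next
    show "m (\<lambda>x. 1) = 1" by (rule mean_const)
  qed
  then show ?thesis by (auto simp: amenable_def)
qed

section \<open>Almost invariant probability vectors\<close>

context mean_group
begin

text \<open>
  Reiter's condition.  If it failed, the differences \<open>g h - h\<close> of nonnegative \<open>h\<close> would have norm at
  least \<open>\<epsilon>\<close> times the mass of \<open>h\<close>.  A functional separating them from \<open>0\<close> is given by bounded functions
  \<open>f\<^sub>g\<close> with \<open>\<Sum>g. f\<^sub>g (g x) - f\<^sub>g x >= \<epsilon>\<close> for all \<open>x\<close>, but the mean of the left-hand side is \<open>0\<close>.
\<close>

lemma reiter:
  assumes F: "finite F" "F \<subseteq> carrier G" and \<epsilon>: "\<epsilon> > 0"
  obtains h :: "'g => real" where "finite {x. h x ~= 0}" "{x. h x ~= 0} \<subseteq> carrier G" "\<And>x. 0 <= h x"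
    "(\<Sum>x\<in>{x. h x ~= 0}. h x) = 1"
    "\<And>g T. [|g \<in> F; finite T; T \<subseteq> carrier G|] ==> (\<Sum>x\<in>T. \<bar>h (inv g \<otimes> x) - h x\<bar>) <= \<epsilon>"
proof -
  define E :: "('g \<times> 'g => real) set" where "E = {y. finite {i. y i ~= 0}}"
  define nrm :: "('g \<times> 'g => real) => real" where "nrm = (\<lambda>y. \<Sum>i\<in>{i. y i ~= 0}. \<bar>y i\<bar>)"
  define P :: "('g => real) set" where
    "P = {h. finite {x. h x ~= 0} \<and> {x. h x ~= 0} \<subseteq> carrier G \<and> (\<forall>x. 0 <= h x)}"
  define mass :: "('g => real) => real" where "mass = (\<lambda>h. \<Sum>x\<in>{x. h x ~= 0}. h x)"
  define d :: "('g => real) => 'g \<times> 'g => real" where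
    "d = (\<lambda>h (g, x). if g \<in> F \<and> x \<in> carrier G then h (inv g \<otimes> x) - h x else 0)"
  have E: "function_cone_space E"
    unfolding function_cone_space_def
  proof (intro conjI ballI allI)
    show "(\<lambda>i. 0) \<in> E" by (simp add: E_def)
    fix x y :: "'g \<times> 'g => real" assume "x \<in> E" "y \<in> E"
    then have "finite ({i. x i ~= 0} \<union> {i. y i ~= 0})" by (simp add: E_def)
    then have "finite {i. x i + y i ~= 0}" by (rule rev_finite_subset) auto
    then show "(\<lambda>i. x i + y i) \<in> E" by (simp add: E_def)
  next
    fix x :: "'g \<times> 'g => real" and c assume "x \<in> E"
    then have "finite {i. x i ~= 0}" by (simp add: E_def)
    then have "finite {i. c * x i ~= 0}" by (rule rev_finite_subset) auto
    then show "(\<lambda>i. c * x i) \<in> E" by (simp add: E_def)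
  qed
  note E' = function_cone_spaceD[OF E]
  have nrm_sup: "nrm y = (\<Sum>i\<in>T. \<bar>y i\<bar>)" if "finite T" "{i. y i ~= 0} \<subseteq> T" for y T
    unfolding nrm_def using that by (intro sum.mono_neutral_left) auto
  have mass_sup: "mass h = (\<Sum>x\<in>T. h x)" if "finite T" "{x. h x ~= 0} \<subseteq> T" for h T
    unfolding mass_def using that by (intro sum.mono_neutral_left) auto
  have nrm_add: "nrm (\<lambda>i. x i + y i) <= nrm x + nrm y" if "x \<in> E" "y \<in> E" for x y
  proof -
    define T where "T = {i. x i ~= 0} \<union> {i. y i ~= 0}"
    have T: "finite T" "{i. x i ~= 0} \<subseteq> T" "{i. y i ~= 0} \<subseteq> T" "{i. x i + y i ~= 0} \<subseteq> T"
      using that by (auto simp: T_def E_def)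
    show ?thesis
      unfolding nrm_sup[OF T(1,2)] nrm_sup[OF T(1,3)] nrm_sup[OF T(1,4)] sum.distrib[symmetric]
      by (intro sum_mono abs_triangle_ineq)
  qed
  have nrm_scale: "nrm (\<lambda>i. c * y i) = \<bar>c\<bar> * nrm y" if "y \<in> E" for c y
  proof -
    have "finite {i. y i ~= 0}" "{i. c * y i ~= 0} \<subseteq> {i. y i ~= 0}" using that by (auto simp: E_def)
    from nrm_sup[OF this] show ?thesis by (simp add: nrm_def abs_mult sum_distrib_left)
  qed
  have nrm_nonneg: "0 <= nrm y" for y by (simp add: nrm_def sum_nonneg)
  have d_in: "d h \<in> E" if h: "h \<in> P" for h
  proof -
    have "{i. d h i ~= 0} \<subseteq> F \<times> ({x. h x ~= 0} \<union> (\<lambda>(g, x). g \<otimes> x) ` (F \<times> {x. h x ~= 0}))"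
    proof
      fix i assume i: "i \<in> {i. d h i ~= 0}"
      obtain g x where gx: "i = (g, x)" by (cases i)
      have g: "g \<in> F" "x \<in> carrier G" "h (inv g \<otimes> x) ~= 0 \<or> h x ~= 0"
        using i by (auto simp: d_def gx split: if_splits)
      have "x = g \<otimes> (inv g \<otimes> x)" using g F by (simp add: m_assoc[symmetric] subset_iff)
      have "x \<in> (\<lambda>(g, x). g \<otimes> x) ` (F \<times> {x. h x ~= 0})" if "h (inv g \<otimes> x) ~= 0"
        by (rule image_eqI[of _ _ "(g, inv g \<otimes> x)"]) (use \<open>x = g \<otimes> (inv g \<otimes> x)\<close> g(1) that in simp_all)
      then show "i \<in> F \<times> ({x. h x ~= 0} \<union> (\<lambda>(g, x). g \<otimes> x) ` (F \<times> {x. h x ~= 0}))"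
        using g gx by blast
    qed
    moreover have "finite (F \<times> ({x. h x ~= 0} \<union> (\<lambda>(g, x). g \<otimes> x) ` (F \<times> {x. h x ~= 0})))"
      using h F by (simp add: P_def)
    ultimately show ?thesis unfolding E_def by (simp add: finite_subset)
  qed
  have P_add: "(\<lambda>x. h x + k x) \<in> P" if "h \<in> P" "k \<in> P" for h k
  proof -
    have sub: "{x. h x + k x ~= 0} \<subseteq> {x. h x ~= 0} \<union> {x. k x ~= 0}" by auto
    have fin: "finite ({x. h x ~= 0} \<union> {x. k x ~= 0})" "{x. h x ~= 0} \<union> {x. k x ~= 0} \<subseteq> carrier G"
      and nn: "0 <= h x" "0 <= k x" for x
      using that by (auto simp: P_def)
    show ?thesis
      unfolding P_def using finite_subset[OF sub fin(1)] subset_trans[OF sub fin(2)] add_nonneg_nonneg[OF nn]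
      by blast
  qed
  have P_scale: "(\<lambda>x. c * h x) \<in> P" if "h \<in> P" "c >= 0" for h c
  proof -
    have sub: "{x. c * h x ~= 0} \<subseteq> {x. h x ~= 0}" by auto
    have fin: "finite {x. h x ~= 0}" "{x. h x ~= 0} \<subseteq> carrier G" and nn: "0 <= h x" for x
      using that by (auto simp: P_def)
    show ?thesis
      unfolding P_def using finite_subset[OF sub fin(1)] subset_trans[OF sub fin(2)]
        mult_nonneg_nonneg[OF that(2) nn] by blast
  qed
  have P_zero: "(\<lambda>x. 0) \<in> P" by (simp add: P_def)
  have mass_add: "mass (\<lambda>x. h x + k x) = mass h + mass k" if "h \<in> P" "k \<in> P" for h k
  proof -
    define T where "T = {x. h x ~= 0} \<union> {x. k x ~= 0}"
    have T: "finite T" "{x. h x ~= 0} \<subseteq> T" "{x. k x ~= 0} \<subseteq> T" "{x. h x + k x ~= 0} \<subseteq> T"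
      using that by (auto simp: T_def P_def)
    show ?thesis
      unfolding mass_sup[OF T(1,2)] mass_sup[OF T(1,3)] mass_sup[OF T(1,4)] by (rule sum.distrib)
  qed
  have mass_scale: "mass (\<lambda>x. c * h x) = c * mass h" if "h \<in> P" for c h
  proof -
    have "finite {x. h x ~= 0}" "{x. c * h x ~= 0} \<subseteq> {x. h x ~= 0}" using that by (auto simp: P_def)
    from mass_sup[OF this] show ?thesis by (simp add: mass_def sum_distrib_left)
  qed
  have d_add: "d (\<lambda>x. h x + k x) = (\<lambda>i. d h i + d k i)" for h k
    by (auto simp: d_def fun_eq_iff)
  have d_scale: "d (\<lambda>x. c * h x) = (\<lambda>i. c * d h i)" for h c
    by (auto simp: d_def fun_eq_iff right_diff_distrib)
  have "\<exists>h\<in>P. mass h > 0 \<and> nrm (d h) < \<epsilon> * mass h"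
  proof (rule ccontr)
    assume none: "\<not> (\<exists>h\<in>P. mass h > 0 \<and> nrm (d h) < \<epsilon> * mass h)"
    have big: "\<epsilon> * mass h <= nrm (d h)" if h: "h \<in> P" for h
    proof (cases "mass h > 0")
      case True
      then show ?thesis using none h by force
    next
      case False
      then have "\<epsilon> * mass h <= 0" using \<epsilon> by (simp add: mult_nonneg_nonpos)
      then show ?thesis using nrm_nonneg[of "d h"] by linarith
    qed
    define V where "V = (\<lambda>y h. nrm (\<lambda>i. y i + d h i) - \<epsilon> * mass h)"
    define p where "p = (\<lambda>y. INF h\<in>P. V y h)"
    have V_lower: "- nrm y <= V y h" if y: "y \<in> E" and h: "h \<in> P" for y h
    proof -
      have "nrm (\<lambda>i. (y i + d h i) + (-1) * y i) <= nrm (\<lambda>i. y i + d h i) + nrm (\<lambda>i. (-1) * y i)"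
        by (intro nrm_add E' y d_in h)
      then show ?thesis using nrm_scale[OF y, of "-1"] big[OF h] by (simp add: V_def)
    qed
    have p_le: "p y <= V y h" if "y \<in> E" "h \<in> P" for y h
      unfolding p_def by (rule cINF_lower) (use V_lower that in \<open>auto simp: bdd_below_def\<close>)
    have le_p: "b <= p y" if "\<And>h. h \<in> P ==> b <= V y h" for b y
      unfolding p_def by (rule cINF_greatest) (use P_zero that in auto)
    have p_nrm: "p y <= nrm y" if "y \<in> E" for y
    proof -
      have "d (\<lambda>x. 0) = (\<lambda>i. 0)" by (auto simp: d_def fun_eq_iff)
      then show ?thesis using p_le[OF that P_zero] by (simp add: V_def mass_def)
    qed
    have p_sub: "sublinear_on E p"
    proof (rule sublinear_onI[OF E])
      fix x y assume x: "x \<in> E" and y: "y \<in> E"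
      have pair: "p (\<lambda>i. x i + y i) <= V x h + V y k" if h: "h \<in> P" and k: "k \<in> P" for h k
      proof -
        have "p (\<lambda>i. x i + y i) <= V (\<lambda>i. x i + y i) (\<lambda>z. h z + k z)"
          by (rule p_le[OF E'(2)[OF x y] P_add[OF h k]])
        also have "\<dots> = nrm (\<lambda>i. (x i + d h i) + (y i + d k i)) - \<epsilon> * (mass h + mass k)"
          unfolding V_def d_add mass_add[OF h k] by (simp add: add.assoc add.left_commute)
        also have "\<dots> <= V x h + V y k"
          using nrm_add[OF E'(2)[OF x d_in[OF h]] E'(2)[OF y d_in[OF k]]]
          by (simp add: V_def distrib_left)
        finally show ?thesis .
      qed
      have "p (\<lambda>i. x i + y i) - V y k <= p x" if "k \<in> P" for k
        by (rule le_p) (use pair[OF _ that] in fastforce)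
      then have "p (\<lambda>i. x i + y i) - p x <= p y" by (intro le_p) fastforce
      then show "p (\<lambda>i. x i + y i) <= p x + p y" by linarith
    next
      fix x and c :: real assume x: "x \<in> E" and c: "c > 0"
      have "p (\<lambda>i. c * x i) / c <= p x"
      proof (rule le_p)
        fix h assume h: "h \<in> P"
        have "p (\<lambda>i. c * x i) <= V (\<lambda>i. c * x i) (\<lambda>z. c * h z)"
          by (rule p_le[OF E'(3)[OF x] P_scale[OF h]]) (use c in simp)
        also have "\<dots> = c * V x h"
          unfolding V_def d_scale mass_scale[OF h] distrib_left[symmetric] nrm_scale[OF E'(2)[OF x d_in[OF h]]]
          using c by (simp add: right_diff_distrib)
        finally show "p (\<lambda>i. c * x i) / c <= V x h" using c by (simp add: field_simps)
      qed
      then show "p (\<lambda>i. c * x i) <= c * p x" using c by (simp add: field_simps)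
    next
      have "0 <= p (\<lambda>i. 0)" by (rule le_p) (use big in \<open>simp add: V_def\<close>)
      then show "p (\<lambda>i. 0) = 0" using p_nrm[OF E'(1)] by (simp add: nrm_def)
    qed
    obtain \<Lambda> where below: "\<And>x. x \<in> E ==> \<Lambda> x <= p x"
      and add: "\<And>x y. [|x \<in> E; y \<in> E|] ==> \<Lambda> (\<lambda>i. x i + y i) = \<Lambda> x + \<Lambda> y"
      using ex_linear_below_sublinear[OF E p_sub] by blast
    have \<Lambda>0: "\<Lambda> (\<lambda>i. 0) = 0" using add[OF E'(1) E'(1)] by simp
    have neg: "\<Lambda> (\<lambda>i. (-1) * y i) = - \<Lambda> y" if "y \<in> E" for y
      using add[OF that E'(3)[OF that, of "-1"]] \<Lambda>0 by simp
    have \<Lambda>_abs: "\<bar>\<Lambda> y\<bar> <= nrm y" if y: "y \<in> E" for y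
      using below[OF y] p_nrm[OF y] below[OF E'(3)[OF y, of "-1"]] p_nrm[OF E'(3)[OF y, of "-1"]]
        neg[OF y] nrm_scale[OF y, of "-1"] by linarith
    define e :: "'g \<times> 'g => 'g \<times> 'g => real" where "e = (\<lambda>j i. if i = j then 1 else 0)"
    have e_in: "e j \<in> E" and e_nrm: "nrm (e j) = 1" for j
    proof -
      have *: "{i. e j i ~= 0} = {j}" by (auto simp: e_def)
      show "e j \<in> E" by (simp add: E_def *)
      show "nrm (e j) = 1" unfolding nrm_def * by (simp add: e_def)
    qed
    define f where "f = (\<lambda>g x. \<Lambda> (e (g, x)))"
    have f_bdd: "f g \<in> bounded_functions G" for g
      by (rule bounded_functionsI[of _ 1]) (use \<Lambda>_abs[OF e_in] e_nrm in \<open>simp add: f_def\<close>)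
    have sum: "(\<lambda>i. \<Sum>g\<in>I. y g i) \<in> E \<and> \<Lambda> (\<lambda>i. \<Sum>g\<in>I. y g i) = (\<Sum>g\<in>I. \<Lambda> (y g))"
      if "finite I" "\<And>g. g \<in> I ==> y g \<in> E" for y :: "'g => 'g \<times> 'g => real" and I
      using that
    proof (induction I rule: finite_induct)
      case empty
      then show ?case using E'(1) \<Lambda>0 by simp
    next
      case (insert g I)
      then have "y g \<in> E" "(\<lambda>i. \<Sum>g\<in>I. y g i) \<in> E" "\<Lambda> (\<lambda>i. \<Sum>g\<in>I. y g i) = (\<Sum>g\<in>I. \<Lambda> (y g))"
        by auto
      then show ?case using insert.hyps E'(2) add by simp
    qed
    have lower: "\<epsilon> <= (\<Sum>g\<in>F. f g (g \<otimes> x) - f g x)" if x: "x \<in> carrier G" for x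
    proof -
      define h :: "'g => real" where "h = (\<lambda>z. if z = x then 1 else 0)"
      have supp: "{z. h z ~= 0} = {x}" by (auto simp: h_def)
      have h: "h \<in> P" unfolding P_def using x by (simp add: supp) (simp add: h_def)
      have mh: "mass h = 1" unfolding mass_def supp by (simp add: h_def)
      have ed: "(\<lambda>i. e (g, g \<otimes> x) i + (-1) * e (g, x) i) \<in> E" for g by (intro E' e_in)
      have dh: "d h = (\<lambda>i. \<Sum>g\<in>F. e (g, g \<otimes> x) i + (-1) * e (g, x) i)"
      proof
        fix i :: "'g \<times> 'g"
        obtain g z where i: "i = (g, z)" by (cases i)
        show "d h i = (\<Sum>g\<in>F. e (g, g \<otimes> x) i + (-1) * e (g, x) i)"
        proof (cases "g \<in> F")
          case True
          have "(\<Sum>g'\<in>F. e (g', g' \<otimes> x) i + (-1) * e (g', x) i) = (\<Sum>g'\<in>{g}. e (g', g' \<otimes> x) i + (-1) * e (g', x) i)"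
            using True F by (intro sum.mono_neutral_right) (auto simp: e_def i)
          also have "\<dots> = (if z = g \<otimes> x then 1 else 0) - (if z = x then 1 else 0)"
            by (simp add: e_def i)
          also have "\<dots> = d h i"
          proof (cases "z \<in> carrier G")
            case zc: True
            have "inv g \<otimes> z = x \<longleftrightarrow> z = g \<otimes> x"
              using True F x zc by (metis inv_solve_left subsetD)
            then show ?thesis using True zc by (simp add: d_def i h_def)
          next
            case False
            then have "z ~= g \<otimes> x" "z ~= x" using True F x by auto
            then show ?thesis using False by (simp add: d_def i)
          qed
          finally show ?thesis by simp
        next
          case False
          then have "(\<Sum>g\<in>F. e (g, g \<otimes> x) i + (-1) * e (g, x) i) = 0"
            by (intro sum.neutral) (auto simp: e_def i)
          then show ?thesis using False by (simp add: d_def i)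
        qed
      qed
      have "\<Lambda> (d h) = (\<Sum>g\<in>F. f g (g \<otimes> x) - f g x)"
      proof -
        have "\<Lambda> (\<lambda>i. e (g, g \<otimes> x) i + (-1) * e (g, x) i) = f g (g \<otimes> x) - f g x" for g
          unfolding add[OF e_in E'(3)[OF e_in]] neg[OF e_in] f_def by simp
        then show ?thesis
          unfolding dh using sum[OF F(1) ed] by simp
      qed
      moreover have "p (\<lambda>i. (-1) * d h i) <= - \<epsilon>"
        using p_le[OF E'(3)[OF d_in[OF h]] h, of "-1"] mh by (simp add: V_def nrm_def)
      ultimately show ?thesis
        using below[OF E'(3)[OF d_in[OF h], of "-1"]] neg[OF d_in[OF h]] by linarith
    qed
    have t: "(\<lambda>x. f g (g \<otimes> x) - f g x) \<in> bounded_functions G" if "g \<in> F" for g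
      using f_bdd that F by (intro bounded_functions_diff bounded_functions_translate) auto
    have "m (\<lambda>x. f g (g \<otimes> x) - f g x) = 0" if "g \<in> F" for g
      using mean_diff[OF bounded_functions_translate f_bdd, of "f g" g g] mean_translate[of "f g" g]
        f_bdd that F by auto
    then have "m (\<lambda>x. \<Sum>g\<in>F. f g (g \<otimes> x) - f g x) = 0"
      using mean_sum[OF F(1) t] by simp
    moreover have "m (\<lambda>x. \<epsilon>) <= m (\<lambda>x. \<Sum>g\<in>F. f g (g \<otimes> x) - f g x)"
      by (rule mean_mono) (use mean_sum[OF F(1) t] lower in auto)
    ultimately show False using mean_const[of \<epsilon>] \<epsilon> by simp
  qed
  then obtain h where h: "h \<in> P" "mass h > 0" "nrm (d h) < \<epsilon> * mass h" by blast
  define k where "k = (\<lambda>x. inverse (mass h) * h x)"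
  have k: "k \<in> P" unfolding k_def using h by (intro P_scale) auto
  have mk: "mass k = 1" unfolding k_def mass_scale[OF h(1)] using h by simp
  have "nrm (d k) = inverse (mass h) * nrm (d h)"
    unfolding k_def d_scale nrm_scale[OF d_in[OF h(1)]] using h by simp
  also have "\<dots> <= inverse (mass h) * (\<epsilon> * mass h)" using h by (intro mult_left_mono) auto
  also have "\<dots> = \<epsilon>" using h by simp
  finally have nk: "nrm (d k) <= \<epsilon>" .
  show thesis
  proof (rule that[of k])
    fix g T assume g: "g \<in> F" and T: "finite T" "T \<subseteq> carrier G"
    have "(\<Sum>x\<in>T. \<bar>k (inv g \<otimes> x) - k x\<bar>) = (\<Sum>i\<in>Pair g ` T. \<bar>d k i\<bar>)"
      using g T by (subst sum.reindex) (auto simp: inj_on_def d_def intro!: sum.cong)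
    also have "\<dots> <= (\<Sum>i\<in>Pair g ` T \<union> {i. d k i ~= 0}. \<bar>d k i\<bar>)"
      using T d_in[OF k] by (intro sum_mono2) (auto simp: E_def)
    also have "\<dots> = nrm (d k)"
      using T d_in[OF k] by (intro nrm_sup[symmetric]) (auto simp: E_def)
    finally show "(\<Sum>x\<in>T. \<bar>k (inv g \<otimes> x) - k x\<bar>) <= \<epsilon>" using nk by simp
  qed (use k mk in \<open>auto simp: P_def mass_def\<close>)
qed

end

section \<open>Almost invariant positive definite functions\<close>

lemma norm_cis_diff_one_le: "cmod (cis x - 1) <= \<bar>x\<bar>"
proof -
  have "cmod (cis x - 1) = 2 * \<bar>sin (x / 2)\<bar>"
  proof -
    have "cis x - 1 = cis (x / 2) * (cis (x / 2) - cis (- (x / 2)))"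
      by (simp add: cis_mult right_diff_distrib)
    also have "cis (x / 2) - cis (- (x / 2)) = complex_of_real (2 * sin (x / 2)) * \<i>"
      by (simp add: complex_eq_iff)
    finally show ?thesis by (simp add: norm_mult)
  qed
  also have "\<dots> <= 2 * \<bar>x / 2\<bar>" by (intro mult_left_mono abs_sin_x_le_abs_x) simp
  finally show ?thesis by simp
qed

lemma cnj_mult_unimodular:
  assumes "cnj c * c = 1"
  shows "cnj (c * x) * (c * y) = cnj x * y"
proof -
  have "cnj (c * x) * (c * y) = (cnj c * c) * (cnj x * y)" by (simp only: complex_cnj_mult ac_simps)
  then show ?thesis using assms by simp
qed

lemma (in group) inv_cancel:
  assumes "x \<in> carrier G" "y \<in> carrier G"
  shows "inv x \<otimes> (x \<otimes> y) = y" "x \<otimes> (inv x \<otimes> y) = y"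
  using assms by (simp_all add: m_assoc[symmetric])

text \<open>
  A subgroup \<open>H\<close> of finite index and a normal subgroup \<open>A\<close> of \<open>G\<close> inside \<open>H\<close>, with an
  \<open>H\<close>-invariant homomorphism \<open>\<psi>\<close> from \<open>A\<close> to the reals.  The characters \<open>cis (t * \<psi> a)\<close> are then
  \<open>H\<close>-invariant, and inducing them to \<open>G\<close> gives a path of representations of \<open>G\<close>.
\<close>

locale invariant_character = group G for G :: "('g, 'm) monoid_scheme" (structure) +
  fixes A H :: "'g set" and \<psi> :: "'g => real"
  assumes A_normal: "A \<lhd> G" and H_subgroup: "subgroup H G" and A_H: "A \<subseteq> H"
    and H_finite_index: "finite (rcosets H)"
    and \<psi>_hom: "[|a \<in> A; b \<in> A|] ==> \<psi> (a \<otimes> b) = \<psi> a + \<psi> b"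
    and \<psi>_inv: "[|h \<in> H; a \<in> A|] ==> \<psi> (h \<otimes> a \<otimes> inv h) = \<psi> a"
begin

lemma A_subgroup: "subgroup A G"
  using A_normal by (rule normal_imp_subgroup)

lemma H_in [simp]: "h \<in> H ==> h \<in> carrier G"
  using subgroup.mem_carrier[OF H_subgroup] .

lemma A_in [simp]: "a \<in> A ==> a \<in> carrier G"
  using subgroup.mem_carrier[OF A_subgroup] .

lemma A_conj: "[|a \<in> A; g \<in> carrier G|] ==> g \<otimes> a \<otimes> inv g \<in> A"
  using A_normal by (rule normal.inv_op_closed2)

lemma A_conj': "[|a \<in> A; g \<in> carrier G|] ==> inv g \<otimes> a \<otimes> g \<in> A"
  using A_normal by (rule normal.inv_op_closed1)

lemma \<psi>_inv': "[|h \<in> H; a \<in> A|] ==> \<psi> (inv h \<otimes> a \<otimes> h) = \<psi> a"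
  using \<psi>_inv[of "inv h" a] subgroup.m_inv_closed[OF H_subgroup, of h] by simp

lemma \<psi>_one: "\<psi> \<one> = 0"
  using \<psi>_hom[of \<one> \<one>] subgroup.one_closed[OF A_subgroup] by simp

lemma \<psi>_inverse: "a \<in> A ==> \<psi> (inv a) = - \<psi> a"
  using \<psi>_hom[of a "inv a"] subgroup.m_inv_closed[OF A_subgroup, of a] \<psi>_one by simp

abbreviation coset :: "'g => 'g set" where "coset k \<equiv> A #> k"

definition rep :: "'g set => 'g" where "rep C = (SOME k. k \<in> C)"

lemma coset_in [simp]: "k \<in> carrier G ==> coset k \<in> rcosets A"
  by (rule rcosetsI[OF subgroup.subset[OF A_subgroup]])

lemma rep_mem:
  assumes "C \<in> rcosets A" shows "rep C \<in> C"
proof -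
  have "\<exists>k. k \<in> C" using subgroup.rcosets_non_empty[OF A_subgroup assms] by blast
  then show ?thesis unfolding rep_def by (rule someI_ex)
qed

lemma rep_in [simp]:
  assumes "C \<in> rcosets A" shows "rep C \<in> carrier G"
  by (rule subsetD[OF subgroup.rcosets_carrier[OF A_subgroup is_group assms] rep_mem[OF assms]])

lemma coset_rep [simp]:
  assumes C: "C \<in> rcosets A" shows "coset (rep C) = C"
proof -
  obtain k where k: "k \<in> carrier G" "C = coset k" using C unfolding RCOSETS_def by blast
  have "rep C \<in> coset k" using rep_mem[OF C] k(2) by simp
  then show ?thesis using repr_independence[OF _ k(1) A_subgroup] k(2) by simp
qed

lemma coset_mult_left [simp]:
  assumes a: "a \<in> A" and k: "k \<in> carrier G" shows "coset (a \<otimes> k) = coset k"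
proof -
  have "a \<otimes> k \<in> coset k" using rcosI[OF a subgroup.subset[OF A_subgroup] k] .
  then show ?thesis using repr_independence[OF _ k A_subgroup] by simp
qed

lemma coset_eqD:
  assumes "coset k = coset l" "k \<in> carrier G" "l \<in> carrier G"
  shows "k \<otimes> inv l \<in> A"
proof -
  have "k \<in> coset l" using rcos_self[OF assms(2) A_subgroup] assms(1) by simp
  then obtain a where a: "a \<in> A" "k = a \<otimes> l" unfolding r_coset_def by blast
  have "k \<otimes> inv l = a" unfolding a(2) using a(1) assms(3) by (simp add: m_assoc)
  then show ?thesis using a(1) by simp
qed

lemma coset_mult_left_cancel:
  assumes "coset k = coset l" "k \<in> carrier G" "l \<in> carrier G" "g \<in> carrier G"
  shows "coset (g \<otimes> k) = coset (g \<otimes> l)"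
proof -
  define a where "a = k \<otimes> inv l"
  have a: "a \<in> A" using coset_eqD[OF assms(1-3)] by (simp add: a_def)
  have k: "k = a \<otimes> l" using assms(2,3) by (simp add: a_def m_assoc)
  have "(g \<otimes> a \<otimes> inv g) \<otimes> (g \<otimes> l) = g \<otimes> (a \<otimes> l)"
    using assms(3,4) a by (simp add: m_assoc inv_cancel)
  then show ?thesis
    unfolding k using coset_mult_left[OF A_conj[OF a assms(4)], of "g \<otimes> l"] assms(3,4) by simp
qed

text \<open>A choice of logarithm for an \<open>A\<close>-covariant function of modulus one on \<open>G\<close>.\<close>

definition phase :: "'g => real" where "phase k = \<psi> (k \<otimes> inv (rep (coset k)))"

lemma phase_mult:
  assumes a: "a \<in> A" and k: "k \<in> carrier G"
  shows "phase (a \<otimes> k) = \<psi> a + phase k"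
proof -
  have "k \<otimes> inv (rep (coset k)) \<in> A"
    by (rule coset_eqD) (use k in simp_all)
  then have "\<psi> (a \<otimes> (k \<otimes> inv (rep (coset k)))) = \<psi> a + \<psi> (k \<otimes> inv (rep (coset k)))"
    using a by (intro \<psi>_hom)
  then show ?thesis using a k by (simp add: phase_def m_assoc)
qed

lemma phase_rep: "C \<in> rcosets A ==> phase (rep C) = 0"
  by (simp add: phase_def \<psi>_one)

definition probability_vector :: "('g set => real) => bool" where
  "probability_vector f \<longleftrightarrow> finite {C. f C ~= 0} \<and> {C. f C ~= 0} \<subseteq> rcosets A \<and> (\<forall>C. 0 <= f C) \<and>
     (\<Sum>C\<in>{C. f C ~= 0}. f C) = 1"

definition covariant_vector :: "('g set => real) => real => 'g => complex" where
  "covariant_vector f s k = of_real (sqrt (f (coset k))) * cis (- s * phase k)"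

text \<open>
  The matrix coefficient at the unit vector \<open>covariant_vector f s\<close> of the representation of \<open>H\<close>
  induced from the character \<open>cis (s * \<psi> a)\<close> of \<open>A\<close>.
\<close>

definition coefficient :: "('g set => real) => real => 'g => complex" where
  "coefficient f s l =
     (\<Sum>C\<in>{C. f C ~= 0}. cnj (covariant_vector f s (rep C)) * covariant_vector f s (inv l \<otimes> rep C))"

lemma covariant_vector_mult:
  assumes "a \<in> A" "k \<in> carrier G"
  shows "covariant_vector f s (a \<otimes> k) = cis (- s * \<psi> a) * covariant_vector f s k"
proof -
  have "cis (- s * phase (a \<otimes> k)) = cis (- s * \<psi> a) * cis (- s * phase k)"
    unfolding phase_mult[OF assms] cis_mult by (simp add: algebra_simps)
  then show ?thesis using assms by (simp add: covariant_vector_def)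
qed

lemma coefficient_one:
  assumes f: "probability_vector f"
  shows "coefficient f s \<one> = 1"
proof -
  have "coefficient f s \<one> = (\<Sum>C\<in>{C. f C ~= 0}. of_real (f C))"
    unfolding coefficient_def
  proof (intro sum.cong refl)
    fix C assume C: "C \<in> {C. f C ~= 0}"
    then have "C \<in> rcosets A" "0 <= f C" using f by (auto simp: probability_vector_def)
    then have "covariant_vector f s (rep C) = of_real (sqrt (f C))"
      by (simp add: covariant_vector_def phase_rep)
    moreover have "complex_of_real (sqrt (f C)) * of_real (sqrt (f C)) = of_real (f C)"
      using \<open>0 <= f C\<close> by (simp flip: of_real_mult)
    ultimately show "cnj (covariant_vector f s (rep C)) * covariant_vector f s (inv \<one> \<otimes> rep C) = of_real (f C)"
      using \<open>C \<in> rcosets A\<close> by simp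
  qed
  also have "\<dots> = of_real (\<Sum>C\<in>{C. f C ~= 0}. f C)" by simp
  also have "(\<Sum>C\<in>{C. f C ~= 0}. f C) = 1" using f by (simp add: probability_vector_def)
  finally show ?thesis by simp
qed

lemma coefficient_mult:
  assumes f: "probability_vector f" and a: "a \<in> A" and l: "l \<in> H"
  shows "coefficient f s (a \<otimes> l) = cis (s * \<psi> a) * coefficient f s l"
proof -
  have "covariant_vector f s (inv (a \<otimes> l) \<otimes> rep C) = cis (s * \<psi> a) * covariant_vector f s (inv l \<otimes> rep C)"
    if "C \<in> rcosets A" for C
  proof -
    have ia: "inv a \<in> A" using subgroup.m_inv_closed[OF A_subgroup a] .
    have "inv (a \<otimes> l) \<otimes> rep C = (inv l \<otimes> inv a \<otimes> l) \<otimes> (inv l \<otimes> rep C)"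
      using a l that by (simp add: inv_mult_group m_assoc inv_cancel)
    moreover have "\<psi> (inv l \<otimes> inv a \<otimes> l) = - \<psi> a"
      using \<psi>_inv'[OF l ia] \<psi>_inverse[OF a] by simp
    ultimately show ?thesis
      using covariant_vector_mult[OF A_conj'[OF ia], of l "inv l \<otimes> rep C" f s] l that by simp
  qed
  then show ?thesis
    using f unfolding coefficient_def sum_distrib_left probability_vector_def
    by (intro sum.cong refl) (auto simp: mult.left_commute)
qed

text \<open>Positive definiteness of the coefficient, in the strong form of a finite Gram matrix.\<close>

lemma coefficient_gram:
  assumes f: "probability_vector f" and Y: "finite Y" "Y \<subseteq> H"
  shows "\<exists>(Z :: 'g set set) w. finite Z \<and> (\<forall>l\<in>Y. \<forall>l'\<in>Y. coefficient f s (inv l \<otimes> l') = (\<Sum>D\<in>Z. cnj (w D l) * w D l'))"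
proof -
  define P where "P = {C. f C ~= 0}"
  have P: "finite P" "P \<subseteq> rcosets A" using f by (auto simp: P_def probability_vector_def)
  define Z where "Z = (\<lambda>(l, C). coset (l \<otimes> rep C)) ` (Y \<times> P)"
  define w where "w = (\<lambda>D l. covariant_vector f s (inv l \<otimes> rep D))"
  have Z: "finite Z" "Z \<subseteq> rcosets A" using P Y by (auto simp: Z_def subset_iff)
  have "coefficient f s (inv l \<otimes> l') = (\<Sum>D\<in>Z. cnj (w D l) * w D l')" if l: "l \<in> Y" and l': "l' \<in> Y" for l l'
  proof -
    have lH: "l \<in> H" "l' \<in> H" using l l' Y by auto
    define e where "e = (\<lambda>C. coset (l \<otimes> rep C))"
    have retract: "coset (inv l \<otimes> rep (e C)) = C" if C: "C \<in> rcosets A" for C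
    proof -
      have "coset (inv l \<otimes> rep (e C)) = coset (inv l \<otimes> (l \<otimes> rep C))"
        using C lH by (intro coset_mult_left_cancel) (simp_all add: e_def)
      then show ?thesis using C lH by (simp add: m_assoc[symmetric])
    qed
    have inj: "inj_on e P"
      by (rule inj_on_inverseI[where g = "\<lambda>D. coset (inv l \<otimes> rep D)"]) (rule retract[OF subsetD[OF P(2)]])
    have summand: "cnj (w (e C) l) * w (e C) l'
        = cnj (covariant_vector f s (rep C)) * covariant_vector f s (inv (inv l \<otimes> l') \<otimes> rep C)"
      if C: "C \<in> P" for C
    proof -
      have CA: "C \<in> rcosets A" using C P by auto
      define a where "a = rep (e C) \<otimes> inv (l \<otimes> rep C)"
      have a: "a \<in> A"
        unfolding a_def using CA lH by (intro coset_eqD) (simp_all add: e_def)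
      have \<sigma>: "rep (e C) = a \<otimes> (l \<otimes> rep C)"
        using CA lH by (simp add: a_def e_def m_assoc)
      have "inv l \<otimes> rep (e C) = (inv l \<otimes> a \<otimes> l) \<otimes> rep C"
        unfolding \<sigma> using a CA lH by (simp add: m_assoc)
      then have "w (e C) l = covariant_vector f s ((inv l \<otimes> a \<otimes> l) \<otimes> rep C)" by (simp only: w_def)
      also have "\<dots> = cis (- s * \<psi> (inv l \<otimes> a \<otimes> l)) * covariant_vector f s (rep C)"
        using CA lH by (intro covariant_vector_mult A_conj'[OF a]) simp_all
      finally have 1: "w (e C) l = cis (- s * \<psi> a) * covariant_vector f s (rep C)"
        unfolding \<psi>_inv'[OF lH(1) a] .
      have "inv l' \<otimes> rep (e C) = (inv l' \<otimes> a \<otimes> l') \<otimes> (inv (inv l \<otimes> l') \<otimes> rep C)"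
        unfolding \<sigma> using a CA lH by (simp add: m_assoc inv_mult_group inv_cancel)
      then have "w (e C) l' = covariant_vector f s ((inv l' \<otimes> a \<otimes> l') \<otimes> (inv (inv l \<otimes> l') \<otimes> rep C))"
        by (simp only: w_def)
      also have "\<dots> = cis (- s * \<psi> (inv l' \<otimes> a \<otimes> l')) * covariant_vector f s (inv (inv l \<otimes> l') \<otimes> rep C)"
        using CA lH by (intro covariant_vector_mult A_conj'[OF a]) simp_all
      finally have 2: "w (e C) l' = cis (- s * \<psi> a) * covariant_vector f s (inv (inv l \<otimes> l') \<otimes> rep C)"
        unfolding \<psi>_inv'[OF lH(2) a] .
      have "cnj (cis (- s * \<psi> a)) * cis (- s * \<psi> a) = 1"
        by (simp add: cis_cnj cis_mult)
      then show ?thesis unfolding 1 2 by (rule cnj_mult_unimodular)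
    qed
    have "(\<Sum>D\<in>Z. cnj (w D l) * w D l') = (\<Sum>D\<in>e ` P. cnj (w D l) * w D l')"
    proof (rule sum.mono_neutral_right)
      show "e ` P \<subseteq> Z"
      proof
        fix D assume "D \<in> e ` P"
        then obtain C where C: "C \<in> P" "D = coset (l \<otimes> rep C)" unfolding e_def by blast
        show "D \<in> Z"
          unfolding Z_def by (rule image_eqI[of _ _ "(l, C)"]) (use C l in simp_all)
      qed
      show "\<forall>D\<in>Z - e ` P. cnj (w D l) * w D l' = 0"
      proof
        fix D assume D: "D \<in> Z - e ` P"
        then have DA: "D \<in> rcosets A" using Z by auto
        define C where "C = coset (inv l \<otimes> rep D)"
        have "e C = coset (l \<otimes> (inv l \<otimes> rep D))"
          unfolding e_def C_def using DA lH by (intro coset_mult_left_cancel) simp_all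
        then have "e C = D" using DA lH by (simp add: m_assoc[symmetric])
        then have "C \<notin> P" using D by auto
        then have "w D l = 0" by (simp add: w_def covariant_vector_def P_def C_def)
        then show "cnj (w D l) * w D l' = 0" by simp
      qed
    qed (use Z in auto)
    also have "\<dots> = coefficient f s (inv l \<otimes> l')"
      unfolding sum.reindex[OF inj] coefficient_def P_def[symmetric]
      by (intro sum.cong refl) (simp only: o_def summand)
    finally show ?thesis by simp
  qed
  then show ?thesis by (intro exI[of _ Z] exI[of _ w] conjI ballI Z(1))
qed

lemma coefficient_near_one:
  assumes f: "probability_vector f" and l: "l \<in> carrier G"
    and near: "(\<Sum>C\<in>{C. f C ~= 0}. \<bar>f (coset (inv l \<otimes> rep C)) - f C\<bar>) <= e"
    and B: "\<And>C. f C ~= 0 ==> \<bar>phase (inv l \<otimes> rep C)\<bar> <= B"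
  shows "cmod (coefficient f s l - 1) <= \<bar>s\<bar> * B * (1 + e) + e"
proof -
  define P where "P = {C. f C ~= 0}"
  have P: "finite P" "P \<subseteq> rcosets A" and nn: "\<And>C. 0 <= f C" and one: "sum f P = 1"
    using f by (auto simp: P_def probability_vector_def)
  define f' where "f' = (\<lambda>C. f (coset (inv l \<otimes> rep C)))"
  define r where "r = (\<lambda>C. sqrt (f C) * sqrt (f' C))"
  have r: "0 <= r C" for C using nn by (simp add: r_def f'_def)
  have rf: "\<bar>f C - r C\<bar> <= \<bar>f' C - f C\<bar>" for C
  proof -
    have "f C - r C = sqrt (f C) * (sqrt (f C) - sqrt (f' C))"
      using nn[of C] by (simp add: r_def right_diff_distrib)
    then have "\<bar>f C - r C\<bar> = sqrt (f C) * \<bar>sqrt (f C) - sqrt (f' C)\<bar>"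
      using nn[of C] by (simp add: abs_mult)
    also have "\<dots> <= (sqrt (f C) + sqrt (f' C)) * \<bar>sqrt (f C) - sqrt (f' C)\<bar>"
      using nn by (intro mult_right_mono) (simp_all add: f'_def)
    also have "\<dots> = \<bar>(sqrt (f C) + sqrt (f' C)) * (sqrt (f C) - sqrt (f' C))\<bar>"
      using nn by (simp add: abs_mult f'_def)
    also have "(sqrt (f C) + sqrt (f' C)) * (sqrt (f C) - sqrt (f' C)) = f C - f' C"
      using nn by (simp add: f'_def algebra_simps)
    finally show ?thesis by (simp add: abs_minus_commute)
  qed
  have sum_r: "\<bar>1 - sum r P\<bar> <= e"
  proof -
    have "\<bar>1 - sum r P\<bar> = \<bar>\<Sum>C\<in>P. f C - r C\<bar>" using one by (simp add: sum_subtractf)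
    also have "\<dots> <= (\<Sum>C\<in>P. \<bar>f' C - f C\<bar>)"
      by (rule order_trans[OF sum_abs sum_mono]) (rule rf)
    finally show ?thesis using near by (simp add: f'_def P_def)
  qed
  have summand: "cnj (covariant_vector f s (rep C)) * covariant_vector f s (inv l \<otimes> rep C)
      = of_real (r C) * cis (- s * phase (inv l \<otimes> rep C))" if "C \<in> P" for C
  proof -
    have "C \<in> rcosets A" using that P by auto
    then show ?thesis by (simp add: covariant_vector_def phase_rep r_def f'_def)
  qed
  have "cmod (coefficient f s l - of_real (sum r P))
      = cmod (\<Sum>C\<in>P. of_real (r C) * (cis (- s * phase (inv l \<otimes> rep C)) - 1))"
    unfolding coefficient_def P_def[symmetric] right_diff_distrib sum_subtractf of_real_sum
    using summand by simp
  also have "\<dots> <= (\<Sum>C\<in>P. r C * (\<bar>s\<bar> * B))"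
  proof (rule sum_norm_le)
    fix C assume C: "C \<in> P"
    have "cmod (cis (- s * phase (inv l \<otimes> rep C)) - 1) <= \<bar>s\<bar> * \<bar>phase (inv l \<otimes> rep C)\<bar>"
      using norm_cis_diff_one_le[of "- s * phase (inv l \<otimes> rep C)"] by (simp add: abs_mult)
    also have "\<dots> <= \<bar>s\<bar> * B" using B C by (intro mult_left_mono) (auto simp: P_def)
    finally show "cmod (of_real (r C) * (cis (- s * phase (inv l \<otimes> rep C)) - 1)) <= r C * (\<bar>s\<bar> * B)"
      using r by (simp add: norm_mult mult_left_mono)
  qed
  also have "\<dots> = \<bar>s\<bar> * B * sum r P" by (simp add: sum_distrib_right[symmetric] mult.commute)
  also have "\<dots> <= \<bar>s\<bar> * B * (1 + e)"
  proof (rule mult_left_mono)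
    have "P ~= {}" using one by auto
    then obtain C where "f C ~= 0" by (auto simp: P_def)
    then have "0 <= B" using order_trans[OF abs_ge_zero B] by blast
    then show "0 <= \<bar>s\<bar> * B" by simp
  qed (use sum_r in linarith)
  finally have 1: "cmod (coefficient f s l - of_real (sum r P)) <= \<bar>s\<bar> * B * (1 + e)" .
  have "cmod (of_real (sum r P) - 1) = \<bar>sum r P - 1\<bar>"
    by (metis norm_of_real of_real_1 of_real_diff)
  then have 2: "cmod (of_real (sum r P) - 1) <= e" using sum_r by (simp add: abs_minus_commute)
  show ?thesis
    using norm_triangle_ineq[of "coefficient f s l - of_real (sum r P)" "of_real (sum r P) - 1"] 1 2 by simp
qed

lemma ex_probability_vector: "\<exists>f. probability_vector f"
proof
  define f :: "'g set => real" where "f = (\<lambda>C. if C = coset \<one> then 1 else 0)"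
  have "{C. f C ~= 0} = {coset \<one>}" by (auto simp: f_def)
  then show "probability_vector f" by (simp add: probability_vector_def f_def)
qed

text \<open>
  Reiter's condition for \<open>G / A\<close> gives a finitely supported vector that is almost invariant under \<open>F\<close>.
  The phases that occur on its support are bounded, so for small \<open>s\<close> they do not matter.
\<close>

lemma ex_almost_invariant_vector:
  assumes am: "amenable G" and F: "finite F" "F \<subseteq> carrier G" and e: "e > 0"
  obtains f \<delta> where "probability_vector f" "\<delta> > 0"
    "\<And>s l. \<bar>s\<bar> < \<delta> ==> l \<in> F ==> cmod (coefficient f s l - 1) < e"
proof -
  interpret N: normal A G by (rule A_normal)
  have Q: "group (G Mod A)" by (rule N.factorgroup_is_group)
  have "amenable (G Mod A)"
  proof (rule amenable_image[OF is_group Q am, where \<pi> = coset])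
    fix q assume "q \<in> carrier (G Mod A)"
    then obtain g where "g \<in> carrier G" "q = coset g" unfolding FactGroup_def RCOSETS_def by auto
    then show "\<exists>g\<in>carrier G. \<forall>x\<in>carrier G. coset (g \<otimes> x) = q \<otimes>\<^bsub>G Mod A\<^esub> coset x"
      by (intro bexI[of _ g]) (auto simp: FactGroup_def N.rcos_sum)
  qed (simp add: FactGroup_def)
  then obtain m where m: "left_invariant_mean (G Mod A) m" by (auto simp: amenable_def)
  interpret Q: mean_group "G Mod A" m
    using Q m by (simp add: mean_group_def mean_group_axioms_def)
  have FQ: "finite (coset ` F)" "coset ` F \<subseteq> carrier (G Mod A)" using F by (auto simp: FactGroup_def)
  have e5: "min (e / 4) 1 > 0" using e by simp
  show thesis
  proof (rule Q.reiter[OF FQ e5])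
  fix f :: "'g set => real"
  assume f: "finite {C. f C ~= 0}" "{C. f C ~= 0} \<subseteq> carrier (G Mod A)" "\<And>C. 0 <= f C"
    "(\<Sum>C\<in>{C. f C ~= 0}. f C) = 1"
    "\<And>q T. [|q \<in> coset ` F; finite T; T \<subseteq> carrier (G Mod A)|] ==>
       (\<Sum>C\<in>T. \<bar>f (inv\<^bsub>G Mod A\<^esub> q \<otimes>\<^bsub>G Mod A\<^esub> C) - f C\<bar>) <= min (e / 4) 1"
  have pf: "probability_vector f" using f by (simp add: probability_vector_def FactGroup_def)
  have near: "(\<Sum>C\<in>{C. f C ~= 0}. \<bar>f (coset (inv l \<otimes> rep C)) - f C\<bar>) <= min (e / 4) 1" if l: "l \<in> F" for l
  proof -
    have lG: "l \<in> carrier G" using l F by auto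
    have "inv\<^bsub>G Mod A\<^esub> (coset l) \<otimes>\<^bsub>G Mod A\<^esub> C = coset (inv l \<otimes> rep C)" if "C \<in> rcosets A" for C
    proof -
      have "inv\<^bsub>G Mod A\<^esub> (coset l) = coset (inv l)"
        using N.inv_FactGroup[of "coset l"] N.rcos_inv[OF lG] lG by (simp add: FactGroup_def)
      moreover have "coset (inv l) <#> coset (rep C) = coset (inv l \<otimes> rep C)"
        using lG that by (intro N.rcos_sum) simp_all
      ultimately show ?thesis using that by (simp add: FactGroup_def)
    qed
    then have "(\<Sum>C\<in>{C. f C ~= 0}. \<bar>f (coset (inv l \<otimes> rep C)) - f C\<bar>)
        = (\<Sum>C\<in>{C. f C ~= 0}. \<bar>f (inv\<^bsub>G Mod A\<^esub> (coset l) \<otimes>\<^bsub>G Mod A\<^esub> C) - f C\<bar>)"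
      using f(2) by (intro sum.cong refl) (simp add: FactGroup_def subset_iff)
    also have "\<dots> <= min (e / 4) 1" by (rule f(5)) (use l f in auto)
    finally show ?thesis .
  qed
  define V where "V = (\<lambda>(l, C). \<bar>phase (inv l \<otimes> rep C)\<bar>) ` (F \<times> {C. f C ~= 0})"
  have "finite V" unfolding V_def using F(1) f(1) by (intro finite_imageI finite_cartesian_product)
  then have "bdd_above V" by (rule bdd_above_finite)
  then obtain B where B: "\<And>x. x \<in> V ==> x <= B" unfolding bdd_above_def by blast
  define B' where "B' = max B 1"
  have B': "B' > 0" by (simp add: B'_def)
  have B'_bound: "\<bar>phase (inv l \<otimes> rep C)\<bar> <= B'" if "l \<in> F" "f C ~= 0" for l C
  proof -
    have "\<bar>phase (inv l \<otimes> rep C)\<bar> <= B"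
      by (rule B, unfold V_def, rule image_eqI[of _ _ "(l, C)"]) (use that in simp_all)
    then show ?thesis by (simp add: B'_def)
  qed
  show thesis
  proof (rule that[OF pf, of "e / (4 * B')"])
    show "e / (4 * B') > 0" using e B' by simp
    fix s l assume s: "\<bar>s\<bar> < e / (4 * B')" and l: "l \<in> F"
    have "cmod (coefficient f s l - 1) <= \<bar>s\<bar> * B' * (1 + min (e / 4) 1) + min (e / 4) 1"
      by (rule coefficient_near_one[OF pf _ near[OF l]]) (use l F B'_bound in auto)
    also have "\<dots> <= \<bar>s\<bar> * B' * 2 + e / 4"
      using B' by (intro add_mono mult_left_mono) auto
    also have "\<bar>s\<bar> * B' < e / (4 * B') * B'" using s B' by (rule mult_strict_right_mono)
    also have "e / (4 * B') * B' = e / 4" using B' by simp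
    finally show "cmod (coefficient f s l - 1) < e" using e by linarith
  qed
  qed
qed

end

section \<open>States of induced representations\<close>

context group
begin

definition positive_kernel :: "('a => 'a => complex) => bool" where
  "positive_kernel K \<longleftrightarrow> (\<forall>Y c. finite Y \<and> Y \<subseteq> carrier G \<longrightarrow>
     (\<exists>s\<ge>0. (\<Sum>y\<in>Y. \<Sum>z\<in>Y. cnj (c y) * c z * K y z) = of_real s))"

text \<open>Repetitions among the points are harmless: group equal points together.\<close>

lemma positive_kernel_family:
  assumes K: "positive_kernel K" and I: "finite I" and w: "\<And>i. i \<in> I ==> w i \<in> carrier G"
  shows "\<exists>s\<ge>0. (\<Sum>i\<in>I. \<Sum>j\<in>I. cnj (c i) * c j * K (w i) (w j)) = of_real s"
proof -
  define d where "d = (\<lambda>y. \<Sum>i\<in>{i\<in>I. w i = y}. c i)"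
  have group_sum: "(\<Sum>i\<in>I. f i * g (w i)) = (\<Sum>y\<in>w ` I. (\<Sum>i\<in>{i\<in>I. w i = y}. f i) * g y)"
    for f g :: "_ => complex"
    unfolding sum.image_gen[OF I, of "\<lambda>i. f i * g (w i)" w] sum_distrib_right
    by (intro sum.cong refl) simp
  have "(\<Sum>i\<in>I. \<Sum>j\<in>I. cnj (c i) * c j * K (w i) (w j))
      = (\<Sum>i\<in>I. cnj (c i) * (\<Sum>z\<in>w ` I. d z * K (w i) z))"
    unfolding d_def group_sum[symmetric] by (simp add: sum_distrib_left mult.assoc)
  also have "\<dots> = (\<Sum>y\<in>w ` I. cnj (d y) * (\<Sum>z\<in>w ` I. d z * K y z))"
  proof -
    have dc: "cnj (d y) = (\<Sum>i\<in>{i\<in>I. w i = y}. cnj (c i))" for y by (simp add: d_def)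
    show ?thesis
      unfolding dc by (rule group_sum[of "\<lambda>i. cnj (c i)" "\<lambda>y. \<Sum>z\<in>w ` I. d z * K y z"])
  qed
  also have "\<dots> = (\<Sum>y\<in>w ` I. \<Sum>z\<in>w ` I. cnj (d y) * d z * K y z)"
    by (simp add: sum_distrib_left mult.assoc)
  finally have eq: "(\<Sum>i\<in>I. \<Sum>j\<in>I. cnj (c i) * c j * K (w i) (w j))
      = (\<Sum>y\<in>w ` I. \<Sum>z\<in>w ` I. cnj (d y) * d z * K y z)" .
  have "finite (w ` I) \<and> w ` I \<subseteq> carrier G" using I w by (simp add: image_subset_iff)
  from K[unfolded positive_kernel_def, rule_format, OF this, of d] show ?thesis unfolding eq .
qed

lemma positive_kernel_diag:
  assumes K: "positive_kernel K" and y: "y \<in> carrier G"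
  shows "\<exists>s\<ge>0. K y y = of_real s"
  using positive_kernel_family[OF K, of "{0::nat}" "\<lambda>_. y" "\<lambda>_. 1"] y by simp

lemma positive_kernel_offdiag:
  assumes K: "positive_kernel K" and y: "y \<in> carrier G" and z: "z \<in> carrier G"
  shows "2 * cmod (K y z) <= Re (K y y) + Re (K z z)"
proof -
  have pos: "\<exists>s\<ge>0. K y y + b * K y z + cnj b * K z y + cnj b * b * K z z = of_real s" for b
    using positive_kernel_family[OF K, of "{0, 1::nat}" "\<lambda>i. if i = 0 then y else z" "\<lambda>i. if i = 0 then 1 else b"] y z
    by (simp add: algebra_simps)
  have s: "Im (K y y) = 0" "Im (K z z) = 0"
    using positive_kernel_diag[OF K y] positive_kernel_diag[OF K z] by auto
  have im: "Im (b * K y z + cnj b * K z y) = 0" for b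
  proof -
    obtain s' where "K y y + b * K y z + cnj b * K z y + cnj b * b * K z z = of_real s'" using pos by blast
    then have "Im (K y y + b * K y z + cnj b * K z y + cnj b * b * K z z) = 0" by simp
    then show ?thesis by (simp add: s)
  qed
  have herm: "K z y = cnj (K y z)"
    using im[of 1] im[of \<i>] by (simp add: complex_eq_iff)
  show ?thesis
  proof (cases "K y z = 0")
    case True
    have "0 <= Re (K y y)" "0 <= Re (K z z)"
      using positive_kernel_diag[OF K y] positive_kernel_diag[OF K z] by auto
    then show ?thesis using True by simp
  next
    case False
    define b where "b = - cnj (K y z) / of_real (cmod (K y z))"
    have bb: "cnj b * b = 1" and bk: "b * K y z = - of_real (cmod (K y z))"
      using False by (simp_all add: b_def complex_norm_square[symmetric] power2_eq_square mult.commute)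
    have "cnj b * K z y = cnj (b * K y z)" by (simp add: herm)
    then have "cnj b * K z y = - of_real (cmod (K y z))" by (simp add: bk)
    moreover obtain s' where "s' >= 0" "K y y + b * K y z + cnj b * K z y + cnj b * b * K z z = of_real s'"
      using pos by blast
    ultimately have "Re (K y y + - of_real (cmod (K y z)) + - of_real (cmod (K y z)) + K z z) >= 0"
      by (simp add: bb bk)
    then show ?thesis by simp
  qed
qed

lemma gns_form_sum:
  assumes x: "x \<in> fin_supp G" and y: "y \<in> fin_supp G"
  shows "gns_form \<phi> x y = (\<Sum>g\<in>{g. x g ~= 0}. \<Sum>h\<in>{h. y h ~= 0}. cnj (x g) * y h * \<phi> (inv g \<otimes> h))"
  unfolding gns_form_def lin_ext_convol[OF involution_in_fin_supp[OF x] y] lin_ext_involution[OF x]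
  unfolding lin_ext_def by (simp add: sum_distrib_left mult.assoc)

end

context invariant_character
begin

lemma H_one [simp]: "\<one> \<in> H"
  by (rule subgroup.one_closed[OF H_subgroup])

lemma H_mult [simp]: "[|h \<in> H; k \<in> H|] ==> h \<otimes> k \<in> H"
  by (rule subgroup.m_closed[OF H_subgroup])

lemma H_inv [simp]: "h \<in> H ==> inv h \<in> H"
  by (rule subgroup.m_inv_closed[OF H_subgroup])

definition Hrep :: "'g => 'g" where "Hrep y = (SOME k. k \<in> H #> y)"

lemma Hrep_mem: "y \<in> carrier G ==> Hrep y \<in> H #> y"
  unfolding Hrep_def by (rule someI[of _ y]) (rule rcos_self[OF _ H_subgroup])

lemma Hrep_in [simp]: "y \<in> carrier G ==> Hrep y \<in> carrier G"
  using Hrep_mem r_coset_subset_G[OF subgroup.subset[OF H_subgroup]] by blast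

lemma Hcoset_mult [simp]: "[|h \<in> H; y \<in> carrier G|] ==> H #> (h \<otimes> y) = H #> y"
  using repr_independence[of "h \<otimes> y" H y] H_subgroup by (simp add: rcosI subgroup.subset)

lemma Hrep_mult [simp]: "[|h \<in> H; y \<in> carrier G|] ==> Hrep (h \<otimes> y) = Hrep y"
  by (simp add: Hrep_def)

lemma Hcoset_Hrep [simp]: "y \<in> carrier G ==> H #> Hrep y = H #> y"
  using repr_independence[OF Hrep_mem _ H_subgroup, of y] by simp

lemma Hrep_Hrep [simp]:
  assumes "y \<in> carrier G" shows "Hrep (Hrep y) = Hrep y"
proof -
  have "Hrep (Hrep y) = (SOME k. k \<in> H #> Hrep y)" by (rule Hrep_def)
  also have "\<dots> = (SOME k. k \<in> H #> y)" by (simp only: Hcoset_Hrep[OF assms])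
  finally show ?thesis by (simp only: Hrep_def[symmetric])
qed

definition Hpart :: "'g => 'g" where "Hpart y = y \<otimes> inv (Hrep y)"

lemma Hpart_in [simp]: "y \<in> carrier G ==> Hpart y \<in> H"
proof -
  assume y: "y \<in> carrier G"
  obtain h where h: "h \<in> H" "Hrep y = h \<otimes> y" using Hrep_mem[OF y] unfolding r_coset_def by blast
  then have "Hpart y = inv h" using y by (simp add: Hpart_def inv_mult_group inv_cancel)
  then show ?thesis using h by simp
qed

lemma Hpart_mult: "[|h \<in> H; y \<in> carrier G|] ==> Hpart (h \<otimes> y) = h \<otimes> Hpart y"
  by (simp add: Hpart_def m_assoc)

lemma Hpart_Hrep: "y \<in> carrier G ==> Hpart y \<otimes> Hrep y = y"
  by (simp add: Hpart_def m_assoc)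

definition transversal :: "'g set" where "transversal = Hrep ` carrier G"

lemma Hrep_in_transversal: "y \<in> carrier G ==> Hrep y \<in> transversal"
  unfolding transversal_def by (rule imageI)

lemma transversal_in [simp]: "r \<in> transversal ==> r \<in> carrier G"
  unfolding transversal_def by (erule imageE) simp

lemma Hrep_transversal [simp]: "r \<in> transversal ==> Hrep r = r"
  unfolding transversal_def by (erule imageE) simp

lemma Hpart_transversal [simp]: "r \<in> transversal ==> Hpart r = \<one>"
  by (simp add: Hpart_def)

lemma finite_transversal: "finite transversal"
proof -
  have "transversal \<subseteq> (\<lambda>C. SOME k. k \<in> C) ` (rcosets H)"
    unfolding transversal_def
  proof (rule image_subsetI)
    fix y assume "y \<in> carrier G"
    then have "H #> y \<in> rcosets H" by (rule rcosetsI[OF subgroup.subset[OF H_subgroup]])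
    then show "Hrep y \<in> (\<lambda>C. SOME k. k \<in> C) ` (rcosets H)"
      unfolding Hrep_def by (rule imageI)
  qed
  then show ?thesis using H_finite_index by (meson finite_imageI finite_subset)
qed

lemma sum_transversal_translate:
  assumes f: "\<And>h y. [|h \<in> H; y \<in> carrier G|] ==> f (h \<otimes> y) = f y" and g: "g \<in> carrier G"
  shows "(\<Sum>r\<in>transversal. f (r \<otimes> g)) = (\<Sum>r\<in>transversal. f r)"
proof -
  have inj: "inj_on (\<lambda>r. Hrep (r \<otimes> g)) transversal"
  proof (rule inj_onI)
    fix r r' assume r: "r \<in> transversal" "r' \<in> transversal" and eq: "Hrep (r \<otimes> g) = Hrep (r' \<otimes> g)"
    have "r \<otimes> g = Hpart (r \<otimes> g) \<otimes> Hrep (r' \<otimes> g)"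
      using Hpart_Hrep[of "r \<otimes> g"] r g eq by simp
    also have "Hrep (r' \<otimes> g) = inv (Hpart (r' \<otimes> g)) \<otimes> (r' \<otimes> g)"
      using inv_cancel(1)[of "Hpart (r' \<otimes> g)" "Hrep (r' \<otimes> g)"] Hpart_Hrep[of "r' \<otimes> g"] r g by simp
    finally have "r \<otimes> g = Hpart (r \<otimes> g) \<otimes> (inv (Hpart (r' \<otimes> g)) \<otimes> (r' \<otimes> g))" .
    moreover have "Hpart (r \<otimes> g) \<otimes> (inv (Hpart (r' \<otimes> g)) \<otimes> (r' \<otimes> g))
        = (Hpart (r \<otimes> g) \<otimes> inv (Hpart (r' \<otimes> g)) \<otimes> r') \<otimes> g"
      using r g by (simp add: m_assoc)
    ultimately have rg: "r \<otimes> g = (Hpart (r \<otimes> g) \<otimes> inv (Hpart (r' \<otimes> g)) \<otimes> r') \<otimes> g"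
      by (rule trans)
    have eq1: "r = Hpart (r \<otimes> g) \<otimes> inv (Hpart (r' \<otimes> g)) \<otimes> r'"
      by (rule iffD1[OF right_cancel rg]) (use r g in simp_all)
    have eq2: "Hrep (Hpart (r \<otimes> g) \<otimes> inv (Hpart (r' \<otimes> g)) \<otimes> r') = Hrep r'"
      using r g by (intro Hrep_mult) simp_all
    have "Hrep r = Hrep r'" by (rule trans[OF arg_cong[OF eq1, where f = Hrep] eq2])
    then show "r = r'" using r by simp
  qed
  have "(\<lambda>r. Hrep (r \<otimes> g)) ` transversal \<subseteq> transversal"
    using g by (intro image_subsetI Hrep_in_transversal) simp
  then have bij: "bij_betw (\<lambda>r. Hrep (r \<otimes> g)) transversal transversal"
    using endo_inj_surj[OF finite_transversal _ inj] inj by (simp add: bij_betw_def)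
  have fH: "f (Hrep y) = f y" if "y \<in> carrier G" for y
    using f[of "Hpart y" "Hrep y"] Hpart_Hrep[OF that] that by simp
  have "(\<Sum>r\<in>transversal. f (r \<otimes> g)) = (\<Sum>r\<in>transversal. f (Hrep (r \<otimes> g)))"
    using fH g by (intro sum.cong refl) simp
  also have "\<dots> = (\<Sum>r\<in>transversal. f r)"
    using sum.reindex_bij_betw[OF bij, of f] .
  finally show ?thesis .
qed

text \<open>
  Kernels \<open>K y z = \<langle>F y, F z\<rangle>\<close> of unit vectors \<open>F\<close> in representations of \<open>G\<close> by right translation on
  functions with \<open>F (h y) = \<sigma> h (F y)\<close>, where \<open>\<sigma>\<close> is a unitary representation of \<open>H\<close> in which \<open>A\<close>
  acts by the character \<open>cis (t * \<psi> a)\<close>.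
\<close>

definition induced_kernel :: "real => ('g => 'g => complex) => bool" where
  "induced_kernel t K \<longleftrightarrow> positive_kernel K \<and>
     (\<forall>h\<in>H. \<forall>y\<in>carrier G. \<forall>z\<in>carrier G. K (h \<otimes> y) (h \<otimes> z) = K y z) \<and>
     (\<forall>a\<in>A. \<forall>y\<in>carrier G. \<forall>z\<in>carrier G. K y (a \<otimes> z) = cis (t * \<psi> a) * K y z) \<and>
     (\<Sum>r\<in>transversal. K r r) = 1"

definition kernel_state :: "('g => 'g => complex) => 'g => complex" where
  "kernel_state K g = (\<Sum>r\<in>transversal. K r (r \<otimes> g))"

definition induced_states :: "real => ('g => complex) set" where
  "induced_states t = kernel_state ` {K. induced_kernel t K}"

lemma induced_kernelD:
  assumes "induced_kernel t K"
  shows "positive_kernel K"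
    and "[|h \<in> H; y \<in> carrier G; z \<in> carrier G|] ==> K (h \<otimes> y) (h \<otimes> z) = K y z"
    and "[|a \<in> A; y \<in> carrier G; z \<in> carrier G|] ==> K y (a \<otimes> z) = cis (t * \<psi> a) * K y z"
    and "(\<Sum>r\<in>transversal. K r r) = 1"
proof -
  note D = assms[unfolded induced_kernel_def]
  show "positive_kernel K" by (rule conjunct1[OF D])
  show "K (h \<otimes> y) (h \<otimes> z) = K y z" if "h \<in> H" "y \<in> carrier G" "z \<in> carrier G"
    by (rule bspec[OF bspec[OF bspec[OF conjunct1[OF conjunct2[OF D]] that(1)] that(2)] that(3)])
  show "K y (a \<otimes> z) = cis (t * \<psi> a) * K y z" if "a \<in> A" "y \<in> carrier G" "z \<in> carrier G"
    by (rule bspec[OF bspec[OF bspec[OF conjunct1[OF conjunct2[OF conjunct2[OF D]]] that(1)] that(2)] that(3)])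
  show "(\<Sum>r\<in>transversal. K r r) = 1" by (rule conjunct2[OF conjunct2[OF conjunct2[OF D]]])
qed

lemma sum_kernel_translate:
  assumes K: "induced_kernel t K" and "g \<in> carrier G" "h \<in> carrier G"
  shows "(\<Sum>r\<in>transversal. K (r \<otimes> g) (r \<otimes> h)) = kernel_state K (inv g \<otimes> h)"
proof -
  have "(\<Sum>r\<in>transversal. K (r \<otimes> g) (r \<otimes> g \<otimes> (inv g \<otimes> h))) = (\<Sum>r\<in>transversal. K r (r \<otimes> (inv g \<otimes> h)))"
    by (rule sum_transversal_translate[where f = "\<lambda>y. K y (y \<otimes> (inv g \<otimes> h))"])
      (use assms induced_kernelD(2)[OF K] in \<open>simp_all add: m_assoc\<close>)
  moreover have "r \<otimes> g \<otimes> (inv g \<otimes> h) = r \<otimes> h" if "r \<in> transversal" for r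
    using that assms by (simp add: m_assoc inv_cancel)
  ultimately show ?thesis by (simp add: kernel_state_def)
qed

lemma gns_form_kernel_state:
  assumes K: "induced_kernel t K" and x: "x \<in> fin_supp G" and y: "y \<in> fin_supp G"
  shows "gns_form (kernel_state K) x y = (\<Sum>r\<in>transversal. \<Sum>g\<in>{g. x g ~= 0}. \<Sum>h\<in>{h. y h ~= 0}.
     cnj (x g) * y h * K (r \<otimes> g) (r \<otimes> h))"
proof -
  have "gns_form (kernel_state K) x y = (\<Sum>g\<in>{g. x g ~= 0}. \<Sum>h\<in>{h. y h ~= 0}.
     \<Sum>r\<in>transversal. cnj (x g) * y h * K (r \<otimes> g) (r \<otimes> h))"
    unfolding gns_form_sum[OF x y]
  proof (intro sum.cong refl)
    fix g h assume "g \<in> {g. x g ~= 0}" "h \<in> {h. y h ~= 0}"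
    then have gh: "g \<in> carrier G" "h \<in> carrier G" using fin_suppD(2)[OF x] fin_suppD(2)[OF y] by blast+
    show "cnj (x g) * y h * kernel_state K (inv g \<otimes> h)
        = (\<Sum>r\<in>transversal. cnj (x g) * y h * K (r \<otimes> g) (r \<otimes> h))"
      unfolding sum_kernel_translate[OF K gh, symmetric] by (rule sum_distrib_left)
  qed
  also have "\<dots> = (\<Sum>g\<in>{g. x g ~= 0}. \<Sum>r\<in>transversal. \<Sum>h\<in>{h. y h ~= 0}.
     cnj (x g) * y h * K (r \<otimes> g) (r \<otimes> h))"
    by (intro sum.cong refl sum.swap)
  also have "\<dots> = (\<Sum>r\<in>transversal. \<Sum>g\<in>{g. x g ~= 0}. \<Sum>h\<in>{h. y h ~= 0}.
     cnj (x g) * y h * K (r \<otimes> g) (r \<otimes> h))"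
    by (rule sum.swap)
  finally show ?thesis .
qed

lemma positive_functional_kernel_state:
  assumes K: "induced_kernel t K"
  shows "positive_functional (kernel_state K)"
  unfolding positive_functional_def
proof (intro conjI ballI)
  show "kernel_state K \<one> = 1" using induced_kernelD(4)[OF K] by (simp add: kernel_state_def)
  fix x assume x: "x \<in> fin_supp G"
  define T where "T = (\<lambda>r. \<Sum>g\<in>{g. x g ~= 0}. \<Sum>h\<in>{h. x h ~= 0}. cnj (x g) * x h * K (r \<otimes> g) (r \<otimes> h))"
  have T: "0 <= Re (T r) \<and> Im (T r) = 0" if r: "r \<in> transversal" for r
  proof -
    have "\<exists>s\<ge>0. T r = of_real s"
      unfolding T_def
      by (rule positive_kernel_family[OF induced_kernelD(1)[OF K] fin_suppD(1)[OF x]])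
        (use fin_suppD(2)[OF x] r in \<open>simp add: subset_iff\<close>)
    then show ?thesis by auto
  qed
  have form: "gns_form (kernel_state K) x x = (\<Sum>r\<in>transversal. T r)"
    unfolding gns_form_kernel_state[OF K x x] T_def ..
  show "0 <= Re (gns_form (kernel_state K) x x)"
    unfolding form Re_sum by (intro sum_nonneg) (simp add: T)
  show "Im (gns_form (kernel_state K) x x) = 0"
    unfolding form Im_sum by (intro sum.neutral) (simp add: T)
qed

text \<open>Vector states: the translates of \<open>F\<close> are combined with the coefficients of \<open>c\<close>.\<close>

lemma induced_states_vector:
  assumes K: "induced_kernel t K" and c: "c \<in> fin_supp G" and nz: "gns_norm (kernel_state K) c ~= 0"
  shows "\<exists>\<phi>'\<in>induced_states t. \<forall>x\<in>fin_supp G.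
    gns_norm \<phi>' x = gns_norm (kernel_state K) (convol G x c) / gns_norm (kernel_state K) c"
proof -
  note pos = positive_functional_kernel_state[OF K]
  define \<beta> where "\<beta> = (gns_norm (kernel_state K) c)\<^sup>2"
  have \<beta>: "\<beta> > 0" using nz by (simp add: \<beta>_def)
  define X where "X = {g. c g ~= 0}"
  have X: "finite X" "X \<subseteq> carrier G" using fin_suppD[OF c] by (simp_all add: X_def)
  have XG: "a \<in> X ==> a \<in> carrier G" for a using X by blast
  define K' where "K' = (\<lambda>y z. of_real (1 / \<beta>) * (\<Sum>a\<in>X. \<Sum>b\<in>X. cnj (c a) * c b * K (y \<otimes> a) (z \<otimes> b)))"
  have "induced_kernel t K'"
    unfolding induced_kernel_def
  proof (intro conjI ballI)
    show "positive_kernel K'"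
      unfolding positive_kernel_def
    proof (intro allI impI)
      fix Y and d :: "'g => complex" assume Y: "finite Y \<and> Y \<subseteq> carrier G"
      have "\<exists>s\<ge>0. (\<Sum>i\<in>Y \<times> X. \<Sum>j\<in>Y \<times> X. cnj (d (fst i) * c (snd i)) * (d (fst j) * c (snd j))
          * K (fst i \<otimes> snd i) (fst j \<otimes> snd j)) = of_real s"
        by (rule positive_kernel_family[OF induced_kernelD(1)[OF K]]) (use X Y in \<open>auto simp: subset_iff\<close>)
      then obtain s where s: "s >= 0" "(\<Sum>i\<in>Y \<times> X. \<Sum>j\<in>Y \<times> X. cnj (d (fst i) * c (snd i)) * (d (fst j) * c (snd j))
          * K (fst i \<otimes> snd i) (fst j \<otimes> snd j)) = of_real s" by blast
      have "(\<Sum>y\<in>Y. \<Sum>z\<in>Y. cnj (d y) * d z * K' y z)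
        = of_real (1 / \<beta>) * (\<Sum>y\<in>Y. \<Sum>z\<in>Y. \<Sum>a\<in>X. \<Sum>b\<in>X. cnj (d y * c a) * (d z * c b) * K (y \<otimes> a) (z \<otimes> b))"
        unfolding K'_def sum_distrib_left by (intro sum.cong refl) (simp add: mult_ac)
      also have "(\<Sum>y\<in>Y. \<Sum>z\<in>Y. \<Sum>a\<in>X. \<Sum>b\<in>X. cnj (d y * c a) * (d z * c b) * K (y \<otimes> a) (z \<otimes> b))
        = (\<Sum>y\<in>Y. \<Sum>a\<in>X. \<Sum>z\<in>Y. \<Sum>b\<in>X. cnj (d y * c a) * (d z * c b) * K (y \<otimes> a) (z \<otimes> b))"
        by (intro sum.cong refl sum.swap)
      also have "\<dots> = of_real s"
      proof -
        have split: "(\<Sum>i\<in>Y \<times> X. k i) = (\<Sum>y\<in>Y. \<Sum>a\<in>X. k (y, a))" for k :: "'g \<times> 'g => complex"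
          by (simp add: sum.cartesian_product)
        show ?thesis unfolding s(2)[symmetric] split by simp
      qed
      finally show "\<exists>s\<ge>0. (\<Sum>y\<in>Y. \<Sum>z\<in>Y. cnj (d y) * d z * K' y z) = of_real s"
        using s(1) \<beta> by (intro exI[of _ "s / \<beta>"]) simp
    qed
  next
    fix h y z assume "h \<in> H" "y \<in> carrier G" "z \<in> carrier G"
    then show "K' (h \<otimes> y) (h \<otimes> z) = K' y z"
      using XG induced_kernelD(2)[OF K] unfolding K'_def
      by (intro arg_cong2[where f = "(*)"] sum.cong refl) (simp add: m_assoc)
  next
    fix a y z assume "a \<in> A" "y \<in> carrier G" "z \<in> carrier G"
    then show "K' y (a \<otimes> z) = cis (t * \<psi> a) * K' y z"
      using XG induced_kernelD(3)[OF K] unfolding K'_def sum_distrib_left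
      by (intro sum.cong refl) (simp add: m_assoc)
  next
    have "(\<Sum>r\<in>transversal. K' r r) = of_real (1 / \<beta>) * gns_form (kernel_state K) c c"
      unfolding K'_def sum_distrib_left[symmetric] gns_form_kernel_state[OF K c c] X_def ..
    then show "(\<Sum>r\<in>transversal. K' r r) = 1"
      using \<beta> by (simp add: gns_form_self[OF pos c] \<beta>_def)
  qed
  then have mem: "kernel_state K' \<in> induced_states t" by (simp add: induced_states_def)
  have state: "kernel_state K' g = of_real (1 / \<beta>) *
      (\<Sum>a\<in>X. \<Sum>b\<in>X. cnj (c a) * c b * kernel_state K (inv a \<otimes> (g \<otimes> b)))" if g: "g \<in> carrier G" for g
  proof -
    have "kernel_state K' g = of_real (1 / \<beta>) *
        (\<Sum>r\<in>transversal. \<Sum>a\<in>X. \<Sum>b\<in>X. cnj (c a) * c b * K (r \<otimes> a) (r \<otimes> (g \<otimes> b)))"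
      unfolding kernel_state_def K'_def sum_distrib_left
      by (intro sum.cong refl) (use XG g in \<open>simp add: m_assoc\<close>)
    also have "(\<Sum>r\<in>transversal. \<Sum>a\<in>X. \<Sum>b\<in>X. cnj (c a) * c b * K (r \<otimes> a) (r \<otimes> (g \<otimes> b)))
      = (\<Sum>a\<in>X. \<Sum>r\<in>transversal. \<Sum>b\<in>X. cnj (c a) * c b * K (r \<otimes> a) (r \<otimes> (g \<otimes> b)))"
      by (rule sum.swap)
    also have "\<dots> = (\<Sum>a\<in>X. \<Sum>b\<in>X. \<Sum>r\<in>transversal. cnj (c a) * c b * K (r \<otimes> a) (r \<otimes> (g \<otimes> b)))"
      by (intro sum.cong refl sum.swap)
    also have "\<dots> = (\<Sum>a\<in>X. \<Sum>b\<in>X. cnj (c a) * c b * kernel_state K (inv a \<otimes> (g \<otimes> b)))"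
    proof (intro sum.cong refl)
      fix a b assume "a \<in> X" "b \<in> X"
      then show "(\<Sum>r\<in>transversal. cnj (c a) * c b * K (r \<otimes> a) (r \<otimes> (g \<otimes> b)))
          = cnj (c a) * c b * kernel_state K (inv a \<otimes> (g \<otimes> b))"
        unfolding sum_distrib_left[symmetric] using XG g by (subst sum_kernel_translate[OF K]) simp_all
    qed
    finally show ?thesis .
  qed
  have lin: "lin_ext (kernel_state K') z
      = of_real (1 / \<beta>) * lin_ext (kernel_state K) (convol G (involution G c) (convol G z c))"
    if z: "z \<in> fin_supp G" for z
  proof -
    have "lin_ext (kernel_state K) (convol G (involution G c) (convol G z c))
      = cnj (lin_ext (\<lambda>a. cnj (lin_ext (\<lambda>g. lin_ext (\<lambda>b. kernel_state K (inv a \<otimes> (g \<otimes> b))) c) z)) c)"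
      using z c by (simp add: lin_ext_convol lin_ext_involution)
    also have "\<dots> = (\<Sum>a\<in>X. \<Sum>g\<in>{g. z g ~= 0}. \<Sum>b\<in>X. cnj (c a) * (z g * (c b * kernel_state K (inv a \<otimes> (g \<otimes> b)))))"
      unfolding lin_ext_def X_def[symmetric] by (simp add: sum_distrib_left)
    also have "\<dots> = (\<Sum>g\<in>{g. z g ~= 0}. \<Sum>a\<in>X. \<Sum>b\<in>X. cnj (c a) * (z g * (c b * kernel_state K (inv a \<otimes> (g \<otimes> b)))))"
      by (rule sum.swap)
    also have "\<dots> = (\<Sum>g\<in>{g. z g ~= 0}. z g * (\<Sum>a\<in>X. \<Sum>b\<in>X. cnj (c a) * c b * kernel_state K (inv a \<otimes> (g \<otimes> b))))"
      unfolding sum_distrib_left by (intro sum.cong refl) (simp add: mult_ac)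
    finally have "of_real (1 / \<beta>) * lin_ext (kernel_state K) (convol G (involution G c) (convol G z c))
      = (\<Sum>g\<in>{g. z g ~= 0}. z g * (of_real (1 / \<beta>) * (\<Sum>a\<in>X. \<Sum>b\<in>X. cnj (c a) * c b * kernel_state K (inv a \<otimes> (g \<otimes> b)))))"
      by (simp add: sum_distrib_left mult.left_commute)
    also have "\<dots> = lin_ext (kernel_state K') z"
      unfolding lin_ext_def using fin_suppD(2)[OF z] by (intro sum.cong refl) (simp add: state subset_iff)
    finally show ?thesis by simp
  qed
  have "gns_norm (kernel_state K') x = gns_norm (kernel_state K) (convol G x c) / gns_norm (kernel_state K) c"
    if x: "x \<in> fin_supp G" for x
  proof -
    have "gns_form (kernel_state K') x x = of_real (1 / \<beta>) * gns_form (kernel_state K) (convol G x c) (convol G x c)"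
      unfolding gns_form_def using x c lin[of "convol G (involution G x) x"]
      by (simp add: involution_convol convol_assoc)
    then have "gns_norm (kernel_state K') x = sqrt (Re (gns_form (kernel_state K) (convol G x c) (convol G x c)) / \<beta>)"
      by (simp add: gns_norm_def)
    also have "\<dots> = gns_norm (kernel_state K) (convol G x c) / sqrt \<beta>"
      by (simp add: gns_norm_def real_sqrt_divide)
    also have "sqrt \<beta> = gns_norm (kernel_state K) c"
      using gns_norm_nonneg[OF pos c] by (simp add: \<beta>_def)
    finally show ?thesis .
  qed
  then show ?thesis using mem by blast
qed

text \<open>
  Multiplying a kernel by a covariant positive definite function moves it along the path of
  characters (Schur product).
\<close>

definition twist :: "('g => complex) => 'g => 'g => complex" where
  "twist u y z = u (inv (Hpart y) \<otimes> Hpart z)"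

lemma twist_invariant:
  assumes "h \<in> H" "y \<in> carrier G" "z \<in> carrier G"
  shows "twist u (h \<otimes> y) (h \<otimes> z) = twist u y z"
  using assms by (simp add: twist_def Hpart_mult inv_mult_group m_assoc inv_cancel)

lemma twist_covariant:
  assumes f: "probability_vector f" and a: "a \<in> A" and y: "y \<in> carrier G" and z: "z \<in> carrier G"
  shows "twist (coefficient f s) y (a \<otimes> z) = cis (s * \<psi> a) * twist (coefficient f s) y z"
proof -
  define h where "h = Hpart y"
  have h: "h \<in> H" using y by (simp add: h_def)
  have "inv h \<otimes> Hpart (a \<otimes> z) = (inv h \<otimes> a \<otimes> h) \<otimes> (inv h \<otimes> Hpart z)"
    using a z h A_H Hpart_mult[of a z] by (simp add: m_assoc inv_cancel subset_iff)
  moreover have "coefficient f s ((inv h \<otimes> a \<otimes> h) \<otimes> (inv h \<otimes> Hpart z))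
      = cis (s * \<psi> (inv h \<otimes> a \<otimes> h)) * coefficient f s (inv h \<otimes> Hpart z)"
    using a z h by (intro coefficient_mult[OF f] A_conj') simp_all
  ultimately show ?thesis using \<psi>_inv'[OF h a] by (simp add: twist_def h_def)
qed

lemma twist_gram:
  assumes f: "probability_vector f" and Y: "finite Y" "Y \<subseteq> carrier G"
  obtains Z :: "'g set set" and w where "finite Z"
    "\<And>y z. [|y \<in> Y; z \<in> Y|] ==> twist (coefficient f s) y z = (\<Sum>D\<in>Z. cnj (w D y) * w D z)"
proof -
  have "finite (Hpart ` Y)" "Hpart ` Y \<subseteq> H" using Y by auto
  from coefficient_gram[OF f this, of s] obtain Z :: "'g set set" and w where Z: "finite Z"
    "\<forall>l\<in>Hpart ` Y. \<forall>l'\<in>Hpart ` Y. coefficient f s (inv l \<otimes> l') = (\<Sum>D\<in>Z. cnj (w D l) * w D l')"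
    by blast
  show thesis
  proof (rule that[OF Z(1), of "\<lambda>D y. w D (Hpart y)"])
    fix y z assume "y \<in> Y" "z \<in> Y"
    then show "twist (coefficient f s) y z = (\<Sum>D\<in>Z. cnj (w D (Hpart y)) * w D (Hpart z))"
      using Z(2) by (simp add: twist_def)
  qed
qed

lemma positive_kernel_twist:
  assumes f: "probability_vector f" and K: "positive_kernel K"
  shows "positive_kernel (\<lambda>y z. K y z * twist (coefficient f s) y z)"
  unfolding positive_kernel_def
proof (intro allI impI)
  fix Y and c :: "'g => complex" assume Y: "finite Y \<and> Y \<subseteq> carrier G"
  obtain Z :: "'g set set" and w where Z: "finite Z"
    "\<And>y z. [|y \<in> Y; z \<in> Y|] ==> twist (coefficient f s) y z = (\<Sum>D\<in>Z. cnj (w D y) * w D z)"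
    using twist_gram[OF f, of Y s] Y by blast
  define T where "T = (\<lambda>D. \<Sum>y\<in>Y. \<Sum>z\<in>Y. cnj (c y * w D y) * (c z * w D z) * K y z)"
  have T: "0 <= Re (T D) \<and> T D = of_real (Re (T D))" for D
  proof -
    have "\<exists>q\<ge>0. T D = of_real q"
      unfolding T_def using K[unfolded positive_kernel_def, rule_format, OF Y, of "\<lambda>y. c y * w D y"] .
    then show ?thesis by auto
  qed
  have "(\<Sum>y\<in>Y. \<Sum>z\<in>Y. cnj (c y) * c z * (K y z * twist (coefficient f s) y z))
      = (\<Sum>y\<in>Y. \<Sum>z\<in>Y. \<Sum>D\<in>Z. cnj (c y * w D y) * (c z * w D z) * K y z)"
    by (intro sum.cong refl) (simp add: Z(2) sum_distrib_left mult_ac)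
  also have "\<dots> = (\<Sum>y\<in>Y. \<Sum>D\<in>Z. \<Sum>z\<in>Y. cnj (c y * w D y) * (c z * w D z) * K y z)"
    by (intro sum.cong refl sum.swap)
  also have "\<dots> = (\<Sum>D\<in>Z. \<Sum>y\<in>Y. \<Sum>z\<in>Y. cnj (c y * w D y) * (c z * w D z) * K y z)"
    by (rule sum.swap)
  also have "\<dots> = (\<Sum>D\<in>Z. T D)" by (simp only: T_def)
  also have "\<dots> = of_real (\<Sum>D\<in>Z. Re (T D))"
    unfolding of_real_sum by (intro sum.cong refl conjunct2[OF T])
  finally show "\<exists>s'\<ge>0. (\<Sum>y\<in>Y. \<Sum>z\<in>Y. cnj (c y) * c z * (K y z * twist (coefficient f s) y z)) = of_real s'"
    by (intro exI[of _ "\<Sum>D\<in>Z. Re (T D)"] conjI sum_nonneg conjunct1[OF T])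
qed

lemma induced_kernel_twist:
  assumes f: "probability_vector f" and K: "induced_kernel t K"
  shows "induced_kernel (t + s) (\<lambda>y z. K y z * twist (coefficient f s) y z)"
  unfolding induced_kernel_def
proof (intro conjI ballI)
  show "positive_kernel (\<lambda>y z. K y z * twist (coefficient f s) y z)"
    by (rule positive_kernel_twist[OF f induced_kernelD(1)[OF K]])
  show "(\<Sum>r\<in>transversal. K r r * twist (coefficient f s) r r) = 1"
    using induced_kernelD(4)[OF K] by (simp add: twist_def coefficient_one[OF f])
next
  fix h y z assume "h \<in> H" "y \<in> carrier G" "z \<in> carrier G"
  then show "K (h \<otimes> y) (h \<otimes> z) * twist (coefficient f s) (h \<otimes> y) (h \<otimes> z)
      = K y z * twist (coefficient f s) y z"
    by (simp add: twist_invariant induced_kernelD(2)[OF K])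
next
  fix a y z assume "a \<in> A" "y \<in> carrier G" "z \<in> carrier G"
  then show "K y (a \<otimes> z) * twist (coefficient f s) y (a \<otimes> z)
      = cis ((t + s) * \<psi> a) * (K y z * twist (coefficient f s) y z)"
    by (simp add: twist_covariant[OF f] induced_kernelD(3)[OF K] distrib_right cis_mult[symmetric])
qed

lemma induced_kernel_coefficient:
  assumes f: "probability_vector f"
  shows "induced_kernel t (\<lambda>y z. of_real (1 / card transversal) * twist (coefficient f t) y z)"
  unfolding induced_kernel_def
proof (intro conjI ballI)
  have "positive_kernel (\<lambda>y z. of_real (1 / card transversal))"
    unfolding positive_kernel_def
  proof (intro allI impI)
    fix Y and c :: "'g => complex"
    define S where "S = (\<Sum>y\<in>Y. c y)"
    have cS: "cnj S = (\<Sum>y\<in>Y. cnj (c y))" by (simp add: S_def)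
    have prod: "(\<Sum>y\<in>Y. \<Sum>z\<in>Y. cnj (c y) * c z * k) = cnj S * S * k" for k
    proof -
      have "(\<Sum>y\<in>Y. \<Sum>z\<in>Y. cnj (c y) * c z * k) = (\<Sum>y\<in>Y. \<Sum>z\<in>Y. cnj (c y) * c z) * k"
        by (simp only: sum_distrib_right)
      then show ?thesis unfolding cS by (simp only: S_def sum_product)
    qed
    have "(\<Sum>y\<in>Y. \<Sum>z\<in>Y. cnj (c y) * c z * of_real (1 / card transversal))
        = cnj S * S * of_real (1 / card transversal)" by (rule prod)
    also have "cnj S * S = of_real ((cmod S)\<^sup>2)"
      unfolding complex_norm_square by (rule mult.commute)
    also have "of_real ((cmod S)\<^sup>2) * complex_of_real (1 / card transversal)
        = of_real ((cmod S)\<^sup>2 * (1 / card transversal))" by (rule of_real_mult[symmetric])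
    finally show "\<exists>s\<ge>0. (\<Sum>y\<in>Y. \<Sum>z\<in>Y. cnj (c y) * c z * of_real (1 / card transversal)) = of_real s"
      by (rule exI[of _ "(cmod S)\<^sup>2 * (1 / card transversal)", OF conjI[rotated]]) simp
  qed
  then show "positive_kernel (\<lambda>y z. of_real (1 / card transversal) * twist (coefficient f t) y z)"
    by (rule positive_kernel_twist[OF f])
  have "Hrep \<one> \<in> transversal" by (rule Hrep_in_transversal[OF one_closed])
  then have "card transversal ~= 0" using finite_transversal by auto
  then show "(\<Sum>r\<in>transversal. of_real (1 / card transversal) * twist (coefficient f t) r r) = 1"
    by (simp add: twist_def coefficient_one[OF f])
qed (simp_all add: twist_invariant twist_covariant[OF f])

lemma state_set_induced_states: "state_set G (induced_states t)"
proof
  obtain f where "probability_vector f" using ex_probability_vector by blast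
  then show "induced_states t ~= {}" using induced_kernel_coefficient by (auto simp: induced_states_def)
  show "positive_functional \<phi>" if "\<phi> \<in> induced_states t" for \<phi>
    using that positive_functional_kernel_state by (auto simp: induced_states_def)
  show "\<exists>\<phi>'\<in>induced_states t. \<forall>x\<in>fin_supp G. gns_norm \<phi>' x = gns_norm \<phi> (convol G x c) / gns_norm \<phi> c"
    if "\<phi> \<in> induced_states t" "c \<in> fin_supp G" "gns_norm \<phi> c ~= 0" for \<phi> c
    using that induced_states_vector unfolding induced_states_def by blast
qed

lemma sum_kernel_offdiag_le:
  assumes K: "induced_kernel t K" and g: "g \<in> carrier G"
  shows "(\<Sum>r\<in>transversal. cmod (K r (r \<otimes> g))) <= 1"
proof -
  have "2 * (\<Sum>r\<in>transversal. cmod (K r (r \<otimes> g)))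
      <= (\<Sum>r\<in>transversal. Re (K r r) + Re (K (r \<otimes> g) (r \<otimes> g)))"
    unfolding sum_distrib_left
    by (intro sum_mono positive_kernel_offdiag[OF induced_kernelD(1)[OF K]]) (use g in simp_all)
  also have "\<dots> = Re (\<Sum>r\<in>transversal. K r r) + Re (\<Sum>r\<in>transversal. K (r \<otimes> g) (r \<otimes> g))"
    by (simp add: sum.distrib)
  also have "\<dots> = 2"
    using induced_kernelD(4)[OF K] positive_functional_kernel_state[OF K] g
    by (simp add: sum_kernel_translate[OF K] positive_functional_def)
  finally show ?thesis by simp
qed

lemma kernel_state_twist_close:
  assumes K: "induced_kernel t K" and g: "g \<in> carrier G"
    and near: "\<And>r. r \<in> transversal ==> cmod (u (Hpart (r \<otimes> g)) - 1) <= e"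
  shows "cmod (kernel_state (\<lambda>y z. K y z * twist u y z) g - kernel_state K g) <= e"
proof -
  have "Hrep \<one> \<in> transversal" by (rule Hrep_in_transversal[OF one_closed])
  then have e: "0 <= e" by (rule order_trans[OF norm_ge_zero near])
  have "kernel_state (\<lambda>y z. K y z * twist u y z) g - kernel_state K g
      = (\<Sum>r\<in>transversal. K r (r \<otimes> g) * (u (Hpart (r \<otimes> g)) - 1))"
    unfolding kernel_state_def sum_subtractf[symmetric]
    by (intro sum.cong refl) (use g in \<open>simp add: twist_def right_diff_distrib\<close>)
  also have "cmod \<dots> <= (\<Sum>r\<in>transversal. cmod (K r (r \<otimes> g)) * e)"
    by (rule sum_norm_le) (unfold norm_mult, intro mult_left_mono near norm_ge_zero)
  also have "\<dots> = (\<Sum>r\<in>transversal. cmod (K r (r \<otimes> g))) * e" by (rule sum_distrib_right[symmetric])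
  also have "\<dots> <= 1 * e" using e by (intro mult_right_mono sum_kernel_offdiag_le[OF K g])
  finally show ?thesis by simp
qed

text \<open>
  A state at \<open>t\<close> is twisted by the coefficient of an almost invariant vector.  The result is a state at
  \<open>t + s\<close>, and it is close because the coefficient is almost \<open>1\<close> on the finitely many group elements
  that occur in \<open>x\<close>.
\<close>

lemma induced_states_close:
  assumes am: "amenable G" and x: "x \<in> fin_supp G" and e: "e > 0"
  obtains \<delta> where "\<delta> > 0" "\<And>t s \<phi>. [|\<bar>s\<bar> < \<delta>; \<phi> \<in> induced_states t|] ==>
     \<exists>\<phi>'\<in>induced_states (t + s). cmod (lin_ext \<phi>' x - lin_ext \<phi> x) <= e"
proof -
  define X where "X = {g. x g ~= 0}"
  have X: "finite X" "X \<subseteq> carrier G" using fin_suppD[OF x] by (simp_all add: X_def)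
  define F where "F = (\<lambda>(r, g). Hpart (r \<otimes> g)) ` (transversal \<times> X)"
  define e' where "e' = e / (l1_norm x + 1)"
  have l1: "0 <= l1_norm x" by (simp add: l1_norm_def sum_nonneg)
  have e': "e' > 0" using e l1 by (simp add: e'_def)
  have F: "finite F" "F \<subseteq> carrier G" using X finite_transversal by (auto simp: F_def subset_iff)
  obtain f \<delta> where f: "probability_vector f" "\<delta> > 0"
    "\<And>s l. \<bar>s\<bar> < \<delta> ==> l \<in> F ==> cmod (coefficient f s l - 1) < e'"
    using ex_almost_invariant_vector[OF am F e'] by blast
  show thesis
  proof (rule that[OF f(2)])
    fix t s \<phi> assume s: "\<bar>s\<bar> < \<delta>" and "\<phi> \<in> induced_states t"
    then obtain K where K: "induced_kernel t K" "\<phi> = kernel_state K" by (auto simp: induced_states_def)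
    define \<phi>' where "\<phi>' = kernel_state (\<lambda>y z. K y z * twist (coefficient f s) y z)"
    have mem: "\<phi>' \<in> induced_states (t + s)"
      unfolding \<phi>'_def induced_states_def using induced_kernel_twist[OF f(1) K(1)] by blast
    have close: "cmod (\<phi>' g - \<phi> g) <= e'" if g: "g \<in> X" for g
      unfolding \<phi>'_def K(2)
    proof (rule kernel_state_twist_close[OF K(1)])
      show "g \<in> carrier G" using g X by blast
      fix r assume "r \<in> transversal"
      then have "Hpart (r \<otimes> g) \<in> F" unfolding F_def using g by force
      then show "cmod (coefficient f s (Hpart (r \<otimes> g)) - 1) <= e'" using f(3)[OF s] by (simp add: less_imp_le)
    qed
    have "lin_ext \<phi>' x - lin_ext \<phi> x = (\<Sum>g\<in>X. x g * (\<phi>' g - \<phi> g))"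
      unfolding lin_ext_def X_def[symmetric] by (simp add: right_diff_distrib sum_subtractf)
    also have "cmod \<dots> <= (\<Sum>g\<in>X. cmod (x g) * e')"
      by (rule sum_norm_le) (use close in \<open>simp add: norm_mult mult_left_mono\<close>)
    also have "\<dots> = l1_norm x * e'" by (simp add: l1_norm_def X_def sum_distrib_right)
    also have "\<dots> <= (l1_norm x + 1) * e'" using e' by simp
    also have "\<dots> = e" using l1 by (simp add: e'_def)
    finally show "\<exists>\<phi>'\<in>induced_states (t + s). cmod (lin_ext \<phi>' x - lin_ext \<phi> x) <= e"
      using mem by blast
  qed
qed

lemma continuous_induced_norm:
  assumes am: "amenable G" and x: "x \<in> fin_supp G"
  shows "continuous_on {0..1} (\<lambda>t. state_set.state_norm G (induced_states t) x)"
proof -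
  define q where "q = (\<lambda>t. state_set.state_norm G (induced_states t) x)"
  have q_nonneg: "0 <= q t" for t
    unfolding q_def by (rule state_set.state_norm_nonneg[OF state_set_induced_states x])
  define y where "y = convol G (involution G x) x"
  have y: "y \<in> fin_supp G" using x by (simp add: y_def)
  have "continuous_on {0..1} (\<lambda>t. (q t)\<^sup>2)"
    unfolding continuous_on_iff
  proof (intro ballI allI impI)
    fix t e :: real assume e: "0 < e"
    obtain \<delta> where \<delta>: "\<delta> > 0" "\<And>t s \<phi>. [|\<bar>s\<bar> < \<delta>; \<phi> \<in> induced_states t|] ==>
      \<exists>\<phi>'\<in>induced_states (t + s). cmod (lin_ext \<phi>' y - lin_ext \<phi> y) <= e / 2"
      using induced_states_close[OF am y half_gt_zero[OF e]] by blast
    have le: "(q t)\<^sup>2 <= (q t')\<^sup>2 + e / 2" if d: "\<bar>t' - t\<bar> < \<delta>" for t t'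
    proof -
      have "q t <= sqrt ((q t')\<^sup>2 + e / 2)"
        unfolding q_def
      proof (rule state_set.state_norm_le[OF state_set_induced_states])
        fix \<phi> assume \<phi>: "\<phi> \<in> induced_states t"
        obtain \<phi>' where \<phi>': "\<phi>' \<in> induced_states t'" "cmod (lin_ext \<phi>' y - lin_ext \<phi> y) <= e / 2"
          using \<delta>(2)[OF d \<phi>] by auto
        note p = state_set.S_positive[OF state_set_induced_states]
        have sq: "Re (lin_ext \<theta> y) = (gns_norm \<theta> x)\<^sup>2" if "\<theta> \<in> induced_states u" for \<theta> u
          using gns_form_self[OF p[OF that] x] by (simp add: gns_form_def y_def)
        have "(gns_norm \<phi> x)\<^sup>2 - (gns_norm \<phi>' x)\<^sup>2 <= e / 2"
          using complex_Re_le_cmod[of "lin_ext \<phi> y - lin_ext \<phi>' y"] \<phi>'(2)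
          by (simp add: sq[OF \<phi>] sq[OF \<phi>'(1)] norm_minus_commute)
        moreover have "(gns_norm \<phi>' x)\<^sup>2 <= (q t')\<^sup>2"
          unfolding q_def using state_set.gns_norm_le_state_norm[OF state_set_induced_states \<phi>'(1) x]
            gns_norm_nonneg[OF p[OF \<phi>'(1)] x] by (rule power_mono)
        ultimately show "gns_norm \<phi> x <= sqrt ((state_set.state_norm G (induced_states t') x)\<^sup>2 + e / 2)"
          unfolding q_def by (intro real_le_rsqrt) linarith
      qed
      then have "(q t)\<^sup>2 <= (sqrt ((q t')\<^sup>2 + e / 2))\<^sup>2" using q_nonneg by (rule power_mono)
      then show ?thesis using e by simp
    qed
    show "\<exists>d>0. \<forall>t'\<in>{0..1}. dist t' t < d --> dist ((q t')\<^sup>2) ((q t)\<^sup>2) < e"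
    proof (intro exI conjI ballI impI)
      fix t' assume "dist t' t < \<delta>"
      then have "\<bar>t' - t\<bar> < \<delta>" "\<bar>t - t'\<bar> < \<delta>" by (simp_all add: dist_real_def)
      from le[OF this(1)] le[OF this(2)] show "dist ((q t')\<^sup>2) ((q t)\<^sup>2) < e"
        using e unfolding dist_real_def by linarith
    qed (rule \<delta>(1))
  qed
  then have "continuous_on {0..1} (\<lambda>t. sqrt ((q t)\<^sup>2))" by (intro continuous_on_real_sqrt)
  then show ?thesis using q_nonneg by (simp add: q_def)
qed

text \<open>
  The element \<open>1 - z\<close> vanishes in the representations induced from the trivial character, but not in
  those induced from a character that is \<open>-1\<close> at \<open>z\<close>.
\<close>

lemma invariant_character_not_pi:
  assumes am: "amenable G" and rr0: "real_rank_zero (full_group_cstar_algebra G)"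
    and z: "z \<in> A" and z_pi: "\<psi> z = pi"
  shows False
proof -
  have zG: "z \<in> carrier G" using z by simp
  define y where "y = (\<lambda>x. delta \<one> x + (-1) * delta z x)"
  have dz: "delta z \<in> fin_supp G" and d1: "delta (one G) \<in> fin_supp G" using zG by simp_all
  have y: "y \<in> fin_supp G" unfolding y_def using zG by (intro add_in_fin_supp scale_in_fin_supp) simp_all
  define a where "a = convol G (involution G y) y"
  have a: "a \<in> fin_supp G" "involution G a = a"
    using y by (simp_all add: a_def involution_convol)
  have form: "Re (gns_form \<phi> y y) = 2 - 2 * Re (\<phi> z)" if p: "positive_functional \<phi>" for \<phi>
  proof -
    have one: "\<phi> \<one> = 1" using p by (simp add: positive_functional_def)
    have 1: "gns_form \<phi> (delta \<one>) (delta \<one>) = 1" "gns_form \<phi> (delta \<one>) (delta z) = \<phi> z"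
      "gns_form \<phi> (delta z) (delta z) = 1"
      using zG one by (simp_all add: gns_form_def involution_delta convol_delta)
    have 2: "gns_form \<phi> (delta z) (delta \<one>) = cnj (\<phi> z)"
      using gns_form_hermitian[OF p d1 dz] 1 by simp
    show ?thesis
      unfolding y_def gns_form_expand[OF p d1 dz] 1 2 by simp
  qed
  have at_z: "kernel_state K z = (\<Sum>r\<in>transversal. cis (t * \<psi> (r \<otimes> z \<otimes> inv r)) * K r r)"
    if K: "induced_kernel t K" for K t
    unfolding kernel_state_def
  proof (intro sum.cong refl)
    fix r assume r: "r \<in> transversal"
    have rz: "(r \<otimes> z \<otimes> inv r) \<otimes> r = r \<otimes> z" using r zG by (simp add: m_assoc)
    have "K r ((r \<otimes> z \<otimes> inv r) \<otimes> r) = cis (t * \<psi> (r \<otimes> z \<otimes> inv r)) * K r r"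
      by (rule induced_kernelD(3)[OF K A_conj[OF z]]) (use r in simp_all)
    then show "K r (r \<otimes> z) = cis (t * \<psi> (r \<otimes> z \<otimes> inv r)) * K r r" unfolding rz .
  qed
  define q where "q = (\<lambda>t. state_set.state_norm G (induced_states t))"
  have q_a: "q t a = (q t y)\<^sup>2" for t
    unfolding q_def a_def
    by (rule cstar_seminorm_star[OF state_set.cstar_seminorm_state_norm[OF state_set_induced_states] y])
  have "q 0 y <= 0"
    unfolding q_def
  proof (rule state_set.state_norm_le[OF state_set_induced_states])
    fix \<phi> assume "\<phi> \<in> induced_states 0"
    then obtain K where K: "induced_kernel 0 K" "\<phi> = kernel_state K" by (auto simp: induced_states_def)
    have "\<phi> z = 1" using at_z[OF K(1)] induced_kernelD(4)[OF K(1)] by (simp add: K(2))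
    then show "gns_norm \<phi> y <= 0"
      using form[OF positive_functional_kernel_state[OF K(1)]] by (simp add: gns_norm_def K(2))
  qed
  moreover have "0 <= q 0 y"
    unfolding q_def by (rule state_set.state_norm_nonneg[OF state_set_induced_states y])
  ultimately have "q 0 y = 0" by (rule antisym)
  then have q0: "q 0 a = 0" by (simp add: q_a)
  have q1: "q 1 a > 0"
  proof -
    obtain f where f: "probability_vector f" using ex_probability_vector by blast
    define K where "K = (\<lambda>y z. of_real (1 / card transversal) * twist (coefficient f 1) y z)"
    have K: "induced_kernel 1 K" unfolding K_def by (rule induced_kernel_coefficient[OF f])
    have Krr: "K r r = of_real (1 / card transversal)" if "r \<in> transversal" for r
      using that by (simp add: K_def twist_def coefficient_one[OF f])
    have r1: "Hrep \<one> \<in> transversal" by (rule Hrep_in_transversal[OF one_closed])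
    have "transversal ~= {}" using r1 by blast
    then have card: "card transversal > 0" using finite_transversal by (simp add: card_gt_0_iff)
    have "Hrep \<one> \<in> H"
      using Hrep_mem[of \<one>] by (simp add: coset_mult_one subgroup.subset[OF H_subgroup])
    then have pi1: "\<psi> (Hrep \<one> \<otimes> z \<otimes> inv (Hrep \<one>)) = pi" using \<psi>_inv[OF _ z] z_pi by simp
    have "Re (kernel_state K z) = (\<Sum>r\<in>transversal. cos (\<psi> (r \<otimes> z \<otimes> inv r)) / card transversal)"
      unfolding at_z[OF K] Re_sum by (intro sum.cong refl) (simp add: Krr)
    also have "\<dots> < (\<Sum>r\<in>transversal. 1 / card transversal)"
    proof (rule sum_strict_mono_ex1[OF finite_transversal])
      show "\<forall>r\<in>transversal. cos (\<psi> (r \<otimes> z \<otimes> inv r)) / card transversal <= 1 / card transversal"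
        by (simp add: divide_right_mono)
      show "\<exists>r\<in>transversal. cos (\<psi> (r \<otimes> z \<otimes> inv r)) / card transversal < 1 / card transversal"
        using r1 card by (intro bexI[of _ "Hrep \<one>"]) (simp_all add: pi1 divide_strict_right_mono)
    qed
    also have "\<dots> = 1" using card by simp
    finally have "Re (gns_form (kernel_state K) y y) > 0"
      using form[OF positive_functional_kernel_state[OF K]] by simp
    then have "gns_norm (kernel_state K) y > 0" by (simp add: gns_norm_def)
    moreover have "gns_norm (kernel_state K) y <= q 1 y"
      unfolding q_def
      by (rule state_set.gns_norm_le_state_norm[OF state_set_induced_states _ y])
        (unfold induced_states_def, intro imageI CollectI K)
    ultimately show ?thesis by (simp add: q_a)
  qed
  have "q 0 a = q 1 a"
    unfolding q_def
    by (rule real_rank_zero_constant_state_norm[OF rr0 state_set_induced_states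
        continuous_induced_norm[OF am] a])
  then show False using q0 q1 by simp
qed

end

text \<open>
  Real rank zero leaves no room for invariant characters: rescaling a nontrivial one would produce a
  path of seminorms as above.
\<close>

theorem (in group) real_rank_zero_invariant_character:
  assumes am: "amenable G" and rr0: "real_rank_zero (full_group_cstar_algebra G)"
    and A: "A \<lhd> G" and H: "subgroup H G" "finite (rcosets H)" "A \<subseteq> H"
    and \<psi>_hom: "\<And>a b. [|a \<in> A; b \<in> A|] ==> \<psi> (a \<otimes> b) = \<psi> a + (\<psi> b :: real)"
    and \<psi>_inv: "\<And>h a. [|h \<in> H; a \<in> A|] ==> \<psi> (h \<otimes> a \<otimes> inv h) = \<psi> a"
    and z: "z \<in> A"
  shows "\<psi> z = 0"
proof (rule ccontr)
  assume nz: "\<psi> z ~= 0"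
  have "invariant_character G A H (\<lambda>a. pi / \<psi> z * \<psi> a)"
    unfolding invariant_character_def invariant_character_axioms_def
    using A H \<psi>_hom \<psi>_inv is_group by (simp add: distrib_left)
  from invariant_character.invariant_character_not_pi[OF this am rr0 z] show False using nz by simp
qed

section \<open>Subgroups of finite index\<close>

definition finite_index :: "('g, 'm) monoid_scheme => 'g set => bool" where
  "finite_index G H \<longleftrightarrow> subgroup H G \<and> finite (rcosets\<^bsub>G\<^esub> H)"

text \<open>
  The condition on \<open>G\<close> that real rank zero will provide, and the only one that the linear part of the
  argument uses besides amenability.
\<close>

definition rigid :: "('g, 'm) monoid_scheme => bool" where
  "rigid G \<longleftrightarrow> (\<forall>H \<theta>. finite_index G H \<longrightarrow>
     (\<forall>g\<in>H. \<forall>h\<in>H. \<theta> (g \<otimes>\<^bsub>G\<^esub> h) = \<theta> g + (\<theta> h :: real)) --> (\<forall>g\<in>H. \<theta> g = 0))"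

lemma rigidD:
  assumes "rigid G" "finite_index G H" "\<And>g h. [|g \<in> H; h \<in> H|] ==> \<theta> (g \<otimes>\<^bsub>G\<^esub> h) = \<theta> g + (\<theta> h :: real)"
    "g \<in> H"
  shows "\<theta> g = 0"
proof -
  have "\<forall>g\<in>H. \<forall>h\<in>H. \<theta> (g \<otimes>\<^bsub>G\<^esub> h) = \<theta> g + \<theta> h" by (intro ballI assms(3))
  from assms(1)[unfolded rigid_def, rule_format, OF assms(2) _ assms(4), of \<theta>] this
  show ?thesis by simp
qed

context group
begin

lemma finite_indexD:
  assumes "finite_index G H"
  shows "subgroup H G" "finite (rcosets H)" "h \<in> H ==> h \<in> carrier G"
proof -
  note D = assms[unfolded finite_index_def]
  show "subgroup H G" by (rule conjunct1[OF D])
  show "finite (rcosets H)" by (rule conjunct2[OF D])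
  show "h \<in> carrier G" if "h \<in> H" by (rule subgroup.mem_carrier[OF conjunct1[OF D] that])
qed

lemma finite_indexI:
  assumes H: "subgroup H G" and fin: "finite (f ` carrier G)"
    and sep: "\<And>x y. [|x \<in> carrier G; y \<in> carrier G; f x = f y|] ==> x \<otimes> inv y \<in> H"
  shows "finite_index G H"
proof -
  define pick where "pick = (\<lambda>v. SOME x. x \<in> carrier G \<and> f x = v)"
  have "rcosets H \<subseteq> (\<lambda>v. H #> pick v) ` f ` carrier G"
  proof
    fix C assume "C \<in> rcosets H"
    then obtain x where x: "x \<in> carrier G" "C = H #> x" unfolding RCOSETS_def by blast
    have p: "pick (f x) \<in> carrier G \<and> f (pick (f x)) = f x"
      unfolding pick_def by (rule someI[of _ x]) (use x in simp)
    then have "pick (f x) \<otimes> inv x \<in> H" using x by (intro sep) simp_all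
    then have "(pick (f x) \<otimes> inv x) \<otimes> x \<in> H #> x"
      using x(1) by (intro rcosI subgroup.subset[OF H])
    then have "pick (f x) \<in> H #> x" using p x(1) by (simp add: m_assoc)
    then have "H #> x = H #> pick (f x)" by (rule repr_independence[OF _ x(1) H])
    then show "C \<in> (\<lambda>v. H #> pick v) ` f ` carrier G" unfolding x(2) using x(1) by (intro image_eqI) simp_all
  qed
  then have "finite (rcosets H)" using fin by (meson finite_imageI finite_subset)
  then show ?thesis using H by (simp add: finite_index_def)
qed

lemma coset_eq_imp:
  assumes "subgroup H G" "x \<in> carrier G" "y \<in> carrier G" "H #> x = H #> y"
  shows "x \<otimes> inv y \<in> H"
proof -
  have "x \<in> H #> y" using rcos_self[OF assms(2,1)] assms(4) by simp
  then obtain h where h: "h \<in> H" "x = h \<otimes> y" unfolding r_coset_def by blast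
  have "h \<otimes> y \<otimes> inv y = h" using subgroup.mem_carrier[OF assms(1) h(1)] assms(3) by (simp add: m_assoc)
  then show ?thesis unfolding h(2) using h(1) by simp
qed

lemma finite_coset_image:
  assumes "finite_index G H" shows "finite ((\<lambda>x. H #> x) ` carrier G)"
proof -
  have "(\<lambda>x. H #> x) ` carrier G = rcosets H" unfolding RCOSETS_def by blast
  then show ?thesis using assms by (simp add: finite_index_def)
qed

lemma finite_index_carrier: "finite_index G (carrier G)"
  by (rule finite_indexI[OF subgroup_self, of "\<lambda>_. ()"]) simp_all

text \<open>A left \<open>H\<close>-equivariant retraction of \<open>G\<close> onto \<open>H\<close>.\<close>

definition equivariant_part :: "'a set => 'a => 'a" where
  "equivariant_part H x = x \<otimes> inv (SOME k. k \<in> H #> x)"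

lemma equivariant_part:
  assumes H: "subgroup H G" and x: "x \<in> carrier G"
  shows "equivariant_part H x \<in> H" "h \<in> H ==> equivariant_part H (h \<otimes> x) = h \<otimes> equivariant_part H x"
proof -
  define r where "r = (\<lambda>x. SOME k. k \<in> H #> x)"
  have r_eq: "(SOME k. k \<in> H #> x) = r x" for x by (simp add: r_def)
  have r: "r x \<in> H #> x" unfolding r_def by (rule someI[of _ x]) (rule rcos_self[OF x H])
  then have rG: "r x \<in> carrier G" using r_coset_subset_G[OF subgroup.subset[OF H] x] by blast
  have "H #> x = H #> r x" by (rule repr_independence[OF r x H])
  then show "equivariant_part H x \<in> H"
    unfolding equivariant_part_def r_eq by (rule coset_eq_imp[OF H x rG])
  assume h: "h \<in> H"
  have hG: "h \<in> carrier G" by (rule subgroup.mem_carrier[OF H h])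
  have "H #> x = H #> (h \<otimes> x)"
    by (rule repr_independence[OF rcosI[OF h subgroup.subset[OF H] x] x H])
  then have "r (h \<otimes> x) = r x" by (simp add: r_def)
  then show "equivariant_part H (h \<otimes> x) = h \<otimes> equivariant_part H x"
    unfolding equivariant_part_def r_eq using hG x rG by (simp add: m_assoc)
qed

lemma finite_index_within:
  assumes H: "finite_index G H" and K: "subgroup K G" "K \<subseteq> H" and fin: "finite (f ` H)"
    and sep: "\<And>x y. [|x \<in> H; y \<in> H; f x = f y|] ==> x \<otimes> inv y \<in> K"
  shows "finite_index G K"
proof (rule finite_indexI[OF K(1), of "\<lambda>x. (H #> x, f (equivariant_part H x))"])
  note sH = finite_indexD(1)[OF H]
  have "(\<lambda>x. (H #> x, f (equivariant_part H x))) ` carrier G \<subseteq> ((\<lambda>x. H #> x) ` carrier G) \<times> (f ` H)"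
    using equivariant_part(1)[OF sH] by (intro image_subsetI SigmaI imageI)
  then show "finite ((\<lambda>x. (H #> x, f (equivariant_part H x))) ` carrier G)"
    by (rule finite_subset) (intro finite_cartesian_product finite_coset_image[OF H] fin)
  fix x y assume x: "x \<in> carrier G" and y: "y \<in> carrier G"
    and eq: "(H #> x, f (equivariant_part H x)) = (H #> y, f (equivariant_part H y))"
  define r where "r = (SOME k. k \<in> H #> x)"
  have rx: "r \<in> H #> x" unfolding r_def by (rule someI[of _ x]) (rule rcos_self[OF x sH])
  have rG: "r \<in> carrier G" using rx r_coset_subset_G[OF subgroup.subset[OF sH] x] by blast
  have cx: "equivariant_part H x = x \<otimes> inv r" and cy: "equivariant_part H y = y \<otimes> inv r"
    using eq by (simp_all add: equivariant_part_def r_def)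
  have "equivariant_part H x \<otimes> inv (equivariant_part H y) \<in> K"
    using eq equivariant_part(1)[OF sH] x y by (intro sep) simp_all
  moreover have "(x \<otimes> inv r) \<otimes> inv (y \<otimes> inv r) = x \<otimes> inv y"
    using x y rG by (simp add: inv_mult_group m_assoc) (simp add: m_assoc[symmetric])
  ultimately show "x \<otimes> inv y \<in> K" unfolding cx cy by simp
qed

lemma subgroup_of_subgroup:
  assumes H: "subgroup H G" and K: "subgroup K (G\<lparr>carrier := H\<rparr>)"
  shows "subgroup K G" "K \<subseteq> H"
  using incl_subgroup[OF H K] subgroup.subset[OF K] by simp_all

lemma finite_index_trans:
  assumes H: "finite_index G H" and K: "finite_index (G\<lparr>carrier := H\<rparr>) K"
  shows "finite_index G K"
proof -
  note sH = finite_indexD(1)[OF H]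
  interpret H: group "G\<lparr>carrier := H\<rparr>" by (rule subgroup_imp_group[OF sH])
  have sK: "subgroup K (G\<lparr>carrier := H\<rparr>)" using K by (simp add: finite_index_def)
  show ?thesis
  proof (rule finite_index_within[OF H subgroup_of_subgroup[OF sH sK], of "\<lambda>x. K #>\<^bsub>G\<lparr>carrier := H\<rparr>\<^esub> x"])
    show "finite ((\<lambda>x. K #>\<^bsub>G\<lparr>carrier := H\<rparr>\<^esub> x) ` H)" using H.finite_coset_image[OF K] by simp
    fix x y assume xy: "x \<in> H" "y \<in> H" "K #>\<^bsub>G\<lparr>carrier := H\<rparr>\<^esub> x = K #>\<^bsub>G\<lparr>carrier := H\<rparr>\<^esub> y"
    have "x \<otimes>\<^bsub>G\<lparr>carrier := H\<rparr>\<^esub> inv\<^bsub>G\<lparr>carrier := H\<rparr>\<^esub> y \<in> K"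
      by (rule H.coset_eq_imp[OF sK]) (use xy in simp_all)
    then show "x \<otimes> inv y \<in> K" using m_inv_consistent[OF sH xy(2)] by simp
  qed
qed

lemma rigid_subgroup:
  assumes "rigid G" and H: "finite_index G H"
  shows "rigid (G\<lparr>carrier := H\<rparr>)"
  unfolding rigid_def
proof (intro allI impI ballI)
  fix K and \<theta> :: "'a => real" and g assume K: "finite_index (G\<lparr>carrier := H\<rparr>) K"
    and hom: "\<forall>g\<in>K. \<forall>h\<in>K. \<theta> (g \<otimes>\<^bsub>G\<lparr>carrier := H\<rparr>\<^esub> h) = \<theta> g + \<theta> h" and g: "g \<in> K"
  show "\<theta> g = 0"
    by (rule rigidD[OF assms(1) finite_index_trans[OF H K] _ g]) (use hom in simp)
qed

lemma amenable_subgroup: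
  assumes am: "amenable G" and H: "subgroup H G"
  shows "amenable (G\<lparr>carrier := H\<rparr>)"
proof (rule amenable_image[OF is_group subgroup_imp_group[OF H] am, where \<pi> = "equivariant_part H"])
  show "equivariant_part H x \<in> carrier (G\<lparr>carrier := H\<rparr>)" if "x \<in> carrier G" for x
    using equivariant_part(1)[OF H that] by simp
  show "\<exists>g\<in>carrier G. \<forall>x\<in>carrier G. equivariant_part H (g \<otimes> x) = q \<otimes>\<^bsub>G\<lparr>carrier := H\<rparr>\<^esub> equivariant_part H x"
    if "q \<in> carrier (G\<lparr>carrier := H\<rparr>)" for q
    using that subgroup.mem_carrier[OF H, of q] equivariant_part(2)[OF H] by (intro bexI[of _ q] ballI) simp_all
qed

text \<open>
  The core consists of the elements that fix every coset of \<open>H\<close>, and there are finitely many cosets.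
\<close>

lemma finite_index_core:
  assumes H: "finite_index G H"
  shows "\<exists>K. finite_index G K \<and> K \<lhd> G \<and> K \<subseteq> H"
proof -
  note sH = finite_indexD(1)[OF H]
  define K where "K = {g \<in> carrier G. \<forall>y\<in>carrier G. y \<otimes> g \<otimes> inv y \<in> H}"
  have KD: "g \<in> carrier G" "y \<in> carrier G ==> y \<otimes> g \<otimes> inv y \<in> H" if "g \<in> K" for g y
    using that by (simp_all add: K_def)
  have sK: "subgroup K G"
  proof (rule subgroupI)
    show "K \<subseteq> carrier G" by (auto simp: K_def)
    have "\<one> \<in> K" using subgroup.one_closed[OF sH] by (simp add: K_def)
    then show "K ~= {}" by blast
  next
    fix a assume a: "a \<in> K"
    have "y \<otimes> inv a \<otimes> inv y \<in> H" if y: "y \<in> carrier G" for y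
    proof -
      have "inv (y \<otimes> a \<otimes> inv y) \<in> H" by (rule subgroup.m_inv_closed[OF sH KD(2)[OF a y]])
      moreover have "inv (y \<otimes> a \<otimes> inv y) = y \<otimes> inv a \<otimes> inv y"
        using y KD(1)[OF a] by (simp add: inv_mult_group m_assoc)
      ultimately show ?thesis by simp
    qed
    then show "inv a \<in> K" using KD(1)[OF a] by (simp add: K_def)
  next
    fix a b assume a: "a \<in> K" and b: "b \<in> K"
    have "y \<otimes> (a \<otimes> b) \<otimes> inv y \<in> H" if y: "y \<in> carrier G" for y
    proof -
      have "(y \<otimes> a \<otimes> inv y) \<otimes> (y \<otimes> b \<otimes> inv y) \<in> H"
        by (rule subgroup.m_closed[OF sH KD(2)[OF a y] KD(2)[OF b y]])
      moreover have "(y \<otimes> a \<otimes> inv y) \<otimes> (y \<otimes> b \<otimes> inv y) = y \<otimes> (a \<otimes> b) \<otimes> inv y"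
      proof -
        have "inv y \<otimes> (y \<otimes> (b \<otimes> inv y)) = b \<otimes> inv y"
          using y KD(1)[OF b] by (simp add: m_assoc[symmetric])
        then show ?thesis using y KD(1)[OF a] KD(1)[OF b] by (simp add: m_assoc)
      qed
      ultimately show ?thesis by simp
    qed
    then show "a \<otimes> b \<in> K" using KD(1)[OF a] KD(1)[OF b] by (simp add: K_def)
  qed
  have nK: "K \<lhd> G"
    unfolding normal_inv_iff
  proof (intro conjI sK ballI)
    fix x h assume x: "x \<in> carrier G" and h: "h \<in> K"
    have "y \<otimes> (x \<otimes> h \<otimes> inv x) \<otimes> inv y \<in> H" if y: "y \<in> carrier G" for y
    proof -
      have "(y \<otimes> x) \<otimes> h \<otimes> inv (y \<otimes> x) \<in> H" by (rule KD(2)[OF h]) (use x y in simp)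
      moreover have "(y \<otimes> x) \<otimes> h \<otimes> inv (y \<otimes> x) = y \<otimes> (x \<otimes> h \<otimes> inv x) \<otimes> inv y"
        using x y KD(1)[OF h] by (simp add: inv_mult_group m_assoc)
      ultimately show ?thesis by simp
    qed
    then show "x \<otimes> h \<otimes> inv x \<in> K" using x KD(1)[OF h] by (simp add: K_def)
  qed
  have KH: "K \<subseteq> H"
  proof
    fix g assume g: "g \<in> K"
    show "g \<in> H" using KD(2)[OF g one_closed] KD(1)[OF g] by simp
  qed
  \<comment> \<open>\<open>g\<close> is determined modulo \<open>K\<close> by its action on the finite set of cosets of \<open>H\<close>.\<close>
  define P where "P = (\<lambda>x. H #> x) ` carrier G"
  define f where "f = (\<lambda>g. {(H #> y, H #> (y \<otimes> g)) |y. y \<in> carrier G})"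
  have "f g \<subseteq> P \<times> P" if "g \<in> carrier G" for g
  proof
    fix p assume "p \<in> f g"
    then obtain y where "y \<in> carrier G" "p = (H #> y, H #> (y \<otimes> g))" unfolding f_def by blast
    then show "p \<in> P \<times> P" unfolding P_def using that by (simp only:) (intro SigmaI imageI m_closed)
  qed
  then have "f ` carrier G \<subseteq> Pow (P \<times> P)" by (intro image_subsetI PowI)
  then have fin: "finite (f ` carrier G)"
    by (rule finite_subset) (simp add: P_def finite_coset_image[OF H])
  have "finite_index G K"
  proof (rule finite_indexI[OF sK fin])
    fix x z assume x: "x \<in> carrier G" and z: "z \<in> carrier G" and eq: "f x = f z"
    have "y \<otimes> (x \<otimes> inv z) \<otimes> inv y \<in> H" if y: "y \<in> carrier G" for y
    proof -
      have "(H #> y, H #> (y \<otimes> x)) \<in> f x"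
        unfolding f_def by (intro CollectI exI[of _ y] conjI refl y)
      then have "(H #> y, H #> (y \<otimes> x)) \<in> f z" unfolding eq .
      then obtain y' where y': "y' \<in> carrier G" "H #> y = H #> y'" "H #> (y \<otimes> x) = H #> (y' \<otimes> z)"
        unfolding f_def by blast
      have 1: "(y \<otimes> x) \<otimes> inv (y' \<otimes> z) \<in> H"
        by (rule coset_eq_imp[OF sH _ _ y'(3)]) (use x z y y'(1) in simp_all)
      have 2: "y' \<otimes> inv y \<in> H" by (rule coset_eq_imp[OF sH y'(1) y y'(2)[symmetric]])
      have "((y \<otimes> x) \<otimes> inv (y' \<otimes> z)) \<otimes> (y' \<otimes> inv y) \<in> H" by (rule subgroup.m_closed[OF sH 1 2])
      moreover have "((y \<otimes> x) \<otimes> inv (y' \<otimes> z)) \<otimes> (y' \<otimes> inv y) = y \<otimes> (x \<otimes> inv z) \<otimes> inv y"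
      proof -
        have "inv y' \<otimes> (y' \<otimes> inv y) = inv y" using y y'(1) by (simp add: m_assoc[symmetric])
        then show ?thesis using x z y y'(1) by (simp add: inv_mult_group m_assoc)
      qed
      ultimately show ?thesis by simp
    qed
    then show "x \<otimes> inv z \<in> K" using x z by (simp add: K_def)
  qed
  then show ?thesis using nK KH by (intro exI[of _ K] conjI)
qed

text \<open>
  Elements of a finite quotient have finite order.
\<close>

lemma finite_index_pow:
  assumes H: "finite_index G H"
  shows "\<exists>n::nat. n > 0 \<and> (\<forall>x\<in>carrier G. x [^] n \<in> H)"
proof -
  note sH = finite_indexD(1)[OF H]
  define N where "N = card ((\<lambda>x. H #> x) ` carrier G)"
  have "x [^] (fact N :: nat) \<in> H" if x: "x \<in> carrier G" for x
  proof -
    define c where "c = (\<lambda>i::nat. H #> (x [^] i))"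
    have "\<not> inj_on c {0..N}"
    proof
      assume "inj_on c {0..N}"
      then have "card (c ` {0..N}) = Suc N" by (simp add: card_image)
      moreover have "c ` {0..N} \<subseteq> (\<lambda>x. H #> x) ` carrier G" unfolding c_def using x by (intro image_subsetI imageI) simp
      ultimately show False
        using card_mono[OF finite_coset_image[OF H], of "c ` {0..N}"] by (simp add: N_def)
    qed
    then obtain i j where ij: "i <= N" "j <= N" "i < j" "c i = c j"
      unfolding inj_on_def by (metis atLeastAtMost_iff linorder_neqE_nat)
    have "x [^] j \<otimes> inv (x [^] i) \<in> H"
      by (rule coset_eq_imp[OF sH _ _ ij(4)[symmetric, unfolded c_def]]) (use x in simp_all)
    moreover have "x [^] j = x [^] (j - i) \<otimes> x [^] i" using ij(3) x by (simp add: nat_pow_mult)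
    ultimately have k: "x [^] (j - i) \<in> H" using x by (simp add: m_assoc)
    have "(j - i) dvd fact N" using ij by (intro dvd_fact) auto
    then obtain q where "fact N = (j - i) * q" by (auto elim: dvdE)
    then have "x [^] (fact N :: nat) = (x [^] (j - i)) [^] q" using x by (simp add: nat_pow_pow)
    moreover have "(x [^] (j - i)) [^] q \<in> H"
      by (induction q) (use k sH in \<open>simp_all add: subgroup.one_closed subgroup.m_closed\<close>)
    ultimately show ?thesis by simp
  qed
  then show ?thesis by (intro exI[of _ "fact N"] conjI ballI) simp_all
qed

end

section \<open>Finite-dimensional subspaces of a normed space\<close>

definition fin_dim :: "'v::real_vector set => bool" where
  "fin_dim V \<longleftrightarrow> subspace V \<and> (\<exists>B. finite B \<and> V \<subseteq> span B)"

lemma fin_dim_subspace: "fin_dim V ==> subspace V"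
  by (simp add: fin_dim_def)

lemma fin_dim_subset:
  assumes "fin_dim V" "subspace U" "U \<subseteq> V"
  shows "fin_dim U"
proof -
  obtain B where "finite B" "V \<subseteq> span B" using assms(1) unfolding fin_dim_def by blast
  then show ?thesis unfolding fin_dim_def using assms(2) subset_trans[OF assms(3)] by blast
qed

lemma fin_dim_independent:
  assumes V: "fin_dim V" and B: "independent B" "B \<subseteq> V"
  shows "finite B"
proof -
  obtain S where S: "finite S" "V \<subseteq> span S" using V by (auto simp: fin_dim_def)
  show ?thesis using independent_span_bound[OF S(1) B(1)] B(2) S(2) by auto
qed

lemma fin_dim_extend_basis:
  assumes V: "fin_dim V" and I: "independent I" "I \<subseteq> V"
  obtains B where "I \<subseteq> B" "finite B" "independent B" "span B = V" "card B = dim V"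
proof -
  obtain B where B: "I \<subseteq> B" "B \<subseteq> V" "independent B" "V \<subseteq> span B"
    by (rule maximal_independent_subset_extend[OF I(2,1)])
  have sp: "span B = V"
    by (rule antisym[OF span_minimal[OF B(2) fin_dim_subspace[OF V]] B(4)])
  show thesis
  proof (rule that[OF B(1) _ B(3) sp])
    show "finite B" by (rule fin_dim_independent[OF V B(3) B(2)])
    show "card B = dim V" by (rule basis_card_eq_dim[OF B(2) B(4) B(3)])
  qed
qed

lemma fin_dim_basis:
  assumes V: "fin_dim V"
  obtains B where "finite B" "independent B" "span B = V" "card B = dim V"
proof (rule fin_dim_extend_basis[OF V independent_empty empty_subsetI])
  fix B assume B: "finite B" "independent B" "span B = V" "card B = dim V"
  show thesis by (rule that[OF B])
qed

lemma fin_dim_dim_less: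
  assumes V: "fin_dim V" and U: "subspace U" "U \<subseteq> V" "U ~= V"
  shows "dim U < dim V"
proof -
  obtain B where B: "finite B" "independent B" "span B = U" "card B = dim U"
    by (rule fin_dim_basis[OF fin_dim_subset[OF V U(1,2)]])
  have "B \<subseteq> V" using span_superset[of B] B(3) U(2) by blast
  then obtain C where C: "B \<subseteq> C" "finite C" "independent C" "span C = V" "card C = dim V"
    by (rule fin_dim_extend_basis[OF V B(2)])
  have "B ~= C" using B(3) C(4) U(3) by blast
  then show ?thesis using psubset_card_mono[OF C(2), of B] C(1) B(4) C(5) by auto
qed

definition seminorm_on :: "'v::real_vector set => ('v => real) => bool" where
  "seminorm_on V s \<longleftrightarrow> (\<forall>v\<in>V. \<forall>w\<in>V. s (v + w) <= s v + s w) \<and> (\<forall>v\<in>V. \<forall>c. s (c *\<^sub>R v) = \<bar>c\<bar> * s v)"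

lemma seminorm_onI:
  assumes "\<And>v w. [|v \<in> V; w \<in> V|] ==> s (v + w) <= s v + s w" "\<And>v c. v \<in> V ==> s (c *\<^sub>R v) = \<bar>c\<bar> * s v"
  shows "seminorm_on V s"
  unfolding seminorm_on_def by (intro conjI ballI allI assms)

lemma seminorm_on_add: "[|seminorm_on V s; v \<in> V; w \<in> V|] ==> s (v + w) <= s v + s w"
  unfolding seminorm_on_def by blast

lemma seminorm_on_scale: "[|seminorm_on V s; v \<in> V|] ==> s (c *\<^sub>R v) = \<bar>c\<bar> * s v"
  unfolding seminorm_on_def by blast

lemma seminorm_on_minus: "[|seminorm_on V s; v \<in> V|] ==> s (- v) = s v"
  using seminorm_on_scale[of V s v "-1"] by simp

lemma seminorm_on_nonneg:
  assumes "seminorm_on V s" "subspace V" "v \<in> V"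
  shows "0 <= s v"
proof -
  have "s (v + - v) <= s v + s (- v)"
    by (rule seminorm_on_add[OF assms(1,3) subspace_neg[OF assms(2,3)]])
  moreover have "s 0 = 0" using seminorm_on_scale[OF assms(1,3), of 0] by simp
  ultimately show ?thesis using seminorm_on_minus[OF assms(1,3)] by simp
qed

lemma seminorm_on_diff:
  assumes "seminorm_on V s" "subspace V" "v \<in> V" "w \<in> V"
  shows "s v <= s (v - w) + s w"
  using seminorm_on_add[OF assms(1) subspace_diff[OF assms(2-4)] assms(4)] by simp

lemma seminorm_on_norm_linear:
  fixes f :: "'v::real_vector => 'w::real_normed_vector"
  assumes "linear f"
  shows "seminorm_on V (\<lambda>v. norm (f v))"
  by (rule seminorm_onI) (simp_all add: linear_add[OF assms] linear_scale[OF assms] norm_triangle_ineq)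

lemma seminorm_on_plus:
  assumes "seminorm_on V s" "seminorm_on V t"
  shows "seminorm_on V (\<lambda>v. s v + t v)"
proof (rule seminorm_onI)
  fix v w assume v: "v \<in> V" and w: "w \<in> V"
  show "s (v + w) + t (v + w) <= s v + t v + (s w + t w)"
    using seminorm_on_add[OF assms(1) v w] seminorm_on_add[OF assms(2) v w] by linarith
next
  fix v and c :: real assume v: "v \<in> V"
  show "s (c *\<^sub>R v) + t (c *\<^sub>R v) = \<bar>c\<bar> * (s v + t v)"
    unfolding seminorm_on_scale[OF assms(1) v] seminorm_on_scale[OF assms(2) v] by (simp add: distrib_left)
qed

lemma seminorm_on_comp:
  assumes s: "seminorm_on V s" and f: "linear f" and fV: "\<And>v. v \<in> U ==> f v \<in> V"
  shows "seminorm_on U (\<lambda>v. s (f v))"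
proof (rule seminorm_onI)
  fix v w assume "v \<in> U" "w \<in> U"
  then show "s (f (v + w)) <= s (f v) + s (f w)"
    unfolding linear_add[OF f] by (intro seminorm_on_add[OF s] fV)
next
  fix v and c :: real assume "v \<in> U"
  then show "s (f (c *\<^sub>R v)) = \<bar>c\<bar> * s (f v)"
    unfolding linear_scale[OF f] by (intro seminorm_on_scale[OF s] fV)
qed

lemma subspace_seminorm_kernel:
  assumes s: "seminorm_on V s" and V: "subspace V"
  shows "subspace {v \<in> V. s v = 0}"
proof (rule subspaceI)
  show "0 \<in> {v \<in> V. s v = 0}"
    using subspace_0[OF V] seminorm_on_scale[OF s subspace_0[OF V], of 0] by simp
next
  fix v w assume "v \<in> {v \<in> V. s v = 0}" "w \<in> {v \<in> V. s v = 0}"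
  then have v: "v \<in> V" "s v = 0" and w: "w \<in> V" "s w = 0" by auto
  have "s (v + w) = 0"
    using seminorm_on_add[OF s v(1) w(1)] seminorm_on_nonneg[OF s V subspace_add[OF V v(1) w(1)]] v w by simp
  then show "v + w \<in> {v \<in> V. s v = 0}" using subspace_add[OF V v(1) w(1)] by simp
next
  fix c :: real and v assume "v \<in> {v \<in> V. s v = 0}"
  then show "c *\<^sub>R v \<in> {v \<in> V. s v = 0}"
    using seminorm_on_scale[OF s] subspace_scale[OF V] by simp
qed

text \<open>
  Coordinates are bounded.  All of this is proved by adjoining one vector at a time: a vector outside a
  closed subspace has positive distance from it.
\<close>

lemma coordinate_bound:
  fixes b :: "'v::real_normed_vector"
  assumes cl: "closed (span B)" and b: "b \<notin> span B"
  shows "\<exists>M>0. \<forall>t. \<forall>y\<in>span B. \<bar>t\<bar> <= M * norm (t *\<^sub>R b + y) \<and> norm y <= M * norm (t *\<^sub>R b + y)"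
proof -
  define d where "d = infdist b (span B)"
  have d: "d > 0"
    unfolding d_def using infdist_pos_not_in_closed[OF cl _ b] span_zero by blast
  have t: "\<bar>t\<bar> * d <= norm (t *\<^sub>R b + y)" if y: "y \<in> span B" for t y
  proof (cases "t = 0")
    case False
    have "d <= dist b ((- 1 / t) *\<^sub>R y)"
      unfolding d_def by (rule infdist_le) (intro span_scale y)
    then have "\<bar>t\<bar> * d <= \<bar>t\<bar> * norm (b - (- 1 / t) *\<^sub>R y)"
      by (intro mult_left_mono) (simp_all add: dist_norm)
    also have "\<dots> = norm (t *\<^sub>R (b - (- 1 / t) *\<^sub>R y))" by simp
    also have "t *\<^sub>R (b - (- 1 / t) *\<^sub>R y) = t *\<^sub>R b + y"
      using False by (simp add: scaleR_right_diff_distrib scaleR_right_distrib)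
    finally show ?thesis .
  qed simp
  define M where "M = 1 / d + (1 + norm b / d)"
  have M: "M > 0" using d by (simp add: M_def add_pos_pos add_pos_nonneg)
  show ?thesis
  proof (intro exI[of _ M] conjI M allI ballI)
    fix t y assume y: "y \<in> span B"
    let ?n = "norm (t *\<^sub>R b + y)"
    have t': "\<bar>t\<bar> <= ?n / d" using t[OF y, of t] d by (simp add: field_simps)
    have "?n / d <= M * ?n"
      using d by (simp add: M_def distrib_right)
    then show "\<bar>t\<bar> <= M * ?n" using t' by linarith
    have "norm y = norm ((t *\<^sub>R b + y) - t *\<^sub>R b)" by simp
    also have "\<dots> <= ?n + \<bar>t\<bar> * norm b" using norm_triangle_ineq4[of "t *\<^sub>R b + y" "t *\<^sub>R b"] by simp
    also have "\<dots> <= ?n + ?n / d * norm b" using t' by (intro add_left_mono mult_right_mono) auto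
    also have "\<dots> <= M * ?n"
    proof -
      have "M * ?n = (?n + ?n / d * norm b) + ?n / d" using d by (simp add: M_def field_simps)
      moreover have "0 <= ?n / d" using d by simp
      ultimately show ?thesis by linarith
    qed
    finally show "norm y <= M * ?n" .
  qed
qed

lemma span_bounded_subsequence:
  fixes x :: "nat => 'v::real_normed_vector"
  assumes "finite B" "\<And>n. x n \<in> span B" "\<And>n. norm (x n) <= K"
  shows "\<exists>l\<in>span B. \<exists>r. strict_mono r \<and> (x \<circ> r) \<longlonglongrightarrow> l"
  using assms
proof (induction B arbitrary: x K rule: finite_induct)
  case empty
  then have "x n = 0" for n by simp
  then have "(x \<circ> id) \<longlonglongrightarrow> 0" by (simp add: comp_def)
  moreover have "strict_mono (id :: nat => nat)" by (simp add: strict_mono_def)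
  ultimately show ?case by (intro bexI[OF _ span_zero] exI[of _ id] conjI)
next
  case (insert b B)
  show ?case
  proof (cases "b \<in> span B")
    case True
    then have "span (insert b B) = span B" by (rule span_redundant)
    then show ?thesis using insert.IH[of x K] insert.prems by simp
  next
    case False
    have cl: "closed (span B)"
      unfolding closed_sequential_limits
    proof (intro allI impI, elim conjE)
      fix y l assume y: "\<forall>n. y n \<in> span B" and l: "y \<longlonglongrightarrow> l"
      have "Bseq y" using l by (intro convergent_imp_Bseq) (auto simp: convergent_def)
      then obtain K' where K': "\<And>n. norm (y n) <= K'" by (auto simp: Bseq_def)
      have "\<exists>l\<in>span B. \<exists>r. strict_mono r \<and> (y \<circ> r) \<longlonglongrightarrow> l"
        by (rule insert.IH[OF spec[OF y] K'])
      then obtain l' r where l': "l' \<in> span B" "strict_mono r" "(y \<circ> r) \<longlonglongrightarrow> l'" by blast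
      have "l = l'" by (rule LIMSEQ_unique[OF LIMSEQ_subseq_LIMSEQ[OF l l'(2)] l'(3)])
      then show "l \<in> span B" using l'(1) by simp
    qed
    obtain M where M0: "M > 0" "\<forall>t. \<forall>y\<in>span B. \<bar>t\<bar> <= M * norm (t *\<^sub>R b + y) \<and> norm y <= M * norm (t *\<^sub>R b + y)"
      using coordinate_bound[OF cl False] by (elim exE conjE)
    have M: "M > 0" "\<bar>t\<bar> <= M * norm (t *\<^sub>R b + y)" "norm y <= M * norm (t *\<^sub>R b + y)"
      if "y \<in> span B" for t y
      using M0(1) bspec[OF spec[OF M0(2), of t] that] by simp_all
    have "\<exists>k. x n - k *\<^sub>R b \<in> span B" for n using insert.prems(1)[of n] unfolding span_insert by blast
    then have "\<exists>t. \<forall>n. x n - t n *\<^sub>R b \<in> span B" by (intro choice allI)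
    then obtain t where t0: "\<forall>n. x n - t n *\<^sub>R b \<in> span B" by (rule exE)
    have t: "x n - t n *\<^sub>R b \<in> span B" for n by (rule spec[OF t0])
    define y where "y = (\<lambda>n. x n - t n *\<^sub>R b)"
    have y: "y n \<in> span B" and xy: "x n = t n *\<^sub>R b + y n" for n using t by (simp_all add: y_def)
    have bd: "\<bar>t n\<bar> <= M * K" "norm (y n) <= M * K" for n
    proof -
      have "M * norm (t n *\<^sub>R b + y n) <= M * K"
        using insert.prems(2)[of n] M0(1) unfolding xy by (intro mult_left_mono) auto
      then show "\<bar>t n\<bar> <= M * K" "norm (y n) <= M * K"
        using M(2)[OF y[of n], of "t n"] M(3)[OF y[of n], of "t n"] by linarith+
    qed
    have "\<exists>l\<in>span B. \<exists>r. strict_mono r \<and> (y \<circ> r) \<longlonglongrightarrow> l"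
      by (rule insert.IH[of y "M * K"]) (fact y bd(2))+
    then obtain l r where l: "l \<in> span B" "strict_mono r" "(y \<circ> r) \<longlonglongrightarrow> l"
      by (elim bexE exE conjE)
    have "bounded (range (t \<circ> r))"
      unfolding bounded_iff using bd(1) by (intro exI[of _ "M * K"]) simp
    then have "\<exists>a q. strict_mono q \<and> ((t \<circ> r) \<circ> q) \<longlonglongrightarrow> a"
      by (rule bounded_imp_convergent_subsequence)
    then obtain a q where a: "strict_mono q" "((t \<circ> r) \<circ> q) \<longlonglongrightarrow> a" by (elim exE conjE)
    have "(\<lambda>n. t (r (q n)) *\<^sub>R b + y (r (q n))) \<longlonglongrightarrow> a *\<^sub>R b + l"
      using a(2) LIMSEQ_subseq_LIMSEQ[OF l(3) a(1)] by (intro tendsto_intros) (simp_all add: comp_def)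
    then have "(x \<circ> (r \<circ> q)) \<longlonglongrightarrow> a *\<^sub>R b + l" unfolding comp_def xy[symmetric] .
    moreover have "strict_mono (r \<circ> q)" by (rule strict_mono_o[OF l(2) a(1)])
    moreover have "a *\<^sub>R b + l \<in> span (insert b B)"
      unfolding span_insert using l(1) by (intro CollectI exI[of _ a]) simp
    ultimately show ?thesis by (intro bexI[of _ "a *\<^sub>R b + l"] exI[of _ "r \<circ> q"] conjI)
  qed
qed

lemma closed_span_finite:
  fixes B :: "'v::real_normed_vector set"
  assumes B: "finite B" shows "closed (span B)"
  unfolding closed_sequential_limits
proof (intro allI impI, elim conjE)
  fix y l assume y: "\<forall>n. y n \<in> span B" and l: "y \<longlonglongrightarrow> l"
  have "Bseq y" using l by (intro convergent_imp_Bseq) (auto simp: convergent_def)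
  then obtain K where K: "\<And>n. norm (y n) <= K" by (auto simp: Bseq_def)
  have "\<exists>l\<in>span B. \<exists>r. strict_mono r \<and> (y \<circ> r) \<longlonglongrightarrow> l"
    by (rule span_bounded_subsequence[OF B, of y K]) (use y K in simp_all)
  then obtain l' r where l': "l' \<in> span B" "strict_mono r" "(y \<circ> r) \<longlonglongrightarrow> l'"
    by (elim bexE exE conjE)
  have "l = l'" by (rule LIMSEQ_unique[OF LIMSEQ_subseq_LIMSEQ[OF l l'(2)] l'(3)])
  then show "l \<in> span B" using l'(1) by simp
qed

lemma fin_dim_common_subsequence:
  fixes x :: "'i => nat => 'v::real_normed_vector"
  assumes V: "fin_dim V" and I: "finite I" and x: "\<And>i n. i \<in> I ==> x i n \<in> V"
    and bd: "\<And>i n. i \<in> I ==> norm (x i n) <= K"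
  shows "\<exists>r l. strict_mono r \<and> (\<forall>i\<in>I. l i \<in> V \<and> (\<lambda>n. x i (r n)) \<longlonglongrightarrow> l i)"
  using I x bd
proof (induction I rule: finite_induct)
  case empty
  have "strict_mono (\<lambda>n::nat. n)" by (simp add: strict_mono_def)
  then show ?case by (intro exI[of _ "\<lambda>n. n"] exI[of _ undefined] conjI ballI) simp_all
next
  case (insert i I)
  have "\<exists>r l. strict_mono r \<and> (\<forall>j\<in>I. l j \<in> V \<and> (\<lambda>n. x j (r n)) \<longlonglongrightarrow> l j)"
    by (rule insert.IH) (use insert.prems in simp_all)
  then obtain r l where r0: "strict_mono r" "\<forall>j\<in>I. l j \<in> V \<and> (\<lambda>n. x j (r n)) \<longlonglongrightarrow> l j"
    by (elim exE conjE)
  have r: "strict_mono r" "\<And>j. j \<in> I ==> l j \<in> V" "\<And>j. j \<in> I ==> (\<lambda>n. x j (r n)) \<longlonglongrightarrow> l j"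
    using r0 by simp_all
  obtain B where B: "finite B" "span B = V" by (rule fin_dim_basis[OF V])
  have "\<exists>l\<in>span B. \<exists>q. strict_mono q \<and> ((\<lambda>n. x i (r n)) \<circ> q) \<longlonglongrightarrow> l"
    by (rule span_bounded_subsequence[OF B(1), of _ K]) (use insert.prems B(2) in simp_all)
  then have "\<exists>l\<in>V. \<exists>q. strict_mono q \<and> (\<lambda>n. x i (r (q n))) \<longlonglongrightarrow> l"
    unfolding comp_def B(2) .
  then obtain a q where q: "a \<in> V" "strict_mono q" "(\<lambda>n. x i (r (q n))) \<longlonglongrightarrow> a"
    by (elim bexE exE conjE)
  define l' where "l' = l(i := a)"
  have l': "l' j \<in> V \<and> (\<lambda>n. x j ((r \<circ> q) n)) \<longlonglongrightarrow> l' j" if j: "j \<in> insert i I" for j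
  proof (cases "j = i")
    case True
    then show ?thesis using q by (simp add: l'_def)
  next
    case False
    then have "j \<in> I" using j by simp
    then show ?thesis
      using False r(2)[of j] LIMSEQ_subseq_LIMSEQ[OF r(3)[of j] q(2)] by (simp add: l'_def comp_def)
  qed
  show ?case
    by (intro exI[of _ "r \<circ> q"] exI[of _ l'] conjI[OF strict_mono_o[OF r(1) q(2)]] ballI l')
qed

text \<open>
  The constant is the same for all seminorms.  It is later applied to the norms \<open>norm (g v)\<close> for all
  group elements \<open>g\<close> at once.
\<close>

lemma seminorm_bound:
  fixes B :: "'v::real_normed_vector set"
  assumes "finite B" "independent B"
  shows "\<exists>M\<ge>0. \<forall>s. seminorm_on (span B) s --> (\<forall>v\<in>span B. s v <= M * (\<Sum>b\<in>B. s b) * norm v)"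
  using assms
proof (induction B rule: finite_induct)
  case empty
  have "s 0 <= 0" if "seminorm_on {0} s" for s :: "'v => real"
    using seminorm_on_scale[OF that, of 0 0] by simp
  then show ?case by (intro exI[of _ 0]) simp
next
  case (insert b B)
  have ind: "independent B" and b: "b \<notin> span B"
    using insert.prems insert.hyps by (simp_all add: independent_insert split: if_splits)
  obtain M where M: "M >= 0"
    "\<forall>s. seminorm_on (span B) s --> (\<forall>v\<in>span B. s v <= M * (\<Sum>b\<in>B. s b) * norm v)"
    using insert.IH[OF ind] by (elim exE conjE)
  obtain D where D0: "D > 0" "\<forall>t. \<forall>y\<in>span B. \<bar>t\<bar> <= D * norm (t *\<^sub>R b + y) \<and> norm y <= D * norm (t *\<^sub>R b + y)"
      using coordinate_bound[OF closed_span_finite[OF insert.hyps(1)] b] by (elim exE conjE)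
    have D: "D > 0" "\<bar>t\<bar> <= D * norm (t *\<^sub>R b + y)" "norm y <= D * norm (t *\<^sub>R b + y)"
      if "y \<in> span B" for t y
      using D0(1) bspec[OF spec[OF D0(2), of t] that] by simp_all
  have bound: "s v <= (D + M * D) * (\<Sum>b\<in>insert b B. s b) * norm v"
    if s: "seminorm_on (span (insert b B)) s" and v: "v \<in> span (insert b B)" for s v
  proof -
    have sub: "span B \<subseteq> span (insert b B)" by (rule span_mono) auto
    have sB: "seminorm_on (span B) s"
      by (rule seminorm_onI) (simp_all add: seminorm_on_add[OF s] seminorm_on_scale[OF s] subsetD[OF sub])
    have bs: "b \<in> span (insert b B)" by (rule span_base) simp
    obtain t where t: "v - t *\<^sub>R b \<in> span B" using v unfolding span_insert by blast
    define y where "y = v - t *\<^sub>R b"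
    have y: "y \<in> span B" and vy: "v = t *\<^sub>R b + y" using t by (simp_all add: y_def)
    have nn: "0 <= s w" if "w \<in> span (insert b B)" for w
      by (rule seminorm_on_nonneg[OF s subspace_span that])
    have sumB: "0 <= (\<Sum>b\<in>B. s b)"
      by (rule sum_nonneg) (rule nn, rule subsetD[OF sub], rule span_base)
    have "s v <= s (t *\<^sub>R b) + s y"
      unfolding vy by (rule seminorm_on_add[OF s span_scale[OF bs] subsetD[OF sub y]])
    also have "s (t *\<^sub>R b) = \<bar>t\<bar> * s b" by (rule seminorm_on_scale[OF s bs])
    also have "\<bar>t\<bar> * s b <= (D * norm v) * s b"
      unfolding vy by (rule mult_right_mono[OF D(2)[OF y] nn[OF bs]])
    also have "s y <= M * (\<Sum>b\<in>B. s b) * norm y" by (rule bspec[OF mp[OF spec[OF M(2)] sB] y])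
    also have "\<dots> <= M * (\<Sum>b\<in>B. s b) * (D * norm v)"
      unfolding vy using D(3)[OF y] M(1) sumB by (intro mult_left_mono) auto
    also have "(D * norm v) * s b + M * (\<Sum>b\<in>B. s b) * (D * norm v)
       <= (D + M * D) * (s b + (\<Sum>b\<in>B. s b)) * norm v"
    proof -
      have "0 <= (D * (\<Sum>b\<in>B. s b) + M * D * s b) * norm v"
        using D0(1) M(1) sumB nn[OF bs] by (intro mult_nonneg_nonneg add_nonneg_nonneg) auto
      then show ?thesis by (simp add: algebra_simps)
    qed
    finally show ?thesis using insert.hyps by simp
  qed
  have "0 <= D + M * D" using D0(1) M(1) by simp
  then show ?case by (intro exI[of _ "D + M * D"] conjI allI impI ballI bound)
qed

lemma fin_dim_seminorm_le:
  fixes V :: "'v::real_normed_vector set"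
  assumes V: "fin_dim V" and s: "seminorm_on V s"
  shows "\<exists>C>0. \<forall>v\<in>V. s v <= C * norm v"
proof -
  obtain B where B: "finite B" "independent B" "span B = V" by (rule fin_dim_basis[OF V])
  obtain M where M0: "\<forall>s. seminorm_on V s --> (\<forall>v\<in>V. s v <= M * (\<Sum>b\<in>B. s b) * norm v)"
    using seminorm_bound[OF B(1,2)] unfolding B(3) by (elim exE conjE)
  have M: "\<And>v. v \<in> V ==> s v <= M * (\<Sum>b\<in>B. s b) * norm v"
    by (rule bspec[OF mp[OF spec[OF M0] s]])
  have "s v <= (\<bar>M * (\<Sum>b\<in>B. s b)\<bar> + 1) * norm v" if "v \<in> V" for v
  proof -
    have "M * (\<Sum>b\<in>B. s b) * norm v <= (\<bar>M * (\<Sum>b\<in>B. s b)\<bar> + 1) * norm v"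
      by (rule mult_right_mono) auto
    then show ?thesis using M[OF that] by linarith
  qed
  then show ?thesis by (intro exI[of _ "\<bar>M * (\<Sum>b\<in>B. s b)\<bar> + 1"] conjI ballI) simp_all
qed

lemma fin_dim_norm_ge:
  fixes V :: "'v::real_normed_vector set"
  assumes V: "fin_dim V" and s: "seminorm_on V s" and def: "\<And>v. [|v \<in> V; s v = 0|] ==> v = 0"
  shows "\<exists>\<delta>>0. \<forall>v\<in>V. \<delta> * norm v <= s v"
proof (rule ccontr)
  assume neg: "\<not> (\<exists>\<delta>>0. \<forall>v\<in>V. \<delta> * norm v <= s v)"
  have none: "\<exists>v\<in>V. s v < \<delta> * norm v" if "\<delta> > 0" for \<delta>
    using neg that by (meson not_le)
  note sV = fin_dim_subspace[OF V]
  have "\<exists>v\<in>V. norm v = 1 \<and> s v < 1 / real (Suc n)" for n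
  proof -
    obtain v where v: "v \<in> V" "s v < 1 / real (Suc n) * norm v" using none[of "1 / real (Suc n)"] by auto
    have "v ~= 0" using v seminorm_on_nonneg[OF s sV v(1)] by auto
    then have nv: "norm v > 0" by simp
    have "s ((1 / norm v) *\<^sub>R v) = 1 / norm v * s v" using seminorm_on_scale[OF s v(1)] nv by simp
    also have "\<dots> < 1 / norm v * (1 / real (Suc n) * norm v)" using v(2) nv by (intro mult_strict_left_mono) auto
    also have "\<dots> = 1 / real (Suc n)" using nv by simp
    finally show ?thesis using nv subspace_scale[OF sV v(1), of "1 / norm v"]
      by (intro bexI[of _ "(1 / norm v) *\<^sub>R v"]) auto
  qed
  then have "\<exists>v. \<forall>n. v n \<in> V \<and> norm (v n) = 1 \<and> s (v n) < 1 / real (Suc n)"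
    by (intro choice allI) (simp only: Bex_def)
  then obtain v where v0: "\<forall>n. v n \<in> V \<and> norm (v n) = 1 \<and> s (v n) < 1 / real (Suc n)" by (rule exE)
  have v: "v n \<in> V" "norm (v n) = 1" "s (v n) < 1 / real (Suc n)" for n using spec[OF v0, of n] by simp_all
  have "\<exists>r l. strict_mono r \<and> (\<forall>i\<in>{()}. l i \<in> V \<and> (\<lambda>n. v (r n)) \<longlonglongrightarrow> l i)"
    by (rule fin_dim_common_subsequence[OF V, of "{()}" "\<lambda>_. v" 1]) (simp_all add: v)
  then obtain r l' where r0: "strict_mono r" "\<forall>i\<in>{()}. l' i \<in> V \<and> (\<lambda>n. v (r n)) \<longlonglongrightarrow> l' i"
    by (elim exE conjE)
  define l where "l = l' ()"
  have r: "strict_mono r" "l \<in> V" "(\<lambda>n. v (r n)) \<longlonglongrightarrow> l"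
    using r0 by (simp_all add: l_def)
  obtain C where C: "C > 0" "\<forall>v\<in>V. s v <= C * norm v" using fin_dim_seminorm_le[OF V s] by (elim exE conjE)
  have "(\<lambda>n. norm (v (r n))) \<longlonglongrightarrow> norm l" by (rule tendsto_norm[OF r(3)])
  then have "norm l = 1" unfolding v(2) by (simp add: LIMSEQ_const_iff)
  moreover have "s l <= 0"
  proof (rule LIMSEQ_le_const)
    have "(\<lambda>n. 1 / real (Suc n)) \<longlonglongrightarrow> 0" using LIMSEQ_inverse_real_of_nat by (simp add: inverse_eq_divide)
    then have "(\<lambda>n. 1 / real (Suc (r n))) \<longlonglongrightarrow> 0" using LIMSEQ_subseq_LIMSEQ[OF _ r(1)] by (simp add: comp_def)
    moreover have "(\<lambda>n. norm (l - v (r n))) \<longlonglongrightarrow> norm (l - l)" by (intro tendsto_intros r(3))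
    ultimately show "(\<lambda>n. C * norm (l - v (r n)) + 1 / real (Suc (r n))) \<longlonglongrightarrow> 0"
      using tendsto_add[OF tendsto_mult_left, of "\<lambda>n. norm (l - v (r n))" 0 sequentially "\<lambda>n. 1 / real (Suc (r n))" 0 C] by simp
    have "s l <= C * norm (l - v (r n)) + 1 / real (Suc (r n))" for n
      using seminorm_on_diff[OF s sV r(2) v(1), of "r n"] bspec[OF C(2) subspace_diff[OF sV r(2) v(1)], of "r n"] v(3)[of "r n"]
      by linarith
    then show "\<exists>N. \<forall>n\<ge>N. s l <= C * norm (l - v (r n)) + 1 / real (Suc (r n))" by (intro exI[of _ 0] allI impI)
  qed
  ultimately have "norm l = 1" "s l = 0" using seminorm_on_nonneg[OF s sV r(2)] by simp_all
  then show False using def[OF r(2)] by simp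
qed

section \<open>Invariant means and strongly irreducible representations\<close>

lemma proper_subspace_functional:
  fixes V :: "'v::real_vector set"
  assumes U: "subspace U" and v: "v \<notin> U"
  shows "\<exists>\<l>. linear \<l> \<and> (\<forall>u\<in>U. \<l> u = (0::real)) \<and> \<l> v = 1"
proof -
  obtain I where I: "I \<subseteq> U" "independent I" "U \<subseteq> span I" "card I = dim U" by (rule basis_exists[of U])
  have sp: "span I = U" by (rule antisym[OF span_minimal[OF I(1) U] I(3)])
  have vI: "v \<notin> I" using v I(1) by blast
  have ind: "independent (insert v I)" by (rule independent_insertI[OF _ I(2)]) (use v sp in simp)
  obtain \<l> where l: "linear \<l>" "\<forall>x\<in>insert v I. \<l> x = (if x = v then 1 else (0::real))"
    using linear_independent_extend[OF ind, of "\<lambda>x. if x = v then 1 else (0::real)"] by (elim exE conjE)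
  have "\<l> u = 0" if "u \<in> U" for u
  proof (rule linear_eq_0_on_span[OF l(1)])
    show "\<l> b = 0" if "b \<in> I" for b using l(2) that vI by auto
    show "u \<in> span I" using that sp by simp
  qed
  then show ?thesis using l by (intro exI[of _ \<l>]) simp
qed

lemma fin_dim_singular_not_surjective:
  fixes T :: "'v::real_vector => 'v"
  assumes V: "fin_dim V" and T: "linear T" and v: "v \<in> V" "v ~= 0" "T v = 0"
  shows "T ` V ~= V"
proof
  assume eq: "T ` V = V"
  have "independent {v}" using v(2) by simp
  then obtain B where B: "{v} \<subseteq> B" "finite B" "independent B" "span B = V" "card B = dim V"
    by (rule fin_dim_extend_basis[OF V]) (use v(1) in simp_all)
  have Bv: "B = insert v (B - {v})" using B(1) by blast
  have "span (T ` B) = T ` V" using linear_span_image[OF T, of B] B(4) by simp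
  also have "T ` B = insert 0 (T ` (B - {v}))" by (subst Bv) (simp only: image_insert v(3))
  finally have "V \<subseteq> span (T ` (B - {v}))" using eq by simp
  then have "dim V <= card (T ` (B - {v}))" by (rule dim_le_card) (use B(2) in simp)
  also have "\<dots> <= card (B - {v})" by (rule card_image_le) (use B(2) in simp)
  also have "\<dots> < card B" using B(1,2) by (intro psubset_card_mono) auto
  finally show False using B(5) by simp
qed

locale representation = group G for G :: "('g, 'm) monoid_scheme" (structure) +
  fixes V :: "'v::real_normed_vector set" and \<rho> :: "'g => 'v => 'v"
  assumes fin_dim: "fin_dim V"
    and linear: "g \<in> carrier G ==> linear (\<rho> g)"
    and invariant: "[|g \<in> carrier G; v \<in> V|] ==> \<rho> g v \<in> V"
    and mult: "[|g \<in> carrier G; h \<in> carrier G; v \<in> V|] ==> \<rho> (g \<otimes> h) v = \<rho> g (\<rho> h v)"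
    and one: "v \<in> V ==> \<rho> \<one> v = v"
begin

lemma subspace_V: "subspace V" by (rule fin_dim_subspace[OF fin_dim])

lemma inv_cancel: "[|g \<in> carrier G; v \<in> V|] ==> \<rho> (inv g) (\<rho> g v) = v"
  using mult[of "inv g" g v] one[of v] by simp

lemma cancel_inv: "[|g \<in> carrier G; v \<in> V|] ==> \<rho> g (\<rho> (inv g) v) = v"
  using mult[of g "inv g" v] one[of v] by simp

lemma seminorm_translate:
  assumes "seminorm_on V s" "g \<in> carrier G" shows "seminorm_on V (\<lambda>v. s (\<rho> g v))"
  by (rule seminorm_on_comp[OF assms(1) linear[OF assms(2)] invariant[OF assms(2)]])

lemma norm_rep_le: "g \<in> carrier G ==> \<exists>C>0. \<forall>v\<in>V. norm (\<rho> g v) <= C * norm v"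
  by (rule fin_dim_seminorm_le[OF fin_dim seminorm_on_norm_linear[OF linear]])

end

text \<open>
  Strong irreducibility is the hypothesis on subspaces that are invariant under a subgroup of finite
  index.  The orbit \<open>o\<close> of a nonzero vector pushes the mean \<open>m\<close> forward to a finitely additive
  measure on directions in \<open>V\<close>.  A seminorm is charged if arbitrarily small neighbourhoods of its
  kernel have mass bounded below.
\<close>

locale furstenberg = representation G V \<rho> + mean_group G m
  for G :: "('g, 'm) monoid_scheme" (structure) and V :: "'v::real_normed_vector set" and \<rho> m +
  fixes v0 :: 'v
  assumes v0: "v0 \<in> V" "v0 ~= 0"
    and rigid: "rigid G"
    and strongly_irreducible:
      "[|finite_index G H; subspace W; W \<subseteq> V; \<forall>h\<in>H. \<forall>w\<in>W. \<rho> h w \<in> W|] ==> W = {0} \<or> W = V"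
begin

definition orbit :: "'g => 'v" where "orbit g = \<rho> g v0"

definition mass :: "'g set => real" where "mass S = m (indicator S)"

definition near :: "('v => real) => real => 'g set" where
  "near s \<epsilon> = {h. s (orbit h) < \<epsilon> * norm (orbit h)}"

definition charged :: "('v => real) => bool" where
  "charged s \<longleftrightarrow> (\<exists>c>0. \<forall>\<epsilon>>0. c <= mass (near s \<epsilon>))"

lemma orbit_in: "g \<in> carrier G ==> orbit g \<in> V"
  unfolding orbit_def by (rule invariant[OF _ v0(1)])

lemma orbit_mult: "[|g \<in> carrier G; h \<in> carrier G|] ==> orbit (g \<otimes> h) = \<rho> g (orbit h)"
  unfolding orbit_def by (rule mult[OF _ _ v0(1)])

lemma orbit_nonzero: assumes "g \<in> carrier G" shows "norm (orbit g) > 0"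
proof -
  have "orbit g ~= 0"
  proof
    assume "orbit g = 0"
    then have "\<rho> (inv g) 0 = v0" using inv_cancel[OF assms v0(1)] by (simp add: orbit_def)
    then show False using v0(2) linear_0[OF linear[OF inv_closed[OF assms]]] by simp
  qed
  then show ?thesis by simp
qed

lemma indicator_bounded [simp]: "(indicator S :: 'g => real) \<in> bounded_functions G"
  by (rule bounded_functionsI[of _ 1]) (simp add: indicator_def)

lemma mass_mono: "(\<And>h. [|h \<in> carrier G; h \<in> S|] ==> h \<in> T) ==> mass S <= mass T"
  unfolding mass_def by (rule mean_mono) (simp_all add: indicator_def)

lemma mass_translate: assumes "g \<in> carrier G" shows "mass {h. g \<otimes> h \<in> S} = mass S"
proof -
  have "(indicator {h. g \<otimes> h \<in> S} :: 'g => real) = (\<lambda>h. indicator S (g \<otimes> h))"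
    by (simp add: fun_eq_iff indicator_def)
  then show ?thesis unfolding mass_def using mean_translate[OF indicator_bounded assms, of S] by simp
qed

lemma mass_compl: "mass (- S) = 1 - mass S"
proof -
  have "(indicator (- S) :: 'g => real) = (\<lambda>h. 1 - indicator S h)"
    by (simp add: fun_eq_iff indicator_def)
  then show ?thesis unfolding mass_def using mean_diff[OF bounded_functions_const[of 1] indicator_bounded[of S]]
    by (simp add: mean_const)
qed

lemma mass_empty: "(\<And>h. h \<in> carrier G ==> h \<notin> S) ==> mass S <= 0"
proof -
  assume S: "\<And>h. h \<in> carrier G ==> h \<notin> S"
  have "m (indicator S) <= m (\<lambda>x. 0)" by (rule mean_mono) (simp_all add: S)
  then show ?thesis by (simp add: mass_def mean_const)
qed

lemma near_mono: "[|\<epsilon> <= \<epsilon>'; h \<in> carrier G; h \<in> near s \<epsilon>|] ==> h \<in> near s \<epsilon>'"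
  unfolding near_def using mult_right_mono[of \<epsilon> \<epsilon>' "norm (orbit h)"] by simp

text \<open>
  For a point in \<open>k >= 1\<close> of the sets this is \<open>k <= 1 + k (k - 1)\<close>.
\<close>

lemma bonferroni:
  assumes I: "finite I"
  shows "(\<Sum>i\<in>I. mass (S i)) <= 1 + (\<Sum>i\<in>I. \<Sum>j\<in>I - {i}. mass (S i \<inter> S j))"
proof -
  have pt: "(\<Sum>i\<in>I. indicator (S i) x) <= 1 + (\<Sum>i\<in>I. \<Sum>j\<in>I - {i}. indicator (S i \<inter> S j) x :: real)" for x
  proof (cases "\<exists>i\<in>I. x \<in> S i")
    case True
    then obtain i where i: "i \<in> I" "x \<in> S i" by blast
    have "(\<Sum>i\<in>I. indicator (S i) x) = (1::real) + (\<Sum>j\<in>I - {i}. indicator (S j) x)"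
      using i by (subst sum.remove[OF I i(1)]) simp
    also have "(\<Sum>j\<in>I - {i}. indicator (S j) x :: real) = (\<Sum>j\<in>I - {i}. indicator (S i \<inter> S j) x)"
      using i(2) by (intro sum.cong refl) (simp add: indicator_def)
    also have "\<dots> <= (\<Sum>i\<in>I. \<Sum>j\<in>I - {i}. indicator (S i \<inter> S j) x)"
      by (rule member_le_sum[OF i(1) _ I]) (intro sum_nonneg, simp)
    finally show ?thesis by simp
  next
    case False
    then have "(\<Sum>i\<in>I. indicator (S i) x) = (0::real)" by (intro sum.neutral ballI) (simp add: indicator_def)
    also have "\<dots> <= 1 + (\<Sum>i\<in>I. \<Sum>j\<in>I - {i}. indicator (S i \<inter> S j) x)"
      by (intro add_nonneg_nonneg sum_nonneg) simp_all
    finally show ?thesis .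
  qed
  note s1 = mean_sum[OF I, of "\<lambda>i. indicator (S i)"]
  have s2: "(\<lambda>x. \<Sum>j\<in>I - {i}. indicator (S i \<inter> S j) x) \<in> bounded_functions G \<and>
      m (\<lambda>x. \<Sum>j\<in>I - {i}. indicator (S i \<inter> S j) x) = (\<Sum>j\<in>I - {i}. mass (S i \<inter> S j))" for i
    unfolding mass_def by (rule mean_sum) (use I in simp_all)
  have s3: "(\<lambda>x. \<Sum>i\<in>I. \<Sum>j\<in>I - {i}. indicator (S i \<inter> S j) x) \<in> bounded_functions G \<and>
      m (\<lambda>x. \<Sum>i\<in>I. \<Sum>j\<in>I - {i}. indicator (S i \<inter> S j) x) = (\<Sum>i\<in>I. m (\<lambda>x. \<Sum>j\<in>I - {i}. indicator (S i \<inter> S j) x))"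
    by (rule mean_sum[OF I]) (use s2 in simp)
  have "m (\<lambda>x. \<Sum>i\<in>I. indicator (S i) x) <= m (\<lambda>x. 1 + (\<Sum>i\<in>I. \<Sum>j\<in>I - {i}. indicator (S i \<inter> S j) x))"
    by (rule mean_mono[OF _ _ pt]) (use s1 s3 in simp_all)
  also have "\<dots> = 1 + (\<Sum>i\<in>I. \<Sum>j\<in>I - {i}. mass (S i \<inter> S j))"
    using s3 by (simp add: mean_add mean_const s2)
  finally show ?thesis using s1 by (simp add: mass_def)
qed

lemma uncharged_eventually:
  assumes "\<not> charged s" "\<delta> > 0"
  shows "\<forall>\<^sub>F \<epsilon> in at_right 0. mass (near s \<epsilon>) < \<delta>"
proof -
  have "\<forall>c>0. \<exists>\<epsilon>>0. mass (near s \<epsilon>) < c" using assms(1) unfolding charged_def by (simp add: not_le)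
  then obtain e where e: "e > 0" "mass (near s e) < \<delta>" using assms(2) by (elim allE[of _ \<delta>]) blast
  have "mass (near s y) < \<delta>" if "y < e" for y
    by (rule le_less_trans[OF mass_mono e(2)], rule near_mono[of y]) (use that in simp_all)
  then show ?thesis using e(1) unfolding eventually_at_right_field by (intro exI[of _ e]) simp
qed

lemma near_translate:
  assumes g: "g \<in> carrier G" and low: "\<forall>\<epsilon>>0. c <= mass (near s \<epsilon>)"
  shows "\<forall>\<epsilon>>0. c <= mass (near (\<lambda>v. s (\<rho> g v)) \<epsilon>)"
proof (intro allI impI)
  fix \<epsilon> :: real assume \<epsilon>: "\<epsilon> > 0"
  obtain C where C: "C > 0" "\<forall>v\<in>V. norm (\<rho> g v) <= C * norm v" using norm_rep_le[OF g] by (elim exE conjE)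
  have "c <= mass (near s (\<epsilon> / C))" using low \<epsilon> C(1) by simp
  also have "\<dots> = mass {h. g \<otimes> h \<in> near s (\<epsilon> / C)}" by (rule mass_translate[OF g, symmetric])
  also have "\<dots> <= mass (near (\<lambda>v. s (\<rho> g v)) \<epsilon>)"
  proof (rule mass_mono)
    fix h assume h: "h \<in> carrier G" and "h \<in> {h. g \<otimes> h \<in> near s (\<epsilon> / C)}"
    then have "s (\<rho> g (orbit h)) < \<epsilon> / C * norm (\<rho> g (orbit h))" by (simp add: near_def orbit_mult[OF g h])
    also have "\<dots> <= \<epsilon> / C * (C * norm (orbit h))"
      using C \<epsilon> orbit_in[OF h] by (intro mult_left_mono) simp_all
    also have "\<dots> = \<epsilon> * norm (orbit h)" using C(1) by simp
    finally show "h \<in> near (\<lambda>v. s (\<rho> g v)) \<epsilon>" by (simp add: near_def)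
  qed
  finally show "c <= mass (near (\<lambda>v. s (\<rho> g v)) \<epsilon>)" .
qed

lemma dim_translated_kernel:
  assumes s: "seminorm_on V s" and g: "g \<in> carrier G"
  shows "dim {v \<in> V. s (\<rho> g v) = 0} <= dim {v \<in> V. s v = 0}"
proof -
  have fd: "fin_dim {v \<in> V. s (\<rho> g v) = 0}"
    by (rule fin_dim_subset[OF fin_dim subspace_seminorm_kernel[OF seminorm_translate[OF s g] subspace_V]]) blast
  have fd': "fin_dim {v \<in> V. s v = 0}"
    by (rule fin_dim_subset[OF fin_dim subspace_seminorm_kernel[OF s subspace_V]]) blast
  obtain B where B: "finite B" "independent B" "span B = {v \<in> V. s (\<rho> g v) = 0}"
    "card B = dim {v \<in> V. s (\<rho> g v) = 0}" by (rule fin_dim_basis[OF fd])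
  have inj: "inj_on (\<rho> g) (span B)"
    by (rule inj_on_inverseI[of _ "\<rho> (inv g)"]) (use B(3) inv_cancel[OF g] in simp)
  have ind: "independent (\<rho> g ` B)"
    by (rule linear_independent_injective_image[OF linear[OF g] B(2) inj])
  have sub: "\<rho> g ` B \<subseteq> {v \<in> V. s v = 0}"
  proof (rule image_subsetI)
    fix b assume "b \<in> B"
    then have "b \<in> {v \<in> V. s (\<rho> g v) = 0}" using span_base[of b B] B(3) by simp
    then show "\<rho> g b \<in> {v \<in> V. s v = 0}" using invariant[OF g] by simp
  qed
  obtain D where D: "\<rho> g ` B \<subseteq> D" "finite D" "independent D" "span D = {v \<in> V. s v = 0}"
    "card D = dim {v \<in> V. s v = 0}" by (rule fin_dim_extend_basis[OF fd' ind sub])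
  have "card B = card (\<rho> g ` B)" by (rule card_image[symmetric, OF inj_on_subset[OF inj span_superset]])
  also have "\<dots> <= card D" by (rule card_mono[OF D(2,1)])
  finally show ?thesis using B(4) D(5) by simp
qed

text \<open>
  Among charged seminorms take one whose kernel has the least dimension.  Two distinct translates of
  that kernel have disjoint neighbourhoods up to small mass, while all neighbourhoods have mass at
  least \<open>c\<close>.  So the kernel has finitely many translates.
\<close>

lemma finite_translated_kernels:
  assumes s: "seminorm_on V s" and c: "c > 0" "\<forall>\<epsilon>>0. c <= mass (near s \<epsilon>)"
    and min: "\<And>t. [|seminorm_on V t; charged t|] ==> dim {v \<in> V. s v = 0} <= dim {v \<in> V. t v = 0}"
  shows "finite ((\<lambda>g. {v \<in> V. s (\<rho> g v) = 0}) ` carrier G)"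
proof (rule ccontr)
  define X where "X = (\<lambda>g. {v \<in> V. s (\<rho> g v) = 0})"
  define t where "t = (\<lambda>g v. s (\<rho> g v))"
  assume "infinite ((\<lambda>g. {v \<in> V. s (\<rho> g v) = 0}) ` carrier G)"
  then have inf: "infinite (X ` carrier G)" by (simp add: X_def)
  obtain n :: nat where n: "2 / c < real n" using reals_Archimedean2 by blast
  obtain Y where Y: "finite Y" "card Y = n" "Y \<subseteq> X ` carrier G"
    using infinite_arbitrarily_large[OF inf, of n] by (elim exE conjE)
  obtain I where I: "I \<subseteq> carrier G" "inj_on X I" "Y = X ` I"
    using Y(3) unfolding subset_image_inj by (elim exE conjE)
  have finI: "finite I" using Y(1) I(3) finite_image_iff[OF I(2)] by simp
  have cardI: "card I = n" using Y(2) I(3) card_image[OF I(2)] by simp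
  have st: "seminorm_on V (t g)" if "g \<in> I" for g
    unfolding t_def using seminorm_translate[OF s] I(1) that by blast
  have unch: "\<not> charged (\<lambda>v. t i v + t j v)" if ij: "i \<in> I" "j \<in> I - {i}" for i j
  proof
    assume ch: "charged (\<lambda>v. t i v + t j v)"
    have iG: "i \<in> carrier G" "j \<in> carrier G" using ij I(1) by auto
    have sij: "seminorm_on V (\<lambda>v. t i v + t j v)" using st ij by (intro seminorm_on_plus) simp_all
    have sX: "subspace (X g)" if "g \<in> carrier G" for g
      unfolding X_def by (rule subspace_seminorm_kernel[OF seminorm_translate[OF s that] subspace_V])
    have fX: "fin_dim (X g)" if "g \<in> carrier G" for g
      by (rule fin_dim_subset[OF fin_dim sX[OF that]]) (auto simp: X_def)
    have nn: "0 <= t g v" if "g \<in> I" "v \<in> V" for g v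
      by (rule seminorm_on_nonneg[OF st[OF that(1)] subspace_V that(2)])
    have "(t i v + t j v = 0) = (t i v = 0 \<and> t j v = 0)" if "v \<in> V" for v
      using nn[OF ij(1) that] nn[of j v] ij(2) that by auto
    then have ker: "{v \<in> V. t i v + t j v = 0} = X i \<inter> X j" unfolding X_def t_def by blast
    have le: "dim {v \<in> V. s v = 0} <= dim (X i \<inter> X j)"
      using min[OF sij ch] by (simp add: ker)
    have sub: "subspace (X i \<inter> X j)" by (rule subspace_inter[OF sX[OF iG(1)] sX[OF iG(2)]])
    have ne: "X i ~= X j" using I(2) ij unfolding inj_on_def by blast
    have dX: "dim (X g) <= dim {v \<in> V. s v = 0}" if "g \<in> carrier G" for g
      unfolding X_def by (rule dim_translated_kernel[OF s that])
    have "dim (X i \<inter> X j) < dim {v \<in> V. s v = 0}"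
    proof (cases "X i \<inter> X j = X i")
      case True
      then have "X i \<inter> X j ~= X j" using ne by simp
      then have "dim (X i \<inter> X j) < dim (X j)" by (intro fin_dim_dim_less[OF fX[OF iG(2)] sub]) simp_all
      then show ?thesis using dX[OF iG(2)] by simp
    next
      case False
      then have "dim (X i \<inter> X j) < dim (X i)" by (intro fin_dim_dim_less[OF fX[OF iG(1)] sub]) simp_all
      then show ?thesis using dX[OF iG(1)] by simp
    qed
    then show False using le by simp
  qed
  have n0: "real n > 0"
  proof -
    have "0 < 2 / c" using c(1) by simp
    then show ?thesis using n by linarith
  qed
  have "\<forall>i\<in>I. \<forall>j\<in>I - {i}. \<forall>\<^sub>F \<epsilon> in at_right 0. mass (near (\<lambda>v. t i v + t j v) \<epsilon>) < 1 / (real n * real n)"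
    using n0 by (intro ballI uncharged_eventually unch) simp_all
  then have "\<forall>\<^sub>F \<epsilon> in at_right 0. \<forall>i\<in>I. \<forall>j\<in>I - {i}. mass (near (\<lambda>v. t i v + t j v) \<epsilon>) < 1 / (real n * real n)"
    using finI by (intro eventually_ball_finite ballI) simp_all
  then obtain b where b: "b > 0"
    "\<forall>y>0. y < b --> (\<forall>i\<in>I. \<forall>j\<in>I - {i}. mass (near (\<lambda>v. t i v + t j v) y) < 1 / (real n * real n))"
    unfolding eventually_at_right_field by (elim exE conjE)
  have "mass (near (t i) (b / 4) \<inter> near (t j) (b / 4)) <= 1 / (real n * real n)"
    if ij: "i \<in> I" "j \<in> I - {i}" for i j
  proof -
    have "mass (near (t i) (b / 4) \<inter> near (t j) (b / 4)) <= mass (near (\<lambda>v. t i v + t j v) (b / 2))"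
      by (rule mass_mono) (simp add: near_def)
    moreover have "mass (near (\<lambda>v. t i v + t j v) (b / 2)) < 1 / (real n * real n)"
      by (rule bspec[OF bspec[OF mp[OF mp[OF spec[OF b(2)]]] ij(1)] ij(2)]) (use b(1) in simp_all)
    ultimately show ?thesis by linarith
  qed
  then have "(\<Sum>i\<in>I. \<Sum>j\<in>I - {i}. mass (near (t i) (b / 4) \<inter> near (t j) (b / 4)))
      <= (\<Sum>i\<in>I. \<Sum>j\<in>I - {i}. 1 / (real n * real n))" by (intro sum_mono)
  also have "\<dots> <= (\<Sum>i\<in>I. real n * (1 / (real n * real n)))"
  proof (rule sum_mono)
    fix i assume "i \<in> I"
    have "card (I - {i}) <= n" using card_mono[of I "I - {i}"] finI cardI by auto
    then have "real (card (I - {i})) * (1 / (real n * real n)) <= real n * (1 / (real n * real n))"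
      by (intro mult_right_mono) simp_all
    then show "(\<Sum>j\<in>I - {i}. 1 / (real n * real n)) <= real n * (1 / (real n * real n))"
      by (simp only: sum_constant)
  qed
  also have "\<dots> = 1" using n0 cardI by simp
  finally have two: "(\<Sum>i\<in>I. mass (near (t i) (b / 4))) <= 2"
    using bonferroni[OF finI, of "\<lambda>i. near (t i) (b / 4)"] by linarith
  have "real n * c <= (\<Sum>i\<in>I. mass (near (t i) (b / 4)))"
  proof -
    have "(\<Sum>i\<in>I. c) <= (\<Sum>i\<in>I. mass (near (t i) (b / 4)))"
    proof (rule sum_mono)
      fix i assume "i \<in> I"
      then have "i \<in> carrier G" using I(1) by blast
      then show "c <= mass (near (t i) (b / 4))" unfolding t_def using near_translate[OF _ c(2)] b(1) by simp
    qed
    then show ?thesis using cardI by simp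
  qed
  then have "real n * c <= 2" using two by linarith
  then show False using n c(1) by (simp add: field_simps)
qed

text \<open>
  The stabilizer of a charged kernel \<open>W\<close> of least dimension has finite index, so \<open>W\<close> is \<open>0\<close> or \<open>V\<close>.
  It is not \<open>0\<close>, since a norm has no small values on the orbit.  As \<open>W\<close> has the least dimension, all
  charged seminorms vanish on \<open>V\<close>.
\<close>

lemma charged_zero:
  assumes s: "seminorm_on V s" "charged s" and v: "v \<in> V"
  shows "s v = 0"
proof -
  define d where "d = (\<lambda>s. dim {v \<in> V. s v = (0::real)})"
  define P where "P = (\<lambda>s. seminorm_on V s \<and> charged s)"
  have "P s" using s by (simp add: P_def)
  then have "P (arg_min d P) \<and> (\<forall>t. P t --> d (arg_min d P) <= d t)" by (rule arg_min_nat_lemma[of P s d])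
  then obtain u where u: "P u" "\<forall>t. P t --> d u <= d t" by (elim conjE)
  have su: "seminorm_on V u" "charged u" using u(1) by (simp_all add: P_def)
  obtain c where c: "c > 0" "\<forall>\<epsilon>>0. c <= mass (near u \<epsilon>)" using su(2) unfolding charged_def by (elim exE conjE)
  define W where "W = {v \<in> V. u v = 0}"
  have W: "subspace W" "W \<subseteq> V" unfolding W_def by (rule subspace_seminorm_kernel[OF su(1) subspace_V]) blast
  define X where "X = (\<lambda>g. {v \<in> V. u (\<rho> g v) = 0})"
  have fin: "finite (X ` carrier G)"
    unfolding X_def
  proof (rule finite_translated_kernels[OF su(1) c])
    fix t assume "seminorm_on V t" "charged t"
    then have "P t" by (simp add: P_def)
    then show "dim {v \<in> V. u v = 0} <= dim {v \<in> V. t v = 0}" using spec[OF u(2), of t] by (simp add: d_def)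
  qed
  define H where "H = {g \<in> carrier G. (\<forall>w\<in>W. \<rho> g w \<in> W) \<and> (\<forall>w\<in>W. \<rho> (inv g) w \<in> W)}"
  have H: "subgroup H G"
  proof (rule subgroupI)
    show "H \<subseteq> carrier G" by (simp add: H_def subset_iff)
    have "\<one> \<in> H" using W(2) by (simp add: H_def one subset_iff)
    then show "H ~= {}" by blast
    show "inv g \<in> H" if "g \<in> H" for g using that by (simp add: H_def)
    show "g \<otimes> h \<in> H" if "g \<in> H" "h \<in> H" for g h
      using that W(2) by (simp add: H_def mult inv_mult_group subset_iff)
  qed
  have sep: "\<rho> (x \<otimes> inv y) w \<in> W" if xy: "x \<in> carrier G" "y \<in> carrier G" "X x = X y" and w: "w \<in> W" for x y w
  proof -
    have wV: "w \<in> V" "u w = 0" using w by (simp_all add: W_def)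
    have iV: "\<rho> (inv y) w \<in> V" using invariant[OF inv_closed[OF xy(2)] wV(1)] .
    then have "\<rho> (inv y) w \<in> X y" unfolding X_def using cancel_inv[OF xy(2) wV(1)] wV(2) by simp
    then have "\<rho> (inv y) w \<in> X x" by (simp only: xy(3))
    then have "u (\<rho> x (\<rho> (inv y) w)) = 0" unfolding X_def by simp
    then show ?thesis unfolding W_def using mult[OF xy(1) inv_closed[OF xy(2)] wV(1)] invariant[OF xy(1) iV] by simp
  qed
  have "finite_index G H"
  proof (rule finite_indexI[OF H fin])
    fix x y assume xy: "x \<in> carrier G" "y \<in> carrier G" "X x = X y"
    have i: "inv (x \<otimes> inv y) = y \<otimes> inv x" using xy by (simp add: inv_mult_group)
    show "x \<otimes> inv y \<in> H" unfolding H_def mem_Collect_eq i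
      using xy sep[OF xy] sep[OF xy(2,1) xy(3)[symmetric]] by (intro conjI ballI) simp_all
  qed
  then have "W = {0} \<or> W = V"
    by (rule strongly_irreducible[OF _ W]) (simp add: H_def)
  then have WV: "W = V"
  proof
    assume W0: "W = {0}"
    have "\<exists>\<delta>>0. \<forall>v\<in>V. \<delta> * norm v <= u v"
    proof (rule fin_dim_norm_ge[OF fin_dim su(1)])
      fix v assume "v \<in> V" "u v = 0"
      then have "v \<in> W" by (simp add: W_def)
      then show "v = 0" using W0 by simp
    qed
    then obtain \<delta> where \<delta>: "\<delta> > 0" "\<forall>v\<in>V. \<delta> * norm v <= u v" by (elim exE conjE)
    have "mass (near u \<delta>) <= 0"
      by (rule mass_empty) (use \<delta>(2) orbit_in in \<open>simp add: near_def not_less\<close>)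
    moreover have "c <= mass (near u \<delta>)" using c(2) \<delta>(1) by simp
    ultimately have False using c(1) by linarith
    then show ?thesis ..
  qed
  show ?thesis
  proof (rule ccontr)
    assume nz: "s v ~= 0"
    have "{v \<in> V. s v = 0} ~= V" using nz v by blast
    then have "dim {v \<in> V. s v = 0} < dim V"
      by (intro fin_dim_dim_less[OF fin_dim subspace_seminorm_kernel[OF s(1) subspace_V]]) simp_all
    moreover have "d u <= d s" using spec[OF u(2), of s] s by (simp add: P_def)
    moreover have "d u = dim V" using WV by (simp add: d_def W_def)
    ultimately show False by (simp add: d_def)
  qed
qed

end

context furstenberg
begin

text \<open>
  Suppose that the elements \<open>g\<close> distort \<open>V\<close> without bound.  A limit of normalized such elements is a
  singular operator \<open>T ~= 0\<close>.  Most of the mass stays away from the kernel of \<open>T\<close>, so it is moved by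
  these elements close to the image of \<open>T\<close>, and the mean is invariant.  Hence a linear form that
  vanishes on that image is charged, which is impossible.
\<close>

lemma bounded_distortion:
  assumes B: "finite B" "independent B" "span B = V"
  shows "\<exists>c>0. \<forall>g\<in>carrier G. \<forall>v\<in>V. c * (\<Sum>b\<in>B. norm (\<rho> g b)) * norm v <= norm (\<rho> g v)"
proof (rule ccontr)
  define N where "N = (\<lambda>g. \<Sum>b\<in>B. norm (\<rho> g b))"
  assume "\<not> (\<exists>c>0. \<forall>g\<in>carrier G. \<forall>v\<in>V. c * (\<Sum>b\<in>B. norm (\<rho> g b)) * norm v <= norm (\<rho> g v))"
  then have neg: "\<forall>c>0. \<exists>g\<in>carrier G. \<exists>v\<in>V. norm (\<rho> g v) < c * N g * norm v"
    unfolding N_def by (simp add: not_le)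
  have "\<exists>M\<ge>0. \<forall>s. seminorm_on V s --> (\<forall>v\<in>V. s v <= M * (\<Sum>b\<in>B. s b) * norm v)"
    using seminorm_bound[OF B(1,2)] unfolding B(3) .
  then obtain M where M: "M >= 0" "\<forall>s. seminorm_on V s --> (\<forall>v\<in>V. s v <= M * (\<Sum>b\<in>B. s b) * norm v)"
    by (elim exE conjE)
  have BV: "b \<in> V" if "b \<in> B" for b using span_base[OF that] B(3) by simp
  have "\<exists>p. fst p \<in> carrier G \<and> snd p \<in> V \<and> norm (\<rho> (fst p) (snd p)) < 1 / real (Suc n) * N (fst p) * norm (snd p)" for n
  proof -
    have "\<exists>g\<in>carrier G. \<exists>v\<in>V. norm (\<rho> g v) < 1 / real (Suc n) * N g * norm v" by (rule mp[OF spec[OF neg]]) simp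
    then obtain g v where "g \<in> carrier G" "v \<in> V" "norm (\<rho> g v) < 1 / real (Suc n) * N g * norm v"
      by (elim bexE)
    then show ?thesis by (intro exI[of _ "(g, v)"]) simp
  qed
  then have "\<exists>p. \<forall>n. fst (p n) \<in> carrier G \<and> snd (p n) \<in> V \<and>
      norm (\<rho> (fst (p n)) (snd (p n))) < 1 / real (Suc n) * N (fst (p n)) * norm (snd (p n))"
    by (intro choice allI)
  then obtain p where p: "\<forall>n. fst (p n) \<in> carrier G \<and> snd (p n) \<in> V \<and>
      norm (\<rho> (fst (p n)) (snd (p n))) < 1 / real (Suc n) * N (fst (p n)) * norm (snd (p n))" by (rule exE)
  define a v where "a = (\<lambda>n. fst (p n))" and "v = (\<lambda>n. snd (p n))"
  have a: "a n \<in> carrier G" and v: "v n \<in> V"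
    and lt: "norm (\<rho> (a n) (v n)) < 1 / real (Suc n) * N (a n) * norm (v n)" for n
    using spec[OF p, of n] by (simp_all add: a_def v_def)
  have N_nonneg: "0 <= N g" for g by (simp add: N_def sum_nonneg)
  have Npos: "N (a n) > 0" and vpos: "norm (v n) > 0" for n
  proof -
    have "0 < 1 / real (Suc n) * N (a n) * norm (v n)" using lt[of n] norm_ge_zero le_less_trans by blast
    then show "N (a n) > 0" "norm (v n) > 0" using N_nonneg[of "a n"]
      by (auto simp: zero_less_mult_iff order_less_le)
  qed
  define x where "x = (\<lambda>b n. (1 / N (a n)) *\<^sub>R \<rho> (a n) b)"
  have xV: "x b n \<in> V" if "b \<in> B" for b n
    unfolding x_def by (rule subspace_scale[OF subspace_V invariant[OF a BV[OF that]]])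
  have xsum: "(\<Sum>b\<in>B. norm (x b n)) = 1" for n
  proof -
    have "(\<Sum>b\<in>B. norm (x b n)) = N (a n) / N (a n)"
      unfolding x_def N_def sum_divide_distrib using N_nonneg[of "a n"] by (simp add: N_def)
    then show ?thesis using Npos[of n] by simp
  qed
  have x1: "norm (x b n) <= 1" if "b \<in> B" for b n
    using member_le_sum[OF that _ B(1), of "\<lambda>b. norm (x b n)"] xsum[of n] by simp
  have "\<exists>r l. strict_mono r \<and> (\<forall>b\<in>B. l b \<in> V \<and> (\<lambda>n. x b (r n)) \<longlonglongrightarrow> l b)"
    by (rule fin_dim_common_subsequence[OF fin_dim B(1) xV x1])
  then obtain r l where r: "strict_mono r" and l: "\<forall>b\<in>B. l b \<in> V \<and> (\<lambda>n. x b (r n)) \<longlonglongrightarrow> l b"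
    by (elim exE conjE)
  obtain T where T: "linear T" "\<forall>b\<in>B. T b = l b"
    using linear_independent_extend[OF B(2), of l] by (elim exE conjE)
  have TV: "T w \<in> V" if "w \<in> V" for w
  proof -
    have "T ` V = span (T ` B)" using linear_span_image[OF T(1), of B] B(3) by simp
    also have "\<dots> \<subseteq> V" by (rule span_minimal[OF _ subspace_V]) (use T(2) l in auto)
    finally show ?thesis using that by blast
  qed
  define \<eta> where "\<eta> = (\<lambda>n. M * (\<Sum>b\<in>B. norm (x b (r n) - l b)))"
  have "(\<lambda>n. \<Sum>b\<in>B. norm (x b (r n) - l b)) \<longlonglongrightarrow> (\<Sum>b\<in>B. norm (l b - l b))"
    using l by (intro tendsto_intros) simp_all
  then have eta: "\<eta> \<longlonglongrightarrow> 0" unfolding \<eta>_def using tendsto_mult_right_zero by fastforce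
  have approx: "norm ((1 / N (a (r n))) *\<^sub>R \<rho> (a (r n)) w - T w) <= \<eta> n * norm w" if w: "w \<in> V" for n w
  proof -
    have lin: "linear (\<lambda>w. (1 / N (a (r n))) *\<^sub>R \<rho> (a (r n)) w - T w)"
      by (intro linear_compose_sub linear_compose_scale_right linear a T(1))
    have "norm ((1 / N (a (r n))) *\<^sub>R \<rho> (a (r n)) w - T w)
        <= M * (\<Sum>b\<in>B. norm ((1 / N (a (r n))) *\<^sub>R \<rho> (a (r n)) b - T b)) * norm w"
      by (rule bspec[OF mp[OF spec[OF M(2)] seminorm_on_norm_linear[OF lin]] w])
    also have "(\<Sum>b\<in>B. norm ((1 / N (a (r n))) *\<^sub>R \<rho> (a (r n)) b - T b)) = (\<Sum>b\<in>B. norm (x b (r n) - l b))"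
      by (rule sum.cong[OF refl]) (simp add: x_def T(2))
    finally show ?thesis by (simp add: \<eta>_def)
  qed
  have scale: "norm (\<rho> (a (r n)) w) = N (a (r n)) * norm ((1 / N (a (r n))) *\<^sub>R \<rho> (a (r n)) w)" for n w
    using Npos[of "r n"] by simp
  have Tnz: "\<exists>b\<in>B. norm (T b) ~= 0"
  proof (rule ccontr)
    assume "\<not> (\<exists>b\<in>B. norm (T b) ~= 0)"
    then have l0: "l b = 0" if "b \<in> B" for b using T(2) that by simp
    have "(\<lambda>n. \<Sum>b\<in>B. norm (x b (r n))) \<longlonglongrightarrow> (\<Sum>b\<in>B. norm (l b))"
      using l by (intro tendsto_intros) simp_all
    then show False using l0 by (simp add: xsum LIMSEQ_const_iff)
  qed
  have s1: "seminorm_on V (\<lambda>w. norm (T w))" by (rule seminorm_on_norm_linear[OF T(1)])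
  have sing: "\<exists>w\<in>V. w ~= 0 \<and> T w = 0"
  proof (rule ccontr)
    assume no: "\<not> (\<exists>w\<in>V. w ~= 0 \<and> T w = 0)"
    have "\<exists>\<delta>>0. \<forall>w\<in>V. \<delta> * norm w <= norm (T w)"
    proof (rule fin_dim_norm_ge[OF fin_dim s1])
      fix w assume "w \<in> V" "norm (T w) = 0"
      then show "w = 0" using no by auto
    qed
    then obtain \<delta> where \<delta>: "\<delta> > 0" "\<forall>w\<in>V. \<delta> * norm w <= norm (T w)" by (elim exE conjE)
    have "(\<lambda>n. 1 / real (Suc n)) \<longlonglongrightarrow> 0" using LIMSEQ_inverse_real_of_nat by (simp add: inverse_eq_divide)
    then have "(\<lambda>n. 1 / real (Suc (r n))) \<longlonglongrightarrow> 0" using LIMSEQ_subseq_LIMSEQ[OF _ r] by (simp add: comp_def)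
    then have "(\<lambda>n. 1 / real (Suc (r n)) + \<eta> n) \<longlonglongrightarrow> 0 + 0" by (intro tendsto_add eta)
    then have "\<forall>\<^sub>F n in sequentially. 1 / real (Suc (r n)) + \<eta> n < \<delta>"
      using \<delta>(1) by (intro order_tendstoD(2)) simp_all
    then obtain n where n: "1 / real (Suc (r n)) + \<eta> n < \<delta>" using eventually_happens trivial_limit_sequentially by blast
    let ?w = "v (r n)"
    have "norm ((1 / N (a (r n))) *\<^sub>R \<rho> (a (r n)) ?w) < 1 / real (Suc (r n)) * norm ?w"
      using lt[of "r n"] Npos[of "r n"] unfolding scale[of n ?w] by (simp add: field_simps)
    moreover have "norm (T ?w) <= norm ((1 / N (a (r n))) *\<^sub>R \<rho> (a (r n)) ?w) + \<eta> n * norm ?w"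
      using approx[OF v, of n "r n"] norm_triangle_ineq2[of "T ?w" "(1 / N (a (r n))) *\<^sub>R \<rho> (a (r n)) ?w"]
      by (simp add: norm_minus_commute)
    moreover have "\<delta> * norm ?w <= norm (T ?w)" by (rule bspec[OF \<delta>(2) v])
    ultimately have "\<delta> * norm ?w < (1 / real (Suc (r n)) + \<eta> n) * norm ?w" unfolding distrib_right by linarith
    then show False using n vpos[of "r n"] by (simp add: mult_less_cancel_right)
  qed
  then obtain w0 where w0: "w0 \<in> V" "w0 ~= 0" "T w0 = 0" by (elim bexE conjE)
  have "T ` V ~= V" by (rule fin_dim_singular_not_surjective[OF fin_dim T(1) w0])
  moreover have "T ` V \<subseteq> V" using TV by blast
  ultimately obtain z where z: "z \<in> V" "z \<notin> T ` V" by blast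
  obtain \<l> where \<l>: "linear \<l>" "\<forall>u\<in>T ` V. \<l> u = (0::real)" "\<l> z = 1"
    using proper_subspace_functional[OF linear_subspace_image[OF T(1) subspace_V] z(2)] by (elim exE conjE)
  have s2: "seminorm_on V (\<lambda>w. norm (\<l> w))" by (rule seminorm_on_norm_linear[OF \<l>(1)])
  obtain L where L: "L > 0" "\<forall>w\<in>V. norm (\<l> w) <= L * norm w" using fin_dim_seminorm_le[OF fin_dim s2] by (elim exE conjE)
  obtain b1 where b1: "b1 \<in> B" "norm (T b1) ~= 0" using Tnz by (elim bexE)
  have unch: "\<not> charged (\<lambda>w. norm (T w))"
  proof
    assume "charged (\<lambda>w. norm (T w))"
    from charged_zero[OF s1 this BV[OF b1(1)]] b1(2) show False by simp
  qed
  have unch': "\<forall>c>0. \<exists>\<epsilon>>0. mass (near (\<lambda>w. norm (T w)) \<epsilon>) < c"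
    using unch unfolding charged_def by (simp add: not_le)
  have "\<exists>\<epsilon>>0. mass (near (\<lambda>w. norm (T w)) \<epsilon>) < 1 / 2" by (rule mp[OF spec[OF unch', of "1/2"]]) simp
  then obtain \<epsilon> where \<epsilon>: "\<epsilon> > 0" "mass (near (\<lambda>w. norm (T w)) \<epsilon>) < 1 / 2" by (elim exE conjE)
  have "charged (\<lambda>w. norm (\<l> w))"
    unfolding charged_def
  proof (intro exI[of _ "1/2"] conjI allI impI)
    show "(0::real) < 1 / 2" by simp
    fix \<epsilon>' :: real assume \<epsilon>': "\<epsilon>' > 0"
    have "(\<lambda>n. L * \<eta> n + \<epsilon>' * \<eta> n) \<longlonglongrightarrow> L * 0 + \<epsilon>' * 0" by (intro tendsto_intros eta)
    then have "\<forall>\<^sub>F n in sequentially. L * \<eta> n + \<epsilon>' * \<eta> n < \<epsilon>' * \<epsilon>"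
      using mult_pos_pos[OF \<epsilon>' \<epsilon>(1)] by (intro order_tendstoD(2)) simp_all
    then obtain n where n: "L * \<eta> n + \<epsilon>' * \<eta> n < \<epsilon>' * \<epsilon>" using eventually_happens trivial_limit_sequentially by blast
    let ?g = "a (r n)"
    have "1 / 2 <= mass (- near (\<lambda>w. norm (T w)) \<epsilon>)" using \<epsilon>(2) by (simp add: mass_compl)
    also have "\<dots> <= mass {h. ?g \<otimes> h \<in> near (\<lambda>w. norm (\<l> w)) \<epsilon>'}"
    proof (rule mass_mono)
      fix h assume h: "h \<in> carrier G" and nh: "h \<in> - near (\<lambda>w. norm (T w)) \<epsilon>"
      let ?o = "orbit h"
      define e where "e = (1 / N ?g) *\<^sub>R \<rho> ?g ?o - T ?o"
      have o: "?o \<in> V" "norm ?o > 0" using orbit_in[OF h] orbit_nonzero[OF h] by simp_all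
      have e: "norm e <= \<eta> n * norm ?o" unfolding e_def by (rule approx[OF o(1)])
      have eV: "e \<in> V" unfolding e_def
        by (intro subspace_diff subspace_scale subspace_V invariant a o(1) TV)
      have far: "\<epsilon> * norm ?o <= norm (T ?o)" using nh by (simp add: near_def)
      have rho: "\<rho> ?g ?o = N ?g *\<^sub>R (T ?o + e)" using Npos[of "r n"] by (simp add: e_def)
      have "\<l> (\<rho> ?g ?o) = N ?g * (\<l> (T ?o) + \<l> e)"
        unfolding rho by (simp add: linear_scale[OF \<l>(1)] linear_add[OF \<l>(1)])
      also have "\<l> (T ?o) = 0" using \<l>(2) o(1) by simp
      finally have "norm (\<l> (\<rho> ?g ?o)) = N ?g * norm (\<l> e)" using Npos[of "r n"] by (simp add: abs_mult)
      also have "\<dots> <= N ?g * (L * (\<eta> n * norm ?o))"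
      proof (rule mult_left_mono[OF _ N_nonneg])
        have "norm (\<l> e) <= L * norm e" by (rule bspec[OF L(2) eV])
        also have "\<dots> <= L * (\<eta> n * norm ?o)" by (rule mult_left_mono[OF e]) (use L(1) in simp)
        finally show "norm (\<l> e) <= L * (\<eta> n * norm ?o)" .
      qed
      also have "\<dots> < N ?g * (\<epsilon>' * (\<epsilon> * norm ?o - \<eta> n * norm ?o))"
      proof (rule mult_strict_left_mono[OF _ Npos])
        have "(L * \<eta> n + \<epsilon>' * \<eta> n) * norm ?o < \<epsilon>' * \<epsilon> * norm ?o" by (rule mult_strict_right_mono[OF n o(2)])
        then show "L * (\<eta> n * norm ?o) < \<epsilon>' * (\<epsilon> * norm ?o - \<eta> n * norm ?o)" by (simp add: algebra_simps)
      qed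
      also have "\<dots> <= N ?g * (\<epsilon>' * norm (T ?o + e))"
      proof (intro mult_left_mono N_nonneg)
        show "\<epsilon> * norm ?o - \<eta> n * norm ?o <= norm (T ?o + e)"
          using far e norm_triangle_ineq2[of "T ?o" "- e"] by simp
      qed (use \<epsilon>' in simp)
      also have "\<dots> = \<epsilon>' * norm (\<rho> ?g ?o)" unfolding rho using N_nonneg[of ?g] by simp
      finally show "h \<in> {h. ?g \<otimes> h \<in> near (\<lambda>w. norm (\<l> w)) \<epsilon>'}"
        by (simp add: near_def orbit_mult[OF a h])
    qed
    also have "\<dots> = mass (near (\<lambda>w. norm (\<l> w)) \<epsilon>')" by (rule mass_translate[OF a])
    finally show "1 / 2 <= mass (near (\<lambda>w. norm (\<l> w)) \<epsilon>')" .
  qed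
  then have "norm (\<l> z) = 0" by (rule charged_zero[OF s2 _ z(1)])
  then show False using \<l>(3) by simp
qed

text \<open>
  With bounded distortion, the mean of the logarithmic growth along the orbit is a homomorphism to
  \<open>\<real>\<close> that controls the norms of the group elements.  It vanishes because \<open>G\<close> is rigid.
\<close>

lemma uniformly_bounded: "\<exists>C>0. \<forall>g\<in>carrier G. \<forall>v\<in>V. norm (\<rho> g v) <= C * norm v"
proof -
  obtain B where B: "finite B" "independent B" "span B = V" "card B = dim V" by (rule fin_dim_basis[OF fin_dim])
  define N where "N = (\<lambda>g. \<Sum>b\<in>B. norm (\<rho> g b))"
  have "\<exists>M\<ge>0. \<forall>s. seminorm_on V s --> (\<forall>v\<in>V. s v <= M * (\<Sum>b\<in>B. s b) * norm v)"
    using seminorm_bound[OF B(1,2)] unfolding B(3) .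
  then obtain M where M: "M >= 0" "\<forall>s. seminorm_on V s --> (\<forall>v\<in>V. s v <= M * (\<Sum>b\<in>B. s b) * norm v)"
    by (elim exE conjE)
  have up: "norm (\<rho> g v) <= M * N g * norm v" if "g \<in> carrier G" "v \<in> V" for g v
    unfolding N_def by (rule bspec[OF mp[OF spec[OF M(2)] seminorm_on_norm_linear[OF linear[OF that(1)]]] that(2)])
  obtain c where c: "c > 0" "\<forall>g\<in>carrier G. \<forall>v\<in>V. c * N g * norm v <= norm (\<rho> g v)"
    using bounded_distortion[OF B(1-3)] unfolding N_def by (elim exE conjE)
  have N_nonneg: "0 <= N g" for g by (simp add: N_def sum_nonneg)
  have MN: "M * N g > 0" if g: "g \<in> carrier G" for g
  proof -
    have "0 < norm (\<rho> g v0)" using orbit_nonzero[OF g] by (simp add: orbit_def)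
    also have "\<dots> <= M * N g * norm v0" by (rule up[OF g v0(1)])
    finally have "0 < M * N g * norm v0" .
    then show ?thesis using v0(2) by (simp add: zero_less_mult_iff)
  qed
  have Npos: "N g > 0" if g: "g \<in> carrier G" for g
    using MN[OF g] M(1) N_nonneg[of g] by (simp add: zero_less_mult_iff)
  define f where "f = (\<lambda>g h. ln (norm (orbit (g \<otimes> h))) - ln (norm (orbit h)))"
  have flo: "ln (c * N g) <= f g h" and fup: "f g h <= ln (M * N g)" if g: "g \<in> carrier G" and h: "h \<in> carrier G" for g h
  proof -
    have p: "0 < norm (orbit h)" "0 < norm (orbit (g \<otimes> h))" using orbit_nonzero g h by simp_all
    have "c * N g * norm (orbit h) <= norm (orbit (g \<otimes> h))"
      unfolding orbit_mult[OF g h] by (rule bspec[OF bspec[OF c(2) g] orbit_in[OF h]])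
    then have "ln (c * N g * norm (orbit h)) <= ln (norm (orbit (g \<otimes> h)))"
      using c(1) Npos[OF g] p by (subst ln_le_cancel_iff) simp_all
    moreover have "ln (c * N g * norm (orbit h)) = ln (c * N g) + ln (norm (orbit h))"
      by (rule ln_mult_pos) (use c(1) Npos[OF g] p in simp_all)
    ultimately show "ln (c * N g) <= f g h" by (simp add: f_def)
    have "norm (orbit (g \<otimes> h)) <= M * N g * norm (orbit h)"
      unfolding orbit_mult[OF g h] by (rule up[OF g orbit_in[OF h]])
    then have "ln (norm (orbit (g \<otimes> h))) <= ln (M * N g * norm (orbit h))"
      using MN[OF g] p by (subst ln_le_cancel_iff) simp_all
    moreover have "ln (M * N g * norm (orbit h)) = ln (M * N g) + ln (norm (orbit h))"
      by (rule ln_mult_pos) (use MN[OF g] p in simp_all)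
    ultimately show "f g h <= ln (M * N g)" by (simp add: f_def)
  qed
  have bd: "f g \<in> bounded_functions G" if g: "g \<in> carrier G" for g
  proof (rule bounded_functionsI)
    fix h assume "h \<in> carrier G"
    from flo[OF g this] fup[OF g this] show "\<bar>f g h\<bar> <= \<bar>ln (c * N g)\<bar> + \<bar>ln (M * N g)\<bar>" by linarith
  qed
  have hom: "m (f (g \<otimes> k)) = m (f g) + m (f k)" if g: "g \<in> carrier G" and k: "k \<in> carrier G" for g k
  proof -
    have bt: "(\<lambda>h. f g (k \<otimes> h)) \<in> bounded_functions G" by (rule bounded_functions_translate[OF bd[OF g] k])
    have le: "m (f (g \<otimes> k)) <= m (\<lambda>h. f g (k \<otimes> h) + f k h)"
      by (rule mean_mono[OF bd[OF m_closed[OF g k]] bounded_functions_add[OF bt bd[OF k]]])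
        (simp add: f_def m_assoc g k)
    have ge: "m (\<lambda>h. f g (k \<otimes> h) + f k h) <= m (f (g \<otimes> k))"
      by (rule mean_mono[OF bounded_functions_add[OF bt bd[OF k]] bd[OF m_closed[OF g k]]])
        (simp add: f_def m_assoc g k)
    have "m (\<lambda>h. f g (k \<otimes> h) + f k h) = m (f g) + m (f k)"
      using mean_add[OF bt bd[OF k]] mean_translate[OF bd[OF g] k] by simp
    then show ?thesis using le ge by linarith
  qed
  have zero: "m (f g) = 0" if "g \<in> carrier G" for g
    by (rule rigidD[OF rigid finite_index_carrier, of "\<lambda>g. m (f g)"]) (use hom that in simp_all)
  have Nle: "N g <= 1 / c" if g: "g \<in> carrier G" for g
  proof -
    have "m (\<lambda>_. ln (c * N g)) <= m (f g)" by (rule mean_mono[OF bounded_functions_const bd[OF g] flo[OF g]])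
    then have "ln (c * N g) <= 0" using zero[OF g] by (simp add: mean_const)
    then have "c * N g <= 1" using c(1) Npos[OF g] by (simp add: ln_le_zero_iff)
    then show ?thesis using c(1) by (simp add: field_simps)
  qed
  show ?thesis
  proof (intro exI[of _ "M / c + 1"] conjI ballI)
    show "0 < M / c + 1" using M(1) c(1) by (simp add: add_nonneg_pos)
    fix g v assume g: "g \<in> carrier G" and v: "v \<in> V"
    have "M * N g * norm v <= M * (1 / c) * norm v" using Nle[OF g] M(1) by (intro mult_right_mono mult_left_mono) simp_all
    also have "\<dots> <= (M / c + 1) * norm v" by (rule mult_right_mono) simp_all
    finally show "norm (\<rho> g v) <= (M / c + 1) * norm v" using up[OF g v] by linarith
  qed
qed

end

text \<open>Furstenberg's lemma for rigid amenable groups.\<close>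

lemma (in representation) strongly_irreducible_bounded:
  assumes am: "amenable G" and rigid: "rigid G"
    and irr: "\<And>H W. [|finite_index G H; subspace W; W \<subseteq> V; \<forall>h\<in>H. \<forall>w\<in>W. \<rho> h w \<in> W|] ==> W = {0} \<or> W = V"
  shows "\<exists>C>0. \<forall>g\<in>carrier G. \<forall>v\<in>V. norm (\<rho> g v) <= C * norm v"
proof (cases "V = {0}")
  case True
  then show ?thesis using linear_0[OF linear] by (intro exI[of _ 1]) simp
next
  case False
  then obtain v0 where v0: "v0 \<in> V" "v0 ~= 0" using subspace_0[OF subspace_V] by blast
  obtain m where m: "left_invariant_mean G m" using am unfolding amenable_def by (rule exE)
  have "furstenberg G V \<rho> m v0"
    by (intro furstenberg.intro representation_axioms mean_group.intro is_group mean_group_axioms.intro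
        furstenberg_axioms.intro m v0 rigid irr)
  then show ?thesis by (rule furstenberg.uniformly_bounded)
qed

section \<open>Adapted norms and fixed lattice points\<close>

lemma seminorm_onI_le:
  assumes V: "subspace V"
    and add: "\<And>v w. [|v \<in> V; w \<in> V|] ==> s (v + w) <= s v + s w"
    and scale: "\<And>v c. v \<in> V ==> s (c *\<^sub>R v) <= \<bar>c\<bar> * s v"
  shows "seminorm_on V s"
proof (rule seminorm_onI[OF add])
  fix v c assume v: "v \<in> V"
  show "s (c *\<^sub>R v) = \<bar>c\<bar> * s v"
  proof (cases "c = 0")
    case True
    have "0 <= s 0" using add[OF subspace_0[OF V] subspace_0[OF V]] by simp
    moreover have "s 0 <= 0" using scale[OF v, of 0] by simp
    ultimately show ?thesis using True by simp
  next
    case False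
    have "s ((1 / c) *\<^sub>R c *\<^sub>R v) <= \<bar>1 / c\<bar> * s (c *\<^sub>R v)" by (rule scale[OF subspace_scale[OF V v]])
    then have "\<bar>c\<bar> * s v <= s (c *\<^sub>R v)" using False by (simp add: field_simps)
    then show ?thesis using scale[OF v, of c] by simp
  qed
qed

text \<open>A bounded group action becomes isometric for the supremum of the norm along orbits.\<close>

lemma (in representation) invariant_norm:
  assumes C: "\<And>g v. [|g \<in> carrier G; v \<in> V|] ==> norm (\<rho> g v) <= C * norm v"
  shows "\<exists>\<nu>. seminorm_on V \<nu> \<and> (\<forall>v\<in>V. norm v <= \<nu> v) \<and> (\<forall>g\<in>carrier G. \<forall>v\<in>V. \<nu> (\<rho> g v) <= \<nu> v)"
proof -
  define \<nu> where "\<nu> = (\<lambda>v. SUP g\<in>carrier G. norm (\<rho> g v))"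
  have bdd: "bdd_above ((\<lambda>g. norm (\<rho> g v)) ` carrier G)" if "v \<in> V" for v
    by (rule bdd_aboveI2[of _ _ "C * norm v"]) (rule C[OF _ that])
  have up: "norm (\<rho> g v) <= \<nu> v" if "g \<in> carrier G" "v \<in> V" for g v
    unfolding \<nu>_def by (rule cSUP_upper[OF that(1) bdd[OF that(2)]])
  have least: "\<nu> v <= r" if "\<And>g. g \<in> carrier G ==> norm (\<rho> g v) <= r" for v r
    unfolding \<nu>_def by (rule cSUP_least) (use that one_closed in blast)+
  have "seminorm_on V \<nu>"
  proof (rule seminorm_onI_le[OF subspace_V])
    fix v w assume vw: "v \<in> V" "w \<in> V"
    show "\<nu> (v + w) <= \<nu> v + \<nu> w"
    proof (rule least)
      fix g assume g: "g \<in> carrier G"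
      show "norm (\<rho> g (v + w)) <= \<nu> v + \<nu> w"
        using norm_triangle_ineq[of "\<rho> g v" "\<rho> g w"] up[OF g vw(1)] up[OF g vw(2)]
        by (simp add: linear_add[OF linear[OF g]])
    qed
  next
    fix v c assume v: "v \<in> V"
    show "\<nu> (c *\<^sub>R v) <= \<bar>c\<bar> * \<nu> v"
    proof (rule least)
      fix g assume g: "g \<in> carrier G"
      have "\<bar>c\<bar> * norm (\<rho> g v) <= \<bar>c\<bar> * \<nu> v" by (rule mult_left_mono[OF up[OF g v]]) simp
      then show "norm (\<rho> g (c *\<^sub>R v)) <= \<bar>c\<bar> * \<nu> v" by (simp add: linear_scale[OF linear[OF g]])
    qed
  qed
  moreover have "\<forall>v\<in>V. norm v <= \<nu> v"
  proof
    fix v assume v: "v \<in> V"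
    show "norm v <= \<nu> v" using up[OF one_closed v] one[OF v] by simp
  qed
  moreover have "\<nu> (\<rho> g v) <= \<nu> v" if g: "g \<in> carrier G" and v: "v \<in> V" for g v
  proof (rule least)
    fix h assume h: "h \<in> carrier G"
    show "norm (\<rho> h (\<rho> g v)) <= \<nu> v" using up[OF m_closed[OF h g] v] mult[OF h g v] by simp
  qed
  ultimately show ?thesis by (intro exI[of _ \<nu>] conjI ballI) simp_all
qed

lemma (in representation) restrict_representation:
  assumes H: "subgroup H G" and W: "subspace W" "W \<subseteq> V" "\<forall>h\<in>H. \<forall>w\<in>W. \<rho> h w \<in> W"
  shows "representation (G\<lparr>carrier := H\<rparr>) W \<rho>"
proof (intro representation.intro subgroup_imp_group[OF H] representation_axioms.intro)
  note HG = subgroup.mem_carrier[OF H]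
  show "fin_dim W" by (rule fin_dim_subset[OF fin_dim W(1,2)])
  show "linear (\<rho> g)" if "g \<in> carrier (G\<lparr>carrier := H\<rparr>)" for g using that HG linear by simp
  show "\<rho> g v \<in> W" if "g \<in> carrier (G\<lparr>carrier := H\<rparr>)" "v \<in> W" for g v using that W(3) by simp
  show "\<rho> (g \<otimes>\<^bsub>G\<lparr>carrier := H\<rparr>\<^esub> h) v = \<rho> g (\<rho> h v)"
    if "g \<in> carrier (G\<lparr>carrier := H\<rparr>)" "h \<in> carrier (G\<lparr>carrier := H\<rparr>)" "v \<in> W" for g h v
    using that HG subsetD[OF W(2)] mult by simp
  show "\<rho> \<one>\<^bsub>G\<lparr>carrier := H\<rparr>\<^esub> v = v" if "v \<in> W" for v using that subsetD[OF W(2)] one by simp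
qed

lemma subspace_projection:
  fixes V :: "'v::real_vector set"
  assumes V: "fin_dim V" and W: "subspace W" "W \<subseteq> V" "W ~= {0}"
  shows "\<exists>\<pi> U. linear \<pi> \<and> subspace U \<and> U \<subseteq> V \<and> dim U < dim V \<and> (\<forall>w\<in>W. \<pi> w = 0) \<and> (\<forall>u\<in>U. \<pi> u = u) \<and>
    (\<forall>v\<in>V. \<pi> v \<in> U \<and> v - \<pi> v \<in> W)"
proof -
  obtain I where I: "finite I" "independent I" "span I = W" "card I = dim W"
    by (rule fin_dim_basis[OF fin_dim_subset[OF V W(1,2)]])
  have "I \<subseteq> V" using span_superset[of I] I(3) W(2) by simp
  then obtain B where B: "I \<subseteq> B" "finite B" "independent B" "span B = V" "card B = dim V"
    by (rule fin_dim_extend_basis[OF V I(2)])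
  have "\<exists>\<pi>. linear \<pi> \<and> (\<forall>b\<in>B. \<pi> b = (if b \<in> I then 0 else b))" by (rule linear_independent_extend[OF B(3)])
  then obtain \<pi> where \<pi>: "linear \<pi>" "\<forall>b\<in>B. \<pi> b = (if b \<in> I then 0 else b)" by (elim exE conjE)
  have "I ~= {}" using I(3) W(3) by auto
  then have "card (B - I) < card B" using B(1,2) by (intro psubset_card_mono) auto
  moreover have "dim (span (B - I)) <= card (B - I)" by (rule dim_le_card) (use B(2) in simp_all)
  ultimately have d: "dim (span (B - I)) < dim V" using B(5) by simp
  have 1: "\<pi> w = 0" if w: "w \<in> W" for w
  proof (rule linear_eq_0_on_span[OF \<pi>(1), of I])
    show "\<pi> b = 0" if "b \<in> I" for b using bspec[OF \<pi>(2) subsetD[OF B(1) that]] that by simp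
    show "w \<in> span I" using w I(3) by simp
  qed
  have 2: "\<pi> u = id u" if u: "u \<in> span (B - I)" for u
  proof (rule linear_eq_on_span[OF \<pi>(1) linear_id])
    show "\<pi> b = id b" if "b \<in> B - I" for b using \<pi>(2) that by simp
  qed (rule u)
  have 3: "\<pi> v \<in> span (B - I)" if v: "v \<in> V" for v
  proof -
    have "\<pi> ` V = span (\<pi> ` B)" using linear_span_image[OF \<pi>(1), of B] B(4) by simp
    also have "\<dots> \<subseteq> span (B - I)"
    proof (rule span_minimal[OF image_subsetI subspace_span])
      fix b assume "b \<in> B"
      then show "\<pi> b \<in> span (B - I)" using \<pi>(2) by (cases "b \<in> I") (simp_all add: span_zero span_base)
    qed
    finally show ?thesis using v by blast
  qed
  have 4: "v - \<pi> v \<in> W" if v: "v \<in> V" for v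
  proof -
    have lin: "linear (\<lambda>v. v - \<pi> v)" using linear_compose_sub[OF linear_id \<pi>(1)] by simp
    have "(\<lambda>v. v - \<pi> v) ` V = span ((\<lambda>v. v - \<pi> v) ` B)" using linear_span_image[OF lin, of B] B(4) by simp
    also have "\<dots> \<subseteq> W"
    proof (rule span_minimal[OF image_subsetI W(1)])
      fix b assume "b \<in> B"
      then show "b - \<pi> b \<in> W" using \<pi>(2) span_base[of b I] I(3) subspace_0[OF W(1)] by (cases "b \<in> I") simp_all
    qed
    finally show ?thesis using v by blast
  qed
  have 5: "span (B - I) \<subseteq> V" using span_mono[of "B - I" B] B(4) by auto
  show ?thesis
    by (intro exI[of _ \<pi>] exI[of _ "span (B - I)"] conjI ballI \<pi>(1) subspace_span d 1 3 4 5)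
      ((assumption | rule 2[unfolded id_apply])+)
qed

text \<open>
  A rigid amenable group acts with subexponential growth on every finite-dimensional space, after
  passing to a subgroup of finite index: for any finitely many elements there are norms in which they
  expand vectors by at most \<open>1 + \<epsilon>\<close>.  On a minimal subspace \<open>W\<close> that is invariant under a subgroup
  of finite index the action is bounded by Furstenberg's lemma.  The norm on a complement, from the
  quotient by \<open>W\<close>, gets a large weight \<open>K\<close>, which makes the off-diagonal part small.
\<close>

definition slowly_growing :: "'v::real_normed_vector set => ('g => 'v => 'v) => 'g set => real => bool" where
  "slowly_growing V \<rho> F \<epsilon> \<longleftrightarrow> (\<exists>\<nu> C. seminorm_on V \<nu> \<and> (\<forall>v\<in>V. norm v <= C * \<nu> v) \<and>
     (\<forall>f\<in>F. \<forall>v\<in>V. \<nu> (\<rho> f v) <= (1 + \<epsilon>) * \<nu> v))"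

text \<open>
  In block form, an element of \<open>F\<close> acts by isometries on \<open>W\<close>, expands \<open>U\<close> by at most \<open>1 + \<epsilon> / 2\<close>, and
  has an off-diagonal block from \<open>U\<close> to \<open>W\<close>, which the weight \<open>K\<close> absorbs into the other \<open>\<epsilon> / 2\<close>.
\<close>

lemma (in representation) slowly_growing_extension:
  assumes H: "subgroup H G"
    and W: "subspace W" "W \<subseteq> V" "\<forall>h\<in>H. \<forall>w\<in>W. \<rho> h w \<in> W"
    and bd: "\<forall>h\<in>H. \<forall>w\<in>W. norm (\<rho> h w) <= C1 * norm w"
    and \<pi>: "linear \<pi>" "subspace U" "U \<subseteq> V" "\<And>w. w \<in> W ==> \<pi> w = 0"
      "\<And>v. v \<in> V ==> \<pi> v \<in> U" "\<And>v. v \<in> V ==> v - \<pi> v \<in> W"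
    and F: "finite F" "F \<subseteq> H" and \<epsilon>: "\<epsilon> > 0"
    and quot: "slowly_growing U (\<lambda>h v. \<pi> (\<rho> h v)) F (\<epsilon> / 2)"
  shows "slowly_growing V \<rho> F \<epsilon>"
proof -
  note HG = subgroup.mem_carrier[OF H]
  have FG: "f \<in> carrier G" "f \<in> H" if "f \<in> F" for f using that F(2) HG by auto
  interpret W: representation "G\<lparr>carrier := H\<rparr>" W \<rho> by (rule restrict_representation[OF H W])
  have "\<exists>\<nu>. seminorm_on W \<nu> \<and> (\<forall>v\<in>W. norm v <= \<nu> v) \<and>
      (\<forall>g\<in>carrier (G\<lparr>carrier := H\<rparr>). \<forall>v\<in>W. \<nu> (\<rho> g v) <= \<nu> v)"
    by (rule W.invariant_norm[of C1]) (use bd in simp)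
  then obtain \<nu>1 where n1: "seminorm_on W \<nu>1" "\<forall>v\<in>W. norm v <= \<nu>1 v" "\<forall>g\<in>H. \<forall>v\<in>W. \<nu>1 (\<rho> g v) <= \<nu>1 v"
    by (elim exE conjE) simp
  obtain \<nu>2 C2 where n2: "seminorm_on U \<nu>2" "\<forall>v\<in>U. norm v <= C2 * \<nu>2 v"
    "\<forall>f\<in>F. \<forall>v\<in>U. \<nu>2 (\<pi> (\<rho> f v)) <= (1 + \<epsilon> / 2) * \<nu>2 v"
    using quot unfolding slowly_growing_def by (elim exE conjE)
  have nn2: "0 <= \<nu>2 u" if "u \<in> U" for u by (rule seminorm_on_nonneg[OF n2(1) \<pi>(2) that])
  have nn1: "0 <= \<nu>1 w" if "w \<in> W" for w by (rule seminorm_on_nonneg[OF n1(1) W(1) that])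
  have C2: "norm u <= \<bar>C2\<bar> * \<nu>2 u" if "u \<in> U" for u
    using bspec[OF n2(2) that] mult_right_mono[OF abs_ge_self nn2[OF that], of C2] by linarith
  have fU: "fin_dim U" by (rule fin_dim_subset[OF fin_dim \<pi>(2,3)])
  have "\<forall>f\<in>F. \<exists>D>0. \<forall>u\<in>U. \<nu>1 (\<rho> f u - \<pi> (\<rho> f u)) <= D * norm u"
  proof
    fix f assume f: "f \<in> F"
    have lin: "linear (\<lambda>u. \<rho> f u - \<pi> (\<rho> f u))"
      using linear_compose_sub[OF linear[OF FG(1)[OF f]] linear_compose[OF linear[OF FG(1)[OF f]] \<pi>(1)]]
      by (simp add: comp_def)
    show "\<exists>D>0. \<forall>u\<in>U. \<nu>1 (\<rho> f u - \<pi> (\<rho> f u)) <= D * norm u"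
      by (rule fin_dim_seminorm_le[OF fU seminorm_on_comp[OF n1(1) lin]])
        (rule \<pi>(6), rule invariant[OF FG(1)[OF f]], rule subsetD[OF \<pi>(3)])
  qed
  then obtain D where D: "\<forall>f\<in>F. D f > 0 \<and> (\<forall>u\<in>U. \<nu>1 (\<rho> f u - \<pi> (\<rho> f u)) <= D f * norm u)"
    by (rule bchoice[elim_format]) (elim exE)
  define S where "S = (\<Sum>f\<in>F. D f) * \<bar>C2\<bar>"
  have S: "\<nu>1 (\<rho> f u - \<pi> (\<rho> f u)) <= S * \<nu>2 u" if f: "f \<in> F" and u: "u \<in> U" for f u
  proof -
    have "\<nu>1 (\<rho> f u - \<pi> (\<rho> f u)) <= D f * norm u" using D f u by simp
    also have "\<dots> <= (\<Sum>f\<in>F. D f) * norm u"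
    proof (rule mult_right_mono)
      show "D f <= (\<Sum>f\<in>F. D f)" by (rule member_le_sum[OF f _ F(1)]) (use D in \<open>simp add: less_imp_le\<close>)
    qed simp
    also have "\<dots> <= (\<Sum>f\<in>F. D f) * (\<bar>C2\<bar> * \<nu>2 u)"
      by (rule mult_left_mono[OF C2[OF u]]) (use D in \<open>simp add: less_imp_le sum_nonneg\<close>)
    finally show ?thesis by (simp add: S_def mult.assoc)
  qed
  define K where "K = 1 + 2 * \<bar>S\<bar> / \<epsilon>"
  have "K * (\<epsilon> / 2) = \<epsilon> / 2 + \<bar>S\<bar>" using \<epsilon> by (simp add: K_def field_simps)
  moreover have "K >= 1" using \<epsilon> by (simp add: K_def)
  ultimately have K: "K >= 1" "S <= K * (\<epsilon> / 2)" using \<epsilon> by linarith+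
  define \<nu> where "\<nu> = (\<lambda>v. K * \<nu>2 (\<pi> v) + \<nu>1 (v - \<pi> v))"
  have linp: "linear (\<lambda>v. v - \<pi> v)" using linear_compose_sub[OF linear_id \<pi>(1)] by simp
  have s2: "seminorm_on V (\<lambda>v. K * \<nu>2 (\<pi> v))"
  proof (rule seminorm_onI)
    fix v w assume vw: "v \<in> V" "w \<in> V"
    show "K * \<nu>2 (\<pi> (v + w)) <= K * \<nu>2 (\<pi> v) + K * \<nu>2 (\<pi> w)"
      unfolding distrib_left[symmetric] linear_add[OF \<pi>(1)]
      by (rule mult_left_mono[OF seminorm_on_add[OF n2(1) \<pi>(5)[OF vw(1)] \<pi>(5)[OF vw(2)]]]) (use K in simp)
  next
    fix v c assume v: "v \<in> V"
    show "K * \<nu>2 (\<pi> (c *\<^sub>R v)) = \<bar>c\<bar> * (K * \<nu>2 (\<pi> v))"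
      using seminorm_on_scale[OF n2(1) \<pi>(5)[OF v], of c] by (simp add: linear_scale[OF \<pi>(1)])
  qed
  have sn: "seminorm_on V \<nu>"
    unfolding \<nu>_def by (rule seminorm_on_plus[OF s2 seminorm_on_comp[OF n1(1) linp \<pi>(6)]])
  have low: "norm v <= (\<bar>C2\<bar> + 1) * \<nu> v" if v: "v \<in> V" for v
  proof -
    have a: "0 <= \<nu>2 (\<pi> v)" "0 <= \<nu>1 (v - \<pi> v)" using nn1 nn2 \<pi>(5,6)[OF v] by simp_all
    have b: "\<nu>2 (\<pi> v) <= K * \<nu>2 (\<pi> v)" using mult_right_mono[OF K(1) a(1)] by simp
    have c: "norm v <= norm (\<pi> v) + norm (v - \<pi> v)" using norm_triangle_ineq[of "\<pi> v" "v - \<pi> v"] by simp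
    have d: "norm (v - \<pi> v) <= \<nu>1 (v - \<pi> v)" by (rule bspec[OF n1(2) \<pi>(6)[OF v]])
    have e: "\<bar>C2\<bar> * \<nu>2 (\<pi> v) <= \<bar>C2\<bar> * (K * \<nu>2 (\<pi> v))" by (rule mult_left_mono[OF b]) simp
    have g: "0 <= \<bar>C2\<bar> * \<nu>1 (v - \<pi> v)" using a by simp
    show ?thesis using C2[OF \<pi>(5)[OF v]] a b c d e g unfolding \<nu>_def distrib_left distrib_right by linarith
  qed
  have grow: "\<nu> (\<rho> f v) <= (1 + \<epsilon>) * \<nu> v" if f: "f \<in> F" and v: "v \<in> V" for f v
  proof -
    note lf = linear[OF FG(1)[OF f]]
    define u w where "u = \<pi> v" and "w = v - \<pi> v"
    have u: "u \<in> U" and w: "w \<in> W" and vuw: "v = u + w" using \<pi>(5,6)[OF v] by (simp_all add: u_def w_def)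
    have uV: "u \<in> V" using u \<pi>(3) by blast
    have rw: "\<rho> f w \<in> W" using W(3) FG(2)[OF f] w by simp
    have p: "\<pi> (\<rho> f v) = \<pi> (\<rho> f u)"
      unfolding vuw linear_add[OF lf] linear_add[OF \<pi>(1)] by (simp add: \<pi>(4)[OF rw])
    have q: "\<rho> f v - \<pi> (\<rho> f v) = \<rho> f w + (\<rho> f u - \<pi> (\<rho> f u))"
      unfolding p unfolding vuw linear_add[OF lf] by simp
    have "\<nu>1 (\<rho> f v - \<pi> (\<rho> f v)) <= \<nu>1 (\<rho> f w) + \<nu>1 (\<rho> f u - \<pi> (\<rho> f u))"
      unfolding q by (rule seminorm_on_add[OF n1(1) rw \<pi>(6)[OF invariant[OF FG(1)[OF f] uV]]])
    also have "\<dots> <= \<nu>1 w + S * \<nu>2 u"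
      using bspec[OF bspec[OF n1(3) FG(2)[OF f]] w] S[OF f u] by (rule add_mono)
    finally have A: "\<nu>1 (\<rho> f v - \<pi> (\<rho> f v)) <= \<nu>1 w + S * \<nu>2 u" .
    have B: "S * \<nu>2 u <= K * (\<epsilon> / 2) * \<nu>2 u" by (rule mult_right_mono[OF K(2) nn2[OF u]])
    have "K * \<nu>2 (\<pi> (\<rho> f v)) <= K * ((1 + \<epsilon> / 2) * \<nu>2 u)"
      unfolding p by (rule mult_left_mono[OF bspec[OF bspec[OF n2(3) f] u]]) (use K in simp)
    then have "\<nu> (\<rho> f v) <= K * ((1 + \<epsilon> / 2) * \<nu>2 u) + (\<nu>1 w + K * (\<epsilon> / 2) * \<nu>2 u)"
      using A B unfolding \<nu>_def by linarith
    also have "\<dots> = (1 + \<epsilon>) * (K * \<nu>2 u) + \<nu>1 w" by (simp add: algebra_simps)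
    also have "\<dots> <= (1 + \<epsilon>) * (K * \<nu>2 u) + (1 + \<epsilon>) * \<nu>1 w"
      using mult_right_mono[of 1 "1 + \<epsilon>", OF _ nn1[OF w]] \<epsilon> by simp
    also have "\<dots> = (1 + \<epsilon>) * \<nu> v" by (simp add: \<nu>_def u_def w_def distrib_left)
    finally show ?thesis .
  qed
  show ?thesis
    unfolding slowly_growing_def by (intro exI[of _ \<nu>] exI[of _ "\<bar>C2\<bar> + 1"] conjI ballI sn low grow)
qed

lemma (in representation) quotient_representation:
  assumes H: "subgroup H G"
    and W: "\<forall>h\<in>H. \<forall>w\<in>W. \<rho> h w \<in> W"
    and \<pi>: "linear \<pi>" "subspace U" "U \<subseteq> V" "\<And>w. w \<in> W ==> \<pi> w = 0"
      "\<And>v. v \<in> V ==> \<pi> v \<in> U" "\<And>v. v \<in> V ==> v - \<pi> v \<in> W" "\<And>u. u \<in> U ==> \<pi> u = u"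
  shows "representation (G\<lparr>carrier := H\<rparr>) U (\<lambda>h v. \<pi> (\<rho> h v))"
proof (intro representation.intro subgroup_imp_group[OF H] representation_axioms.intro)
  note HG = subgroup.mem_carrier[OF H]
  show "fin_dim U" by (rule fin_dim_subset[OF fin_dim \<pi>(2,3)])
  show "linear (\<lambda>v. \<pi> (\<rho> g v))" if "g \<in> carrier (G\<lparr>carrier := H\<rparr>)" for g
    using that linear_compose[OF linear \<pi>(1), of g] HG by (simp add: comp_def)
  show "\<pi> (\<rho> g v) \<in> U" if "g \<in> carrier (G\<lparr>carrier := H\<rparr>)" "v \<in> U" for g v
    using that HG by (intro \<pi>(5) invariant subsetD[OF \<pi>(3)]) simp_all
  show "\<pi> (\<rho> (g \<otimes>\<^bsub>G\<lparr>carrier := H\<rparr>\<^esub> h) v) = \<pi> (\<rho> g (\<pi> (\<rho> h v)))"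
    if "g \<in> carrier (G\<lparr>carrier := H\<rparr>)" "h \<in> carrier (G\<lparr>carrier := H\<rparr>)" "v \<in> U" for g h v
  proof -
    have gh: "g \<in> carrier G" "h \<in> carrier G" "g \<in> H" using that HG by simp_all
    have v: "v \<in> V" using that(3) \<pi>(3) by blast
    define y where "y = \<rho> h v"
    have "\<rho> g (y - \<pi> y) \<in> W" using W gh(3) \<pi>(6)[of y] invariant[OF gh(2) v] by (simp add: y_def)
    then have "\<pi> (\<rho> g (y - \<pi> y)) = 0" by (rule \<pi>(4))
    then have "\<pi> (\<rho> g y) = \<pi> (\<rho> g (\<pi> y))" by (simp add: linear_diff[OF linear[OF gh(1)]] linear_diff[OF \<pi>(1)])
    then show ?thesis using mult[OF gh(1,2) v] by (simp add: y_def)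
  qed
  show "\<pi> (\<rho> \<one>\<^bsub>G\<lparr>carrier := H\<rparr>\<^esub> v) = v" if "v \<in> U" for v using that subsetD[OF \<pi>(3)] one \<pi>(7) by simp
qed

lemma rigid_amenable_slowly_growing:
  assumes "representation G V \<rho>" "amenable G" "rigid G"
  shows "\<exists>H. finite_index G H \<and> (\<forall>F \<epsilon>. finite F --> F \<subseteq> H --> \<epsilon> > 0 --> slowly_growing V \<rho> F \<epsilon>)"
  using assms
proof (induction "dim V" arbitrary: G V \<rho> rule: less_induct)
  case (less V G \<rho>)
  interpret representation G V \<rho> by (rule less.prems(1))
  show ?case
  proof (cases "V = {0}")
    case True
    have "slowly_growing V \<rho> F \<epsilon>" if F: "F \<subseteq> carrier G" for F \<epsilon>
    proof -
      have "\<rho> f 0 = 0" if "f \<in> F" for f using linear_0[OF linear] that F by blast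
      then show ?thesis
        unfolding slowly_growing_def using True
        by (intro exI[of _ norm] exI[of _ 1]) (simp add: seminorm_on_def)
    qed
    then show ?thesis by (intro exI[of _ "carrier G"] conjI finite_index_carrier allI impI)
  next
    case False
    define P where "P = (\<lambda>W. subspace W \<and> W \<subseteq> V \<and> W ~= {0} \<and>
        (\<exists>H. finite_index G H \<and> (\<forall>h\<in>H. \<forall>w\<in>W. \<rho> h w \<in> W)))"
    have "P V" unfolding P_def
      by (intro conjI exI[of _ "carrier G"] subspace_V subset_refl False finite_index_carrier ballI invariant)
    then have "P (arg_min dim P) \<and> (\<forall>W. P W --> dim (arg_min dim P) <= dim W)" by (rule arg_min_nat_lemma[of P V dim])
    then obtain W where PW: "P W" and min: "\<forall>W'. P W' --> dim W <= dim W'" by (elim conjE)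
    obtain H where W: "subspace W" "W \<subseteq> V" "W ~= {0}" and H: "finite_index G H" and HW: "\<forall>h\<in>H. \<forall>w\<in>W. \<rho> h w \<in> W"
      using PW unfolding P_def by (elim exE conjE)
    note sH = finite_indexD(1)[OF H]
    interpret W: representation "G\<lparr>carrier := H\<rparr>" W \<rho> by (rule restrict_representation[OF sH W(1,2) HW])
    have am: "amenable (G\<lparr>carrier := H\<rparr>)" by (rule amenable_subgroup[OF less.prems(2) sH])
    have ri: "rigid (G\<lparr>carrier := H\<rparr>)" by (rule rigid_subgroup[OF less.prems(3) H])
    have "\<exists>C>0. \<forall>g\<in>carrier (G\<lparr>carrier := H\<rparr>). \<forall>v\<in>W. norm (\<rho> g v) <= C * norm v"
    proof (rule W.strongly_irreducible_bounded[OF am ri])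
      fix K W' assume K: "finite_index (G\<lparr>carrier := H\<rparr>) K"
        and W': "subspace W'" "W' \<subseteq> W" "\<forall>h\<in>K. \<forall>w\<in>W'. \<rho> h w \<in> W'"
      show "W' = {0} \<or> W' = W"
      proof (rule ccontr)
        assume no: "\<not> (W' = {0} \<or> W' = W)"
        then have "dim W' < dim W" by (intro fin_dim_dim_less[OF W.fin_dim W'(1,2)]) simp
        moreover have "P W'"
          unfolding P_def using no by (intro conjI exI[of _ K] W' finite_index_trans[OF H K] subset_trans[OF W'(2) W(2)]) simp
        ultimately show False using spec[OF min, of W'] by simp
      qed
    qed
    then obtain C where C: "\<forall>g\<in>H. \<forall>v\<in>W. norm (\<rho> g v) <= C * norm v" by (elim exE conjE) simp
    obtain \<pi> U where \<pi>: "linear \<pi>" "subspace U" "U \<subseteq> V" "dim U < dim V" "\<forall>w\<in>W. \<pi> w = 0"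
      "\<forall>u\<in>U. \<pi> u = u" "\<forall>v\<in>V. \<pi> v \<in> U \<and> v - \<pi> v \<in> W"
      using subspace_projection[OF fin_dim W] by (elim exE conjE)
    have p: "\<And>w. w \<in> W ==> \<pi> w = 0" "\<And>u. u \<in> U ==> \<pi> u = u" "\<And>v. v \<in> V ==> \<pi> v \<in> U" "\<And>v. v \<in> V ==> v - \<pi> v \<in> W"
      using \<pi>(5-7) by simp_all
    have rq: "representation (G\<lparr>carrier := H\<rparr>) U (\<lambda>h v. \<pi> (\<rho> h v))"
      by (rule quotient_representation[OF sH HW \<pi>(1-3) p(1,3,4,2)])
    obtain K where K: "finite_index (G\<lparr>carrier := H\<rparr>) K"
      "\<forall>F \<epsilon>. finite F --> F \<subseteq> K --> \<epsilon> > 0 --> slowly_growing U (\<lambda>h v. \<pi> (\<rho> h v)) F \<epsilon>"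
      using less.hyps[OF \<pi>(4) rq am ri] by (elim exE conjE)
    have KH: "K \<subseteq> H" using W.finite_indexD(1)[OF K(1)] subgroup.subset by fastforce
    have "slowly_growing V \<rho> F \<epsilon>" if F: "finite F" "F \<subseteq> K" and \<epsilon>: "\<epsilon> > 0" for F \<epsilon>
    proof (rule slowly_growing_extension[OF sH W(1,2) HW C \<pi>(1-3) p(1,3,4) F(1) subset_trans[OF F(2) KH] \<epsilon>])
      show "slowly_growing U (\<lambda>h v. \<pi> (\<rho> h v)) F (\<epsilon> / 2)" using K(2) F \<epsilon> by simp
    qed
    then show ?thesis by (intro exI[of _ K] conjI finite_index_trans[OF H K(1)] allI impI)
  qed
qed

text \<open>
  A nearly shortest lattice vector \<open>l\<close> for an adapted norm is fixed: \<open>f l - l\<close> is three times a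
  lattice vector, and its length is less than three times the minimum.
\<close>

lemma (in representation) finite_set_fixes_lattice_point:
  assumes slow: "slowly_growing V \<rho> F (1/2)"
    and L: "L \<subseteq> V" "c0 > 0" "\<And>l. [|l \<in> L; l ~= 0|] ==> c0 <= norm l" "l0 \<in> L" "l0 ~= 0"
    and F: "F \<subseteq> carrier G" "\<And>f l. [|f \<in> F; l \<in> L|] ==> \<exists>z\<in>L. \<rho> f l - l = 3 *\<^sub>R z"
  shows "\<exists>l\<in>L. l ~= 0 \<and> (\<forall>f\<in>F. \<rho> f l = l)"
proof -
  obtain \<nu> C where \<nu>: "seminorm_on V \<nu>" "\<forall>v\<in>V. norm v <= C * \<nu> v" "\<forall>f\<in>F. \<forall>v\<in>V. \<nu> (\<rho> f v) <= (1 + 1/2) * \<nu> v"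
    using slow unfolding slowly_growing_def by (elim exE conjE)
  have nn: "0 <= \<nu> v" if "v \<in> V" for v by (rule seminorm_on_nonneg[OF \<nu>(1) subspace_V that])
  define A where "A = \<nu> ` {l \<in> L. l ~= 0}"
  have C: "norm v <= (\<bar>C\<bar> + 1) * \<nu> v" if v: "v \<in> V" for v
  proof -
    have "C * \<nu> v <= (\<bar>C\<bar> + 1) * \<nu> v" by (rule mult_right_mono[OF _ nn[OF v]]) linarith
    then show ?thesis using bspec[OF \<nu>(2) v] by linarith
  qed
  have low: "c0 / (\<bar>C\<bar> + 1) <= \<nu> l" if "l \<in> L" "l ~= 0" for l
  proof -
    have "c0 <= (\<bar>C\<bar> + 1) * \<nu> l" using L(3)[OF that] C[of l] L(1) that(1) by (meson order_trans subsetD)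
    then show ?thesis by (simp add: pos_divide_le_eq mult.commute add_nonneg_pos)
  qed
  have ne: "A ~= {}" using L(4,5) by (auto simp: A_def)
  have bdd: "bdd_below A" unfolding A_def by (rule bdd_belowI2[of _ "c0 / (\<bar>C\<bar> + 1)"]) (use low in simp)
  have "c0 / (\<bar>C\<bar> + 1) <= Inf A" by (rule cInf_greatest[OF ne]) (use low in \<open>auto simp: A_def\<close>)
  moreover have "0 < c0 / (\<bar>C\<bar> + 1)" using L(2) by (simp add: add_nonneg_pos)
  ultimately have pos: "0 < Inf A" by linarith
  then have "Inf A < 11 / 10 * Inf A" by simp
  then obtain a where "a \<in> A" "a < 11 / 10 * Inf A" using cInf_lessD[OF ne] by blast
  then obtain l where l: "l \<in> L" "l ~= 0" "\<nu> l < 11 / 10 * Inf A" unfolding A_def by blast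
  have lV: "l \<in> V" using l(1) L(1) by blast
  have "\<rho> f l = l" if f: "f \<in> F" for f
  proof (rule ccontr)
    assume ne: "\<rho> f l ~= l"
    obtain z where z: "z \<in> L" "\<rho> f l - l = 3 *\<^sub>R z" using F(2)[OF f l(1)] by (elim bexE)
    have zV: "z \<in> V" using z(1) L(1) by blast
    have "z ~= 0" using z(2) ne by auto
    then have "Inf A <= \<nu> z" using z(1) by (intro cInf_lower[OF _ bdd]) (simp add: A_def)
    have fV: "\<rho> f l \<in> V" using f F(1) invariant lV by blast
    have "3 * \<nu> z = \<nu> (\<rho> f l + - l)" using seminorm_on_scale[OF \<nu>(1) zV, of 3] z(2) by simp
    also have "\<dots> <= \<nu> (\<rho> f l) + \<nu> (- l)" by (rule seminorm_on_add[OF \<nu>(1) fV subspace_neg[OF subspace_V lV]])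
    also have "\<dots> <= (1 + 1/2) * \<nu> l + \<nu> l"
      using bspec[OF bspec[OF \<nu>(3) f] lV] seminorm_on_minus[OF \<nu>(1) lV] by simp
    also have "\<dots> = 5 / 2 * \<nu> l" by simp
    finally show False using l(3) \<open>Inf A <= \<nu> z\<close> pos by linarith
  qed
  then show ?thesis using l(1,2) by (intro bexI[of _ l]) simp_all
qed

text \<open>
  An element acts on \<open>L / 3 L\<close> through its values on representatives, and there are finitely many
  possibilities for these.
\<close>

lemma (in representation) lattice_congruence_subgroup:
  fixes red :: "'v => 'r"
  assumes H: "finite_index G H"
    and L: "L \<subseteq> V" "0 \<in> L" "\<And>x y. [|x \<in> L; y \<in> L|] ==> x - y \<in> L" "\<And>g l. [|g \<in> carrier G; l \<in> L|] ==> \<rho> g l \<in> L"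
    and red: "finite (red ` L)" "\<And>x y. [|x \<in> L; y \<in> L; red x = red y|] ==> \<exists>z\<in>L. x - y = 3 *\<^sub>R z"
  shows "finite_index G {g \<in> H. \<forall>l\<in>L. \<exists>z\<in>L. \<rho> g l - l = 3 *\<^sub>R z}" (is "finite_index G ?K")
proof -
  note HG = finite_indexD(3)[OF H] and sH = finite_indexD(1)[OF H]
  have neg: "- x \<in> L" if "x \<in> L" for x using L(3)[OF L(2) that] by simp
  have add: "x + y \<in> L" if "x \<in> L" "y \<in> L" for x y using L(3)[OF that(1) neg[OF that(2)]] by simp
  have LV: "x \<in> V" if "x \<in> L" for x using that L(1) by blast
  have K: "subgroup ?K G"
  proof (rule subgroupI)
    show "?K \<subseteq> carrier G" using HG by blast
    have "\<one> \<in> ?K" using subgroup.one_closed[OF sH] L(2) LV by (auto simp: one intro!: bexI[of _ 0])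
    then show "?K ~= {}" by blast
  next
    fix g assume g: "g \<in> ?K"
    then have gH: "g \<in> H" and gG: "g \<in> carrier G" using HG by auto
    have "\<exists>z\<in>L. \<rho> (inv g) l - l = 3 *\<^sub>R z" if l: "l \<in> L" for l
    proof -
      obtain z where z: "z \<in> L" "\<rho> g l - l = 3 *\<^sub>R z" using g l by blast
      note li = linear[OF inv_closed[OF gG]]
      have "\<rho> (inv g) (\<rho> g l - l) = 3 *\<^sub>R \<rho> (inv g) z" unfolding z(2) by (rule linear_scale[OF li])
      then have "\<rho> (inv g) l - l = 3 *\<^sub>R (- \<rho> (inv g) z)"
        unfolding linear_diff[OF li] inv_cancel[OF gG LV[OF l]] by (simp add: algebra_simps)
      then show ?thesis using neg[OF L(4)[OF inv_closed[OF gG] z(1)]] by (rule bexI)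
    qed
    then show "inv g \<in> ?K" using subgroup.m_inv_closed[OF sH gH] by simp
  next
    fix g h assume g: "g \<in> ?K" and h: "h \<in> ?K"
    have gG: "g \<in> carrier G" "h \<in> carrier G" using g h HG by auto
    have "\<exists>z\<in>L. \<rho> (g \<otimes> h) l - l = 3 *\<^sub>R z" if l: "l \<in> L" for l
    proof -
      obtain z where z: "z \<in> L" "\<rho> h l - l = 3 *\<^sub>R z" using h l by blast
      obtain y where y: "y \<in> L" "\<rho> g l - l = 3 *\<^sub>R y" using g l by blast
      note lg = linear[OF gG(1)]
      have "\<rho> g (\<rho> h l - l) = 3 *\<^sub>R \<rho> g z" unfolding z(2) by (rule linear_scale[OF lg])
      then have "\<rho> (g \<otimes> h) l - l = 3 *\<^sub>R (\<rho> g z + y)"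
        using y(2) unfolding linear_diff[OF lg] mult[OF gG LV[OF l]] by (simp add: algebra_simps)
      then show ?thesis using add[OF L(4)[OF gG(1) z(1)] y(1)] by (rule bexI)
    qed
    then show "g \<otimes> h \<in> ?K" using subgroup.m_closed[OF sH] g h by simp
  qed
  define rep where "rep = (\<lambda>r. SOME l. l \<in> L \<and> red l = r)"
  have rep: "rep (red l) \<in> L \<and> red (rep (red l)) = red l" if "l \<in> L" for l
    unfolding rep_def by (rule someI[of _ l]) (use that in simp)
  define f where "f = (\<lambda>g. restrict (\<lambda>r. red (\<rho> g (rep r))) (red ` L))"
  show ?thesis
  proof (rule finite_index_within[OF H K])
    show "?K \<subseteq> H" by blast
    have "f ` H \<subseteq> (red ` L) \<rightarrow>\<^sub>E (red ` L)"
    proof (rule image_subsetI)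
      fix g assume "g \<in> H"
      then have "red (\<rho> g (rep r)) \<in> red ` L" if "r \<in> red ` L" for r
        using that rep L(4)[OF HG] by (intro imageI) blast
      then show "f g \<in> (red ` L) \<rightarrow>\<^sub>E (red ` L)" unfolding f_def by simp
    qed
    then show "finite (f ` H)" by (rule finite_subset) (intro finite_PiE red(1))
  next
    fix x y assume x: "x \<in> H" and y: "y \<in> H" and eq: "f x = f y"
    have xG: "x \<in> carrier G" "y \<in> carrier G" using x y HG by simp_all
    note lx = linear[OF xG(1)] and ly = linear[OF xG(2)]
    have main: "\<exists>z\<in>L. \<rho> x l - \<rho> y l = 3 *\<^sub>R z" if l: "l \<in> L" for l
    proof -
      define k where "k = rep (red l)"
      have k: "k \<in> L" "red l = red k" using rep[OF l] by (simp_all add: k_def)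
      obtain z where z: "z \<in> L" "l - k = 3 *\<^sub>R z" using red(2)[OF l k] by (elim bexE)
      have eqk: "red (\<rho> x k) = red (\<rho> y k)" using fun_cong[OF eq, of "red l"] l by (simp add: f_def k_def)
      obtain u where u: "u \<in> L" "\<rho> x k - \<rho> y k = 3 *\<^sub>R u" using red(2)[OF L(4)[OF xG(1) k(1)] L(4)[OF xG(2) k(1)] eqk] by (elim bexE)
      have "\<rho> x (l - k) = 3 *\<^sub>R \<rho> x z" "\<rho> y (l - k) = 3 *\<^sub>R \<rho> y z" unfolding z(2) by (rule linear_scale[OF lx] linear_scale[OF ly])+
      then have "\<rho> x l - \<rho> y l = 3 *\<^sub>R (u + (\<rho> x z - \<rho> y z))"
        using u(2) unfolding linear_diff[OF lx] linear_diff[OF ly] by (simp add: algebra_simps)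
      then show ?thesis using add[OF u(1) L(3)[OF L(4)[OF xG(1) z(1)] L(4)[OF xG(2) z(1)]]] by (rule bexI)
    qed
    have "\<exists>z\<in>L. \<rho> (x \<otimes> inv y) l - l = 3 *\<^sub>R z" if l: "l \<in> L" for l
      using main[OF L(4)[OF inv_closed[OF xG(2)] l]] mult[OF xG(1) inv_closed[OF xG(2)] LV[OF l]]
        cancel_inv[OF xG(2) LV[OF l]] by simp
    then show "x \<otimes> inv y \<in> ?K" using subgroup.m_closed[OF sH x subgroup.m_inv_closed[OF sH y]] by simp
  qed
qed

text \<open>
  Every finite set of elements has a nonzero fixed lattice point.  A finite set whose fixed space has
  the least dimension has the same fixed space as the whole group.
\<close>

lemma (in representation) fixed_lattice_point:
  fixes red :: "'v => 'r"
  assumes am: "amenable G" and rigid: "rigid G"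
    and L: "L \<subseteq> V" "0 \<in> L" "\<And>x y. [|x \<in> L; y \<in> L|] ==> x - y \<in> L" "\<And>g l. [|g \<in> carrier G; l \<in> L|] ==> \<rho> g l \<in> L"
    and disc: "c0 > 0" "\<And>l. [|l \<in> L; l ~= 0|] ==> c0 <= norm l" "l0 \<in> L" "l0 ~= 0"
    and red: "finite (red ` L)" "\<And>x y. [|x \<in> L; y \<in> L; red x = red y|] ==> \<exists>z\<in>L. x - y = 3 *\<^sub>R z"
  shows "\<exists>H. finite_index G H \<and> (\<exists>l\<in>L. l ~= 0 \<and> (\<forall>h\<in>H. \<rho> h l = l))"
proof -
  obtain H0 where H0: "finite_index G H0"
    "\<forall>F \<epsilon>. finite F --> F \<subseteq> H0 --> \<epsilon> > 0 --> slowly_growing V \<rho> F \<epsilon>"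
    using rigid_amenable_slowly_growing[OF representation_axioms am rigid] by (elim exE conjE)
  define H where "H = {g \<in> H0. \<forall>l\<in>L. \<exists>z\<in>L. \<rho> g l - l = 3 *\<^sub>R z}"
  have H: "finite_index G H" unfolding H_def by (rule lattice_congruence_subgroup[OF H0(1) L red])
  note HG = finite_indexD(3)[OF H]
  define Fix where "Fix = (\<lambda>F. {v \<in> V. \<forall>f\<in>F. \<rho> f v = v})"
  have sF: "subspace (Fix F)" if "F \<subseteq> H" for F
    unfolding subspace_def
  proof (intro conjI ballI allI)
    have lin: "linear (\<rho> f)" if "f \<in> F" for f using that \<open>F \<subseteq> H\<close> HG linear by blast
    show "0 \<in> Fix F" using linear_0[OF lin] subspace_0[OF subspace_V] by (simp add: Fix_def)
    show "x + y \<in> Fix F" if "x \<in> Fix F" "y \<in> Fix F" for x y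
      using that linear_add[OF lin] subspace_add[OF subspace_V] by (simp add: Fix_def)
    show "c *\<^sub>R x \<in> Fix F" if "x \<in> Fix F" for c x
      using that linear_scale[OF lin] subspace_scale[OF subspace_V] by (simp add: Fix_def)
  qed
  define P where "P = (\<lambda>F. finite F \<and> F \<subseteq> H)"
  have "P {}" by (simp add: P_def)
  then have "P (arg_min (\<lambda>F. dim (Fix F)) P) \<and> (\<forall>F. P F --> dim (Fix (arg_min (\<lambda>F. dim (Fix F)) P)) <= dim (Fix F))"
    by (rule arg_min_nat_lemma[of P "{}" "\<lambda>F. dim (Fix F)"])
  then obtain F where PF: "P F" and min: "\<forall>F'. P F' --> dim (Fix F) <= dim (Fix F')" by (elim conjE)
  have F: "finite F" "F \<subseteq> H" using PF by (simp_all add: P_def)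
  have "F \<subseteq> H0" using F(2) by (auto simp: H_def)
  then have slow: "slowly_growing V \<rho> F (1/2)" using H0(2) F(1) by simp
  have "\<exists>l\<in>L. l ~= 0 \<and> (\<forall>f\<in>F. \<rho> f l = l)"
  proof (rule finite_set_fixes_lattice_point[OF slow L(1) disc])
    show "F \<subseteq> carrier G" using F(2) HG by blast
    show "\<exists>z\<in>L. \<rho> f l - l = 3 *\<^sub>R z" if "f \<in> F" "l \<in> L" for f l
      using that F(2) by (auto simp: H_def)
  qed
  then obtain l where l: "l \<in> L" "l ~= 0" "\<forall>f\<in>F. \<rho> f l = l" by (elim bexE conjE)
  have lF: "l \<in> Fix F" using l(1,3) L(1) by (auto simp: Fix_def)
  have "\<rho> h l = l" if h: "h \<in> H" for h
  proof -
    have hF: "insert h F \<subseteq> H" "P (insert h F)" using h F by (simp_all add: P_def)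
    have "Fix (insert h F) = Fix F"
    proof (rule ccontr)
      assume ne: "Fix (insert h F) ~= Fix F"
      have sub: "Fix (insert h F) \<subseteq> Fix F" by (auto simp: Fix_def)
      have "fin_dim (Fix F)" by (rule fin_dim_subset[OF fin_dim sF[OF F(2)]]) (auto simp: Fix_def)
      then have "dim (Fix (insert h F)) < dim (Fix F)" by (rule fin_dim_dim_less[OF _ sF[OF hF(1)] sub ne])
      then show False using spec[OF min, of "insert h F"] hF(2) by simp
    qed
    then show ?thesis using lF by (auto simp: Fix_def)
  qed
  then show ?thesis using H l(1,2) by (intro exI[of _ H] conjI bexI[of _ l]) simp_all
qed

section \<open>Series with cyclic quotients\<close>

definition additive_on :: "('g, 'm) monoid_scheme => 'g set => ('g => real) => bool" where
  "additive_on G A \<psi> \<longleftrightarrow> (\<forall>a\<in>A. \<forall>b\<in>A. \<psi> (a \<otimes>\<^bsub>G\<^esub> b) = \<psi> a + \<psi> b)"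

lemma additive_onI: "(\<And>a b. [|a \<in> A; b \<in> A|] ==> \<psi> (a \<otimes>\<^bsub>G\<^esub> b) = \<psi> a + \<psi> b) ==> additive_on G A \<psi>"
  unfolding additive_on_def by (intro ballI)

lemma additive_onD: "[|additive_on G A \<psi>; a \<in> A; b \<in> A|] ==> \<psi> (a \<otimes>\<^bsub>G\<^esub> b) = \<psi> a + \<psi> b"
  unfolding additive_on_def by simp

context group
begin

lemma finite_carrier_if_finite_index:
  assumes H: "finite_index G H" "finite H" shows "finite (carrier G)"
proof -
  note sH = finite_indexD(1)[OF H(1)]
  have "finite C" if "C \<in> rcosets H" for C
    using that H(2) unfolding RCOSETS_def r_coset_def by auto
  then have "finite (\<Union>(rcosets H))" using finite_indexD(2)[OF H(1)] by (intro finite_Union)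
  then show ?thesis using rcosets_part_G[OF sH] by simp
qed

lemma cancel_right: "[|a \<in> carrier G; b \<in> carrier G|] ==> (a \<otimes> inv b) \<otimes> b = a"
  by (simp add: m_assoc)

lemma nat_pow_in_subgroup: "[|subgroup H G; h \<in> H|] ==> h [^] (k :: nat) \<in> H"
  using subgroup_int_pow_closed[of H h "int k"] by (simp add: int_pow_int)

lemma finite_subgroup_torsion:
  assumes D: "subgroup D G" "finite D" and d: "d \<in> D"
  shows "\<exists>k>0. d [^] (k::nat) = \<one>"
proof -
  have "range (\<lambda>k::nat. d [^] k) \<subseteq> D" using nat_pow_in_subgroup[OF D(1) d] by (intro image_subsetI)
  then have "finite (range (\<lambda>k::nat. d [^] k))" using D(2) by (rule finite_subset)
  then have "\<not> inj (\<lambda>k::nat. d [^] k)" using finite_imageD infinite_UNIV_nat by blast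
  then have "\<exists>i j::nat. i < j \<and> d [^] i = d [^] j" unfolding inj_on_def by (metis nat_neq_iff)
  then obtain i j :: nat where ij: "i < j" "d [^] i = d [^] j" by (elim exE conjE)
  have dG: "d \<in> carrier G" by (rule subgroup.mem_carrier[OF D(1) d])
  have "d [^] i \<otimes> d [^] (j - i) = d [^] i" using nat_pow_mult[OF dG, of i "j - i"] ij by simp
  then have "d [^] (j - i) = \<one>" using dG by simp
  then show ?thesis using ij(1) by (intro exI[of _ "j - i"] conjI) simp_all
qed

context
  fixes A \<psi>
  assumes A: "subgroup A G" and \<psi>: "additive_on G A \<psi>"
begin

lemma additive_one: "\<psi> \<one> = 0"
  using additive_onD[OF \<psi> subgroup.one_closed[OF A] subgroup.one_closed[OF A]] by simp

lemma additive_inv: "a \<in> A ==> \<psi> (inv a) = - \<psi> a"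
  using additive_onD[OF \<psi> _ subgroup.m_inv_closed[OF A], of a a] subgroup.mem_carrier[OF A, of a] additive_one
  by simp

lemma additive_nat_pow: "a \<in> A ==> \<psi> (a [^] (k::nat)) = real k * \<psi> a"
proof (induction k)
  case (Suc k)
  then show ?case using additive_onD[OF \<psi> nat_pow_in_subgroup[OF A, of a k] Suc.prems] by (simp add: distrib_right)
qed (simp add: additive_one)

lemma additive_int_pow:
  assumes a: "a \<in> A" shows "\<psi> (a [^] (j::int)) = of_int j * \<psi> a"
proof (cases j)
  case (nonneg k)
  then show ?thesis using additive_nat_pow[OF a, of k] by (simp add: int_pow_int)
next
  case (neg k)
  have aG: "a \<in> carrier G" by (rule subgroup.mem_carrier[OF A a])
  have "a [^] j = inv (a [^] Suc k)" unfolding neg by (rule int_pow_neg_int[OF aG])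
  then have "\<psi> (a [^] j) = - (real (Suc k) * \<psi> a)"
    by (simp only: additive_inv[OF nat_pow_in_subgroup[OF A a]] additive_nat_pow[OF a])
  also have "\<dots> = of_int j * \<psi> a" unfolding neg by (simp add: algebra_simps)
  finally show ?thesis .
qed

lemma additive_conj: "[|a \<in> A; b \<in> A|] ==> \<psi> (b \<otimes> a \<otimes> inv b) = \<psi> a"
  using additive_onD[OF \<psi> subgroup.m_closed[OF A] subgroup.m_inv_closed[OF A], of b a b]
    additive_onD[OF \<psi>, of b a] additive_inv[of b] by simp

lemma additive_torsion: "[|a \<in> A; k > 0; a [^] (k::nat) = \<one>|] ==> \<psi> a = 0"
  using additive_nat_pow[of a k] additive_one by simp

end

end

locale cyclic_series = group G for G :: "('g, 'm) monoid_scheme" (structure) +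
  fixes T :: "nat => 'g set" and x :: "nat => 'g" and n :: nat
  assumes T_0: "T 0 = {\<one>}"
    and T_subgroup: "i <= n ==> subgroup (T i) G"
    and T_Suc: "i < n ==> T i \<subseteq> T (Suc i)"
    and T_normal: "[|i < n; g \<in> T (Suc i); s \<in> T i|] ==> g \<otimes> s \<otimes> inv g \<in> T i"
    and generator_in: "i < n ==> x i \<in> T (Suc i)"
    and generator: "[|i < n; y \<in> T (Suc i)|] ==> \<exists>j::int. y \<otimes> inv (x i [^] j) \<in> T i"
begin

lemma T_carrier: "[|i <= n; y \<in> T i|] ==> y \<in> carrier G"
  by (rule subgroup.mem_carrier[OF T_subgroup])

lemma T_mono: "i <= j ==> j <= n ==> T i \<subseteq> T j"
proof (induction j)
  case (Suc j)
  show ?case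
  proof (cases "i = Suc j")
    case False
    then have "T i \<subseteq> T j" using Suc by simp
    also have "T j \<subseteq> T (Suc j)" using Suc.prems by (intro T_Suc) simp
    finally show ?thesis .
  qed simp
qed simp

lemma x_carrier: "i < n ==> x i \<in> carrier G"
  using T_carrier[OF _ generator_in, of i] by simp

text \<open>
  The exponent of \<open>x i\<close> modulo \<open>m\<close> separates the cosets.
\<close>

lemma finite_index_step:
  assumes i: "i < n" and m: "m > 0" "x i [^] (m::nat) \<in> T i"
  shows "finite_index (G\<lparr>carrier := T (Suc i)\<rparr>) (T i)"
proof -
  have s1: "subgroup (T (Suc i)) G" and s0: "subgroup (T i) G" using T_subgroup i by simp_all
  interpret S: group "G\<lparr>carrier := T (Suc i)\<rparr>" by (rule subgroup_imp_group[OF s1])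
  note a = x_carrier[OF i] and c0 = subgroup.mem_carrier[OF s0] and c1 = subgroup.mem_carrier[OF s1]
  have red: "\<exists>j::int. (0 <= j \<and> j < int m) \<and> y \<otimes> inv (x i [^] j) \<in> T i" if y: "y \<in> T (Suc i)" for y
  proof -
    obtain k :: int where k: "y \<otimes> inv (x i [^] k) \<in> T i" using generator[OF i y] by (elim exE)
    define t where "t = k div int m"
    have "(x i [^] m) [^] t \<in> T i" by (rule subgroup_int_pow_closed[OF s0 m(2)])
    then have p: "x i [^] (int m * t) \<in> T i" using int_pow_pow[OF a, of "int m" t] by (simp add: int_pow_int)
    have "x i [^] (int m * t + k mod int m) = x i [^] k" by (simp add: t_def)
    then have "x i [^] k = x i [^] (int m * t) \<otimes> x i [^] (k mod int m)" using int_pow_mult[OF a] by simp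
    then have "y \<otimes> inv (x i [^] (k mod int m)) = (y \<otimes> inv (x i [^] k)) \<otimes> x i [^] (int m * t)"
    proof -
      assume e: "x i [^] k = x i [^] (int m * t) \<otimes> x i [^] (k mod int m)"
      have cl: "x i [^] (int m * t) \<in> carrier G" "x i [^] (k mod int m) \<in> carrier G" using a by simp_all
      have "inv (x i [^] k) \<otimes> x i [^] (int m * t) = inv (x i [^] (k mod int m))"
        unfolding e using cl by (simp add: inv_mult_group m_assoc)
      then show ?thesis using c1[OF y] a by (simp add: m_assoc)
    qed
    then have "y \<otimes> inv (x i [^] (k mod int m)) \<in> T i" using subgroup.m_closed[OF s0 k p] by simp
    then show ?thesis using m(1) by (intro exI[of _ "k mod int m"]) simp
  qed
  define f where "f = (\<lambda>y. SOME j::int. (0 <= j \<and> j < int m) \<and> y \<otimes> inv (x i [^] j) \<in> T i)"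
  have f: "(0 <= f y \<and> f y < int m) \<and> y \<otimes> inv (x i [^] f y) \<in> T i" if "y \<in> T (Suc i)" for y
    unfolding f_def by (rule someI_ex[OF red[OF that]])
  show ?thesis
  proof (rule S.finite_indexI[of _ f])
    show "subgroup (T i) (G\<lparr>carrier := T (Suc i)\<rparr>)" by (rule subgroup_incl[OF s0 s1 T_Suc[OF i]])
    have "f ` carrier (G\<lparr>carrier := T (Suc i)\<rparr>) \<subseteq> {0..<int m}" using f by (intro image_subsetI) simp
    then show "finite (f ` carrier (G\<lparr>carrier := T (Suc i)\<rparr>))" by (rule finite_subset) simp
    fix y z assume "y \<in> carrier (G\<lparr>carrier := T (Suc i)\<rparr>)" "z \<in> carrier (G\<lparr>carrier := T (Suc i)\<rparr>)" and eq: "f y = f z"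
    then have y: "y \<in> T (Suc i)" and z: "z \<in> T (Suc i)" by simp_all
    have p: "y \<otimes> inv (x i [^] f y) \<in> T i" "z \<otimes> inv (x i [^] f y) \<in> T i" using f[OF y] f[OF z] eq by simp_all
    have "(y \<otimes> inv (x i [^] f y)) \<otimes> inv (z \<otimes> inv (x i [^] f y)) \<in> T i"
      by (rule subgroup.m_closed[OF s0 p(1) subgroup.m_inv_closed[OF s0 p(2)]])
    also have "(y \<otimes> inv (x i [^] f y)) \<otimes> inv (z \<otimes> inv (x i [^] f y)) = y \<otimes> inv z"
    proof -
      define c where "c = x i [^] f y"
      have c: "c \<in> carrier G" using a by (simp add: c_def)
      have "(y \<otimes> inv c) \<otimes> inv (z \<otimes> inv c) = y \<otimes> inv z"
        using c c1[OF y] c1[OF z] inv_cancel(2)[of "inv c" "inv z"] by (simp add: inv_mult_group m_assoc)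
      then show ?thesis by (simp add: c_def)
    qed
    finally show "y \<otimes>\<^bsub>G\<lparr>carrier := T (Suc i)\<rparr>\<^esub> inv\<^bsub>G\<lparr>carrier := T (Suc i)\<rparr>\<^esub> z \<in> T i"
      using m_inv_consistent[OF s1 z] by simp
  qed
qed

lemma infinite_step:
  assumes i: "i < n" and m: "m > 0" "x i [^] (m::nat) \<in> T i" and inf: "infinite (T (Suc i))"
  shows "infinite (T i)"
proof
  assume "finite (T i)"
  have "group (G\<lparr>carrier := T (Suc i)\<rparr>)" by (rule subgroup_imp_group[OF T_subgroup]) (use i in simp)
  from group.finite_carrier_if_finite_index[OF this finite_index_step[OF i m] \<open>finite (T i)\<close>] inf
  show False by simp
qed

lemma power_step:
  assumes i: "i < n" and m: "m > 0" "x i [^] (m::nat) \<in> T i"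
  shows "\<exists>k::nat. k > 0 \<and> (\<forall>y\<in>T (Suc i). y [^] k \<in> T i)"
proof -
  have "group (G\<lparr>carrier := T (Suc i)\<rparr>)" by (rule subgroup_imp_group[OF T_subgroup]) (use i in simp)
  from group.finite_index_pow[OF this finite_index_step[OF i m]]
  show ?thesis unfolding nat_pow_consistent[symmetric] by simp
qed

lemma infinite_order_element: "[|i <= n; infinite (T i)|] ==> \<exists>z\<in>T i. \<forall>k::nat. k > 0 --> z [^] k ~= \<one>"
proof (induction i)
  case 0
  then show ?case using T_0 by simp
next
  case (Suc i)
  then have i: "i < n" "i <= n" by simp_all
  show ?case
  proof (cases "\<exists>m::nat. m > 0 \<and> x i [^] m \<in> T i")
    case True
    then obtain m :: nat where m: "m > 0" "x i [^] m \<in> T i" by (elim exE conjE)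
    obtain z where z: "z \<in> T i" "\<forall>k::nat. k > 0 --> z [^] k ~= \<one>"
      using Suc.IH[OF i(2) infinite_step[OF i(1) m Suc.prems(2)]] by (elim bexE)
    show ?thesis by (intro bexI[of _ z] z(2) subsetD[OF T_Suc[OF i(1)] z(1)])
  next
    case False
    have one: "\<one> \<in> T i" by (rule subgroup.one_closed[OF T_subgroup[OF i(2)]])
    have "x i [^] k ~= \<one>" if "k > 0" for k :: nat
    proof
      assume "x i [^] k = \<one>"
      then have "k > 0 \<and> x i [^] k \<in> T i" using that one by simp
      then show False using False by blast
    qed
    then show ?thesis by (intro bexI[of _ "x i"] allI impI generator_in[OF i(1)])
  qed
qed

text \<open>
  The coefficients do not depend on the homomorphism.  Hence a homomorphism is determined by its values
  on the generators, and is integral if these are.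
\<close>

lemma additive_coefficients:
  assumes "i <= n" "y \<in> T i"
  shows "\<exists>c::nat => int. \<forall>\<psi>. additive_on G (T n) \<psi> --> \<psi> y = (\<Sum>k<i. of_int (c k) * \<psi> (x k))"
  using assms
proof (induction i arbitrary: y)
  case 0
  then have "y = \<one>" using T_0 by simp
  then show ?case using additive_one[OF T_subgroup[OF le_refl]] by simp
next
  case (Suc i)
  then have i: "i < n" "i <= n" by simp_all
  note sub = subsetD[OF T_mono[OF _ le_refl]]
  obtain j :: int where j: "y \<otimes> inv (x i [^] j) \<in> T i" using generator[OF i(1) Suc.prems(2)] by (elim exE)
  obtain c :: "nat => int" where c: "\<forall>\<psi>. additive_on G (T n) \<psi> \<longrightarrow>
      \<psi> (y \<otimes> inv (x i [^] j)) = (\<Sum>k<i. of_int (c k) * \<psi> (x k))" using Suc.IH[OF i(2) j] by (elim exE)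
  have yG: "y \<in> carrier G" by (rule T_carrier[OF Suc.prems])
  have xn: "x i \<in> T n" by (rule sub[OF Suc.prems(1) generator_in[OF i(1)]])
  have y: "y = (y \<otimes> inv (x i [^] j)) \<otimes> x i [^] j" using yG x_carrier[OF i(1)] by (simp add: m_assoc)
  have "\<psi> y = (\<Sum>k<Suc i. of_int ((c(i := j)) k) * \<psi> (x k))" if \<psi>: "additive_on G (T n) \<psi>" for \<psi>
  proof -
    have "\<psi> y = \<psi> (y \<otimes> inv (x i [^] j)) + \<psi> (x i [^] j)"
      by (subst y, rule additive_onD[OF \<psi> sub[OF i(2) j] subgroup_int_pow_closed[OF T_subgroup[OF le_refl] xn]])
    also have "\<psi> (x i [^] j) = of_int j * \<psi> (x i)" by (rule additive_int_pow[OF T_subgroup[OF le_refl] \<psi> xn])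
    also have "\<psi> (y \<otimes> inv (x i [^] j)) = (\<Sum>k<i. of_int ((c(i := j)) k) * \<psi> (x k))"
      using c \<psi> by simp
    finally show ?thesis by simp
  qed
  then show ?case by (intro exI[of _ "c(i := j)"] allI impI)
qed

text \<open>
  The exponent of \<open>x i\<close> gives the homomorphism if the quotient \<open>T (Suc i) / T i\<close> is infinite.  If it is
  finite, a homomorphism on \<open>T i\<close> is extended by \<open>y \<mapsto> \<psi> (y\<^sup>k)\<close>, and torsion commutators make this
  additive.
\<close>

lemma integer_homomorphism:
  assumes comm: "\<And>a b m. [|a \<in> T n; b \<in> T n|] ==>
      \<exists>k>0. ((a \<otimes> b) [^] (m::nat) \<otimes> inv (a [^] m \<otimes> b [^] m)) [^] (k::nat) = \<one>"
  shows "[|i <= n; infinite (T i)|] ==>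
    \<exists>\<psi>. additive_on G (T i) \<psi> \<and> (\<forall>y\<in>T i. \<psi> y \<in> \<int>) \<and> (\<exists>z\<in>T i. \<psi> z ~= 0)"
proof (induction i)
  case 0
  then show ?case using T_0 by simp
next
  case (Suc i)
  then have i: "i < n" "i <= n" by simp_all
  note s0 = T_subgroup[OF i(2)] and s1 = T_subgroup[OF Suc.prems(1)] and a = x_carrier[OF i(1)]
  note c0 = subgroup.mem_carrier[OF s0] and c1 = subgroup.mem_carrier[OF s1]
  note up = subsetD[OF T_mono[OF Suc.prems(1) le_refl]]
  show ?case
  proof (cases "\<exists>m::nat. m > 0 \<and> x i [^] m \<in> T i")
    case True
    then obtain m :: nat where m: "m > 0" "x i [^] m \<in> T i" by (elim exE conjE)
    obtain \<psi> where \<psi>: "additive_on G (T i) \<psi>" "\<forall>y\<in>T i. \<psi> y \<in> \<int>" "\<exists>z\<in>T i. \<psi> z ~= 0"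
      using Suc.IH[OF i(2) infinite_step[OF i(1) m Suc.prems(2)]] by (elim exE conjE)
    obtain k :: nat where k: "k > 0" "\<forall>y\<in>T (Suc i). y [^] k \<in> T i" using power_step[OF i(1) m] by (elim exE conjE)
    have "additive_on G (T (Suc i)) (\<lambda>y. \<psi> (y [^] k))"
    proof (rule additive_onI)
      fix y z assume y: "y \<in> T (Suc i)" and z: "z \<in> T (Suc i)"
      have p: "y [^] k \<in> T i" "z [^] k \<in> T i" "(y \<otimes> z) [^] k \<in> T i"
        using k(2) y z subgroup.m_closed[OF s1 y z] by simp_all
      have q: "y [^] k \<otimes> z [^] k \<in> T i" by (rule subgroup.m_closed[OF s0 p(1,2)])
      define d where "d = (y \<otimes> z) [^] k \<otimes> inv (y [^] k \<otimes> z [^] k)"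
      have d: "d \<in> T i" unfolding d_def by (rule subgroup.m_closed[OF s0 p(3) subgroup.m_inv_closed[OF s0 q]])
      obtain l :: nat where l: "l > 0" "d [^] l = \<one>"
        using comm[OF up[OF y] up[OF z], of k] unfolding d_def by (elim exE conjE)
      have "(y \<otimes> z) [^] k = d \<otimes> (y [^] k \<otimes> z [^] k)"
        unfolding d_def by (rule cancel_right[OF c0[OF p(3)] c0[OF q], symmetric])
      then have "\<psi> ((y \<otimes> z) [^] k) = \<psi> d + \<psi> (y [^] k \<otimes> z [^] k)" using additive_onD[OF \<psi>(1) d q] by simp
      also have "\<psi> d = 0" by (rule additive_torsion[OF s0 \<psi>(1) d l])
      also have "\<psi> (y [^] k \<otimes> z [^] k) = \<psi> (y [^] k) + \<psi> (z [^] k)" by (rule additive_onD[OF \<psi>(1) p(1,2)])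
      finally show "\<psi> ((y \<otimes> z) [^] k) = \<psi> (y [^] k) + \<psi> (z [^] k)" by simp
    qed
    moreover have "\<forall>y\<in>T (Suc i). \<psi> (y [^] k) \<in> \<int>" using k(2) \<psi>(2) by simp
    moreover have "\<exists>z\<in>T (Suc i). \<psi> (z [^] k) ~= 0"
    proof -
      obtain z where z: "z \<in> T i" "\<psi> z ~= 0" using \<psi>(3) by (elim bexE)
      have "\<psi> (z [^] k) ~= 0" using additive_nat_pow[OF s0 \<psi>(1) z(1), of k] z(2) k(1) by simp
      then show ?thesis using subsetD[OF T_Suc[OF i(1)] z(1)] by (rule bexI)
    qed
    ultimately show ?thesis by (intro exI[of _ "\<lambda>y. \<psi> (y [^] k)"] conjI)
  next
    case False
    have zero: "t = 0" if "x i [^] (t::int) \<in> T i" for t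
    proof (rule ccontr)
      assume "t ~= 0"
      have "x i [^] \<bar>t\<bar> \<in> T i"
        using that subgroup.m_inv_closed[OF s0 that] int_pow_neg[OF a, of t] by (cases "t >= 0") simp_all
      then have "x i [^] nat \<bar>t\<bar> \<in> T i" using int_pow_int[of G "x i" "nat \<bar>t\<bar>"] by simp
      then show False using False \<open>t ~= 0\<close> by (auto dest!: spec[of _ "nat \<bar>t\<bar>"])
    qed
    define e where "e = (\<lambda>y. SOME k::int. y \<otimes> inv (x i [^] k) \<in> T i)"
    have e: "y \<otimes> inv (x i [^] e y) \<in> T i" if "y \<in> T (Suc i)" for y
      unfolding e_def by (rule someI_ex[OF generator[OF i(1) that]])
    have uniq: "e y = k" if y: "y \<in> T (Suc i)" and k: "y \<otimes> inv (x i [^] k) \<in> T i" for y and k :: int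
    proof -
      define u v where "u = x i [^] e y" and "v = x i [^] k"
      have uv: "u \<in> carrier G" "v \<in> carrier G" using a by (simp_all add: u_def v_def)
      have "inv (y \<otimes> inv u) \<otimes> (y \<otimes> inv v) \<in> T i"
        unfolding u_def v_def by (rule subgroup.m_closed[OF s0 subgroup.m_inv_closed[OF s0 e[OF y]] k])
      also have "inv (y \<otimes> inv u) \<otimes> (y \<otimes> inv v) = u \<otimes> inv v"
        using uv c1[OF y] inv_cancel(2)[of "inv y" "inv v"] by (simp add: inv_mult_group m_assoc)
      also have "\<dots> = x i [^] (e y - k)" unfolding u_def v_def by (rule int_pow_diff[OF a, symmetric])
      finally show ?thesis using zero by fastforce
    qed
    have "additive_on G (T (Suc i)) (\<lambda>y. of_int (e y))"
    proof (rule additive_onI)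
      fix y z assume y: "y \<in> T (Suc i)" and z: "z \<in> T (Suc i)"
      define u v where "u = x i [^] e y" and "v = x i [^] e z"
      have uv: "u \<in> carrier G" "v \<in> carrier G" using a by (simp_all add: u_def v_def)
      define s t where "s = y \<otimes> inv u" and "t = z \<otimes> inv v"
      have st: "s \<in> T i" "t \<in> T i" using e[OF y] e[OF z] by (simp_all add: s_def t_def u_def v_def)
      have uT: "u \<in> T (Suc i)" unfolding u_def by (rule subgroup_int_pow_closed[OF s1 generator_in[OF i(1)]])
      have "s \<otimes> (u \<otimes> t \<otimes> inv u) \<in> T i" by (rule subgroup.m_closed[OF s0 st(1) T_normal[OF i(1) uT st(2)]])
      also have "s \<otimes> (u \<otimes> t \<otimes> inv u) = (y \<otimes> z) \<otimes> inv (u \<otimes> v)"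
      proof -
        have "s \<otimes> u = y" using uv c1[OF y] by (simp add: s_def m_assoc)
        then have "s \<otimes> (u \<otimes> t \<otimes> inv u) = y \<otimes> (t \<otimes> inv u)"
          using c0[OF st(1)] c0[OF st(2)] c1[OF y] uv by (simp add: m_assoc[symmetric])
        then show ?thesis using uv c1[OF y] c1[OF z] by (simp add: t_def inv_mult_group m_assoc)
      qed
      also have "u \<otimes> v = x i [^] (e y + e z)" unfolding u_def v_def by (rule int_pow_mult[OF a, symmetric])
      finally have "e (y \<otimes> z) = e y + e z" by (intro uniq[OF subgroup.m_closed[OF s1 y z]])
      then show "(of_int (e (y \<otimes> z)) :: real) = of_int (e y) + of_int (e z)" by simp
    qed
    moreover have "e (x i) = 1"
      by (rule uniq[OF generator_in[OF i(1)]]) (use a subgroup.one_closed[OF s0] in simp)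
    then have "\<exists>z\<in>T (Suc i). (of_int (e z) :: real) ~= 0" using generator_in[OF i(1)] by (intro bexI[of _ "x i"]) simp_all
    ultimately show ?thesis by (intro exI[of _ "\<lambda>y. of_int (e y)"] conjI ballI Ints_of_int)
  qed
qed

text \<open>
  In the cyclic quotient \<open>T (Suc i) / T i\<close> all commutators vanish.
\<close>

lemma derived_step:
  assumes i: "i < n" shows "derived G (T (Suc i)) \<subseteq> T i"
proof -
  have i': "i <= n" "Suc i <= n" using i by simp_all
  note s0 = T_subgroup[OF i'(1)] and s1 = T_subgroup[OF i'(2)] and a = x_carrier[OF i]
  note c0 = subgroup.mem_carrier[OF s0] and c1 = subgroup.mem_carrier[OF s1]
  have cm: "y \<otimes> z \<otimes> inv y \<otimes> inv z \<in> T i" if y: "y \<in> T (Suc i)" and z: "z \<in> T (Suc i)" for y z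
  proof -
    obtain j k :: int where jk: "y \<otimes> inv (x i [^] j) \<in> T i" "z \<otimes> inv (x i [^] k) \<in> T i"
      using generator[OF i y] generator[OF i z] by (elim exE)
    define u v where "u = x i [^] j" and "v = x i [^] k"
    have uv: "u \<in> carrier G" "v \<in> carrier G" using a by (simp_all add: u_def v_def)
    have uvT: "u \<in> T (Suc i)" "v \<in> T (Suc i)"
      unfolding u_def v_def by (rule subgroup_int_pow_closed[OF s1 generator_in[OF i]])+
    define s t where "s = y \<otimes> inv u" and "t = z \<otimes> inv v"
    have st: "s \<in> T i" "t \<in> T i" using jk by (simp_all add: s_def t_def u_def v_def)
    have yz: "y = s \<otimes> u" "z = t \<otimes> v" using uv c1[OF y] c1[OF z] by (simp_all add: s_def t_def m_assoc)
    have vu: "v \<otimes> inv u = inv u \<otimes> v"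
      unfolding u_def v_def int_pow_neg[OF a, symmetric] int_pow_mult[OF a, symmetric] by (simp add: add.commute)
    have "s \<otimes> (u \<otimes> t \<otimes> inv u) \<otimes> (v \<otimes> inv s \<otimes> inv v) \<otimes> inv t \<in> T i"
      by (intro subgroup.m_closed[OF s0] st T_normal[OF i] uvT subgroup.m_inv_closed[OF s0])
    also have "s \<otimes> (u \<otimes> t \<otimes> inv u) \<otimes> (v \<otimes> inv s \<otimes> inv v) \<otimes> inv t
        = s \<otimes> (u \<otimes> (t \<otimes> ((inv u \<otimes> v) \<otimes> (inv s \<otimes> (inv v \<otimes> inv t)))))"
      using c0[OF st(1)] c0[OF st(2)] uv by (simp add: m_assoc)
    also have "\<dots> = y \<otimes> z \<otimes> inv y \<otimes> inv z"
      unfolding vu[symmetric] yz using c0[OF st(1)] c0[OF st(2)] uv by (simp add: m_assoc inv_mult_group)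
    finally show ?thesis .
  qed
  show ?thesis
    unfolding derived_def by (rule generate_subgroup_incl[OF _ s0]) (use cm in blast)
qed

lemma derived_series_trivial: "i <= n ==> (derived G ^^ i) (T n) \<subseteq> T (n - i)"
proof (induction i)
  case (Suc i)
  have "(derived G ^^ Suc i) (T n) \<subseteq> derived G (T (n - i))"
    unfolding funpow.simps comp_def by (rule mono_derived) (use Suc in simp)
  also have "\<dots> = derived G (T (Suc (n - Suc i)))" using Suc.prems by (simp add: Suc_diff_Suc)
  also have "\<dots> \<subseteq> T (n - Suc i)" by (rule derived_step) (use Suc.prems in simp)
  finally show ?case .
qed simp

end

text \<open>
  A subgroup of a cyclic group is generated by the power with the least positive exponent that occurs.
  If none occurs, the image of \<open>A\<close> is trivial.
\<close>

lemma (in group_hom) cyclic_image_generator: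
  assumes X: "X \<in> carrier H" "\<And>u. u \<in> carrier H ==> \<exists>k::int. u = X [^]\<^bsub>H\<^esub> k" and A: "subgroup A G"
  shows "\<exists>a\<in>A. \<forall>y\<in>A. \<exists>j::int. h (y \<otimes> inv (a [^] j)) = \<one>\<^bsub>H\<^esub>"
proof -
  note AG = subgroup.mem_carrier[OF A]
  define P where "P = (\<lambda>d::nat. d > 0 \<and> (\<exists>y\<in>A. h y = X [^]\<^bsub>H\<^esub> int d))"
  show ?thesis
  proof (cases "\<exists>d. P d")
    case True
    define d where "d = (LEAST d. P d)"
    have "P d" unfolding d_def by (rule LeastI_ex[OF True])
    then have d0: "d > 0" and "\<exists>y\<in>A. h y = X [^]\<^bsub>H\<^esub> int d" unfolding P_def by simp_all
    then obtain a where a: "a \<in> A" "h a = X [^]\<^bsub>H\<^esub> int d" by (elim bexE)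
    have "\<exists>j::int. h (y \<otimes> inv (a [^] j)) = \<one>\<^bsub>H\<^esub>" if y: "y \<in> A" for y
    proof -
      obtain k :: int where k: "h y = X [^]\<^bsub>H\<^esub> k" using X(2)[of "h y"] AG[OF y] by (elim exE[OF X(2)[OF hom_closed[OF AG[OF y]]]])
      define y' where "y' = y \<otimes> inv (a [^] (k div int d))"
      have y': "y' \<in> A" unfolding y'_def
        by (intro subgroup.m_closed[OF A] y subgroup.m_inv_closed[OF A] G.subgroup_int_pow_closed[OF A a(1)])
      have "h y' = h y \<otimes>\<^bsub>H\<^esub> inv\<^bsub>H\<^esub> (h a [^]\<^bsub>H\<^esub> (k div int d))"
        unfolding y'_def using AG[OF y] AG[OF a(1)] by (simp add: hom_int_pow)
      also have "\<dots> = X [^]\<^bsub>H\<^esub> (k - int d * (k div int d))"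
        unfolding k a(2) H.int_pow_pow[OF X(1)] by (rule H.int_pow_diff[OF X(1), symmetric])
      also have "k - int d * (k div int d) = k mod int d" by (simp add: minus_mult_div_eq_mod)
      finally have hy: "h y' = X [^]\<^bsub>H\<^esub> (k mod int d)" .
      have "k mod int d = 0"
      proof (rule ccontr)
        assume ne: "k mod int d ~= 0"
        have r: "0 <= k mod int d" "k mod int d < int d" using d0 by simp_all
        have "P (nat (k mod int d))" unfolding P_def using ne r hy y' by (intro conjI bexI[of _ y']) simp_all
        then have "d <= nat (k mod int d)" unfolding d_def by (rule Least_le)
        then show False using r by linarith
      qed
      then show ?thesis using hy unfolding y'_def by (intro exI[of _ "k div int d"]) simp
    qed
    then show ?thesis using a(1) by (intro bexI[of _ a] ballI)
  next
    case False
    have "h y = \<one>\<^bsub>H\<^esub>" if y: "y \<in> A" for y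
    proof -
      obtain k :: int where k: "h y = X [^]\<^bsub>H\<^esub> k" by (rule exE[OF X(2)[OF hom_closed[OF AG[OF y]]]])
      have "\<not> k > 0"
      proof
        assume "k > 0"
        then have "P (nat k)" unfolding P_def using y k by (intro conjI bexI[of _ y]) simp_all
        then show False using False by blast
      qed
      moreover have "\<not> k < 0"
      proof
        assume "k < 0"
        have "h (inv y) = X [^]\<^bsub>H\<^esub> (- k)" using k AG[OF y] by (simp add: H.int_pow_neg[OF X(1)])
        then have "P (nat (- k))" unfolding P_def using \<open>k < 0\<close> subgroup.m_inv_closed[OF A y]
          by (intro conjI bexI[of _ "inv y"]) simp_all
        then show False using False by blast
      qed
      ultimately have "k = 0" by simp
      then show ?thesis using k by simp
    qed
    then have "\<forall>y\<in>A. \<exists>j::int. h (y \<otimes> inv (\<one> [^] j)) = \<one>\<^bsub>H\<^esub>" using AG by simp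
    then show ?thesis using subgroup.one_closed[OF A] by (rule bexI)
  qed
qed

lemma (in group) polycyclic_subgroup_series:
  assumes K: "subgroup K G" "polycyclic (G\<lparr>carrier := K\<rparr>)" and A: "subgroup A G" "A \<subseteq> K"
  shows "\<exists>T x n. cyclic_series G T x n \<and> T n = A"
proof -
  obtain n and S :: "nat => 'a set" where S0: "S 0 = {\<one>}" and Sn: "S n = K"
    and sub: "\<forall>i\<le>n. subgroup (S i) (G\<lparr>carrier := K\<rparr>)"
    and st: "\<forall>i<n. S i \<lhd> G\<lparr>carrier := S (Suc i)\<rparr> \<and> cyclic_group (G\<lparr>carrier := S (Suc i)\<rparr> Mod S i)"
    using K(2) unfolding polycyclic_def by (elim exE conjE) simp
  have sG: "subgroup (S i) G" if "i <= n" for i using subgroup_of_subgroup(1)[OF K(1)] sub that by blast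
  have nor: "S i \<lhd> G\<lparr>carrier := S (Suc i)\<rparr>" if "i < n" for i using st that by simp
  have cyc: "cyclic_group (G\<lparr>carrier := S (Suc i)\<rparr> Mod S i)" if "i < n" for i using st that by simp
  define T where "T = (\<lambda>i. A \<inter> S i)"
  have Tsub: "subgroup (T i) G" if "i <= n" for i
    unfolding T_def by (rule subgroups_Inter_pair[OF A(1) sG[OF that]])
  have SS: "S i \<subseteq> S (Suc i)" if "i < n" for i
    using subgroup.subset[OF normal_imp_subgroup[OF nor[OF that]]] by simp
  have "\<exists>a. a \<in> T (Suc i) \<and> (\<forall>y\<in>T (Suc i). \<exists>j::int. y \<otimes> inv (a [^] j) \<in> T i)" if i: "i < n" for i
  proof -
    have i': "i <= n" "Suc i <= n" using i by simp_all
    note s1 = sG[OF i'(2)]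
    let ?G = "G\<lparr>carrier := S (Suc i)\<rparr>"
    let ?Q = "?G Mod S i"
    interpret N: normal "S i" ?G by (rule nor[OF i])
    have gQ: "group ?Q" by (rule N.factorgroup_is_group)
    interpret q: group_hom ?G ?Q "\<lambda>y. S i #>\<^bsub>?G\<^esub> y"
      by (intro group_hom.intro N.is_group gQ group_hom_axioms.intro N.r_coset_hom_Mod)
    obtain X where X: "X \<in> carrier ?Q" "carrier ?Q = range (\<lambda>k::int. X [^]\<^bsub>?Q\<^esub> k)"
      using cyc[OF i] unfolding group.cyclic_group[OF gQ] by (elim bexE)
    have X2: "\<exists>k::int. u = X [^]\<^bsub>?Q\<^esub> k" if "u \<in> carrier ?Q" for u
      using that unfolding X(2) by (elim rangeE) (rule exI)
    have sT: "subgroup (T (Suc i)) ?G" by (rule subgroup_incl[OF Tsub[OF i'(2)] s1]) (simp add: T_def)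
    have "\<exists>a\<in>T (Suc i). \<forall>y\<in>T (Suc i). \<exists>j::int. S i #>\<^bsub>?G\<^esub> (y \<otimes>\<^bsub>?G\<^esub> inv\<^bsub>?G\<^esub> (a [^]\<^bsub>?G\<^esub> j)) = \<one>\<^bsub>?Q\<^esub>"
      by (rule q.cyclic_image_generator[OF X(1) _ sT]) (rule X2)
    then obtain a where a: "a \<in> T (Suc i)"
      "\<forall>y\<in>T (Suc i). \<exists>j::int. S i #>\<^bsub>?G\<^esub> (y \<otimes>\<^bsub>?G\<^esub> inv\<^bsub>?G\<^esub> (a [^]\<^bsub>?G\<^esub> j)) = \<one>\<^bsub>?Q\<^esub>"
      by (elim bexE)
    have aS: "a \<in> S (Suc i)" using a(1) by (simp add: T_def)
    have "\<exists>j::int. y \<otimes> inv (a [^] j) \<in> T i" if y: "y \<in> T (Suc i)" for y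
    proof -
      obtain j :: int where j: "S i #>\<^bsub>?G\<^esub> (y \<otimes>\<^bsub>?G\<^esub> inv\<^bsub>?G\<^esub> (a [^]\<^bsub>?G\<^esub> j)) = \<one>\<^bsub>?Q\<^esub>"
        by (rule exE[OF bspec[OF a(2) y]])
      have pS: "a [^] j \<in> S (Suc i)" "a [^] j \<in> A"
        using subgroup_int_pow_closed[OF s1 aS] subgroup_int_pow_closed[OF A(1)] a(1) by (simp_all add: T_def)
      have e: "y \<otimes>\<^bsub>?G\<^esub> inv\<^bsub>?G\<^esub> (a [^]\<^bsub>?G\<^esub> j) = y \<otimes> inv (a [^] j)"
        using int_pow_consistent[OF s1 aS, of j] m_inv_consistent[OF s1 pS(1)] by simp
      have yS: "y \<in> S (Suc i)" "y \<in> A" using y by (simp_all add: T_def)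
      have yin: "y \<otimes> inv (a [^] j) \<in> S (Suc i)" "y \<otimes> inv (a [^] j) \<in> A"
        using subgroup.m_closed[OF s1 yS(1) subgroup.m_inv_closed[OF s1 pS(1)]]
          subgroup.m_closed[OF A(1) yS(2) subgroup.m_inv_closed[OF A(1) pS(2)]] by simp_all
      have "S i #>\<^bsub>?G\<^esub> (y \<otimes> inv (a [^] j)) = S i" using j unfolding e by (simp add: FactGroup_def)
      then have "y \<otimes> inv (a [^] j) \<in> S i"
        by (rule N.coset_join1) (use yin(1) N.subgroup_axioms in simp_all)
      then show ?thesis using yin(2) by (intro exI[of _ j]) (simp add: T_def)
    qed
    then show ?thesis using a(1) by (intro exI[of _ a] conjI ballI)
  qed
  then have "\<forall>i. \<exists>a. i < n --> a \<in> T (Suc i) \<and> (\<forall>y\<in>T (Suc i). \<exists>j::int. y \<otimes> inv (a [^] j) \<in> T i)" by simp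
  then have "\<exists>x. \<forall>i. i < n --> x i \<in> T (Suc i) \<and> (\<forall>y\<in>T (Suc i). \<exists>j::int. y \<otimes> inv (x i [^] j) \<in> T i)" by (rule choice)
  then obtain x where x: "\<forall>i. i < n --> x i \<in> T (Suc i) \<and> (\<forall>y\<in>T (Suc i). \<exists>j::int. y \<otimes> inv (x i [^] j) \<in> T i)" by (rule exE)
  have "cyclic_series G T x n"
  proof (intro cyclic_series.intro is_group cyclic_series_axioms.intro)
    show "T 0 = {\<one>}" using S0 subgroup.one_closed[OF A(1)] by (auto simp: T_def)
    show "subgroup (T i) G" if "i <= n" for i by (rule Tsub[OF that])
    show "T i \<subseteq> T (Suc i)" if "i < n" for i using SS[OF that] by (auto simp: T_def)
    show "x i \<in> T (Suc i)" if "i < n" for i using x that by simp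
    show "\<exists>j::int. y \<otimes> inv (x i [^] j) \<in> T i" if "i < n" "y \<in> T (Suc i)" for i y using x that by simp
    show "g \<otimes> s \<otimes> inv g \<in> T i" if i: "i < n" and g: "g \<in> T (Suc i)" and s: "s \<in> T i" for i g s
    proof -
      have gs: "g \<in> S (Suc i)" "g \<in> A" "s \<in> S i" "s \<in> A" using g s by (simp_all add: T_def)
      have s1: "subgroup (S (Suc i)) G" by (rule sG) (use i in simp)
      have "g \<otimes>\<^bsub>G\<lparr>carrier := S (Suc i)\<rparr>\<^esub> s \<otimes>\<^bsub>G\<lparr>carrier := S (Suc i)\<rparr>\<^esub> inv\<^bsub>G\<lparr>carrier := S (Suc i)\<rparr>\<^esub> g \<in> S i"
        by (rule normal.inv_op_closed2[OF nor[OF i]]) (use gs in simp_all)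
      then have "g \<otimes> s \<otimes> inv g \<in> S i" using m_inv_consistent[OF s1 gs(1)] by simp
      moreover have "g \<otimes> s \<otimes> inv g \<in> A"
        by (intro subgroup.m_closed[OF A(1)] subgroup.m_inv_closed[OF A(1)] gs)
      ultimately show ?thesis by (simp add: T_def)
    qed
  qed
  moreover have "T n = A" using A(2) Sn by (auto simp: T_def)
  ultimately show ?thesis by (intro exI[of _ T] exI[of _ x] exI[of _ n] conjI)
qed

section \<open>Invariant homomorphisms on a normal subgroup\<close>

definition finite_vector :: "nat => (nat => real) => nat \<Rightarrow>\<^sub>C real" where
  "finite_vector n f = Bcontfun (\<lambda>k. if k < n then f k else 0)"

lemma apply_finite_vector [simp]: "apply_bcontfun (finite_vector n f) k = (if k < n then f k else 0)"
proof -
  have "(\<lambda>k. if k < n then f k else 0) \<in> bcontfun"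
  proof (rule bcontfun_normI[of _ "\<Sum>k<n. \<bar>f k\<bar>"])
    show "norm (if k < n then f k else 0) <= (\<Sum>k<n. \<bar>f k\<bar>)" for k
      using member_le_sum[of k "{..<n}" "\<lambda>k. \<bar>f k\<bar>"] by (simp add: sum_nonneg)
  qed simp
  then show ?thesis unfolding finite_vector_def by (simp add: Bcontfun_inverse)
qed

lemma apply_bcontfun_sum: "apply_bcontfun (\<Sum>k\<in>S. f k) l = (\<Sum>k\<in>S. apply_bcontfun (f k :: nat \<Rightarrow>\<^sub>C real) l)"
  by (induction S rule: infinite_finite_induct) simp_all

locale normal_cyclic_series = cyclic_series +
  assumes normal: "T n \<lhd> G"
begin

lemma conj_in: "[|g \<in> carrier G; a \<in> T n|] ==> g \<otimes> a \<otimes> inv g \<in> T n"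
  by (rule normal.inv_op_closed2[OF normal])

lemma conj_inv_in: "[|g \<in> carrier G; a \<in> T n|] ==> inv g \<otimes> a \<otimes> g \<in> T n"
  by (rule normal.inv_op_closed1[OF normal])

lemma A_carrier: "a \<in> T n ==> a \<in> carrier G"
  by (rule T_carrier[OF le_refl])

lemma x_in: "k < n ==> x k \<in> T n"
  by (rule subsetD[OF T_mono[OF _ le_refl] generator_in]) simp_all

lemma additive_on_conj:
  assumes \<psi>: "additive_on G (T n) \<psi>" and g: "g \<in> carrier G"
  shows "additive_on G (T n) (\<lambda>a. \<psi> (inv g \<otimes> a \<otimes> g))"
proof (rule additive_onI)
  fix a b assume ab: "a \<in> T n" "b \<in> T n"
  have "inv g \<otimes> (a \<otimes> b) \<otimes> g = (inv g \<otimes> a \<otimes> g) \<otimes> (inv g \<otimes> b \<otimes> g)"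
    using ab[THEN A_carrier] g inv_cancel(2)[of g "b \<otimes> g"] by (simp add: m_assoc)
  then show "\<psi> (inv g \<otimes> (a \<otimes> b) \<otimes> g) = \<psi> (inv g \<otimes> a \<otimes> g) + \<psi> (inv g \<otimes> b \<otimes> g)"
    using additive_onD[OF \<psi> conj_inv_in[OF g ab(1)] conj_inv_in[OF g ab(2)]] by simp
qed

definition coefficient :: "'a => nat => int" where
  "coefficient y = (SOME c. \<forall>\<psi>. additive_on G (T n) \<psi> --> \<psi> y = (\<Sum>k<n. of_int (c k) * \<psi> (x k)))"

lemma coefficient:
  assumes "y \<in> T n" "additive_on G (T n) \<psi>"
  shows "\<psi> y = (\<Sum>k<n. of_int (coefficient y k) * \<psi> (x k))"
proof -
  have "\<forall>\<psi>. additive_on G (T n) \<psi> --> \<psi> y = (\<Sum>k<n. of_int (coefficient y k) * \<psi> (x k))"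
    unfolding coefficient_def by (rule someI_ex[OF additive_coefficients[OF le_refl assms(1)]])
  then show ?thesis using assms(2) by simp
qed

text \<open>Homomorphisms \<open>T n \<rightarrow> \<real>\<close> are encoded by their values on the generators \<open>x k\<close>.\<close>

definition gen_values :: "('a => real) => nat \<Rightarrow>\<^sub>C real" where
  "gen_values \<psi> = finite_vector n (\<lambda>k. \<psi> (x k))"

definition hom_space :: "(nat \<Rightarrow>\<^sub>C real) set" where
  "hom_space = {v. \<exists>\<psi>. v = gen_values \<psi> \<and> additive_on G (T n) \<psi>}"

definition hom_lattice :: "(nat \<Rightarrow>\<^sub>C real) set" where
  "hom_lattice = {v. \<exists>\<psi>. v = gen_values \<psi> \<and> additive_on G (T n) \<psi> \<and> (\<forall>a\<in>T n. \<psi> a \<in> \<int>)}"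

definition act :: "'a => (nat \<Rightarrow>\<^sub>C real) => nat \<Rightarrow>\<^sub>C real" where
  "act g v = finite_vector n (\<lambda>k. \<Sum>l<n. of_int (coefficient (inv g \<otimes> x k \<otimes> g) l) * apply_bcontfun v l)"

lemma gen_values_cong: "(\<And>k. k < n ==> \<psi> (x k) = \<phi> (x k)) ==> gen_values \<psi> = gen_values \<phi>"
  by (rule bcontfun_eqI) (simp add: gen_values_def)

lemma gen_values_eqD:
  assumes "gen_values \<psi> = gen_values \<phi>" "additive_on G (T n) \<psi>" "additive_on G (T n) \<phi>" "a \<in> T n"
  shows "\<psi> a = \<phi> a"
proof -
  have "\<psi> (x k) = \<phi> (x k)" if "k < n" for k
    using arg_cong[OF assms(1), of "\<lambda>v. apply_bcontfun v k"] that by (simp add: gen_values_def)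
  then show ?thesis unfolding coefficient[OF assms(4,2)] coefficient[OF assms(4,3)] by simp
qed

lemma act_gen_values:
  assumes "g \<in> carrier G" "additive_on G (T n) \<psi>"
  shows "act g (gen_values \<psi>) = gen_values (\<lambda>a. \<psi> (inv g \<otimes> a \<otimes> g))"
proof (rule bcontfun_eqI)
  fix k show "apply_bcontfun (act g (gen_values \<psi>)) k = apply_bcontfun (gen_values (\<lambda>a. \<psi> (inv g \<otimes> a \<otimes> g))) k"
    using coefficient[OF conj_inv_in[OF assms(1) x_in] assms(2), of k] by (simp add: act_def gen_values_def)
qed

lemma representation_hom_space: "representation G hom_space act"
proof (intro representation.intro is_group representation_axioms.intro)
  have sub: "subspace hom_space"
    unfolding subspace_def
  proof (intro conjI ballI allI)
    have "0 = gen_values (\<lambda>_. 0)" by (rule bcontfun_eqI) (simp add: gen_values_def)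
    moreover have "additive_on G (T n) (\<lambda>_. 0)" by (simp add: additive_on_def)
    ultimately show "0 \<in> hom_space" unfolding hom_space_def by (intro CollectI exI[of _ "\<lambda>_. 0"] conjI)
    fix v assume v: "v \<in> hom_space"
    obtain \<psi> where \<psi>: "v = gen_values \<psi>" "additive_on G (T n) \<psi>" using v unfolding hom_space_def by (elim CollectE exE conjE)
    show "c *\<^sub>R v \<in> hom_space" for c
    proof -
      have "c *\<^sub>R v = gen_values (\<lambda>a. c * \<psi> a)" by (rule bcontfun_eqI) (simp add: \<psi>(1) gen_values_def)
      moreover have "additive_on G (T n) (\<lambda>a. c * \<psi> a)" using \<psi>(2) by (simp add: additive_on_def distrib_left)
      ultimately show ?thesis unfolding hom_space_def by (intro CollectI exI[of _ "\<lambda>a. c * \<psi> a"] conjI)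
    qed
    fix w assume w: "w \<in> hom_space"
    obtain \<phi> where \<phi>: "w = gen_values \<phi>" "additive_on G (T n) \<phi>" using w unfolding hom_space_def by (elim CollectE exE conjE)
    have "v + w = gen_values (\<lambda>a. \<psi> a + \<phi> a)" by (rule bcontfun_eqI) (simp add: \<psi>(1) \<phi>(1) gen_values_def)
    moreover have "additive_on G (T n) (\<lambda>a. \<psi> a + \<phi> a)" using \<psi>(2) \<phi>(2) by (simp add: additive_on_def)
    ultimately show "v + w \<in> hom_space" unfolding hom_space_def by (intro CollectI exI[of _ "\<lambda>a. \<psi> a + \<phi> a"] conjI)
  qed
  define e where "e = (\<lambda>k. finite_vector n (\<lambda>l. if l = k then 1 else 0))"
  have "hom_space \<subseteq> span (e ` {..<n})"
  proof
    fix v assume "v \<in> hom_space"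
    then obtain \<psi> where \<psi>: "v = gen_values \<psi>" unfolding hom_space_def by (elim CollectE exE conjE)
    have "v = (\<Sum>k<n. \<psi> (x k) *\<^sub>R e k)"
    proof (rule bcontfun_eqI)
      fix l
      have "(\<Sum>k<n. if l = k then (if l < n then \<psi> (x k) else 0) else 0) = (if l < n then \<psi> (x l) else 0)"
        by (simp add: sum.delta)
      moreover have "(\<Sum>k<n. \<psi> (x k) * apply_bcontfun (e k) l) = (\<Sum>k<n. if l = k then (if l < n then \<psi> (x k) else 0) else 0)"
        by (rule sum.cong) (simp_all add: e_def)
      ultimately show "apply_bcontfun v l = apply_bcontfun (\<Sum>k<n. \<psi> (x k) *\<^sub>R e k) l"
        by (simp add: \<psi> gen_values_def apply_bcontfun_sum)
    qed
    moreover have "(\<Sum>k<n. \<psi> (x k) *\<^sub>R e k) \<in> span (e ` {..<n})"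
      by (intro span_sum span_scale span_base imageI)
    ultimately show "v \<in> span (e ` {..<n})" by (simp only:)
  qed
  then show "fin_dim hom_space" unfolding fin_dim_def using sub by (intro conjI exI[of _ "e ` {..<n}"]) simp_all
  show "linear (act g)" for g
    by (rule linearI; rule bcontfun_eqI) (simp_all add: act_def algebra_simps sum.distrib sum_distrib_left)
  show "act g v \<in> hom_space" if g: "g \<in> carrier G" and v: "v \<in> hom_space" for g v
  proof -
    obtain \<psi> where \<psi>: "v = gen_values \<psi>" "additive_on G (T n) \<psi>" using v unfolding hom_space_def by (elim CollectE exE conjE)
    show ?thesis unfolding hom_space_def \<psi>(1) act_gen_values[OF g \<psi>(2)]
      by (intro CollectI exI[of _ "\<lambda>a. \<psi> (inv g \<otimes> a \<otimes> g)"] conjI refl additive_on_conj[OF \<psi>(2) g])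
  qed
  show "act (g \<otimes> h) v = act g (act h v)" if g: "g \<in> carrier G" and h: "h \<in> carrier G" and v: "v \<in> hom_space" for g h v
  proof -
    obtain \<psi> where \<psi>: "v = gen_values \<psi>" "additive_on G (T n) \<psi>" using v unfolding hom_space_def by (elim CollectE exE conjE)
    show ?thesis unfolding \<psi>(1) act_gen_values[OF h \<psi>(2)] act_gen_values[OF g additive_on_conj[OF \<psi>(2) h]]
        act_gen_values[OF m_closed[OF g h] \<psi>(2)]
      by (rule gen_values_cong) (use g h x_carrier in \<open>simp add: inv_mult_group m_assoc\<close>)
  qed
  show "act \<one> v = v" if v: "v \<in> hom_space" for v
  proof -
    obtain \<psi> where \<psi>: "v = gen_values \<psi>" "additive_on G (T n) \<psi>" using v unfolding hom_space_def by (elim CollectE exE conjE)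
    show ?thesis unfolding \<psi>(1) act_gen_values[OF one_closed \<psi>(2)]
      by (rule gen_values_cong) (use x_carrier in simp)
  qed
qed

lemma hom_lattice_discrete: assumes "v \<in> hom_lattice" "v ~= 0" shows "1 <= norm v"
proof -
  obtain \<psi> where \<psi>: "v = gen_values \<psi>" "additive_on G (T n) \<psi>" "\<forall>a\<in>T n. \<psi> a \<in> \<int>"
    using assms(1) unfolding hom_lattice_def by (elim CollectE exE conjE)
  have "\<exists>k<n. \<psi> (x k) ~= 0"
  proof (rule ccontr)
    assume no: "\<not> (\<exists>k<n. \<psi> (x k) ~= 0)"
    have "gen_values \<psi> = 0" by (rule bcontfun_eqI) (use no in \<open>simp add: gen_values_def\<close>)
    then show False using assms(2) \<psi>(1) by simp
  qed
  then obtain k where k: "k < n" "\<psi> (x k) ~= 0" by (elim exE conjE)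
  have "1 <= \<bar>\<psi> (x k)\<bar>" by (rule Ints_nonzero_abs_ge1[OF bspec[OF \<psi>(3) x_in[OF k(1)]] k(2)])
  also have "\<dots> <= norm v" using norm_bounded[of v k] k(1) by (simp add: \<psi>(1) gen_values_def)
  finally show ?thesis .
qed

definition residues_mod_3 :: "(nat \<Rightarrow>\<^sub>C real) => nat => int" where
  "residues_mod_3 v = restrict (\<lambda>k. \<lfloor>apply_bcontfun v k\<rfloor> mod 3) {..<n}"

lemma finite_residues: "finite (residues_mod_3 ` S)"
proof (rule finite_subset)
  show "residues_mod_3 ` S \<subseteq> {..<n} \<rightarrow>\<^sub>E {0..<3}"
    by (rule image_subsetI) (simp add: residues_mod_3_def)
  show "finite ({..<n} \<rightarrow>\<^sub>E {0..<3::int})" by (intro finite_PiE) simp_all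
qed

text \<open>
  A homomorphism whose values on the generators are divisible by \<open>3\<close> is three times an integral one.
\<close>

lemma equal_residues:
  assumes v: "v \<in> hom_lattice" and w: "w \<in> hom_lattice" and eq: "residues_mod_3 v = residues_mod_3 w"
  shows "\<exists>z\<in>hom_lattice. v - w = 3 *\<^sub>R z"
proof -
  obtain \<psi> where \<psi>: "v = gen_values \<psi>" "additive_on G (T n) \<psi>" "\<forall>a\<in>T n. \<psi> a \<in> \<int>"
    using v unfolding hom_lattice_def by (elim CollectE exE conjE)
  obtain \<phi> where \<phi>: "w = gen_values \<phi>" "additive_on G (T n) \<phi>" "\<forall>a\<in>T n. \<phi> a \<in> \<int>"
    using w unfolding hom_lattice_def by (elim CollectE exE conjE)
  define \<chi>' where "\<chi>' = (\<lambda>a. (\<psi> a - \<phi> a) / 3)"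
  have add: "additive_on G (T n) \<chi>'"
    using \<psi>(2) \<phi>(2) by (simp add: additive_on_def \<chi>'_def add_divide_distrib diff_divide_distrib)
  have gen: "\<chi>' (x k) \<in> \<int>" if k: "k < n" for k
  proof -
    obtain p q :: int where pq: "\<psi> (x k) = of_int p" "\<phi> (x k) = of_int q"
      using bspec[OF \<psi>(3) x_in[OF k]] bspec[OF \<phi>(3) x_in[OF k]] by (elim Ints_cases)
    have "p mod 3 = q mod 3" using fun_cong[OF eq, of k] k pq by (simp add: residues_mod_3_def \<psi>(1) \<phi>(1) gen_values_def)
    then have "3 dvd p - q" by (simp add: mod_eq_dvd_iff)
    then obtain r where "p - q = 3 * r" by (elim dvdE)
    then have "p = q + 3 * r" by simp
    then have "\<chi>' (x k) = of_int r" unfolding \<chi>'_def pq by simp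
    then show ?thesis by simp
  qed
  have "\<chi>' a \<in> \<int>" if a: "a \<in> T n" for a
    unfolding coefficient[OF a add] by (intro Ints_sum Ints_mult Ints_of_int gen) simp
  then have "gen_values \<chi>' \<in> hom_lattice" unfolding hom_lattice_def using add by (intro CollectI exI[of _ \<chi>'] conjI ballI) simp_all
  moreover have "v - w = 3 *\<^sub>R gen_values \<chi>'"
    by (rule bcontfun_eqI) (simp add: \<psi>(1) \<phi>(1) gen_values_def \<chi>'_def)
  ultimately show ?thesis by (intro bexI[of _ "gen_values \<chi>'"])
qed

lemma invariant_homomorphism:
  assumes am: "amenable G" and rigid: "rigid G"
    and \<psi>0: "additive_on G (T n) \<psi>0" "\<forall>a\<in>T n. \<psi>0 a \<in> \<int>" and z: "z \<in> T n" "\<psi>0 z ~= 0"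
  shows "\<exists>H \<psi>. finite_index G H \<and> additive_on G (T n) \<psi> \<and> (\<exists>z\<in>T n. \<psi> z ~= 0) \<and>
    (\<forall>h\<in>H. \<forall>a\<in>T n. \<psi> (h \<otimes> a \<otimes> inv h) = \<psi> a)"
proof -
  interpret R: representation G hom_space act by (rule representation_hom_space)
  have zero: "gen_values (\<lambda>_. 0) = 0" by (rule bcontfun_eqI) (simp add: gen_values_def)
  have add0: "additive_on G (T n) (\<lambda>_. 0)" by (simp add: additive_on_def)
  have nz: "gen_values \<psi>0 ~= 0"
  proof
    assume "gen_values \<psi>0 = 0"
    then have "\<psi>0 z = 0" using gen_values_eqD[OF _ \<psi>0(1) add0 z(1)] zero by simp
    then show False using z(2) by simp
  qed
  have "\<exists>H. finite_index G H \<and> (\<exists>l\<in>hom_lattice. l ~= 0 \<and> (\<forall>h\<in>H. act h l = l))"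
  proof (rule R.fixed_lattice_point[OF am rigid, of hom_lattice 1 "gen_values \<psi>0" residues_mod_3])
    show "hom_lattice \<subseteq> hom_space" unfolding hom_lattice_def hom_space_def by blast
    show "0 \<in> hom_lattice" unfolding hom_lattice_def
      by (intro CollectI exI[of _ "\<lambda>_. 0"] conjI ballI add0 zero[symmetric]) simp
    show "v - w \<in> hom_lattice" if v: "v \<in> hom_lattice" and w: "w \<in> hom_lattice" for v w
    proof -
      obtain \<psi> where \<psi>: "v = gen_values \<psi>" "additive_on G (T n) \<psi>" "\<forall>a\<in>T n. \<psi> a \<in> \<int>"
        using v unfolding hom_lattice_def by (elim CollectE exE conjE)
      obtain \<phi> where \<phi>: "w = gen_values \<phi>" "additive_on G (T n) \<phi>" "\<forall>a\<in>T n. \<phi> a \<in> \<int>"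
        using w unfolding hom_lattice_def by (elim CollectE exE conjE)
      have "v - w = gen_values (\<lambda>a. \<psi> a - \<phi> a)" by (rule bcontfun_eqI) (simp add: \<psi>(1) \<phi>(1) gen_values_def)
      moreover have "additive_on G (T n) (\<lambda>a. \<psi> a - \<phi> a)" using \<psi>(2) \<phi>(2) by (simp add: additive_on_def)
      moreover have "\<forall>a\<in>T n. \<psi> a - \<phi> a \<in> \<int>" using \<psi>(3) \<phi>(3) by (intro ballI Ints_diff) simp_all
      ultimately show ?thesis unfolding hom_lattice_def by (intro CollectI exI[of _ "\<lambda>a. \<psi> a - \<phi> a"] conjI)
    qed
    show "act g v \<in> hom_lattice" if g: "g \<in> carrier G" and v: "v \<in> hom_lattice" for g v
    proof -
      obtain \<psi> where \<psi>: "v = gen_values \<psi>" "additive_on G (T n) \<psi>" "\<forall>a\<in>T n. \<psi> a \<in> \<int>"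
        using v unfolding hom_lattice_def by (elim CollectE exE conjE)
      have "\<forall>a\<in>T n. \<psi> (inv g \<otimes> a \<otimes> g) \<in> \<int>" by (intro ballI bspec[OF \<psi>(3)] conj_inv_in g)
      then show ?thesis unfolding hom_lattice_def \<psi>(1) act_gen_values[OF g \<psi>(2)]
        by (intro CollectI exI[of _ "\<lambda>a. \<psi> (inv g \<otimes> a \<otimes> g)"] conjI refl additive_on_conj[OF \<psi>(2) g])
    qed
    show "gen_values \<psi>0 \<in> hom_lattice" unfolding hom_lattice_def by (intro CollectI exI[of _ \<psi>0] conjI refl \<psi>0)
  qed (simp_all add: hom_lattice_discrete nz finite_residues equal_residues)
  then obtain H l where H: "finite_index G H" and l: "l \<in> hom_lattice" "l ~= 0" "\<forall>h\<in>H. act h l = l"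
    by (elim exE bexE conjE)
  obtain \<psi> where \<psi>: "l = gen_values \<psi>" "additive_on G (T n) \<psi>" "\<forall>a\<in>T n. \<psi> a \<in> \<int>"
    using l(1) unfolding hom_lattice_def by (elim CollectE exE conjE)
  have "\<psi> (h \<otimes> a \<otimes> inv h) = \<psi> a" if h: "h \<in> H" and a: "a \<in> T n" for h a
  proof -
    have ih: "inv h \<in> H" by (rule subgroup.m_inv_closed[OF finite_indexD(1)[OF H] h])
    have hG: "h \<in> carrier G" "inv h \<in> carrier G" using finite_indexD(3)[OF H] h ih by simp_all
    have "gen_values (\<lambda>a. \<psi> (inv (inv h) \<otimes> a \<otimes> inv h)) = gen_values \<psi>"
      using bspec[OF l(3) ih] unfolding \<psi>(1) act_gen_values[OF hG(2) \<psi>(2)] .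
    from gen_values_eqD[OF this additive_on_conj[OF \<psi>(2) hG(2)] \<psi>(2) a] show ?thesis using hG(1) by simp
  qed
  moreover have "\<exists>z\<in>T n. \<psi> z ~= 0"
  proof (rule ccontr)
    assume no: "\<not> (\<exists>z\<in>T n. \<psi> z ~= 0)"
    have "gen_values \<psi> = gen_values (\<lambda>_. 0)" by (rule gen_values_cong) (use no x_in in simp)
    then show False using zero l(2) \<psi>(1) by simp
  qed
  ultimately show ?thesis using H \<psi>(2) by (intro exI[of _ H] exI[of _ \<psi>] conjI ballI) simp_all
qed

end

section \<open>Virtually polycyclic normal subgroups\<close>

context group
begin

text \<open>
  On the normal core of \<open>H\<close> the homomorphism is invariant under conjugation by the core itself, and each
  element of \<open>H\<close> has a power in the core.
\<close>

lemma real_rank_zero_rigid: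
  assumes am: "amenable G" and rr0: "real_rank_zero (full_group_cstar_algebra G)"
  shows "rigid G"
  unfolding rigid_def
proof (intro allI impI ballI)
  fix H and \<theta> :: "'a => real" and h
  assume H: "finite_index G H" and hom: "\<forall>g\<in>H. \<forall>h\<in>H. \<theta> (g \<otimes> h) = \<theta> g + \<theta> h" and h: "h \<in> H"
  have addH: "additive_on G H \<theta>" using hom by (simp add: additive_on_def)
  obtain K where K: "finite_index G K" "K \<lhd> G" "K \<subseteq> H" using finite_index_core[OF H] by (elim exE conjE)
  have addK: "additive_on G K \<theta>" using hom K(3) by (auto simp: additive_on_def)
  have zero: "\<theta> k = 0" if k: "k \<in> K" for k
    by (rule real_rank_zero_invariant_character[OF am rr0 K(2) finite_indexD(1,2)[OF K(1)] subset_refl])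
      (use additive_onD[OF addK] additive_conj[OF finite_indexD(1)[OF K(1)] addK] k in simp_all)
  obtain n :: nat where n: "n > 0" "\<forall>x\<in>carrier G. x [^] n \<in> K" using finite_index_pow[OF K(1)] by (elim exE conjE)
  have "\<theta> (h [^] n) = real n * \<theta> h" by (rule additive_nat_pow[OF finite_indexD(1)[OF H] addH h])
  moreover have "\<theta> (h [^] n) = 0" using zero n(2) finite_indexD(3)[OF H h] by simp
  ultimately show "\<theta> h = 0" using n(1) by simp
qed

text \<open>
  The fixed homomorphism is also invariant under \<open>T n\<close>, so its stabilizer is a subgroup of finite index
  that contains \<open>T n\<close>.
\<close>

lemma real_rank_zero_no_integer_homomorphism:
  assumes am: "amenable G" and rr0: "real_rank_zero (full_group_cstar_algebra G)"
    and S: "cyclic_series G T x n" and normal: "T n \<lhd> G"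
    and \<psi>0: "additive_on G (T n) \<psi>0" "\<forall>a\<in>T n. \<psi>0 a \<in> \<int>" and z: "z \<in> T n"
  shows "\<psi>0 z = 0"
proof (rule ccontr)
  assume nz: "\<psi>0 z ~= 0"
  interpret S: normal_cyclic_series G T x n
    by (intro normal_cyclic_series.intro S normal_cyclic_series_axioms.intro normal)
  obtain H \<psi> where H: "finite_index G H" and \<psi>: "additive_on G (T n) \<psi>" "\<exists>z\<in>T n. \<psi> z ~= 0"
    and inv: "\<forall>h\<in>H. \<forall>a\<in>T n. \<psi> (h \<otimes> a \<otimes> inv h) = \<psi> a"
    using S.invariant_homomorphism[OF am real_rank_zero_rigid[OF am rr0] \<psi>0 z nz] by (elim exE conjE)
  define H' where "H' = {g \<in> carrier G. \<forall>a\<in>T n. \<psi> (g \<otimes> a \<otimes> inv g) = \<psi> a}"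
  have sT: "subgroup (T n) G" by (rule S.T_subgroup[OF le_refl])
  have sH': "subgroup H' G"
  proof (rule subgroupI)
    show "H' \<subseteq> carrier G" by (auto simp: H'_def)
    have "\<one> \<in> H'" using S.A_carrier by (simp add: H'_def)
    then show "H' ~= {}" by blast
    show "inv g \<in> H'" if g: "g \<in> H'" for g
    proof -
      have gG: "g \<in> carrier G" using g by (simp add: H'_def)
      have "\<psi> (inv g \<otimes> a \<otimes> g) = \<psi> a" if a: "a \<in> T n" for a
      proof -
        have "g \<otimes> (inv g \<otimes> a \<otimes> g) \<otimes> inv g = a"
          using gG S.A_carrier[OF a] inv_cancel(2)[of g a] by (simp add: m_assoc)
        moreover have "\<psi> (g \<otimes> (inv g \<otimes> a \<otimes> g) \<otimes> inv g) = \<psi> (inv g \<otimes> a \<otimes> g)"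
          using g S.conj_inv_in[OF gG a] by (simp add: H'_def)
        ultimately show ?thesis by simp
      qed
      then show ?thesis using gG by (simp add: H'_def)
    qed
    show "g \<otimes> h \<in> H'" if g: "g \<in> H'" and h: "h \<in> H'" for g h
    proof -
      have gh: "g \<in> carrier G" "h \<in> carrier G" using g h by (simp_all add: H'_def)
      have "\<psi> (g \<otimes> h \<otimes> a \<otimes> inv (g \<otimes> h)) = \<psi> a" if a: "a \<in> T n" for a
      proof -
        have "g \<otimes> h \<otimes> a \<otimes> inv (g \<otimes> h) = g \<otimes> (h \<otimes> a \<otimes> inv h) \<otimes> inv g"
          using gh S.A_carrier[OF a] by (simp add: inv_mult_group m_assoc)
        moreover have "\<psi> (g \<otimes> (h \<otimes> a \<otimes> inv h) \<otimes> inv g) = \<psi> (h \<otimes> a \<otimes> inv h)"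
          using g S.conj_in[OF gh(2) a] by (simp add: H'_def)
        moreover have "\<psi> (h \<otimes> a \<otimes> inv h) = \<psi> a" using h a by (simp add: H'_def)
        ultimately show ?thesis by simp
      qed
      then show ?thesis using gh by (simp add: H'_def)
    qed
  qed
  have HH': "H \<subseteq> H'" using inv finite_indexD(3)[OF H] by (auto simp: H'_def)
  have fin: "finite_index G H'"
    by (rule finite_indexI[OF sH' finite_coset_image[OF H]])
      (rule subsetD[OF HH'], rule coset_eq_imp[OF finite_indexD(1)[OF H]])
  have AH': "T n \<subseteq> H'" using additive_conj[OF sT \<psi>(1)] S.A_carrier by (auto simp: H'_def)
  have "\<psi> y = 0" if "y \<in> T n" for y
    by (rule real_rank_zero_invariant_character[OF am rr0 normal sH' finite_indexD(2)[OF fin] AH' additive_onD[OF \<psi>(1)] _ that])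
      (simp_all add: H'_def)
  then show False using \<psi>(2) by blast
qed

lemma conj_nat_pow:
  assumes "g \<in> carrier G" "a \<in> carrier G"
  shows "g \<otimes> a [^] (k::nat) \<otimes> inv g = (g \<otimes> a \<otimes> inv g) [^] k"
proof (induction k)
  case (Suc k)
  have "g \<otimes> a [^] Suc k \<otimes> inv g = (g \<otimes> a [^] k \<otimes> inv g) \<otimes> (g \<otimes> a \<otimes> inv g)"
    using assms inv_cancel(2)[of "inv g" "a \<otimes> inv g"] by (simp add: m_assoc)
  then show ?case using Suc by simp
qed (use assms in simp)

lemma power_commutator_in_derived:
  assumes A: "A \<lhd> G" and ab: "a \<in> A" "b \<in> A"
  shows "(a \<otimes> b) [^] (m::nat) \<otimes> inv (a [^] m \<otimes> b [^] m) \<in> derived G A"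
proof -
  have sA: "subgroup A G" by (rule normal_imp_subgroup[OF A])
  have G: "a \<in> carrier G" "b \<in> carrier G" using ab subgroup.mem_carrier[OF sA] by simp_all
  interpret D: normal "derived G A" G by (rule derived_is_normal[OF A])
  note sD = D.subgroup_axioms
  have gQ: "group (G Mod derived G A)" by (rule D.factorgroup_is_group)
  interpret q: group_hom G "G Mod derived G A" "\<lambda>y. derived G A #> y"
    by (intro group_hom.intro is_group gQ group_hom_axioms.intro D.r_coset_hom_Mod)
  have "a \<otimes> b \<otimes> inv a \<otimes> inv b \<in> derived G A" unfolding derived_def by (rule generate.incl) (use ab in blast)
  then have "(a \<otimes> b \<otimes> inv a \<otimes> inv b) \<otimes> (b \<otimes> a) \<in> derived G A #> (b \<otimes> a)"
    by (rule rcosI[OF _ subgroup.subset[OF sD]]) (use G in simp)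
  also have "(a \<otimes> b \<otimes> inv a \<otimes> inv b) \<otimes> (b \<otimes> a) = a \<otimes> b"
    using G inv_cancel(2)[of "inv b" a] by (simp add: m_assoc)
  finally have "derived G A #> (b \<otimes> a) = derived G A #> (a \<otimes> b)"
    by (rule repr_independence[OF _ _ sD]) (use G in simp)
  then have comm: "(derived G A #> a) \<otimes>\<^bsub>G Mod derived G A\<^esub> (derived G A #> b)
      = (derived G A #> b) \<otimes>\<^bsub>G Mod derived G A\<^esub> (derived G A #> a)"
    unfolding q.hom_mult[OF G, symmetric] q.hom_mult[OF G(2,1), symmetric] by simp
  have "derived G A #> ((a \<otimes> b) [^] int m) = derived G A #> (a [^] int m \<otimes> b [^] int m)"
    using G q.H.int_pow_mult_distrib[OF comm q.hom_closed[OF G(1)] q.hom_closed[OF G(2)], of "int m"]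
    unfolding q.hom_int_pow[OF m_closed[OF G]] q.hom_mult[OF G] q.hom_mult[OF int_pow_closed[OF G(1)] int_pow_closed[OF G(2)]]
      q.hom_int_pow[OF G(1)] q.hom_int_pow[OF G(2)] by simp
  then have "derived G A #> ((a \<otimes> b) [^] m) = derived G A #> (a [^] m \<otimes> b [^] m)" by (simp add: int_pow_int)
  then show ?thesis by (rule coset_eq_imp[OF sD, rotated 2]) (use G in simp_all)
qed

text \<open>
  The \<open>k\<close>-th powers of elements of \<open>N\<close> form a normal subset of \<open>G\<close>, unlike the given polycyclic subgroup
  \<open>K\<close>.  They generate an infinite group, because \<open>K\<close> has an element of infinite order.
\<close>

lemma infinite_polycyclic_normal_core:
  assumes N: "N \<lhd> G" "virtually_polycyclic (G\<lparr>carrier := N\<rparr>)" "infinite N"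
  shows "\<exists>K M. subgroup K G \<and> polycyclic (G\<lparr>carrier := K\<rparr>) \<and> M \<lhd> G \<and> M \<subseteq> K \<and> infinite M"
proof -
  have sN: "subgroup N G" by (rule normal_imp_subgroup[OF N(1)])
  note NG = subgroup.mem_carrier[OF sN]
  have gN: "group (G\<lparr>carrier := N\<rparr>)" by (rule subgroup_imp_group[OF sN])
  obtain K where K: "subgroup K (G\<lparr>carrier := N\<rparr>)" "finite (rcosets\<^bsub>G\<lparr>carrier := N\<rparr>\<^esub> K)"
    "polycyclic (G\<lparr>carrier := N\<rparr>\<lparr>carrier := K\<rparr>)" using N(2) unfolding virtually_polycyclic_def by (elim exE conjE)
  have pc: "polycyclic (G\<lparr>carrier := K\<rparr>)" using K(3) by simp
  have sK: "subgroup K G" "K \<subseteq> N" using subgroup_of_subgroup[OF sN K(1)] by simp_all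
  have fK: "finite_index (G\<lparr>carrier := N\<rparr>) K" using K(1,2) by (simp add: finite_index_def)
  have infK: "infinite K" using group.finite_carrier_if_finite_index[OF gN fK] N(3) by auto
  have "\<exists>k::nat. k > 0 \<and> (\<forall>y\<in>N. y [^] k \<in> K)"
    using group.finite_index_pow[OF gN fK] unfolding nat_pow_consistent[symmetric] by simp
  then obtain k :: nat where k: "k > 0" "\<forall>y\<in>N. y [^] k \<in> K" by (elim exE conjE)
  define P where "P = (\<lambda>y. y [^] k) ` N"
  have PK: "P \<subseteq> K" using k(2) by (auto simp: P_def)
  have PG: "P \<subseteq> carrier G" using PK subgroup.subset[OF sK(1)] by blast
  have M: "generate G P \<lhd> G"
  proof (rule normal_generateI[OF PG])
    fix h g assume h: "h \<in> P" and g: "g \<in> carrier G"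
    obtain y where y: "y \<in> N" "h = y [^] k" using h unfolding P_def by blast
    have "g \<otimes> h \<otimes> inv g = (g \<otimes> y \<otimes> inv g) [^] k" unfolding y(2) by (rule conj_nat_pow[OF g NG[OF y(1)]])
    moreover have "g \<otimes> y \<otimes> inv g \<in> N" by (rule normal.inv_op_closed2[OF N(1) g y(1)])
    ultimately show "g \<otimes> h \<otimes> inv g \<in> P" unfolding P_def by simp
  qed
  have MK: "generate G P \<subseteq> K" by (rule generate_subgroup_incl[OF PK sK(1)])
  have "infinite (generate G P)"
  proof
    assume fin: "finite (generate G P)"
    obtain T x n where T: "cyclic_series G T x n" "T n = K"
      using polycyclic_subgroup_series[OF sK(1) pc sK(1) subset_refl] by (elim exE conjE)
    have "\<exists>z\<in>K. \<forall>l::nat. l > 0 --> z [^] l ~= \<one>"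
      using cyclic_series.infinite_order_element[OF T(1) le_refl] infK unfolding T(2) by simp
    then obtain z where z: "z \<in> K" "\<forall>l::nat. l > 0 --> z [^] l ~= \<one>" by (elim bexE)
    have zG: "z \<in> carrier G" by (rule subgroup.mem_carrier[OF sK(1) z(1)])
    have "z [^] k \<in> generate G P" by (rule generate.incl) (use z(1) sK(2) in \<open>auto simp: P_def\<close>)
    then obtain l :: nat where l: "l > 0" "(z [^] k) [^] l = \<one>"
      using finite_subgroup_torsion[OF normal_imp_subgroup[OF M] fin] by blast
    have "z [^] (k * l) = \<one>" using l(2) nat_pow_pow[OF zG, of k l] by simp
    then show False using z(2) k(1) l(1) by simp
  qed
  then show ?thesis using sK(1) pc M MK by (intro exI[of _ K] exI[of _ "generate G P"] conjI)
qed

text \<open>The last infinite term of the derived series has finite derived subgroup.\<close>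

lemma infinite_normal_with_finite_derived:
  assumes K: "subgroup K G" "polycyclic (G\<lparr>carrier := K\<rparr>)" and M: "M \<lhd> G" "M \<subseteq> K" "infinite M"
  shows "\<exists>A. A \<lhd> G \<and> A \<subseteq> K \<and> infinite A \<and> finite (derived G A)"
proof -
  define D where "D = (\<lambda>i. (derived G ^^ i) M)"
  have D_Suc: "D (Suc i) = derived G (D i)" for i by (simp add: D_def)
  have nor: "D i \<lhd> G" for i
  proof (induction i)
    case (Suc i)
    then show ?case unfolding D_Suc by (rule derived_is_normal)
  qed (simp add: D_def M(1))
  have sub: "D i \<subseteq> K" for i
  proof (induction i)
    case (Suc i)
    then show ?case unfolding D_Suc by (rule derived_incl[OF _ K(1)])
  qed (simp add: D_def M(2))
  obtain T x n where T: "cyclic_series G T x n" "T n = K"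
    using polycyclic_subgroup_series[OF K K(1) subset_refl] by (elim exE conjE)
  have "D n \<subseteq> (derived G ^^ n) K" unfolding D_def by (rule mono_exp_of_derived[OF M(2)])
  also have "\<dots> \<subseteq> T 0" using cyclic_series.derived_series_trivial[OF T(1) le_refl] T(2) by simp
  finally have "finite (D n)" using cyclic_series.T_0[OF T(1)] finite_subset by fastforce
  define j where "j = (LEAST i. finite (D i))"
  have j: "finite (D j)" unfolding j_def by (rule LeastI[of "\<lambda>i. finite (D i)" n]) (fact \<open>finite (D n)\<close>)
  have "j ~= 0"
  proof
    assume "j = 0"
    then show False using j M(3) by (simp add: D_def)
  qed
  obtain i where i: "j = Suc i" using not0_implies_Suc[OF \<open>j ~= 0\<close>] by (elim exE)
  have "infinite (D i)"
  proof
    assume "finite (D i)"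
    then have "j <= i" unfolding j_def by (rule Least_le)
    then show False using i by simp
  qed
  moreover have "finite (derived G (D i))" using j unfolding i D_Suc .
  ultimately show ?thesis using nor sub by (intro exI[of _ "D i"] conjI)
qed

end

theorem corollary1p3:
  fixes G :: "('g, 'm) monoid_scheme" (structure)
  assumes "group G"
    and "amenable G"
    and "real_rank_zero (full_group_cstar_algebra G)"
  shows "\<forall>N. N \<lhd> G \<longrightarrow> virtually_polycyclic (G\<lparr>carrier := N\<rparr>) \<longrightarrow> finite N"
proof (intro allI impI, rule ccontr)
  interpret group G by (rule assms(1))
  fix N assume N: "N \<lhd> G" "virtually_polycyclic (G\<lparr>carrier := N\<rparr>)" "infinite N"
  obtain K M where K: "subgroup K G" "polycyclic (G\<lparr>carrier := K\<rparr>)" and M: "M \<lhd> G" "M \<subseteq> K" "infinite M"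
    using infinite_polycyclic_normal_core[OF N] by (elim exE conjE)
  obtain A where A: "A \<lhd> G" "A \<subseteq> K" "infinite A" "finite (derived G A)"
    using infinite_normal_with_finite_derived[OF K M] by (elim exE conjE)
  have sA: "subgroup A G" by (rule normal_imp_subgroup[OF A(1)])
  obtain T x n where T: "cyclic_series G T x n" "T n = A"
    using polycyclic_subgroup_series[OF K sA A(2)] by (elim exE conjE)
  have sD: "subgroup (derived G A) G" by (rule normal_imp_subgroup[OF derived_is_normal[OF A(1)]])
  have "\<exists>\<psi>. additive_on G (T n) \<psi> \<and> (\<forall>y\<in>T n. \<psi> y \<in> \<int>) \<and> (\<exists>z\<in>T n. \<psi> z \<noteq> 0)"
  proof (rule cyclic_series.integer_homomorphism[OF T(1) _ le_refl])
    show "infinite (T n)" using A(3) T(2) by simp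
    show "\<exists>k>0. ((a \<otimes> b) [^] (m::nat) \<otimes> inv (a [^] m \<otimes> b [^] m)) [^] (k::nat) = \<one>"
      if "a \<in> T n" "b \<in> T n" for a b m
      by (rule finite_subgroup_torsion[OF sD A(4) power_commutator_in_derived[OF A(1)]]) (use that T(2) in simp_all)
  qed
  then obtain \<psi> z where "additive_on G (T n) \<psi>" "\<forall>y\<in>T n. \<psi> y \<in> \<int>" "z \<in> T n" "\<psi> z \<noteq> 0"
    by (elim exE conjE bexE)
  then show False
    using real_rank_zero_no_integer_homomorphism[OF assms(2,3) T(1)] A(1) T(2) by simp
qed

end
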